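(* Let $D$ be any finite-dimensional division algebra over a field $k$ and let $M$ be any $D$-bimodule with $M\simeq D$ as $k$-vector space. Then $T_{D^*}(M^* )$ is a chain coalgebra of type $D$. If $D$ is separable over $k$, then any chain coalgebra of type $D$ embeds (as a coalgebra) into some cotensor coalgebra of the form $T_{D^*}(M^* )$, where $M$ is a $D$-bimodule with $M\simeq D$ as $k$-vector space.
   Context: Coalgebras are coassociative and counital over $k$; $D$-bimodules are $k$-linear bimodules ($k$ acts the same way on both sides). A chain coalgebra is a coalgebra $C$ whose right coideals (right subcomodules of $C$) are linearly ordered by inclusion (equivalently, whose left coideals are). Its coradical $C_0$ is the socle of $C$ as a left $C^*$-module, where $C^*$ has the convolution product; $C$ is of type $D$ if $(C_0)^*\simeq D$ as $k$-algebras. $D^*=\mathrm{Hom}_k(D,k)$ is the dual coalgebra of $D$, and for a finite-dimensional $D$-bimodule $M$ the dual $M^*$ is a $D^*$-bicomodule by dualizing the two actions. For a coalgebra $C$ and a $C$-bicomodule $N$ with left coaction $\rho^l$ and right coaction $\rho^r$, the cotensor product $N\Box_C N$ is the kernel of $\rho^r\otimes \mathrm{id}-\mathrm{id}\otimes\rho^l: N\otimes N\to N\otimes C\otimes N$ (similarly for iterated ones), and the cotensor coalgebra is $T_C(N)=\bigoplus_{n\ge 0}N^{\Box_C n}$ with $N^{\Box_C 0}=C$, $N^{\Box_C 1}=N$, and $N^{\Box_C n}$ the $n$-fold cotensor product. Its comultiplication is $\Delta_C$ on $C$, $\Delta(m)=\rho^l(m)+\rho^r(m)$ for $m\in N$,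 and for $n\ge2$ $$\Delta(m_1\Box\cdots\Box m_n)=\sum (m_1)_{-1}\otimes((m_1)_0\Box m_2\Box\cdots\Box m_n)+\sum_{i=1}^{n-1}(m_1\Box\cdots\Box m_i)\otimes(m_{i+1}\Box\cdots\Box m_n)+\sum(m_1\Box\cdots\Box m_{n-1}\Box(m_n)_0)\otimes(m_n)_1,$$ where $\rho^l(m_1)=\sum (m_1)_{-1}\otimes(m_1)_0$ and $\rho^r(m_n)=\sum(m_n)_0\otimes(m_n)_1$; its counit is $\varepsilon_C$ on $C$ and $0$ on $N^{\Box_C n}$ for $n\ge1$. *)

theory Defs
  imports
    HOL.Vector_Spaces
    "HOL-Library.Function_Algebras"
    "HOL-Library.Product_Plus"
begin

section \<open>Vector spaces, linear maps, duals\<close>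

text \<open>
  A vector space over the field \<open>'k\<close> is given as a subspace (\<open>vcarrier\<close>) of an ambient vector
  space, the whole type \<open>'v\<close> with scalar multiplication \<open>vscale\<close>. This is needed because dual
  spaces, tensor products and cotensor products are carved out of function types; addition on
  function and product types is the pointwise one.
\<close>

record ('k, 'v) vspace =
  vcarrier :: "'v set"
  vscale :: "'k \<Rightarrow> 'v \<Rightarrow> 'v"

definition is_vspace :: "('k::field, 'v::ab_group_add, 'z) vspace_scheme \<Rightarrow> bool" where
  "is_vspace V \<longleftrightarrow> vector_space (vscale V) \<and> module.subspace (vscale V) (vcarrier V)"

definition full_space :: "('k \<Rightarrow> 'v \<Rightarrow> 'v) \<Rightarrow> ('k, 'v) vspace" where
  "full_space s = \<lparr>vcarrier = UNIV, vscale = s\<rparr>"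

abbreviation ground :: "('k::field, 'k) vspace" where
  "ground \<equiv> full_space (*)"

definition linear_map ::
  "('k, 'v::ab_group_add, 'z) vspace_scheme \<Rightarrow> ('k, 'w::ab_group_add, 'y) vspace_scheme \<Rightarrow> ('v \<Rightarrow> 'w) \<Rightarrow> bool" where
  "linear_map V W f \<longleftrightarrow>
     (\<forall>x\<in>vcarrier V. f x \<in> vcarrier W) \<and>
     (\<forall>x\<in>vcarrier V. \<forall>y\<in>vcarrier V. f (x + y) = f x + f y) \<and>
     (\<forall>a. \<forall>x\<in>vcarrier V. f (vscale V a x) = vscale W a (f x))"

definition bilinear_map ::
  "('k, 'v::ab_group_add, 'z) vspace_scheme \<Rightarrow> ('k, 'w::ab_group_add, 'y) vspace_scheme \<Rightarrow>
   ('k, 'u::ab_group_add, 'x) vspace_scheme \<Rightarrow> ('v \<Rightarrow> 'w \<Rightarrow> 'u) \<Rightarrow> bool" where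
  "bilinear_map V W U \<beta> \<longleftrightarrow>
     (\<forall>x\<in>vcarrier V. linear_map W U (\<beta> x)) \<and> (\<forall>y\<in>vcarrier W. linear_map V U (\<lambda>x. \<beta> x y))"

definition vspace_iso ::
  "('k, 'v::ab_group_add, 'z) vspace_scheme \<Rightarrow> ('k, 'w::ab_group_add, 'y) vspace_scheme \<Rightarrow> bool" where
  "vspace_iso V W \<longleftrightarrow> (\<exists>f. linear_map V W f \<and> bij_betw f (vcarrier V) (vcarrier W))"

definition fscale :: "'k::times \<Rightarrow> ('x \<Rightarrow> 'k) \<Rightarrow> ('x \<Rightarrow> 'k)" where
  "fscale a f = (\<lambda>x. a * f x)"

text \<open>A functional on a space is represented by its extension by zero to the ambient type.\<close>

definition dual_space ::
  "('k::field, 'v::ab_group_add, 'z) vspace_scheme \<Rightarrow> ('k, 'v \<Rightarrow> 'k) vspace" where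
  "dual_space V =
     \<lparr>vcarrier = {f. linear_map V ground f \<and> (\<forall>x. x \<notin> vcarrier V \<longrightarrow> f x = 0)}, vscale = fscale\<rparr>"


section \<open>Tensor products\<close>

text \<open>
  The tensor product \<open>V \<otimes> W\<close> is realised inside the space of functions of two linear functionals:
  \<open>x \<otimes> y\<close> is \<open>(f, g) \<mapsto> f x * g y\<close>, and \<open>V \<otimes> W\<close> is the span of these functions. The functionals
  range over the functionals on the ambient types, so that for subspaces \<open>V'\<close> of \<open>V\<close> and
  \<open>W'\<close> of \<open>W\<close> the space \<open>V' \<otimes> W'\<close> is literally a subspace of \<open>V \<otimes> W\<close>. The universal
  property is proved as \<open>tensor_universal\<close> at the end of this theory.
\<close>

type_synonym ('k, 'v, 'w) tensor = "('v \<Rightarrow> 'k) \<times> ('w \<Rightarrow> 'k) \<Rightarrow> 'k"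

definition tens ::
  "('k::field, 'v::ab_group_add, 'z) vspace_scheme \<Rightarrow> ('k, 'w::ab_group_add, 'y) vspace_scheme \<Rightarrow>
   'v \<Rightarrow> 'w \<Rightarrow> ('k, 'v, 'w) tensor" where
  "tens V W x y = (\<lambda>(f, g).
     if Vector_Spaces.linear (vscale V) (*) f \<and> Vector_Spaces.linear (vscale W) (*) g
     then f x * g y else 0)"

definition tensor_space ::
  "('k::field, 'v::ab_group_add, 'z) vspace_scheme \<Rightarrow> ('k, 'w::ab_group_add, 'y) vspace_scheme \<Rightarrow>
   ('k, ('k, 'v, 'w) tensor) vspace" where
  "tensor_space V W =
     \<lparr>vcarrier = module.span fscale {tens V W x y |x y. x \<in> vcarrier V \<and> y \<in> vcarrier W},
      vscale = fscale\<rparr>"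

text \<open>
  \<open>tlift V W \<beta>\<close> is the linear map on \<open>V \<otimes> W\<close> induced by a bilinear map \<open>\<beta>\<close>; it plays the role
  of Sweedler's notation: if \<open>t = \<Sum> x\<^sub>i \<otimes> y\<^sub>i\<close>, its value at \<open>t\<close> is \<open>\<Sum> \<beta> x\<^sub>i y\<^sub>i\<close>.
\<close>

definition tlift ::
  "('k::field, 'v::ab_group_add, 'z) vspace_scheme \<Rightarrow> ('k, 'w::ab_group_add, 'y) vspace_scheme \<Rightarrow>
   ('v \<Rightarrow> 'w \<Rightarrow> 'u::ab_group_add) \<Rightarrow> ('k, 'v, 'w) tensor \<Rightarrow> 'u" where
  "tlift V W \<beta> t = (THE z. \<exists>ps. set ps \<subseteq> vcarrier V \<times> vcarrier W \<and>
     t = (\<Sum>(x, y)\<leftarrow>ps. tens V W x y) \<and> z = (\<Sum>(x, y)\<leftarrow>ps. \<beta> x y))"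

text \<open>
  Tensor powers in the same style, with lists of functionals: \<open>ltens N [x\<^sub>1, \<dots>, x\<^sub>n]\<close> is
  \<open>x\<^sub>1 \<otimes> \<dots> \<otimes> x\<^sub>n\<close>. All powers of a space thus live in a single type. Only exponents
  \<open>n \<ge> 1\<close> are used. The map \<open>llift N n \<beta>\<close> is the linear map on \<open>N\<^sup>\<otimes>\<^sup>n\<close> induced by a multilinear
  \<open>\<beta>\<close>; it is well defined by \<open>llift_eq\<close>.
\<close>

type_synonym ('k, 'v) ltensor = "('v \<Rightarrow> 'k) list \<Rightarrow> 'k"

definition ltens ::
  "('k::field, 'v::ab_group_add, 'z) vspace_scheme \<Rightarrow> 'v list \<Rightarrow> ('k, 'v) ltensor" where
  "ltens N xs = (\<lambda>fs.
     if length fs = length xs \<and> (\<forall>f\<in>set fs. Vector_Spaces.linear (vscale N) (*) f)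
     then (\<Prod>(f, x)\<leftarrow>zip fs xs. f x) else 0)"

definition tensor_power ::
  "('k::field, 'v::ab_group_add, 'z) vspace_scheme \<Rightarrow> nat \<Rightarrow> ('k, ('k, 'v) ltensor) vspace" where
  "tensor_power N n =
     \<lparr>vcarrier = module.span fscale {ltens N xs |xs. length xs = n \<and> set xs \<subseteq> vcarrier N},
      vscale = fscale\<rparr>"

definition llift ::
  "('k::field, 'v::ab_group_add, 'z) vspace_scheme \<Rightarrow> nat \<Rightarrow>
   ('v list \<Rightarrow> 'u::ab_group_add) \<Rightarrow> ('k, 'v) ltensor \<Rightarrow> 'u" where
  "llift N n \<beta> t = (THE z. \<exists>xss. (\<forall>xs\<in>set xss. length xs = n \<and> set xs \<subseteq> vcarrier N) \<and>
     t = (\<Sum>xs\<leftarrow>xss. ltens N xs) \<and> z = (\<Sum>xs\<leftarrow>xss. \<beta> xs))"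

definition multilinear_map ::
  "('k, 'v::ab_group_add, 'z) vspace_scheme \<Rightarrow> nat \<Rightarrow>
   ('k, 'u::ab_group_add, 'x) vspace_scheme \<Rightarrow> ('v list \<Rightarrow> 'u) \<Rightarrow> bool" where
  "multilinear_map N n U \<beta> \<longleftrightarrow>
     (\<forall>us vs. Suc (length us + length vs) = n \<and> set us \<subseteq> vcarrier N \<and> set vs \<subseteq> vcarrier N \<longrightarrow>
        linear_map N U (\<lambda>x. \<beta> (us @ x # vs)))"


section \<open>Coalgebras\<close>

record ('k, 'c) coalg = "('k, 'c) vspace" +
  comul :: "'c \<Rightarrow> ('k, 'c, 'c) tensor"
  counit :: "'c \<Rightarrow> 'k"

definition coalgebra :: "('k::field, 'c::ab_group_add) coalg \<Rightarrow> bool" where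
  "coalgebra C \<longleftrightarrow>
     is_vspace C \<and>
     linear_map C (tensor_space C C) (comul C) \<and>
     linear_map C ground (counit C) \<and>
     (\<forall>c\<in>vcarrier C.
        tlift C C (\<lambda>x y. tens (tensor_space C C) C (comul C x) y) (comul C c) =
        tlift C C (\<lambda>x y. tlift C C (\<lambda>y' y''. tens (tensor_space C C) C (tens C C x y') y'') (comul C y))
          (comul C c)) \<and>
     (\<forall>c\<in>vcarrier C. tlift C C (\<lambda>x y. vscale C (counit C x) y) (comul C c) = c) \<and>
     (\<forall>c\<in>vcarrier C. tlift C C (\<lambda>x y. vscale C (counit C y) x) (comul C c) = c)"

definition right_coideal :: "('k::field, 'c::ab_group_add) coalg \<Rightarrow> 'c set \<Rightarrow> bool" where
  "right_coideal C I \<longleftrightarrow>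
     I \<subseteq> vcarrier C \<and> module.subspace (vscale C) I \<and>
     (\<forall>x\<in>I. comul C x \<in> vcarrier (tensor_space (C\<lparr>vcarrier := I\<rparr>) C))"

definition chain_coalgebra :: "('k::field, 'c::ab_group_add) coalg \<Rightarrow> bool" where
  "chain_coalgebra C \<longleftrightarrow>
     coalgebra C \<and> (\<forall>I J. right_coideal C I \<longrightarrow> right_coideal C J \<longrightarrow> I \<subseteq> J \<or> J \<subseteq> I)"

definition convolution ::
  "('k::field, 'c::ab_group_add) coalg \<Rightarrow> ('c \<Rightarrow> 'k) \<Rightarrow> ('c \<Rightarrow> 'k) \<Rightarrow> ('c \<Rightarrow> 'k)" where
  "convolution C f g =
     (\<lambda>c. if c \<in> vcarrier C then tlift C C (\<lambda>x y. f x * g y) (comul C c) else 0)"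

definition convolution_one :: "('k::field, 'c::ab_group_add) coalg \<Rightarrow> ('c \<Rightarrow> 'k)" where
  "convolution_one C = (\<lambda>c. if c \<in> vcarrier C then counit C c else 0)"

text \<open>The left action of the convolution algebra \<open>C\<^sup>*\<close> on \<open>C\<close>: \<open>f \<cdot> c = \<Sum> f(c\<^sub>2) c\<^sub>1\<close>.\<close>

definition dual_action ::
  "('k::field, 'c::ab_group_add) coalg \<Rightarrow> ('c \<Rightarrow> 'k) \<Rightarrow> 'c \<Rightarrow> 'c" where
  "dual_action C f c = tlift C C (\<lambda>x y. vscale C (f y) x) (comul C c)"

definition dual_submodule :: "('k::field, 'c::ab_group_add) coalg \<Rightarrow> 'c set \<Rightarrow> bool" where
  "dual_submodule C S \<longleftrightarrow>
     S \<subseteq> vcarrier C \<and> module.subspace (vscale C) S \<and>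
     (\<forall>f\<in>vcarrier (dual_space C). \<forall>x\<in>S. dual_action C f x \<in> S)"

definition simple_dual_submodule :: "('k::field, 'c::ab_group_add) coalg \<Rightarrow> 'c set \<Rightarrow> bool" where
  "simple_dual_submodule C S \<longleftrightarrow>
     dual_submodule C S \<and> S \<noteq> {0} \<and> (\<forall>S'. dual_submodule C S' \<and> S' \<subseteq> S \<longrightarrow> S' = {0} \<or> S' = S)"

definition coradical :: "('k::field, 'c::ab_group_add) coalg \<Rightarrow> 'c set" where
  "coradical C = module.span (vscale C) (\<Union>{S. simple_dual_submodule C S})"

text \<open>\<open>C\<lparr>vcarrier := coradical C\<rparr>\<close> is the coradical as a subcoalgebra of \<open>C\<close>.\<close>

definition of_type ::
  "('k::field, 'c::ab_group_add) coalg \<Rightarrow> ('k \<Rightarrow> 'd::division_ring \<Rightarrow> 'd) \<Rightarrow> bool" where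
  "of_type C s \<longleftrightarrow>
     (let C0 = C\<lparr>vcarrier := coradical C\<rparr> in
      \<exists>\<phi>. linear_map (dual_space C0) (full_space s) \<phi> \<and>
          bij_betw \<phi> (vcarrier (dual_space C0)) UNIV \<and>
          (\<forall>f\<in>vcarrier (dual_space C0). \<forall>g\<in>vcarrier (dual_space C0).
             \<phi> (convolution C0 f g) = \<phi> f * \<phi> g) \<and>
          \<phi> (convolution_one C0) = 1)"

definition coalgebra_embedding ::
  "('k::field, 'c::ab_group_add) coalg \<Rightarrow> ('k, 'e::ab_group_add) coalg \<Rightarrow> ('c \<Rightarrow> 'e) \<Rightarrow> bool" where
  "coalgebra_embedding C E f \<longleftrightarrow>
     linear_map C E f \<and> inj_on f (vcarrier C) \<and>
     (\<forall>c\<in>vcarrier C. comul E (f c) = tlift C C (\<lambda>x y. tens E E (f x) (f y)) (comul C c)) \<and>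
     (\<forall>c\<in>vcarrier C. counit E (f c) = counit C c)"


section \<open>Division algebras and their bimodules\<close>

definition fd_division_algebra :: "('k::field \<Rightarrow> 'd::division_ring \<Rightarrow> 'd) \<Rightarrow> bool" where
  "fd_division_algebra s \<longleftrightarrow>
     vector_space s \<and>
     (\<forall>a x y. s a (x * y) = s a x * y) \<and> (\<forall>a x y. s a (x * y) = x * s a y) \<and>
     (\<exists>B. finite B \<and> module.span s B = UNIV)"

text \<open>
  Separability of the \<open>k\<close>-algebra \<open>D\<close>: the multiplication \<open>D \<otimes> D \<rightarrow> D\<close> has a section that is a
  homomorphism of \<open>D\<close>-bimodules.
\<close>

definition separable :: "('k::field \<Rightarrow> 'd::division_ring \<Rightarrow> 'd) \<Rightarrow> bool" where
  "separable s \<longleftrightarrow>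
     (let D = full_space s in
      \<exists>\<sigma>. linear_map D (tensor_space D D) \<sigma> \<and>
          (\<forall>a x b. \<sigma> (a * x * b) = tlift D D (\<lambda>y z. tens D D (a * y) (z * b)) (\<sigma> x)) \<and>
          (\<forall>x. tlift D D (*) (\<sigma> x) = x))"

record ('k, 'd, 'm) bimod = "('k, 'm) vspace" +
  lact :: "'d \<Rightarrow> 'm \<Rightarrow> 'm"
  ract :: "'m \<Rightarrow> 'd \<Rightarrow> 'm"

definition bimodule ::
  "('k::field \<Rightarrow> 'd::division_ring \<Rightarrow> 'd) \<Rightarrow> ('k, 'd, 'm::ab_group_add) bimod \<Rightarrow> bool" where
  "bimodule s M \<longleftrightarrow>
     is_vspace M \<and>
     (\<forall>d. \<forall>m\<in>vcarrier M. lact M d m \<in> vcarrier M \<and> ract M m d \<in> vcarrier M) \<and>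
     (\<forall>d. \<forall>m\<in>vcarrier M. \<forall>m'\<in>vcarrier M.
        lact M d (m + m') = lact M d m + lact M d m' \<and>
        ract M (m + m') d = ract M m d + ract M m' d) \<and>
     (\<forall>d e. \<forall>m\<in>vcarrier M.
        lact M (d + e) m = lact M d m + lact M e m \<and>
        ract M m (d + e) = ract M m d + ract M m e) \<and>
     (\<forall>d e. \<forall>m\<in>vcarrier M.
        lact M (d * e) m = lact M d (lact M e m) \<and>
        ract M m (d * e) = ract M (ract M m d) e \<and>
        ract M (lact M d m) e = lact M d (ract M m e)) \<and>
     (\<forall>m\<in>vcarrier M. lact M 1 m = m \<and> ract M m 1 = m) \<and>
     (\<forall>a. \<forall>m\<in>vcarrier M. lact M (s a 1) m = vscale M a m \<and> ract M m (s a 1) = vscale M a m)"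


section \<open>Dual coalgebras and dual bicomodules\<close>

text \<open>
  The transpose \<open>X\<^sup>* \<rightarrow> (U \<otimes> V)\<^sup>* \<cong> U\<^sup>* \<otimes> V\<^sup>*\<close> of a bilinear map \<open>\<mu> : U \<times> V \<rightarrow> X\<close>, for
  finite-dimensional \<open>U\<close> and \<open>V\<close>: it sends \<open>f\<close> to the tensor \<open>\<Sum> f' \<otimes> f''\<close> with
  \<open>f (\<mu> u v) = \<Sum> f' u * f'' v\<close>.
\<close>

definition transpose_map ::
  "('k::field, 'u::ab_group_add, 'z) vspace_scheme \<Rightarrow> ('k, 'v::ab_group_add, 'y) vspace_scheme \<Rightarrow>
   ('u \<Rightarrow> 'v \<Rightarrow> 'x) \<Rightarrow> ('x \<Rightarrow> 'k) \<Rightarrow> ('k, 'u \<Rightarrow> 'k, 'v \<Rightarrow> 'k) tensor" where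
  "transpose_map U V \<mu> f = (THE t.
     t \<in> vcarrier (tensor_space (dual_space U) (dual_space V)) \<and>
     (\<forall>u\<in>vcarrier U. \<forall>v\<in>vcarrier V.
        tlift (dual_space U) (dual_space V) (\<lambda>g h. g u * h v) t = f (\<mu> u v)))"

definition dual_coalgebra ::
  "('k::field \<Rightarrow> 'd::division_ring \<Rightarrow> 'd) \<Rightarrow> ('k, 'd \<Rightarrow> 'k) coalg" where
  "dual_coalgebra s =
     \<lparr>vcarrier = vcarrier (dual_space (full_space s)), vscale = fscale,
      comul = transpose_map (full_space s) (full_space s) (*),
      counit = (\<lambda>f. f 1)\<rparr>"

record ('k, 'c, 'n) bicomod = "('k, 'n) vspace" +
  lcoact :: "'n \<Rightarrow> ('k, 'c, 'n) tensor"
  rcoact :: "'n \<Rightarrow> ('k, 'n, 'c) tensor"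

definition dual_bicomodule ::
  "('k::field \<Rightarrow> 'd::division_ring \<Rightarrow> 'd) \<Rightarrow> ('k, 'd, 'm::ab_group_add) bimod \<Rightarrow>
   ('k, 'd \<Rightarrow> 'k, 'm \<Rightarrow> 'k) bicomod" where
  "dual_bicomodule s M =
     \<lparr>vcarrier = vcarrier (dual_space M), vscale = fscale,
      lcoact = transpose_map (full_space s) M (lact M),
      rcoact = transpose_map M (full_space s) (ract M)\<rparr>"


section \<open>Cotensor coalgebras\<close>

text \<open>
  For \<open>n \<ge> 1\<close>, \<open>N\<^sup>\<box>\<^sup>n\<close> consists of the \<open>t \<in> N\<^sup>\<otimes>\<^sup>n\<close> such that, for every pair of adjacent factors,
  applying \<open>\<rho>\<^sup>r\<close> to the left one and applying \<open>\<rho>\<^sup>l\<close> to the right one give the same element of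
  \<open>N\<^sup>\<otimes>\<^sup>i\<^sup>+\<^sup>1 \<otimes> C \<otimes> N\<^sup>\<otimes>\<^sup>n\<^sup>-\<^sup>i\<^sup>-\<^sup>1\<close> (factors are numbered from 0). For \<open>n = 1\<close> this is \<open>N\<close>, up to
  the identification of \<open>m\<close> with \<open>ltens N [m]\<close>.
\<close>

definition cotensor_power ::
  "('k::field, 'c::ab_group_add) coalg \<Rightarrow> ('k, 'c, 'n::ab_group_add) bicomod \<Rightarrow> nat \<Rightarrow>
   ('k, 'n) ltensor set" where
  "cotensor_power C N n =
     {t \<in> vcarrier (tensor_power N n). \<forall>i. Suc i < n \<longrightarrow>
        (let A = tensor_power N (Suc i); B = tensor_power N (n - Suc i);
             word = (\<lambda>us c vs. tens (tensor_space A C) B (tens A C (ltens N us) c) (ltens N vs))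
         in llift N n (\<lambda>xs. tlift N C (\<lambda>m c. word (take i xs @ [m]) c (drop (Suc i) xs))
                        (rcoact N (xs ! i))) t =
            llift N n (\<lambda>xs. tlift C N (\<lambda>c m. word (take (Suc i) xs) c (m # drop (Suc (Suc i)) xs))
                        (lcoact N (xs ! Suc i))) t)}"

text \<open>
  Elements of the direct sum are pairs of a component in \<open>C\<close> and a finitely supported sequence
  whose \<open>n\<close>-th entry is the component in \<open>N\<^sup>\<box>\<^sup>n\<close>, \<open>n \<ge> 1\<close>.
\<close>

type_synonym ('k, 'c, 'n) cotensor = "'c \<times> (nat \<Rightarrow> ('k, 'n) ltensor)"

definition cotensor_space ::
  "('k::field, 'c::ab_group_add) coalg \<Rightarrow> ('k, 'c, 'n::ab_group_add) bicomod \<Rightarrow>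
   ('k, ('k, 'c, 'n) cotensor) vspace" where
  "cotensor_space C N =
     \<lparr>vcarrier = {(c, t). c \<in> vcarrier C \<and> t 0 = 0 \<and>
                    (\<forall>n\<ge>1. t n \<in> cotensor_power C N n) \<and> finite {n. t n \<noteq> 0}},
      vscale = (\<lambda>a (c, t). (vscale C a c, \<lambda>n. fscale a (t n)))\<rparr>"

definition inj_base :: "'c \<Rightarrow> ('k::field, 'c, 'n) cotensor" where
  "inj_base c = (c, 0)"

definition inj_power :: "nat \<Rightarrow> ('k::field, 'n) ltensor \<Rightarrow> ('k, 'c::ab_group_add, 'n) cotensor" where
  "inj_power n t = (0, (\<lambda>_. 0)(n := t))"

text \<open>
  The comultiplication of a pure tensor \<open>m\<^sub>1 \<otimes> \<dots> \<otimes> m\<^sub>n\<close>, given by the list \<open>xs\<close>, \<open>n \<ge> 1\<close>. For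
  \<open>n = 1\<close> the middle sum is empty. Individual summands of an element of \<open>N\<^sup>\<box>\<^sup>n\<close> need not lie in
  the cotensor product; the formula is evaluated in the larger space with \<open>N\<^sup>\<otimes>\<^sup>i\<close> instead of
  \<open>N\<^sup>\<box>\<^sup>i\<close>, whose tensor square contains that of the cotensor coalgebra.
\<close>

definition word_comul ::
  "('k::field, 'c::ab_group_add) coalg \<Rightarrow> ('k, 'c, 'n::ab_group_add) bicomod \<Rightarrow> 'n list \<Rightarrow>
   ('k, ('k, 'c, 'n) cotensor, ('k, 'c, 'n) cotensor) tensor" where
  "word_comul C N xs =
     (let n = length xs; T = cotensor_space C N;
          pow = (\<lambda>ys. inj_power (length ys) (ltens N ys))
      in tlift C N (\<lambda>c m. tens T T (inj_base c) (pow (m # tl xs))) (lcoact N (hd xs)) +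
         (\<Sum>i = 1..<n. tens T T (pow (take i xs)) (pow (drop i xs))) +
         tlift N C (\<lambda>m c. tens T T (pow (butlast xs @ [m])) (inj_base c)) (rcoact N (last xs)))"

definition cotensor_coalgebra ::
  "('k::field, 'c::ab_group_add) coalg \<Rightarrow> ('k, 'c, 'n::ab_group_add) bicomod \<Rightarrow>
   ('k, ('k, 'c, 'n) cotensor) coalg" where
  "cotensor_coalgebra C N =
     (let T = cotensor_space C N in
      \<lparr>vcarrier = vcarrier T, vscale = vscale T,
       comul = (\<lambda>(c, t).
         tlift C C (\<lambda>x y. tens T T (inj_base x) (inj_base y)) (comul C c) +
         (\<Sum>n | t n \<noteq> 0. llift N n (word_comul C N) (t n))),
       counit = (\<lambda>(c, t). counit C c)\<rparr>)"


section \<open>The universal property of the tensor product\<close>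


lemma fun_sum_apply: "(\<Sum>i\<in>I. f i) x = (\<Sum>i\<in>I. f i x)"
  for f :: "'i \<Rightarrow> 'x \<Rightarrow> 'k::comm_monoid_add"
  by (induction I rule: infinite_finite_induct) auto

lemma vector_space_fscale: "vector_space (fscale :: 'k::field \<Rightarrow> ('x \<Rightarrow> 'k) \<Rightarrow> 'x \<Rightarrow> 'k)"
  by unfold_locales (auto simp: fscale_def fun_eq_iff algebra_simps)

lemma vector_space_ground: "vector_space ((*) :: 'k::field \<Rightarrow> 'k \<Rightarrow> 'k)"
  by unfold_locales (auto simp: algebra_simps)

lemma linear_map_zero:
  assumes "is_vspace V" "is_vspace W" "linear_map V W f"
  shows "f 0 = 0"
proof -
  interpret V: vector_space "vscale V" using assms(1) by (simp add: is_vspace_def)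
  have "0 \<in> vcarrier V" using assms(1) by (simp add: is_vspace_def V.subspace_0)
  then have "f (0 + 0) = f 0 + f 0" using assms(3) unfolding linear_map_def by blast
  then show ?thesis by simp
qed

lemma linear_map_sum:
  assumes "is_vspace V" "is_vspace W" "linear_map V W f" "\<And>i. i \<in> I \<Longrightarrow> x i \<in> vcarrier V"
  shows "f (\<Sum>i\<in>I. x i) = (\<Sum>i\<in>I. f (x i))"
proof -
  interpret V: vector_space "vscale V" using assms(1) by (simp add: is_vspace_def)
  have sub: "V.subspace (vcarrier V)" using assms(1) by (simp add: is_vspace_def)
  show ?thesis
    using assms(4)
  proof (induction I rule: infinite_finite_induct)
    case (insert i I)
    then have "x i \<in> vcarrier V" "(\<Sum>i\<in>I. x i) \<in> vcarrier V"
      using V.subspace_sum[OF sub, of I x] by auto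
    then show ?case using insert assms(3) unfolding linear_map_def by simp
  qed (use linear_map_zero[OF assms(1-3)] in auto)
qed

text \<open>Coordinates with respect to a finite independent set, as functionals on the ambient space.\<close>

lemma coordinates_exist:
  assumes V: "vector_space s" and S: "finite S"
  obtains B c where "finite B" "B \<subseteq> S" "\<And>b. Vector_Spaces.linear s (*) (c b)"
    "\<And>x. x \<in> S \<Longrightarrow> x = (\<Sum>b\<in>B. s (c b x) b)"
proof -
  interpret vector_space s by fact
  obtain B where B: "B \<subseteq> S" "independent B" "S \<subseteq> span B"
    using maximal_independent_subset by blast
  then have fB: "finite B" using S finite_subset by blast
  have ext: "independent (extend_basis B)" "span (extend_basis B) = UNIV" "B \<subseteq> extend_basis B"
    using B by (auto simp: independent_extend_basis extend_basis_superset)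
  define c where "c b x = representation (extend_basis B) x b" for b x
  have lin: "Vector_Spaces.linear s (*) (c b)" for b
    using linear_representation[OF ext(1,2), of b] unfolding c_def by simp
  have coord: "x = (\<Sum>b\<in>B. s (c b x) b)" if "x \<in> S" for x
  proof -
    have "x \<in> span B" using B that by blast
    then have "representation (extend_basis B) x = representation B x"
      using representation_extend[OF ext(1) _ ext(3)] by simp
    moreover have "(\<Sum>b\<in>B. s (representation B x b) b) = x"
      by (rule sum_representation_eq[OF B(2) \<open>x \<in> span B\<close> fB subset_refl])
    ultimately show ?thesis by (simp add: c_def)
  qed
  show ?thesis by (rule that[OF fB B(1) lin coord])
qed

lemma functionals_separate:
  assumes V: "vector_space s" and g: "\<And>g. Vector_Spaces.linear s (*) g \<Longrightarrow> g y = 0"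
  shows "y = 0"
proof -
  obtain B c where *: "\<And>b. Vector_Spaces.linear s (*) (c b)" "y = (\<Sum>b\<in>B. s (c b y) b)"
    by (rule coordinates_exist[OF V, of "{y}"]) auto
  interpret vector_space s by fact
  have "(\<Sum>b\<in>B. s (c b y) b) = 0" by (simp add: g[OF *(1)])
  then show ?thesis using *(2) by simp
qed

lemma tens_sum_zero:
  assumes V: "is_vspace V" and W: "is_vspace W" and U: "is_vspace U"
    and \<beta>: "bilinear_map V W U \<beta>" and I: "finite I"
    and x: "\<And>i. i \<in> I \<Longrightarrow> x i \<in> vcarrier V" and y: "\<And>i. i \<in> I \<Longrightarrow> y i \<in> vcarrier W"
    and zero: "(\<Sum>i\<in>I. tens V W (x i) (y i)) = 0"
  shows "(\<Sum>i\<in>I. \<beta> (x i) (y i)) = 0"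
proof -
  interpret V: vector_space "vscale V" using V by (simp add: is_vspace_def)
  interpret W: vector_space "vscale W" using W by (simp add: is_vspace_def)
  have subV: "V.subspace (vcarrier V)" and subW: "W.subspace (vcarrier W)"
    using V W by (auto simp: is_vspace_def)
  obtain B c where B: "finite B" "B \<subseteq> x ` I" "\<And>b. Vector_Spaces.linear (vscale V) (*) (c b)"
    "\<And>v. v \<in> x ` I \<Longrightarrow> v = (\<Sum>b\<in>B. vscale V (c b v) b)"
    using coordinates_exist[OF V.vector_space_axioms, of "x ` I"] I by blast
  have BV: "B \<subseteq> vcarrier V" using B(2) x by auto
  have y0: "(\<Sum>i\<in>I. vscale W (c b (x i)) (y i)) = 0" for b
  proof (rule functionals_separate[OF W.vector_space_axioms])
    fix g assume g: "Vector_Spaces.linear (vscale W) (*) g"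
    then interpret g: Vector_Spaces.linear "vscale W" "(*)" g .
    have "0 = (\<Sum>i\<in>I. tens V W (x i) (y i)) (c b, g)" using zero by simp
    also have "\<dots> = (\<Sum>i\<in>I. c b (x i) * g (y i))"
      using g B(3) by (simp add: fun_sum_apply tens_def)
    finally show "g (\<Sum>i\<in>I. vscale W (c b (x i)) (y i)) = 0"
      by (simp add: g.sum g.scale)
  qed
  have "(\<Sum>i\<in>I. \<beta> (x i) (y i)) = (\<Sum>i\<in>I. \<Sum>b\<in>B. \<beta> b (vscale W (c b (x i)) (y i)))"
  proof (rule sum.cong[OF refl])
    fix i assume i: "i \<in> I"
    have l1: "linear_map V U (\<lambda>v. \<beta> v (y i))" using \<beta> y[OF i] by (simp add: bilinear_map_def)
    have "\<beta> (x i) (y i) = \<beta> (\<Sum>b\<in>B. vscale V (c b (x i)) b) (y i)" using B(4) i by auto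
    also have "\<dots> = (\<Sum>b\<in>B. \<beta> (vscale V (c b (x i)) b) (y i))"
      using BV V.subspace_scale[OF subV] by (intro linear_map_sum[OF V U l1]) auto
    also have "\<dots> = (\<Sum>b\<in>B. \<beta> b (vscale W (c b (x i)) (y i)))"
    proof (rule sum.cong[OF refl])
      fix b assume "b \<in> B"
      then have b: "b \<in> vcarrier V" using BV by auto
      then have l2: "linear_map W U (\<beta> b)" using \<beta> by (simp add: bilinear_map_def)
      show "\<beta> (vscale V (c b (x i)) b) (y i) = \<beta> b (vscale W (c b (x i)) (y i))"
        using l1 l2 b y[OF i] by (simp add: linear_map_def)
    qed
    finally show "\<beta> (x i) (y i) = (\<Sum>b\<in>B. \<beta> b (vscale W (c b (x i)) (y i)))" .
  qed
  also have "\<dots> = (\<Sum>b\<in>B. \<Sum>i\<in>I. \<beta> b (vscale W (c b (x i)) (y i)))" by (rule sum.swap)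
  also have "\<dots> = 0"
  proof (rule sum.neutral, rule ballI)
    fix b assume "b \<in> B"
    then have l2: "linear_map W U (\<beta> b)" using BV \<beta> by (auto simp: bilinear_map_def)
    have "(\<Sum>i\<in>I. \<beta> b (vscale W (c b (x i)) (y i))) = \<beta> b (\<Sum>i\<in>I. vscale W (c b (x i)) (y i))"
      using y W.subspace_scale[OF subW] by (intro linear_map_sum[OF W U l2, symmetric]) auto
    then show "(\<Sum>i\<in>I. \<beta> b (vscale W (c b (x i)) (y i))) = 0"
      using y0 linear_map_zero[OF W U l2] by simp
  qed
  finally show ?thesis .
qed

lemma ext_pair: "(\<And>x y. f (x, y) = g (x, y)) \<Longrightarrow> f = g"
  by auto

lemma tens_linear:
  assumes "is_vspace V" "is_vspace W"
  shows "tens V W (x + x') y = tens V W x y + tens V W x' y"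
    "tens V W x (y + y') = tens V W x y + tens V W x y'"
    "tens V W (vscale V a x) y = fscale a (tens V W x y)"
    "tens V W x (vscale W a y) = fscale a (tens V W x y)"
proof -
  have *: "tens V W (x + x') y (f, g) = (tens V W x y + tens V W x' y) (f, g) \<and>
    tens V W x (y + y') (f, g) = (tens V W x y + tens V W x y') (f, g) \<and>
    tens V W (vscale V a x) y (f, g) = fscale a (tens V W x y) (f, g) \<and>
    tens V W x (vscale W a y) (f, g) = fscale a (tens V W x y) (f, g)" for f g
  proof (cases "Vector_Spaces.linear (vscale V) (*) f \<and> Vector_Spaces.linear (vscale W) (*) g")
    case True
    then have "f (x + x') = f x + f x'" "f (vscale V a x) = a * f x"
      "g (y + y') = g y + g y'" "g (vscale W a y) = a * g y"
      by (simp_all add: Vector_Spaces.linear_iff)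
    then show ?thesis using True
      by (simp add: tens_def fscale_def distrib_left distrib_right mult.assoc mult.left_commute)
  next
    case False
    then show ?thesis by (auto simp: tens_def fscale_def)
  qed
  show "tens V W (x + x') y = tens V W x y + tens V W x' y"
    by (rule ext_pair) (rule *[THEN conjunct1])
  show "tens V W x (y + y') = tens V W x y + tens V W x y'"
    by (rule ext_pair) (rule *[THEN conjunct2, THEN conjunct1])
  show "tens V W (vscale V a x) y = fscale a (tens V W x y)"
    by (rule ext_pair) (rule *[THEN conjunct2, THEN conjunct2, THEN conjunct1])
  show "tens V W x (vscale W a y) = fscale a (tens V W x y)"
    by (rule ext_pair) (rule *[THEN conjunct2, THEN conjunct2, THEN conjunct2])
qed

lemma multilinear_mapD:
  assumes "multilinear_map N n U \<beta>" "Suc (length us + length vs) = n"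
    "set us \<subseteq> vcarrier N" "set vs \<subseteq> vcarrier N"
  shows "linear_map N U (\<lambda>x. \<beta> (us @ x # vs))"
  using assms unfolding multilinear_map_def by blast

lemma ltens_sum_zero:
  assumes N: "is_vspace N" and U: "is_vspace U" and I: "finite I"
  shows "multilinear_map N n U \<beta> \<Longrightarrow>
    (\<And>i. i \<in> I \<Longrightarrow> length (x i) = n \<and> set (x i) \<subseteq> vcarrier N) \<Longrightarrow>
    (\<Sum>i\<in>I. fscale (a i) (ltens N (x i))) = 0 \<Longrightarrow> (n = 0 \<Longrightarrow> \<beta> [] \<in> vcarrier U) \<Longrightarrow>
    (\<Sum>i\<in>I. vscale U (a i) (\<beta> (x i))) = 0"
proof (induction n arbitrary: \<beta> x a)
  case 0
  interpret U: vector_space "vscale U" using U by (simp add: is_vspace_def)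
  have "0 = (\<Sum>i\<in>I. fscale (a i) (ltens N (x i))) []" using 0 by simp
  also have "\<dots> = (\<Sum>i\<in>I. a i)" using 0 by (simp add: fun_sum_apply fscale_def ltens_def)
  finally have "(\<Sum>i\<in>I. a i) = 0" by simp
  moreover have "(\<Sum>i\<in>I. vscale U (a i) (\<beta> (x i))) = vscale U (\<Sum>i\<in>I. a i) (\<beta> [])"
    using 0 by (simp add: U.scale_sum_left)
  ultimately show ?case by simp
next
  case (Suc n)
  interpret N: vector_space "vscale N" using N by (simp add: is_vspace_def)
  interpret U: vector_space "vscale U" using U by (simp add: is_vspace_def)
  have subN: "N.subspace (vcarrier N)" using N by (auto simp: is_vspace_def)
  define h where "h i = hd (x i)" for i
  define r where "r i = tl (x i)" for i
  have xi: "x i = h i # r i" "h i \<in> vcarrier N" "length (r i) = n" "set (r i) \<subseteq> vcarrier N"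
    if "i \<in> I" for i
    using Suc.prems(2)[OF that] unfolding h_def r_def by (cases "x i"; auto)+
  obtain B c where B: "finite B" "B \<subseteq> h ` I" "\<And>b. Vector_Spaces.linear (vscale N) (*) (c b)"
    "\<And>v. v \<in> h ` I \<Longrightarrow> v = (\<Sum>b\<in>B. vscale N (c b v) b)"
    using coordinates_exist[OF N.vector_space_axioms, of "h ` I"] I by blast
  have BN: "B \<subseteq> vcarrier N" using B(2) xi(2) by auto
  have lin: "linear_map N U (\<lambda>v. \<beta> (v # r i))" if "i \<in> I" for i
    using multilinear_mapD[OF Suc.prems(1), of "[]" "r i"] xi[OF that] by simp
  have z: "(\<Sum>i\<in>I. vscale U (a i * c b (h i)) (\<beta> (b # r i))) = 0" if b: "b \<in> B" for b
  proof (rule Suc.IH[where \<beta> = "\<lambda>ys. \<beta> (b # ys)" and x = r])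
    show "multilinear_map N n U (\<lambda>ys. \<beta> (b # ys))"
      unfolding multilinear_map_def
    proof (intro allI impI)
      fix us vs assume "Suc (length us + length vs) = n \<and> set us \<subseteq> vcarrier N \<and> set vs \<subseteq> vcarrier N"
      then show "linear_map N U (\<lambda>x. \<beta> (b # us @ x # vs))"
        using multilinear_mapD[OF Suc.prems(1), of "b # us" vs] b BN by auto
    qed
    show "\<And>i. i \<in> I \<Longrightarrow> length (r i) = n \<and> set (r i) \<subseteq> vcarrier N"
      using xi(3,4) by blast
    show "(\<Sum>i\<in>I. fscale (a i * c b (h i)) (ltens N (r i))) = 0"
    proof (rule ext)
      fix fs
      have "0 = (\<Sum>i\<in>I. fscale (a i) (ltens N (x i))) (c b # fs)" using Suc.prems(3) by simp
      also have "\<dots> = (\<Sum>i\<in>I. a i * ltens N (x i) (c b # fs))"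
        by (simp add: fun_sum_apply fscale_def)
      also have "\<dots> = (\<Sum>i\<in>I. a i * (c b (h i) * ltens N (r i) fs))"
        using B(3) xi(1) by (intro sum.cong refl) (simp add: ltens_def)
      finally show "(\<Sum>i\<in>I. fscale (a i * c b (h i)) (ltens N (r i))) fs = 0 fs"
        by (simp add: fun_sum_apply fscale_def mult.assoc)
    qed
    show "\<beta> [b] \<in> vcarrier U" if n0: "n = 0"
    proof -
      have "linear_map N U (\<lambda>x. \<beta> ([] @ x # []))"
        by (rule multilinear_mapD[OF Suc.prems(1)]) (simp_all add: n0)
      then show ?thesis using b BN by (auto simp: linear_map_def)
    qed
  qed
  have "(\<Sum>i\<in>I. vscale U (a i) (\<beta> (x i))) =
        (\<Sum>i\<in>I. \<Sum>b\<in>B. vscale U (a i * c b (h i)) (\<beta> (b # r i)))"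
  proof (rule sum.cong[OF refl])
    fix i assume i: "i \<in> I"
    have "\<beta> (x i) = \<beta> ((\<Sum>b\<in>B. vscale N (c b (h i)) b) # r i)" using B(4) xi[OF i] i by auto
    also have "\<dots> = (\<Sum>b\<in>B. \<beta> (vscale N (c b (h i)) b # r i))"
      using BN N.subspace_scale[OF subN] by (intro linear_map_sum[OF N U lin[OF i]]) auto
    also have "\<dots> = (\<Sum>b\<in>B. vscale U (c b (h i)) (\<beta> (b # r i)))"
      using lin[OF i] BN by (intro sum.cong refl) (auto simp: linear_map_def)
    finally show "vscale U (a i) (\<beta> (x i)) = (\<Sum>b\<in>B. vscale U (a i * c b (h i)) (\<beta> (b # r i)))"
      by (simp add: U.scale_sum_right)
  qed
  also have "\<dots> = (\<Sum>b\<in>B. \<Sum>i\<in>I. vscale U (a i * c b (h i)) (\<beta> (b # r i)))" by (rule sum.swap)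
  also have "\<dots> = 0" using z by simp
  finally show ?case .
qed


lemma tlift_eq:
  assumes V: "is_vspace V" and W: "is_vspace W" and U: "is_vspace U"
    and \<beta>: "bilinear_map V W U \<beta>" and ps: "set ps \<subseteq> vcarrier V \<times> vcarrier W"
  shows "tlift V W \<beta> (\<Sum>(x, y)\<leftarrow>ps. tens V W x y) = (\<Sum>(x, y)\<leftarrow>ps. \<beta> x y)"
  unfolding tlift_def
proof (rule the_equality)
  interpret V: vector_space "vscale V" using V by (simp add: is_vspace_def)
  interpret W: vector_space "vscale W" using W by (simp add: is_vspace_def)
  interpret U: vector_space "vscale U" using U by (simp add: is_vspace_def)
  have subV: "V.subspace (vcarrier V)" using V by (auto simp: is_vspace_def)
  show "\<exists>qs. set qs \<subseteq> vcarrier V \<times> vcarrier W \<and>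
      (\<Sum>(x, y)\<leftarrow>ps. tens V W x y) = (\<Sum>(x, y)\<leftarrow>qs. tens V W x y) \<and>
      (\<Sum>(x, y)\<leftarrow>ps. \<beta> x y) = (\<Sum>(x, y)\<leftarrow>qs. \<beta> x y)" using ps by blast
  fix z assume "\<exists>qs. set qs \<subseteq> vcarrier V \<times> vcarrier W \<and>
      (\<Sum>(x, y)\<leftarrow>ps. tens V W x y) = (\<Sum>(x, y)\<leftarrow>qs. tens V W x y) \<and>
      z = (\<Sum>(x, y)\<leftarrow>qs. \<beta> x y)"
  then obtain qs where qs: "set qs \<subseteq> vcarrier V \<times> vcarrier W"
      "(\<Sum>(x, y)\<leftarrow>ps. tens V W x y) = (\<Sum>(x, y)\<leftarrow>qs. tens V W x y)"
      "z = (\<Sum>(x, y)\<leftarrow>qs. \<beta> x y)" by blast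
  define rs where "rs = ps @ map (\<lambda>(x, y). (vscale V (-1) x, y)) qs"
  have rs: "set rs \<subseteq> vcarrier V \<times> vcarrier W"
    using ps qs(1) V.subspace_scale[OF subV, of _ "-1"] unfolding rs_def
    by (fastforce simp del: V.scale_minus_left)
  have sum_uminus: "(\<Sum>(x, y)\<leftarrow>qs. - f x y) = - (\<Sum>(x, y)\<leftarrow>qs. f x y)"
    for f :: "_ \<Rightarrow> _ \<Rightarrow> 'h::ab_group_add"
    by (induction qs) auto
  have neg: "fscale (- 1) t = - t" for t :: "('a, 'b, 'd) tensor"
    by (auto simp: fscale_def)
  have "(\<Sum>(x, y)\<leftarrow>rs. tens V W x y) =
      (\<Sum>(x, y)\<leftarrow>ps. tens V W x y) + (\<Sum>(x, y)\<leftarrow>qs. - tens V W x y)"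
    unfolding rs_def
    by (simp add: o_def case_prod_unfold tens_linear[OF V W] neg del: V.scale_minus_left)
  then have "(\<Sum>(x, y)\<leftarrow>rs. tens V W x y) = 0" using qs(2) by (simp add: sum_uminus)
  then have "(\<Sum>i\<in>{0..<length rs}. tens V W (fst (rs ! i)) (snd (rs ! i))) = 0"
    by (simp add: sum_list_sum_nth case_prod_beta)
  then have "(\<Sum>i\<in>{0..<length rs}. \<beta> (fst (rs ! i)) (snd (rs ! i))) = 0"
  proof (rule tens_sum_zero[OF V W U \<beta> finite_atLeastLessThan, rotated 2])
    fix i assume "i \<in> {0..<length rs}"
    then have "rs ! i \<in> set rs" by auto
    then show "fst (rs ! i) \<in> vcarrier V" "snd (rs ! i) \<in> vcarrier W" using rs by auto
  qed
  then have "(\<Sum>(x, y)\<leftarrow>rs. \<beta> x y) = 0"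
    by (simp add: sum_list_sum_nth case_prod_beta)
  moreover have "(\<Sum>(x, y)\<leftarrow>qs. \<beta> (vscale V (-1) x) y) = (\<Sum>(x, y)\<leftarrow>qs. - \<beta> x y)"
  proof (rule arg_cong[of _ _ sum_list], rule map_cong[OF refl])
    fix p assume "p \<in> set qs"
    then obtain x y where p: "p = (x, y)" "x \<in> vcarrier V" "y \<in> vcarrier W" using qs(1) by auto
    then have "linear_map V U (\<lambda>x. \<beta> x y)" using \<beta> by (simp add: bilinear_map_def)
    then have "\<beta> (vscale V (-1) x) y = vscale U (-1) (\<beta> x y)"
      using p(2) unfolding linear_map_def by blast
    then show "(case p of (x, y) \<Rightarrow> \<beta> (vscale V (-1) x) y) = (case p of (x, y) \<Rightarrow> - \<beta> x y)"
      using p(1) by simp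
  qed
  ultimately have "(\<Sum>(x, y)\<leftarrow>ps. \<beta> x y) = (\<Sum>(x, y)\<leftarrow>qs. \<beta> x y)"
    unfolding rs_def by (simp add: o_def case_prod_unfold sum_uminus[unfolded case_prod_unfold])
  then show "z = (\<Sum>(x, y)\<leftarrow>ps. \<beta> x y)" using qs(3) by simp
qed

lemma tensor_space_elem:
  assumes V: "is_vspace V" and W: "is_vspace W"
    and t: "t \<in> vcarrier (tensor_space V W)"
  obtains ps where "set ps \<subseteq> vcarrier V \<times> vcarrier W" "t = (\<Sum>(x, y)\<leftarrow>ps. tens V W x y)"
proof -
  interpret F: vector_space "fscale :: 'a \<Rightarrow> ('a, 'b, 'd) tensor \<Rightarrow> _" by (rule vector_space_fscale)
  interpret V: vector_space "vscale V" using V by (simp add: is_vspace_def)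
  have subV: "V.subspace (vcarrier V)" using V by (auto simp: is_vspace_def)
  have "t \<in> F.span {tens V W x y |x y. x \<in> vcarrier V \<and> y \<in> vcarrier W}"
    using t by (simp add: tensor_space_def)
  then have "\<exists>ps. set ps \<subseteq> vcarrier V \<times> vcarrier W \<and> t = (\<Sum>(x, y)\<leftarrow>ps. tens V W x y)"
  proof (induction rule: F.span_induct_alt)
    case base
    show ?case by (rule exI[of _ "[]"]) auto
  next
    case (step a b t)
    then obtain x y ps where *: "b = tens V W x y" "x \<in> vcarrier V" "y \<in> vcarrier W"
      "set ps \<subseteq> vcarrier V \<times> vcarrier W" "t = (\<Sum>(x, y)\<leftarrow>ps. tens V W x y)" by auto
    show ?case
      by (rule exI[of _ "(vscale V a x, y) # ps"])
        (use * V.subspace_scale[OF subV] in \<open>auto simp: tens_linear[OF V W]\<close>)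
  qed
  then show ?thesis using that by blast
qed

theorem tensor_universal:
  assumes V: "is_vspace V" and W: "is_vspace W" and U: "is_vspace U"
    and \<beta>: "bilinear_map V W U \<beta>"
  shows "bilinear_map V W (tensor_space V W) (tens V W)"
    and "linear_map (tensor_space V W) U (tlift V W \<beta>)"
    and "\<And>x y. x \<in> vcarrier V \<Longrightarrow> y \<in> vcarrier W \<Longrightarrow> tlift V W \<beta> (tens V W x y) = \<beta> x y"
    and "\<And>f t. linear_map (tensor_space V W) U f \<Longrightarrow>
      (\<And>x y. x \<in> vcarrier V \<Longrightarrow> y \<in> vcarrier W \<Longrightarrow> f (tens V W x y) = \<beta> x y) \<Longrightarrow>
      t \<in> vcarrier (tensor_space V W) \<Longrightarrow> f t = tlift V W \<beta> t"
proof -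
  interpret F: vector_space "fscale :: 'a \<Rightarrow> ('a, 'b, 'd) tensor \<Rightarrow> _" by (rule vector_space_fscale)
  interpret V: vector_space "vscale V" using V by (simp add: is_vspace_def)
  interpret U: vector_space "vscale U" using U by (simp add: is_vspace_def)
  have subV: "V.subspace (vcarrier V)" and subU: "U.subspace (vcarrier U)"
    using V U by (auto simp: is_vspace_def)
  have T: "is_vspace (tensor_space V W)"
    by (simp add: is_vspace_def tensor_space_def vector_space_fscale)
  have mem: "tens V W x y \<in> vcarrier (tensor_space V W)"
    if "x \<in> vcarrier V" "y \<in> vcarrier W" for x y
    using that by (auto simp: tensor_space_def intro!: F.span_base)
  then show "bilinear_map V W (tensor_space V W) (tens V W)"
    using tens_linear[OF V W]
    by (simp add: bilinear_map_def linear_map_def) (simp add: tensor_space_def)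
  show pure: "tlift V W \<beta> (tens V W x y) = \<beta> x y" if "x \<in> vcarrier V" "y \<in> vcarrier W" for x y
    using tlift_eq[OF V W U \<beta>, of "[(x, y)]"] that by simp
  have \<beta>U: "\<beta> x y \<in> vcarrier U" if "x \<in> vcarrier V" "y \<in> vcarrier W" for x y
    using \<beta> that by (simp add: bilinear_map_def linear_map_def)
  show lin: "linear_map (tensor_space V W) U (tlift V W \<beta>)"
    unfolding linear_map_def
  proof (intro conjI ballI allI)
    fix t assume "t \<in> vcarrier (tensor_space V W)"
    then obtain ps where ps: "set ps \<subseteq> vcarrier V \<times> vcarrier W"
      "t = (\<Sum>(x, y)\<leftarrow>ps. tens V W x y)" by (rule tensor_space_elem[OF V W])
    have "(\<Sum>(x, y)\<leftarrow>ps. \<beta> x y) \<in> vcarrier U"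
      using ps(1) by (induction ps) (auto intro!: U.subspace_add[OF subU] U.subspace_0[OF subU] \<beta>U)
    then show "tlift V W \<beta> t \<in> vcarrier U" using tlift_eq[OF V W U \<beta> ps(1)] ps(2) by simp
    {
      fix a
      define qs where "qs = map (\<lambda>(x, y). (vscale V a x, y)) ps"
      have qs: "set qs \<subseteq> vcarrier V \<times> vcarrier W"
        using ps(1) V.subspace_scale[OF subV] unfolding qs_def by auto
      have "(\<Sum>(x, y)\<leftarrow>qs. tens V W x y) = fscale a (\<Sum>(x, y)\<leftarrow>ps. tens V W x y)"
        unfolding qs_def
        by (induction ps) (simp_all add: case_prod_beta tens_linear[OF V W] F.scale_right_distrib
            F.scale_zero_right del: plus_fun_apply zero_fun_apply)
      moreover have "(\<Sum>(x, y)\<leftarrow>qs. \<beta> x y) = vscale U a (\<Sum>(x, y)\<leftarrow>ps. \<beta> x y)"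
        using ps(1) \<beta> unfolding qs_def
        by (induction ps) (auto simp: bilinear_map_def linear_map_def U.scale_right_distrib)
      ultimately have "tlift V W \<beta> (fscale a t) = vscale U a (tlift V W \<beta> t)"
        using tlift_eq[OF V W U \<beta> qs] tlift_eq[OF V W U \<beta> ps(1)] ps(2) by simp
      then show "tlift V W \<beta> (vscale (tensor_space V W) a t) = vscale U a (tlift V W \<beta> t)"
        by (simp add: tensor_space_def)
    }
    fix t' assume "t' \<in> vcarrier (tensor_space V W)"
    then obtain qs where qs: "set qs \<subseteq> vcarrier V \<times> vcarrier W"
      "t' = (\<Sum>(x, y)\<leftarrow>qs. tens V W x y)" by (rule tensor_space_elem[OF V W])
    show "tlift V W \<beta> (t + t') = tlift V W \<beta> t + tlift V W \<beta> t'"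
      using tlift_eq[OF V W U \<beta>, of "ps @ qs"] tlift_eq[OF V W U \<beta> ps(1)]
        tlift_eq[OF V W U \<beta> qs(1)] ps qs by simp
  qed
  fix f t assume f: "linear_map (tensor_space V W) U f"
    and ft: "\<And>x y. x \<in> vcarrier V \<Longrightarrow> y \<in> vcarrier W \<Longrightarrow> f (tens V W x y) = \<beta> x y"
    and t: "t \<in> vcarrier (tensor_space V W)"
  obtain ps where ps: "set ps \<subseteq> vcarrier V \<times> vcarrier W"
      "t = (\<Sum>(x, y)\<leftarrow>ps. tens V W x y)" using t by (rule tensor_space_elem[OF V W])
  have "(\<Sum>(x, y)\<leftarrow>ps. tens V W x y) \<in> vcarrier (tensor_space V W) \<and>
      f (\<Sum>(x, y)\<leftarrow>ps. tens V W x y) = (\<Sum>(x, y)\<leftarrow>ps. \<beta> x y)"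
    using ps(1)
  proof (induction ps)
    case Nil
    have "0 \<in> vcarrier (tensor_space V W)"
      unfolding tensor_space_def vspace.simps by (rule F.span_zero)
    then show ?case using linear_map_zero[OF T U f] by (simp only: list.map sum_list.Nil simp_thms)
  next
    case (Cons p ps)
    obtain x y where p: "p = (x, y)" "x \<in> vcarrier V" "y \<in> vcarrier W"
      using Cons.prems by auto
    define t where "t = (\<Sum>(x, y)\<leftarrow>ps. tens V W x y)"
    have t: "t \<in> vcarrier (tensor_space V W)" "f t = (\<Sum>(x, y)\<leftarrow>ps. \<beta> x y)"
      using Cons unfolding t_def by auto
    have "tens V W x y + t \<in> vcarrier (tensor_space V W)"
      using mem[OF p(2,3)] t(1) unfolding tensor_space_def vspace.simps by (rule F.span_add)
    moreover have "f (tens V W x y + t) = \<beta> x y + f t"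
      using f ft[OF p(2,3)] mem[OF p(2,3)] t(1) unfolding linear_map_def by metis
    ultimately show ?case using t(2) by (simp only: p(1) list.map sum_list.Cons prod.case simp_thms flip: t_def)
  qed
  then show "f t = tlift V W \<beta> t" using tlift_eq[OF V W U \<beta> ps(1)] ps(2) by simp
qed

lemma llift_eq:
  assumes N: "is_vspace N" and U: "is_vspace U" and \<beta>: "multilinear_map N n U \<beta>" and n: "n > 0"
    and xss: "\<And>xs. xs \<in> set xss \<Longrightarrow> length xs = n \<and> set xs \<subseteq> vcarrier N"
  shows "llift N n \<beta> (\<Sum>xs\<leftarrow>xss. ltens N xs) = (\<Sum>xs\<leftarrow>xss. \<beta> xs)"
  unfolding llift_def
proof (rule the_equality)
  interpret U: vector_space "vscale U" using U by (simp add: is_vspace_def)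
  show "\<exists>yss. (\<forall>xs\<in>set yss. length xs = n \<and> set xs \<subseteq> vcarrier N) \<and>
      (\<Sum>xs\<leftarrow>xss. ltens N xs) = (\<Sum>xs\<leftarrow>yss. ltens N xs) \<and>
      (\<Sum>xs\<leftarrow>xss. \<beta> xs) = (\<Sum>xs\<leftarrow>yss. \<beta> xs)" using xss by blast
  fix z assume "\<exists>yss. (\<forall>xs\<in>set yss. length xs = n \<and> set xs \<subseteq> vcarrier N) \<and>
      (\<Sum>xs\<leftarrow>xss. ltens N xs) = (\<Sum>xs\<leftarrow>yss. ltens N xs) \<and> z = (\<Sum>xs\<leftarrow>yss. \<beta> xs)"
  then obtain yss where yss: "\<forall>xs\<in>set yss. length xs = n \<and> set xs \<subseteq> vcarrier N"
      "(\<Sum>xs\<leftarrow>xss. ltens N xs) = (\<Sum>xs\<leftarrow>yss. ltens N xs)" "z = (\<Sum>xs\<leftarrow>yss. \<beta> xs)" by blast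
  define zs where "zs = map (Pair (1::'a)) xss @ map (Pair (-1)) yss"
  have sum_uminus: "(\<Sum>xs\<leftarrow>yss. - f xs) = - (\<Sum>xs\<leftarrow>yss. f xs)"
    for f :: "_ \<Rightarrow> 'h::ab_group_add"
    by (induction yss) auto
  have neg: "fscale (- 1) t = - t" "fscale 1 t = t" for t :: "('a, 'b) ltensor"
    by (auto simp: fscale_def)
  have "(\<Sum>p\<leftarrow>zs. fscale (fst p) (ltens N (snd p))) = 0"
    using yss(2) unfolding zs_def by (simp add: o_def neg sum_uminus)
  then have "(\<Sum>i\<in>{0..<length zs}. fscale (fst (zs ! i)) (ltens N (snd (zs ! i)))) = 0"
    by (simp add: sum_list_sum_nth)
  then have "(\<Sum>i\<in>{0..<length zs}. vscale U (fst (zs ! i)) (\<beta> (snd (zs ! i)))) = 0"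
  proof (rule ltens_sum_zero[OF N U finite_atLeastLessThan \<beta>, rotated])
    fix i assume "i \<in> {0..<length zs}"
    then have "zs ! i \<in> set zs" by auto
    then have "snd (zs ! i) \<in> set xss \<union> set yss" unfolding zs_def by (auto simp del: nth_mem)
    then show "length (snd (zs ! i)) = n \<and> set (snd (zs ! i)) \<subseteq> vcarrier N"
      using xss yss(1) by blast
  qed (use n in auto)
  then have "(\<Sum>p\<leftarrow>zs. vscale U (fst p) (\<beta> (snd p))) = 0"
    by (simp add: sum_list_sum_nth)
  then have "(\<Sum>xs\<leftarrow>xss. \<beta> xs) = (\<Sum>xs\<leftarrow>yss. \<beta> xs)"
    unfolding zs_def by (simp add: o_def sum_uminus)
  then show "z = (\<Sum>xs\<leftarrow>xss. \<beta> xs)" using yss(3) by simp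
qed

end

theory Submission
  imports Defs
begin

text \<open>
  Write \<open>N = M\<^sup>*\<close>. Elements of \<open>N\<^sup>\<box>\<^sup>n\<close> are the multilinear forms on \<open>M\<^sup>n\<close> that are balanced over \<open>D\<close>, so
  the cotensor coalgebra is the graded dual of the tensor algebra of \<open>M\<close> over \<open>D\<close>: it is separated by
  evaluations at elements of \<open>D\<close> and at words in \<open>M\<close>, and these evaluations multiply under convolution
  like elements of the tensor algebra. As \<open>M = m\<^sub>0 D\<close>, each degree is a copy of \<open>D\<^sup>*\<close>, on which \<open>D\<close> acts
  transitively away from \<open>0\<close>; hence a right coideal with an element of exact degree \<open>n\<close> contains
  everything of degree at most \<open>n\<close>.

  Conversely, let \<open>A = C\<^sup>*\<close> for a chain coalgebra \<open>C\<close> of type \<open>D\<close> and let \<open>J\<close> be the annihilator of the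
  coradical, so \<open>A / J \<cong> D\<close>. A Nakayama argument shows that every element of \<open>C\<close> is killed by some power
  of \<open>J\<close>. If \<open>D\<close> is separable, a linear section \<open>D \<rightarrow> A\<close> can be corrected step by step along the powers of
  \<open>J\<close> to an algebra homomorphism \<open>\<alpha>\<close> (Wedderburn--Malcev), and the chain condition yields \<open>y \<in> J\<close> with
  \<open>D y = y D\<close> that generates \<open>J\<close> modulo the forms vanishing on \<open>C\<^sub>1\<close>. Then \<open>M = y D\<close> (or \<open>M = D\<close> acting
  as \<open>0\<close> when \<open>C\<close> is its coradical), and the embedding sends \<open>c\<close> to the forms
  \<open>(m\<^sub>1, \<dots>, m\<^sub>n) \<mapsto> (m\<^sub>1 * \<dots> * m\<^sub>n) c\<close>.
\<close>

subsection \<open>Subspaces, functionals and tensors\<close>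

text \<open>Tensors are functions of pairs of functionals on the ambient types, so two of them agree
  as soon as they agree on separating families (\<open>tensor_eqI\<close>), and slicing by such a
  family decides in which subspace a tensor lies (\<open>tensor_in_left\<close>). Sweedler
  computations thus become evaluations. The obstacle in the cotensor coalgebra is that its
  comultiplication is a sum over pure tensors that need not be balanced: it is evaluated in a larger
  space \<open>W\<close> and then cut down to \<open>T\<close>. In the converse, congruences are
  taken modulo the double annihilators \<open>Jn\<close> of the powers of \<open>J\<close>: they are
  equalities on \<open>W n\<close>, and as the \<open>W n\<close> exhaust \<open>C\<close>, the
  successive corrections of a lift have a pointwise limit. Separability enters twice, through the
  same element of \<open>D \<otimes> D\<close>: it contracts the Hochschild cocycle of a lift, and
  it averages a generator of \<open>J\<close> into one that \<open>D\<close> normalizes. A generator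
  modulo \<open>Jn 2\<close> is enough for injectivity of the embedding, because it determines every
  product of \<open>n \<ge> 1\<close> elements of \<open>J\<close> modulo
  \<open>Jn (n + 1)\<close>.\<close>

abbreviation lfun :: "('k::field, 'v::ab_group_add, 'z) vspace_scheme \<Rightarrow> ('v \<Rightarrow> 'k) \<Rightarrow> bool" where
  "lfun V f \<equiv> Vector_Spaces.linear (vscale V) (*) f"

lemma module_fscale: "module (fscale :: 'k::field \<Rightarrow> ('x \<Rightarrow> 'k) \<Rightarrow> 'x \<Rightarrow> 'k)"
  by (simp add: module_iff_vector_space vector_space_fscale)

lemma sum_list_fun_apply: "(\<Sum>p\<leftarrow>ps. f p) x = (\<Sum>p\<leftarrow>ps. f p x)"
  for f :: "'p \<Rightarrow> 'x \<Rightarrow> 'k::comm_monoid_add"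
  by (induction ps) auto

lemma is_vspace_ground [simp]: "is_vspace ground"
proof -
  interpret vector_space "(*) :: 'a \<Rightarrow> 'a \<Rightarrow> 'a" by (rule vector_space_ground)
  show ?thesis by (simp add: is_vspace_def full_space_def vector_space_ground)
qed

lemma ground_simps [simp]: "vcarrier ground = UNIV" "vscale ground = (*)"
  by (simp_all add: full_space_def)

context
  fixes V :: "('k::field, 'v::ab_group_add, 'z) vspace_scheme"
  assumes V: "is_vspace V"
begin

interpretation V: vector_space "vscale V"
  using V by (simp add: is_vspace_def)

lemma is_vspace_vector_space: "vector_space (vscale V)"
  by (rule V.vector_space_axioms)

lemma is_vspace_subspace: "module.subspace (vscale V) (vcarrier V)"
  using V by (simp add: is_vspace_def)

lemma vs_zero: "0 \<in> vcarrier V"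
  using is_vspace_subspace by (rule V.subspace_0)

lemma vs_add: "x \<in> vcarrier V \<Longrightarrow> y \<in> vcarrier V \<Longrightarrow> x + y \<in> vcarrier V"
  using is_vspace_subspace by (rule V.subspace_add)

lemma vs_diff: "x \<in> vcarrier V \<Longrightarrow> y \<in> vcarrier V \<Longrightarrow> x - y \<in> vcarrier V"
  using is_vspace_subspace by (rule V.subspace_diff)

lemma vs_scale: "x \<in> vcarrier V \<Longrightarrow> vscale V a x \<in> vcarrier V"
  using is_vspace_subspace by (rule V.subspace_scale)

lemma vs_sum: "(\<And>i. i \<in> I \<Longrightarrow> g i \<in> vcarrier V) \<Longrightarrow> (\<Sum>i\<in>I. g i) \<in> vcarrier V"
  using is_vspace_subspace by (rule V.subspace_sum)

lemma vs_sum_list: "(\<And>p. p \<in> set ps \<Longrightarrow> g p \<in> vcarrier V) \<Longrightarrow> (\<Sum>p\<leftarrow>ps. g p) \<in> vcarrier V"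
  by (induction ps) (auto intro: vs_zero vs_add)

lemma is_vspace_restrict:
  "module.subspace (vscale V) S \<Longrightarrow> is_vspace (V\<lparr>vcarrier := S\<rparr>)"
  by (simp add: is_vspace_def V.vector_space_axioms)

lemma lfun_linear_map: "lfun V f \<Longrightarrow> linear_map V ground f"
  by (simp add: linear_map_def Vector_Spaces.linear_iff)

lemma lfun_sum_list:
  assumes "lfun V f" shows "f (\<Sum>p\<leftarrow>ps. g p) = (\<Sum>p\<leftarrow>ps. f (g p))"
proof -
  interpret f: Vector_Spaces.linear "vscale V" "(*)" f by fact
  show ?thesis by (induction ps) (simp_all add: f.add)
qed

lemma lfun_simps:
  assumes "lfun V f"
  shows "f 0 = 0" "f (x + y) = f x + f y" "f (x - y) = f x - f y" "f (vscale V a x) = a * f x"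
    "f (\<Sum>i\<in>I. g i) = (\<Sum>i\<in>I. f (g i))"
proof -
  interpret f: Vector_Spaces.linear "vscale V" "(*)" f by fact
  show "f 0 = 0" "f (x + y) = f x + f y" "f (x - y) = f x - f y" "f (vscale V a x) = a * f x"
    "f (\<Sum>i\<in>I. g i) = (\<Sum>i\<in>I. f (g i))"
    by (simp_all add: f.add f.diff f.scale f.sum)
qed

lemma lfun_eqI:
  assumes "\<And>f. lfun V f \<Longrightarrow> f x = f y" shows "x = y"
proof -
  have "x - y = 0"
    by (rule functionals_separate[OF V.vector_space_axioms]) (simp add: assms lfun_simps)
  then show ?thesis by simp
qed

lemma linear_map_sum_list:
  assumes W: "is_vspace W" and f: "linear_map V W f" and g: "\<And>p. p \<in> set ps \<Longrightarrow> g p \<in> vcarrier V"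
  shows "f (\<Sum>p\<leftarrow>ps. g p) = (\<Sum>p\<leftarrow>ps. f (g p))"
  using g
proof (induction ps)
  case Nil
  show ?case using linear_map_zero[OF V W f] by simp
next
  case (Cons p ps)
  then have "g p \<in> vcarrier V" "(\<Sum>p\<leftarrow>ps. g p) \<in> vcarrier V" by (auto intro: vs_sum_list)
  then show ?case using f Cons by (simp add: linear_map_def)
qed

lemma subspace_projection:
  assumes "module.subspace (vscale V) S"
  obtains p where "Vector_Spaces.linear (vscale V) (vscale V) p" "\<And>x. p x \<in> S" "\<And>x. x \<in> S \<Longrightarrow> p x = x"
proof -
  interpret VV: vector_space_pair "vscale V" "vscale V" by unfold_locales
  have "\<exists>g. g ` UNIV \<subseteq> S \<and> Vector_Spaces.linear (vscale V) (vscale V) g \<and> (\<forall>v\<in>S. g (id v) = v)"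
    by (rule VV.linear_exists_left_inverse_on) (auto simp: assms V.linear_id[unfolded id_def])
  then show ?thesis using that by auto
qed

lemma functional_extension:
  assumes f: "linear_map V ground f"
  obtains g where "lfun V g" "\<And>x. x \<in> vcarrier V \<Longrightarrow> g x = f x"
proof -
  obtain p where p: "Vector_Spaces.linear (vscale V) (vscale V) p" "\<And>x. p x \<in> vcarrier V"
    "\<And>x. x \<in> vcarrier V \<Longrightarrow> p x = x"
    using subspace_projection[OF is_vspace_subspace] by blast
  interpret p: Vector_Spaces.linear "vscale V" "vscale V" p by fact
  have "lfun V (\<lambda>x. f (p x))"
    using f p(2) unfolding Vector_Spaces.linear_iff linear_map_def
    by (simp add: V.vector_space_axioms vector_space_ground p.add p.scale)
  then show ?thesis using that p(3) by auto
qed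

end

lemma dual_space_restrict:
  assumes V: "is_vspace V" and f: "linear_map V ground f"
  shows "(\<lambda>x. if x \<in> vcarrier V then f x else 0) \<in> vcarrier (dual_space V)"
  using f by (auto simp: dual_space_def linear_map_def vs_add[OF V] vs_scale[OF V])

lemma is_vspace_dual: "is_vspace V \<Longrightarrow> is_vspace (dual_space V)"
  unfolding is_vspace_def dual_space_def
  by (auto simp: vector_space_fscale module.subspace_def[OF module_fscale]
      linear_map_def fscale_def algebra_simps)

text \<open>A finite-dimensional double annihilator argument, by induction on the spanning set. If
  some \<open>u\<close> is killed by the other \<open>\<Gamma> b'\<close> but not by
  \<open>\<Gamma> b\<close>, subtracting a multiple of \<open>\<Gamma> b\<close> makes
  \<open>f\<close> vanish on the common kernel of the others; if there is no such \<open>u\<close>,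
  then \<open>\<Gamma> b\<close> vanishes on that kernel already.\<close>

lemma functional_in_family:
  fixes s :: "'k::field \<Rightarrow> 'd::ab_group_add \<Rightarrow> 'd" and \<Gamma> :: "'d \<Rightarrow> 'x::ab_group_add \<Rightarrow> 'k"
  assumes s: "vector_space s" and B: "finite B" "module.span s B = UNIV" and X: "is_vspace X"
    and add: "\<And>d e x. x \<in> vcarrier X \<Longrightarrow> \<Gamma> (d + e) x = \<Gamma> d x + \<Gamma> e x"
    and scale: "\<And>a d x. x \<in> vcarrier X \<Longrightarrow> \<Gamma> (s a d) x = a * \<Gamma> d x"
    and lin: "\<And>d. linear_map X ground (\<Gamma> d)"
    and f: "linear_map X ground f"
    and ker: "\<And>x. x \<in> vcarrier X \<Longrightarrow> (\<And>d. \<Gamma> d x = 0) \<Longrightarrow> f x = 0"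
  obtains d where "\<And>x. x \<in> vcarrier X \<Longrightarrow> f x = \<Gamma> d x"
proof -
  interpret s: vector_space s by fact
  interpret X: vector_space "vscale X" using X by (simp add: is_vspace_def)
  have Gs: "\<Gamma> d (x + y) = \<Gamma> d x + \<Gamma> d y" "\<Gamma> d (vscale X a x) = a * \<Gamma> d x"
    if "x \<in> vcarrier X" "y \<in> vcarrier X" for d x y a
    using lin[of d] that by (auto simp: linear_map_def)
  \<comment> \<open>In the induction \<open>B\<close> no longer spans, so the kernel condition has
    to be stated for the members of \<open>B\<close> only.\<close>
  have *: "(\<And>x. x \<in> vcarrier X \<Longrightarrow> (\<And>b. b \<in> B \<Longrightarrow> \<Gamma> b x = 0) \<Longrightarrow> f x = 0) \<Longrightarrow>
      linear_map X ground f \<Longrightarrow> \<exists>d. \<forall>x\<in>vcarrier X. f x = \<Gamma> d x" for f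
    using B(1)
  proof (induction B arbitrary: f)
    case empty
    have "\<Gamma> 0 x = 0" if "x \<in> vcarrier X" for x using scale[OF that, of 0 0] by simp
    then show ?case using empty by auto
  next
    case (insert b B)
    have fs: "f (x + y) = f x + f y" "f (vscale X a x) = a * f x"
      if "x \<in> vcarrier X" "y \<in> vcarrier X" for x y a
      using insert.prems(2) that by (auto simp: linear_map_def)
    show ?case
    proof (cases "\<exists>u\<in>vcarrier X. (\<forall>b'\<in>B. \<Gamma> b' u = 0) \<and> \<Gamma> b u \<noteq> 0")
      case True
      then obtain u where u: "u \<in> vcarrier X" "\<And>b'. b' \<in> B \<Longrightarrow> \<Gamma> b' u = 0" "\<Gamma> b u \<noteq> 0" by blast
      define r where "r = f u / \<Gamma> b u"
      have "\<exists>d. \<forall>x\<in>vcarrier X. f x - r * \<Gamma> b x = \<Gamma> d x"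
      proof (rule insert.IH)
        show "linear_map X ground (\<lambda>x. f x - r * \<Gamma> b x)"
          by (simp add: linear_map_def fs Gs algebra_simps)
        fix x assume x: "x \<in> vcarrier X" "\<And>b'. b' \<in> B \<Longrightarrow> \<Gamma> b' x = 0"
        \<comment> \<open>The multiple of \<open>u\<close> makes \<open>\<Gamma> b y\<close> zero
          without disturbing the values of the other \<open>\<Gamma> b'\<close>.\<close>
        define y where "y = x + vscale X (- (\<Gamma> b x / \<Gamma> b u)) u"
        have y: "y \<in> vcarrier X" unfolding y_def using x u by (intro vs_add[OF X] vs_scale[OF X])
        have "f y = 0"
        proof (rule insert.prems(1)[OF y])
          fix b' assume "b' \<in> insert b B"
          have "\<Gamma> b' y = \<Gamma> b' x + (- (\<Gamma> b x / \<Gamma> b u)) * \<Gamma> b' u"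
            unfolding y_def using x(1) u(1) vs_scale[OF X u(1)] by (simp only: Gs)
          then show "\<Gamma> b' y = 0" using \<open>b' \<in> insert b B\<close> u x by auto
        qed
        moreover have "f y = f x + (- (\<Gamma> b x / \<Gamma> b u)) * f u"
          unfolding y_def using x(1) u(1) vs_scale[OF X u(1)] by (simp only: fs)
        ultimately show "f x - r * \<Gamma> b x = 0" by (simp add: r_def)
      qed
      then obtain d where "\<forall>x\<in>vcarrier X. f x - r * \<Gamma> b x = \<Gamma> d x" by blast
      then have "\<forall>x\<in>vcarrier X. f x = \<Gamma> (d + s r b) x"
        by (simp add: add scale algebra_simps)
      then show ?thesis by blast
    next
      case False
      then show ?thesis using insert.prems by (intro insert.IH) auto
    qed
  qed
  have "\<exists>d. \<forall>x\<in>vcarrier X. f x = \<Gamma> d x"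
  proof (rule *[OF _ f])
    fix x assume x: "x \<in> vcarrier X" "\<And>b. b \<in> B \<Longrightarrow> \<Gamma> b x = 0"
    have "\<Gamma> d x = 0" for d
    proof -
      have "d \<in> s.span B" using B by simp
      then show ?thesis
      proof (induction rule: s.span_induct_alt)
        case base
        show ?case using scale[OF x(1), of 0 0] by simp
      next
        case (step c b y)
        then show ?case using x by (simp add: add scale)
      qed
    qed
    then show "f x = 0" by (rule ker[OF x(1)])
  qed
  then show ?thesis using that by blast
qed

text \<open>Gaussian elimination with functionals from a prescribed family instead of arbitrary
  ones. When a vector \<open>y\<close> is added, the part \<open>y'\<close> of it that is not yet
  represented is detected by some \<open>e\<close> in \<open>E\<close>; subtracting from
  \<open>e\<close> what the old coordinates account for yields the coordinate that belongs to
  \<open>y'\<close>.\<close>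

lemma separating_coordinates:
  assumes X: "is_vspace X" and E: "\<And>e. e \<in> E \<Longrightarrow> lfun X e"
    and sep: "\<And>x. x \<in> vcarrier X \<Longrightarrow> (\<And>e. e \<in> E \<Longrightarrow> e x = 0) \<Longrightarrow> x = 0"
    and S: "finite S" "S \<subseteq> vcarrier X"
  obtains B c where "finite B" "B \<subseteq> vcarrier X" "\<forall>b. c b \<in> module.span fscale E"
    "\<forall>x\<in>S. x = (\<Sum>b\<in>B. vscale X (c b x) b)"
proof -
  interpret X: vector_space "vscale X" using X by (simp add: is_vspace_def)
  interpret F: vector_space "fscale :: 'a \<Rightarrow> ('b \<Rightarrow> 'a) \<Rightarrow> _" by (rule vector_space_fscale)
  have Elin: "lfun X g" if "g \<in> F.span E" for g
    using that
  proof (induction rule: F.span_induct_alt)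
    case base
    show ?case by (simp add: Vector_Spaces.linear_iff X.vector_space_axioms vector_space_ground)
  next
    case (step c x y)
    then show ?case using E[OF step(1)]
      by (simp add: Vector_Spaces.linear_iff fscale_def algebra_simps)
  qed
  have "\<exists>B c. finite B \<and> B \<subseteq> vcarrier X \<and> (\<forall>b. c b \<in> F.span E) \<and>
      (\<forall>x\<in>S. x = (\<Sum>b\<in>B. vscale X (c b x) b))"
    using S
  proof (induction S)
    case empty
    show ?case by (rule exI[of _ "{}"]) (auto intro!: exI[of _ "\<lambda>_. 0"] F.span_zero)
  next
    case (insert y S)
    then obtain B c where B: "finite B" "B \<subseteq> vcarrier X" "\<And>b. c b \<in> F.span E"
      "\<And>x. x \<in> S \<Longrightarrow> x = (\<Sum>b\<in>B. vscale X (c b x) b)" by blast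
    define c' where "c' b = (if b \<in> B then c b else 0)" for b
    define y' where "y' = y - (\<Sum>b\<in>B. vscale X (c b y) b)"
    have y'X: "y' \<in> vcarrier X" unfolding y'_def using insert.prems B
      by (intro vs_diff[OF X] vs_sum[OF X] vs_scale[OF X]) auto
    show ?case
    proof (cases "y' = 0")
      case True
      then show ?thesis using B y'_def by (intro exI[of _ B] exI[of _ c]) auto
    next
      case False
      then obtain e where e: "e \<in> E" "e y' \<noteq> 0" using sep[OF y'X] by blast
      \<comment> \<open>Arranged to vanish on \<open>S\<close> and to be 1 at \<open>y\<close>, so
        that the expansions of the old vectors do not change.\<close>
      define e' where "e' = fscale (1 / e y') (e - (\<Sum>b\<in>B. fscale (e b) (c b)))"
      have e': "e' x = (e x - (\<Sum>b\<in>B. e b * c b x)) / e y'" for x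
        by (simp add: e'_def fscale_def fun_sum_apply)
      have e'span: "e' \<in> F.span E" unfolding e'_def
        by (intro F.span_scale F.span_diff F.span_sum F.span_base e B)
      have ex: "e (\<Sum>b\<in>B. vscale X (c b x) b) = (\<Sum>b\<in>B. e b * c b x)" for x
        by (simp add: lfun_simps[OF X E[OF e(1)]] mult.commute)
      have e'S: "e' x = 0" if "x \<in> S" for x
        using B(4)[OF that] ex[of x] by (simp add: e')
      have e'y: "e' y = 1"
        using e(2) by (simp add: e' y'_def ex lfun_simps(3)[OF X E[OF e(1)]])
      text \<open>The vector \<open>y'\<close> may already lie in \<open>B\<close>; its two coefficients are then added up.\<close>
      define c'' where "c'' b = (if b = y' then c' b + e' else c' b)" for b
      have c'': "c'' b \<in> F.span E" for b
        using B(3) e'span by (auto simp: c''_def c'_def intro: F.span_add F.span_zero)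
      have "(\<Sum>b\<in>insert y' B. vscale X (c'' b x) b) = (\<Sum>b\<in>B. vscale X (c b x) b) + vscale X (e' x) y'"
        for x
      proof -
        have "(\<Sum>b\<in>insert y' B. vscale X (c'' b x) b) =
            (\<Sum>b\<in>insert y' B. vscale X (c' b x) b + (if b = y' then vscale X (e' x) y' else 0))"
          by (rule sum.cong) (auto simp: c''_def X.scale_left_distrib)
        also have "\<dots> = (\<Sum>b\<in>insert y' B. vscale X (c' b x) b) + vscale X (e' x) y'"
          using B(1) by (simp add: sum.distrib sum.delta)
        also have "(\<Sum>b\<in>insert y' B. vscale X (c' b x) b) = (\<Sum>b\<in>B. vscale X (c' b x) b)"
          by (rule sum.mono_neutral_right) (use B(1) in \<open>auto simp: c'_def\<close>)
        finally show ?thesis by (simp add: c'_def)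
      qed
      then show ?thesis using B e'S e'y y'X c''
        by (intro exI[of _ "insert y' B"] exI[of _ c'']) (auto simp: y'_def)
    qed
  qed
  then show ?thesis using that by blast
qed

section \<open>Tensors tested by families of functionals\<close>

lemma is_vspace_tensor [simp]: "is_vspace (tensor_space V W)"
  by (simp add: is_vspace_def tensor_space_def vector_space_fscale
      module.subspace_span[OF module_fscale])

lemma vscale_tensor [simp]: "vscale (tensor_space V W) = fscale"
  by (simp add: tensor_space_def)

lemma tens_update [simp]: "tens (V\<lparr>vcarrier := S\<rparr>) W = tens V W" "tens V (W\<lparr>vcarrier := S'\<rparr>) = tens V W"
  by (intro ext, simp add: tens_def)+

lemma tens_apply: "lfun V f \<Longrightarrow> lfun W g \<Longrightarrow> tens V W x y (f, g) = f x * g y"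
  by (simp add: tens_def)

lemma tens_zero:
  assumes "is_vspace V" "is_vspace W"
  shows "tens V W 0 y = 0" "tens V W x 0 = 0"
  using tens_linear(1)[OF assms, of 0 0 y] tens_linear(2)[OF assms, of x 0 0] by simp_all

lemma tens_in: "x \<in> vcarrier V \<Longrightarrow> y \<in> vcarrier W \<Longrightarrow> tens V W x y \<in> vcarrier (tensor_space V W)"
  unfolding tensor_space_def vspace.simps
  by (intro module.span_base[OF module_fscale]) auto

lemma tensor_rep:
  assumes "is_vspace V" "is_vspace W" "t \<in> vcarrier (tensor_space V W)"
  obtains ps where "\<forall>p\<in>set ps. fst p \<in> vcarrier V \<and> snd p \<in> vcarrier W"
    "t = (\<Sum>p\<leftarrow>ps. tens V W (fst p) (snd p))"
  by (rule tensor_space_elem[OF assms]) (force simp: case_prod_unfold intro: that)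

lemma tlift_rep:
  assumes "is_vspace V" "is_vspace W" "is_vspace U" "bilinear_map V W U \<beta>"
    "\<forall>p\<in>set ps. fst p \<in> vcarrier V \<and> snd p \<in> vcarrier W"
    "t = (\<Sum>p\<leftarrow>ps. tens V W (fst p) (snd p))"
  shows "tlift V W \<beta> t = (\<Sum>p\<leftarrow>ps. \<beta> (fst p) (snd p))"
proof -
  have "set ps \<subseteq> vcarrier V \<times> vcarrier W" using assms(5) by (auto simp: mem_Times_iff)
  then show ?thesis using tlift_eq[OF assms(1-4), of ps] by (simp add: case_prod_unfold assms(6))
qed

lemma tensor_rep_apply:
  assumes "lfun V f" "lfun W g"
  shows "(\<Sum>p\<leftarrow>ps. tens V W (fst p) (snd p)) (f, g) = (\<Sum>p\<leftarrow>ps. f (fst p) * g (snd p))"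
  by (simp add: sum_list_fun_apply tens_apply assms)

text \<open>The contraction of the second factor with \<open>g\<close>, computed from any expression
  of \<open>t\<close> by pure tensors. Slices reduce statements about tensors to statements about
  vectors.\<close>

lemma tensor_slice_right:
  assumes V: "is_vspace V" and W: "is_vspace W" and t: "t \<in> vcarrier (tensor_space V W)" and g: "lfun W g"
  obtains x where "x \<in> vcarrier V" "\<And>f. lfun V f \<Longrightarrow> t (f, g) = f x"
proof -
  obtain ps where ps: "\<forall>p\<in>set ps. fst p \<in> vcarrier V \<and> snd p \<in> vcarrier W" "t = (\<Sum>p\<leftarrow>ps. tens V W (fst p) (snd p))"
    by (rule tensor_rep[OF V W t])
  show ?thesis
    by (rule that[of "\<Sum>p\<leftarrow>ps. vscale V (g (snd p)) (fst p)"])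
      (use ps in \<open>auto intro!: vs_sum_list[OF V] vs_scale[OF V] arg_cong[of _ _ sum_list]
         simp: lfun_sum_list[OF V] lfun_simps(4)[OF V] tensor_rep_apply g mult.commute\<close>)
qed

lemma tensor_slice_left:
  assumes V: "is_vspace V" and W: "is_vspace W" and t: "t \<in> vcarrier (tensor_space V W)" and f: "lfun V f"
  obtains y where "y \<in> vcarrier W" "\<And>g. lfun W g \<Longrightarrow> t (f, g) = g y"
proof -
  obtain ps where ps: "\<forall>p\<in>set ps. fst p \<in> vcarrier V \<and> snd p \<in> vcarrier W" "t = (\<Sum>p\<leftarrow>ps. tens V W (fst p) (snd p))"
    by (rule tensor_rep[OF V W t])
  show ?thesis
    by (rule that[of "\<Sum>p\<leftarrow>ps. vscale W (f (fst p)) (snd p)"])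
      (use ps in \<open>auto intro!: vs_sum_list[OF W] vs_scale[OF W] arg_cong[of _ _ sum_list]
         simp: lfun_sum_list[OF W] lfun_simps(4)[OF W] tensor_rep_apply f mult.commute\<close>)
qed

lemma tensor_nonlinear_zero:
  assumes "is_vspace V" "is_vspace W" "t \<in> vcarrier (tensor_space V W)" "\<not> (lfun V f \<and> lfun W g)"
  shows "t (f, g) = 0"
proof -
  obtain ps where "\<forall>p\<in>set ps. fst p \<in> vcarrier V \<and> snd p \<in> vcarrier W" "t = (\<Sum>p\<leftarrow>ps. tens V W (fst p) (snd p))" by (rule tensor_rep[OF assms(1-3)])
  then show ?thesis using assms(4) by (auto simp: sum_list_fun_apply tens_def)
qed

text \<open>One factor at a time: the slice of \<open>t\<close> by \<open>f j\<close> is killed by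
  every \<open>e i\<close>, hence is 0, so \<open>t\<close> vanishes at \<open>(e', f j)\<close> for
  arbitrary \<open>e'\<close>; slicing by \<open>e'\<close> then treats the other factor in the same
  way.\<close>

lemma tensor_separated:
  assumes V: "is_vspace V" and W: "is_vspace W" and t: "t \<in> vcarrier (tensor_space V W)"
    and E: "\<And>i. i \<in> I \<Longrightarrow> lfun V (e i)" and F: "\<And>j. j \<in> J \<Longrightarrow> lfun W (f j)"
    and sepV: "\<And>x. x \<in> vcarrier V \<Longrightarrow> (\<And>i. i \<in> I \<Longrightarrow> e i x = 0) \<Longrightarrow> x = 0"
    and sepW: "\<And>x. x \<in> vcarrier W \<Longrightarrow> (\<And>j. j \<in> J \<Longrightarrow> f j x = 0) \<Longrightarrow> x = 0"
    and zero: "\<And>i j. i \<in> I \<Longrightarrow> j \<in> J \<Longrightarrow> t (e i, f j) = 0"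
  shows "t = 0"
proof -
  have *: "t (e', f j) = 0" if e': "lfun V e'" and j: "j \<in> J" for e' j
  proof -
    obtain x where x: "x \<in> vcarrier V" "\<And>e'. lfun V e' \<Longrightarrow> t (e', f j) = e' x"
      using tensor_slice_right[OF V W t F[OF j]] by metis
    have "x = 0" using zero[OF _ j] x(2)[OF E] by (intro sepV x(1)) simp
    then show ?thesis using x(2)[OF e'] e' by (simp add: lfun_simps[OF V])
  qed
  have "t (e', f') = 0" if e': "lfun V e'" and f': "lfun W f'" for e' f'
  proof -
    obtain y where y: "y \<in> vcarrier W" "\<And>f. lfun W f \<Longrightarrow> t (e', f) = f y"
      using tensor_slice_left[OF V W t e'] by metis
    have "y = 0" using *[OF e'] y(2)[OF F] by (intro sepW y(1)) simp
    then show ?thesis using y(2)[OF f'] f' by (simp add: lfun_simps[OF W])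
  qed
  then have "t (e', f') = 0" for e' f'
    using tensor_nonlinear_zero[OF V W t] by blast
  then show ?thesis by (auto simp: fun_eq_iff)
qed

lemma tensor_eqI:
  assumes V: "is_vspace V" and W: "is_vspace W" and t: "t \<in> vcarrier (tensor_space V W)"
    and u: "u \<in> vcarrier (tensor_space V W)"
    and E: "\<And>i. i \<in> I \<Longrightarrow> lfun V (e i)" and F: "\<And>j. j \<in> J \<Longrightarrow> lfun W (f j)"
    and sepV: "\<And>x. x \<in> vcarrier V \<Longrightarrow> (\<And>i. i \<in> I \<Longrightarrow> e i x = 0) \<Longrightarrow> x = 0"
    and sepW: "\<And>x. x \<in> vcarrier W \<Longrightarrow> (\<And>j. j \<in> J \<Longrightarrow> f j x = 0) \<Longrightarrow> x = 0"
    and eq: "\<And>i j. i \<in> I \<Longrightarrow> j \<in> J \<Longrightarrow> t (e i, f j) = u (e i, f j)"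
  shows "t = u"
proof -
  have "t - u = 0"
  proof (rule tensor_separated[OF V W _ E F sepV sepW])
    show "t - u \<in> vcarrier (tensor_space V W)" by (rule vs_diff[OF is_vspace_tensor t u])
    show "(t - u) (e i, f j) = 0" if "i \<in> I" "j \<in> J" for i j using eq[OF that] by simp
  qed  then show ?thesis by simp
qed

text \<open>
  With coordinates \<open>c b\<close> from the separating family, \<open>t = \<Sum> (id \<otimes> c b)(t) \<otimes> b\<close>; so \<open>t\<close> lies in
  \<open>S \<otimes> W\<close> as soon as its slices do so for the separating family.
\<close>

lemma tensor_in_left:
  assumes V: "is_vspace V" and W: "is_vspace W" and t: "t \<in> vcarrier (tensor_space V W)"
    and S: "module.subspace (vscale V) S"
    and E: "\<And>g. g \<in> E \<Longrightarrow> lfun W g"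
    and sep: "\<And>x. x \<in> vcarrier W \<Longrightarrow> (\<And>g. g \<in> E \<Longrightarrow> g x = 0) \<Longrightarrow> x = 0"
    and slice: "\<And>g. g \<in> E \<Longrightarrow> \<exists>x\<in>S. \<forall>f. lfun V f \<longrightarrow> t (f, g) = f x"
  shows "t \<in> vcarrier (tensor_space (V\<lparr>vcarrier := S\<rparr>) W)"
proof -
  interpret V: vector_space "vscale V" using V by (simp add: is_vspace_def)
  interpret F: vector_space "fscale :: 'a \<Rightarrow> ('d \<Rightarrow> 'a) \<Rightarrow> _" by (rule vector_space_fscale)
  have S': "is_vspace (V\<lparr>vcarrier := S\<rparr>)" using is_vspace_restrict[OF V S] .
  obtain ps where ps: "\<forall>p\<in>set ps. fst p \<in> vcarrier V \<and> snd p \<in> vcarrier W"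
      "t = (\<Sum>p\<leftarrow>ps. tens V W (fst p) (snd p))"
    by (rule tensor_rep[OF V W t])
  have fin: "finite (snd ` set ps)" and sub: "snd ` set ps \<subseteq> vcarrier W" using ps by auto
  obtain B c where B: "finite B" "B \<subseteq> vcarrier W" "\<forall>b. c b \<in> F.span E"
    "\<forall>x\<in>snd ` set ps. x = (\<Sum>b\<in>B. vscale W (c b x) b)"
    using separating_coordinates[OF W E sep fin sub, of E] by blast
  \<comment> \<open>The slice depends linearly on \<open>g\<close>, so it stays in \<open>S\<close>
    for all combinations of members of \<open>E\<close>, in particular for the coordinates
    \<open>c b\<close>.\<close>
  define sl where "sl g = (\<Sum>p\<leftarrow>ps. vscale V (g (snd p)) (fst p))" for g
  have slS: "sl g \<in> S" if "g \<in> F.span E" for g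
    using that
  proof (induction rule: F.span_induct_alt)
    case base
    show ?case by (simp add: sl_def V.subspace_0[OF S])
  next
    case (step c x y)
    have "sl (fscale c x + y) = vscale V c (sl x) + sl y"
      unfolding sl_def by (induction ps) (simp_all add: fscale_def V.scale_left_distrib V.scale_right_distrib)
    moreover have "sl x \<in> S"
    proof -
      obtain z where z: "z \<in> S" "\<And>f. lfun V f \<Longrightarrow> t (f, x) = f z" using slice[OF step(1)] by blast
      have "sl x = z"
      proof (rule lfun_eqI[OF V])
        fix f assume f: "lfun V f"
        show "f (sl x) = f z"
          using z(2)[OF f] E[OF step(1)] f
          by (simp add: sl_def ps(2) tensor_rep_apply lfun_sum_list[OF V] lfun_simps[OF V] mult.commute)
      qed
      then show ?thesis using z by simp
    qed
    ultimately show ?case using step V.subspace_add[OF S] V.subspace_scale[OF S] by metis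
  qed
  have tl: "tens V W x (\<Sum>b\<in>B. vscale W (a b) b) = (\<Sum>b\<in>B. tens V W (vscale V (a b) x) b)" for x a
    by (induction B rule: infinite_finite_induct)
      (simp_all add: tens_linear[OF V W] tens_zero[OF V W] del: plus_fun_apply zero_fun_apply)
  have sl: "tens V W (sl g) b = (\<Sum>p\<leftarrow>ps. tens V W (vscale V (g (snd p)) (fst p)) b)" for g b
    unfolding sl_def
    by (induction ps)
      (simp_all add: tens_linear[OF V W] tens_zero[OF V W] del: plus_fun_apply zero_fun_apply)
  have "t = (\<Sum>p\<leftarrow>ps. \<Sum>b\<in>B. tens V W (vscale V (c b (snd p)) (fst p)) b)"
    unfolding ps(2) tl[symmetric] using B(4) by (intro arg_cong[of _ _ sum_list] map_cong refl) simp
  also have "\<dots> = (\<Sum>b\<in>B. tens V W (sl (c b)) b)"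
    unfolding sl by (induction ps) (simp_all add: sum.distrib del: plus_fun_apply zero_fun_apply)
  also have "\<dots> \<in> vcarrier (tensor_space (V\<lparr>vcarrier := S\<rparr>) W)"
    by (intro vs_sum[OF is_vspace_tensor])
      (use tens_in[of _ "V\<lparr>vcarrier := S\<rparr>" _ W] slS B in auto)
  finally show ?thesis .
qed

definition tensor_flip :: "('k, 'v, 'w) tensor \<Rightarrow> ('k, 'w, 'v) tensor" where
  "tensor_flip t = (\<lambda>(g, f). t (f, g))"

lemma tensor_flip_in:
  assumes V: "is_vspace V" and W: "is_vspace W" and t: "t \<in> vcarrier (tensor_space V W)"
  shows "tensor_flip t \<in> vcarrier (tensor_space W V)"
proof -
  obtain ps where ps: "\<forall>p\<in>set ps. fst p \<in> vcarrier V \<and> snd p \<in> vcarrier W"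
      "t = (\<Sum>p\<leftarrow>ps. tens V W (fst p) (snd p))"
    by (rule tensor_rep[OF V W t])
  have "tensor_flip t = (\<Sum>p\<leftarrow>ps. tens W V (snd p) (fst p))"
    unfolding tensor_flip_def ps(2)
    by (auto simp: fun_eq_iff sum_list_fun_apply tens_def mult.commute intro!: arg_cong[of _ _ sum_list])
  then show ?thesis using ps by (auto intro!: vs_sum_list tens_in)
qed

lemma tensor_in_right:
  assumes V: "is_vspace V" and W: "is_vspace W" and t: "t \<in> vcarrier (tensor_space V W)"
    and S: "module.subspace (vscale W) S"
    and E: "\<And>f. f \<in> E \<Longrightarrow> lfun V f"
    and sep: "\<And>x. x \<in> vcarrier V \<Longrightarrow> (\<And>f. f \<in> E \<Longrightarrow> f x = 0) \<Longrightarrow> x = 0"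
    and slice: "\<And>f. f \<in> E \<Longrightarrow> \<exists>y\<in>S. \<forall>g. lfun W g \<longrightarrow> t (f, g) = g y"
  shows "t \<in> vcarrier (tensor_space V (W\<lparr>vcarrier := S\<rparr>))"
proof -
  have "tensor_flip t \<in> vcarrier (tensor_space (W\<lparr>vcarrier := S\<rparr>) V)"
    by (rule tensor_in_left[OF W V tensor_flip_in[OF V W t] S E sep])
      (use slice in \<open>simp_all add: tensor_flip_def\<close>)
  then have "tensor_flip (tensor_flip t) \<in> vcarrier (tensor_space V (W\<lparr>vcarrier := S\<rparr>))"
    by (rule tensor_flip_in[OF is_vspace_restrict[OF W S] V])
  then show ?thesis by (simp add: tensor_flip_def)
qed

lemma bilinear_map_separated:
  assumes U: "is_vspace U" and V: "is_vspace V" and W: "is_vspace W"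
    and lin: "\<And>i. i \<in> I \<Longrightarrow> linear_map U ground (e i)"
    and sep: "\<And>x. x \<in> vcarrier U \<Longrightarrow> (\<And>i. i \<in> I \<Longrightarrow> e i x = 0) \<Longrightarrow> x = 0"
    and mem: "\<And>x y. x \<in> vcarrier V \<Longrightarrow> y \<in> vcarrier W \<Longrightarrow> \<beta> x y \<in> vcarrier U"
    and bil: "\<And>i. i \<in> I \<Longrightarrow> bilinear_map V W ground (\<lambda>x y. e i (\<beta> x y))"
  shows "bilinear_map V W U \<beta>"
proof -
  have eqI: "x = y" if "x \<in> vcarrier U" "y \<in> vcarrier U" "\<And>i. i \<in> I \<Longrightarrow> e i x = e i y" for x y
  proof -
    have "e i (x - y) = 0" if i: "i \<in> I" for i
    proof -
      interpret U: vector_space "vscale U" using U by (simp add: is_vspace_def)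
      have "e i (x + vscale U (- 1) y) = e i x + (- 1) * e i y"
        using lin[OF i] \<open>x \<in> _\<close> \<open>y \<in> _\<close> vs_scale[OF U, of y "-1"]
        unfolding linear_map_def by (metis ground_simps(2))
      then show ?thesis using \<open>\<And>i. i \<in> I \<Longrightarrow> e i x = e i y\<close>[OF i] by simp
    qed
    then have "x - y = 0" using that(1,2) by (intro sep vs_diff[OF U])
    then show ?thesis by simp
  qed
  show ?thesis
    unfolding bilinear_map_def linear_map_def
  proof (intro conjI ballI allI)
    fix x y assume x: "x \<in> vcarrier V" and y: "y \<in> vcarrier W"
    show "\<beta> x y \<in> vcarrier U" "\<beta> x y \<in> vcarrier U" using mem[OF x y] by simp_all
    show "\<beta> x (vscale W a y) = vscale U a (\<beta> x y)" for a
      using bil lin x y by (intro eqI mem vs_scale[OF U] vs_scale[OF W])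
        (auto simp: bilinear_map_def linear_map_def mem)
    show "\<beta> (vscale V a x) y = vscale U a (\<beta> x y)" for a
      using bil lin x y by (intro eqI mem vs_scale[OF U] vs_scale[OF V])
        (auto simp: bilinear_map_def linear_map_def mem)
    show "\<beta> x (y + y') = \<beta> x y + \<beta> x y'" if "y' \<in> vcarrier W" for y'
      using bil lin x y that by (intro eqI mem vs_add[OF U] vs_add[OF W])
        (auto simp: bilinear_map_def linear_map_def mem)
    show "\<beta> (x + x') y = \<beta> x y + \<beta> x' y" if "x' \<in> vcarrier V" for x'
      using bil lin x y that by (intro eqI mem vs_add[OF U] vs_add[OF V])
        (auto simp: bilinear_map_def linear_map_def mem)
  qed
qed

lemma bilinear_map_product:
  assumes V: "is_vspace V" and W: "is_vspace W" and p: "lfun V p" and q: "lfun W q"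
    and e: "\<And>x y. x \<in> vcarrier V \<Longrightarrow> y \<in> vcarrier W \<Longrightarrow> \<gamma> x y = k * (p x * q y)"
  shows "bilinear_map V W ground \<gamma>"
  unfolding bilinear_map_def linear_map_def
  by (simp add: e vs_add[OF V] vs_add[OF W] vs_scale[OF V] vs_scale[OF W])
    (simp only: lfun_simps(2,4)[OF V p] lfun_simps(2,4)[OF W q], simp add: algebra_simps)

text \<open>The tool for all computations with \<open>tlift\<close>. If every test functional
  \<open>e i\<close> of the target splits \<open>\<beta> x y\<close> into a functional of
  \<open>x\<close> times one of \<open>y\<close>, then \<open>e i\<close> of the lift is the value
  of \<open>t\<close> at this pair of functionals. As the \<open>e i\<close> separate points, the
  splitting also forces \<open>\<beta>\<close> to be bilinear.\<close>

lemma tlift_eval: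
  assumes V: "is_vspace V" and W: "is_vspace W" and U: "is_vspace U"
    and t: "t \<in> vcarrier (tensor_space V W)"
    and lin: "\<And>i. i \<in> I \<Longrightarrow> linear_map U ground (e i)"
    and sep: "\<And>x. x \<in> vcarrier U \<Longrightarrow> (\<And>i. i \<in> I \<Longrightarrow> e i x = 0) \<Longrightarrow> x = 0"
    and mem: "\<And>x y. x \<in> vcarrier V \<Longrightarrow> y \<in> vcarrier W \<Longrightarrow> \<beta> x y \<in> vcarrier U"
    and p: "\<And>i. i \<in> I \<Longrightarrow> lfun V (p i)" and q: "\<And>i. i \<in> I \<Longrightarrow> lfun W (q i)"
    and e: "\<And>i x y. i \<in> I \<Longrightarrow> x \<in> vcarrier V \<Longrightarrow> y \<in> vcarrier W \<Longrightarrow> e i (\<beta> x y) = k i * (p i x * q i y)"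
  shows "tlift V W \<beta> t \<in> vcarrier U" "\<And>i. i \<in> I \<Longrightarrow> e i (tlift V W \<beta> t) = k i * t (p i, q i)"
    "bilinear_map V W U \<beta>"
proof -
  show bil: "bilinear_map V W U \<beta>"
  proof (rule bilinear_map_separated[where e = e and I = I, OF U V W lin sep mem])
    fix i assume i: "i \<in> I"
    show "bilinear_map V W ground (\<lambda>x y. e i (\<beta> x y))"
      by (rule bilinear_map_product[where k = "k i" and p = "p i" and q = "q i", OF V W p[OF i] q[OF i] e[OF i]])
  qed
  obtain ps where ps: "\<forall>p\<in>set ps. fst p \<in> vcarrier V \<and> snd p \<in> vcarrier W"
    "t = (\<Sum>p\<leftarrow>ps. tens V W (fst p) (snd p))" by (rule tensor_rep[OF V W t])
  have eq: "tlift V W \<beta> t = (\<Sum>p\<leftarrow>ps. \<beta> (fst p) (snd p))"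
    by (rule tlift_rep[OF V W U bil ps])
  then show "tlift V W \<beta> t \<in> vcarrier U" using ps(1) by (auto intro!: vs_sum_list[OF U] mem)
  fix i assume i: "i \<in> I"
  have "e i (tlift V W \<beta> t) = (\<Sum>p\<leftarrow>ps. e i (\<beta> (fst p) (snd p)))"
    unfolding eq using ps(1) by (intro linear_map_sum_list[OF U is_vspace_ground lin[OF i]] mem) auto
  also have "\<dots> = (\<Sum>r\<leftarrow>ps. k i * (p i (fst r) * q i (snd r)))"
    using ps(1) by (intro arg_cong[of _ _ sum_list] map_cong refl e i) auto
  also have "\<dots> = k i * t (p i, q i)"
    by (simp add: ps(2) tensor_rep_apply p q i sum_list_const_mult)
  finally show "e i (tlift V W \<beta> t) = k i * t (p i, q i)" .
qed

lemma lfun_eval: "Vector_Spaces.linear fscale (*) (\<lambda>f. f x :: 'k::field)"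
  by (simp add: Vector_Spaces.linear_iff vector_space_fscale vector_space_ground) (simp add: fscale_def)

lemma lfun_tensor_eval: "lfun (tensor_space V W) (\<lambda>t. t x)"
  by (simp add: lfun_eval)

text \<open>After evaluation at a separating family that convolution multiplies like its indices,
  coassociativity and the counit laws become associativity and unit laws of \<open>mul\<close>.
  These are required only after evaluation on \<open>C\<close>, because words over a bimodule
  multiply associatively only up to moving scalars between letters.\<close>

lemma coalgebraI_eval:
  fixes C :: "('k::field, 'c::ab_group_add) coalg" and ev :: "'i \<Rightarrow> 'c \<Rightarrow> 'k"
  assumes C: "is_vspace C"
    and ev: "\<And>i. i \<in> I \<Longrightarrow> lfun C (ev i)"
    and sep: "\<And>x. x \<in> vcarrier C \<Longrightarrow> (\<And>i. i \<in> I \<Longrightarrow> ev i x = 0) \<Longrightarrow> x = 0"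
    and mul: "\<And>i j. i \<in> I \<Longrightarrow> j \<in> I \<Longrightarrow> mul i j \<in> I"
    and comul: "\<And>c. c \<in> vcarrier C \<Longrightarrow> comul C c \<in> vcarrier (tensor_space C C)"
    and comul_ev: "\<And>c i j. c \<in> vcarrier C \<Longrightarrow> i \<in> I \<Longrightarrow> j \<in> I \<Longrightarrow> comul C c (ev i, ev j) = ev (mul i j) c"
    and one: "one \<in> I" and counit: "\<And>c. c \<in> vcarrier C \<Longrightarrow> counit C c = ev one c"
    and mul_one: "\<And>c i. c \<in> vcarrier C \<Longrightarrow> i \<in> I \<Longrightarrow> ev (mul i one) c = ev i c"
      "\<And>c i. c \<in> vcarrier C \<Longrightarrow> i \<in> I \<Longrightarrow> ev (mul one i) c = ev i c"
    and assoc: "\<And>c i j k. c \<in> vcarrier C \<Longrightarrow> i \<in> I \<Longrightarrow> j \<in> I \<Longrightarrow> k \<in> I \<Longrightarrow>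
      ev (mul (mul i j) k) c = ev (mul i (mul j k)) c"
  shows "coalgebra C"
proof -
  let ?CC = "tensor_space C C" and ?U = "tensor_space (tensor_space C C) C"
  \<comment> \<open>Elements of \<open>C \<otimes> C\<close> are functions, so evaluating them at
    \<open>(ev i, ev j)\<close> is itself a functional, by which the left factor of the threefold
    product can be tested.\<close>
  define e where "e = (\<lambda>(i, j, k) t. t (\<lambda>q :: ('k, 'c, 'c) tensor. q (ev i, ev j), ev k) :: 'k)"
  define III where "III = I \<times> I \<times> I"
  have eqC: "x = y" if "x \<in> vcarrier C" "y \<in> vcarrier C" "\<And>i. i \<in> I \<Longrightarrow> ev i x = ev i y" for x y
  proof -
    have "x - y = 0" using that by (intro sep vs_diff[OF C]) (auto simp: lfun_simps[OF C ev])
    then show ?thesis by simp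
  qed
  have sepCC: "x = 0" if "x \<in> vcarrier ?CC" "\<And>i j. i \<in> I \<Longrightarrow> j \<in> I \<Longrightarrow> x (ev i, ev j) = 0" for x
    by (rule tensor_separated[OF C C that(1) ev ev sep sep that(2)])
  have eqCC: "x = y" if "x \<in> vcarrier ?CC" "y \<in> vcarrier ?CC"
    "\<And>i j. i \<in> I \<Longrightarrow> j \<in> I \<Longrightarrow> x (ev i, ev j) = y (ev i, ev j)" for x y
    by (rule tensor_eqI[OF C C that(1,2) ev ev sep sep that(3)])
  have lin: "linear_map ?U ground (e r)" if "r \<in> III" for r
    unfolding e_def case_prod_unfold
    by (rule lfun_linear_map[OF is_vspace_tensor lfun_tensor_eval])
  have sepU: "x = 0" if x: "x \<in> vcarrier ?U" "\<And>r. r \<in> III \<Longrightarrow> e r x = 0" for x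
  proof (rule tensor_separated[OF is_vspace_tensor C x(1),
        where I = "I \<times> I" and J = I and e = "\<lambda>(i, j) q. q (ev i, ev j)" and f = ev])
    show "lfun ?CC ((\<lambda>(i, j) q. q (ev i, ev j)) r)" if "r \<in> I \<times> I" for r
      by (simp add: case_prod_unfold lfun_eval)
    show "x = 0" if "x \<in> vcarrier ?CC" "\<And>r. r \<in> I \<times> I \<Longrightarrow> (\<lambda>(i, j) q. q (ev i, ev j)) r x = 0" for x
      using that(2)[of "(_, _)"] by (intro sepCC[OF that(1)]) auto
    show "x ((\<lambda>(i, j) q. q (ev i, ev j)) r, ev k) = 0" if "r \<in> I \<times> I" "k \<in> I" for r k
      using x(2)[of "(fst r, snd r, k)"] that by (auto simp: III_def e_def)
  qed (use ev sep in auto)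
  have eU: "e (i, j, k) (tens ?CC C t z) = t (ev i, ev j) * ev k z" if "k \<in> I" for i j k t z
    using that ev by (simp add: e_def tens_apply lfun_eval)
  have lhs: "tlift C C (\<lambda>x y. tens ?CC C (comul C x) y) (comul C c) \<in> vcarrier ?U"
    "\<And>r. r \<in> III \<Longrightarrow> e r (tlift C C (\<lambda>x y. tens ?CC C (comul C x) y) (comul C c)) =
      1 * comul C c (ev (mul (fst r) (fst (snd r))), ev (snd (snd r)))" if c: "c \<in> vcarrier C" for c
  proof -
    have p: "lfun C (ev (mul (fst r) (fst (snd r))))" "lfun C (ev (snd (snd r)))" if "r \<in> III" for r
      using that by (auto simp: III_def intro!: ev mul)
    have k: "e r (tens ?CC C (comul C x) y) = 1 * (ev (mul (fst r) (fst (snd r))) x * ev (snd (snd r)) y)"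
      if "r \<in> III" "x \<in> vcarrier C" "y \<in> vcarrier C" for r x y
      using that by (auto simp: III_def eU comul_ev)
    have m: "tens ?CC C (comul C x) y \<in> vcarrier ?U" if "x \<in> vcarrier C" "y \<in> vcarrier C" for x y
      using that by (intro tens_in comul)
    note * = tlift_eval[where e = e and \<beta> = "\<lambda>x y. tens ?CC C (comul C x) y"
        and k = "\<lambda>r. 1" and p = "\<lambda>r. ev (mul (fst r) (fst (snd r)))" and q = "\<lambda>r. ev (snd (snd r))",
        OF C C is_vspace_tensor comul[OF c] lin sepU m p k]
    show "tlift C C (\<lambda>x y. tens ?CC C (comul C x) y) (comul C c) \<in> vcarrier ?U" by (rule *(1))
    show "\<And>r. r \<in> III \<Longrightarrow> e r (tlift C C (\<lambda>x y. tens ?CC C (comul C x) y) (comul C c)) =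
      1 * comul C c (ev (mul (fst r) (fst (snd r))), ev (snd (snd r)))" by (rule *(2))
  qed
  have inner: "tlift C C (\<lambda>y y'. tens ?CC C (tens C C x y) y') (comul C y) \<in> vcarrier ?U"
    "\<And>r. r \<in> III \<Longrightarrow> e r (tlift C C (\<lambda>y y'. tens ?CC C (tens C C x y) y') (comul C y)) =
      ev (fst r) x * comul C y (ev (fst (snd r)), ev (snd (snd r)))"
    if x: "x \<in> vcarrier C" and y: "y \<in> vcarrier C" for x y
  proof -
    have p: "lfun C (ev (fst (snd r)))" "lfun C (ev (snd (snd r)))" if "r \<in> III" for r
      using that by (auto simp: III_def intro!: ev mul)
    have k: "e r (tens ?CC C (tens C C x y) z) = ev (fst r) x * (ev (fst (snd r)) y * ev (snd (snd r)) z)"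
      if "r \<in> III" "y \<in> vcarrier C" "z \<in> vcarrier C" for r y z
      using that by (auto simp: III_def eU tens_apply ev)
    have m: "tens ?CC C (tens C C x y) z \<in> vcarrier ?U" if "y \<in> vcarrier C" "z \<in> vcarrier C" for y z
      using that x by (intro tens_in)
    note * = tlift_eval[where e = e and \<beta> = "\<lambda>y y'. tens ?CC C (tens C C x y) y'"
        and k = "\<lambda>r. ev (fst r) x" and p = "\<lambda>r. ev (fst (snd r))" and q = "\<lambda>r. ev (snd (snd r))",
        OF C C is_vspace_tensor comul[OF y] lin sepU m p k]
    show "tlift C C (\<lambda>y y'. tens ?CC C (tens C C x y) y') (comul C y) \<in> vcarrier ?U" by (rule *(1))
    show "\<And>r. r \<in> III \<Longrightarrow> e r (tlift C C (\<lambda>y y'. tens ?CC C (tens C C x y) y') (comul C y)) =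
      ev (fst r) x * comul C y (ev (fst (snd r)), ev (snd (snd r)))" by (rule *(2))
  qed
  have rhs: "tlift C C (\<lambda>x y. tlift C C (\<lambda>y y'. tens ?CC C (tens C C x y) y') (comul C y)) (comul C c) \<in> vcarrier ?U"
    "\<And>r. r \<in> III \<Longrightarrow> e r (tlift C C (\<lambda>x y. tlift C C (\<lambda>y y'. tens ?CC C (tens C C x y) y') (comul C y)) (comul C c)) =
      1 * comul C c (ev (fst r), ev (mul (fst (snd r)) (snd (snd r))))" if c: "c \<in> vcarrier C" for c
  proof -
    have p: "lfun C (ev (fst r))" "lfun C (ev (mul (fst (snd r)) (snd (snd r))))" if "r \<in> III" for r
      using that by (auto simp: III_def intro!: ev mul)
    have k: "e r (tlift C C (\<lambda>y y'. tens ?CC C (tens C C x y) y') (comul C y)) =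
        1 * (ev (fst r) x * ev (mul (fst (snd r)) (snd (snd r))) y)"
      if "r \<in> III" "x \<in> vcarrier C" "y \<in> vcarrier C" for r x y
      using inner(2)[OF that(2,3,1)] that by (auto simp: III_def comul_ev)
    note * = tlift_eval[where e = e and \<beta> = "\<lambda>x y. tlift C C (\<lambda>y y'. tens ?CC C (tens C C x y) y') (comul C y)"
        and k = "\<lambda>r. 1" and p = "\<lambda>r. ev (fst r)" and q = "\<lambda>r. ev (mul (fst (snd r)) (snd (snd r)))",
        OF C C is_vspace_tensor comul[OF c] lin sepU inner(1) p k]
    show "tlift C C (\<lambda>x y. tlift C C (\<lambda>y y'. tens ?CC C (tens C C x y) y') (comul C y)) (comul C c) \<in> vcarrier ?U"
      by (rule *(1))
    show "\<And>r. r \<in> III \<Longrightarrow> e r (tlift C C (\<lambda>x y. tlift C C (\<lambda>y y'. tens ?CC C (tens C C x y) y') (comul C y)) (comul C c)) =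
      1 * comul C c (ev (fst r), ev (mul (fst (snd r)) (snd (snd r))))" by (rule *(2))
  qed
  have eqU: "x = y" if "x \<in> vcarrier ?U" "y \<in> vcarrier ?U" "\<And>r. r \<in> III \<Longrightarrow> e r x = e r y" for x y
  proof -
    have "x - y = 0"
      using that by (intro sepU vs_diff[OF is_vspace_tensor]) (auto simp: e_def)
    then show ?thesis by simp
  qed
  show ?thesis
    unfolding coalgebra_def
  proof (intro conjI ballI)
    show "is_vspace C" by fact
    show "linear_map C ?CC (comul C)"
      unfolding linear_map_def
      by (auto simp: comul vs_add[OF C] vs_scale[OF C] comul_ev fscale_def lfun_simps[OF C ev] mul
          intro!: eqCC vs_add[OF is_vspace_tensor] vs_scale[OF is_vspace_tensor, simplified])
    show "linear_map C ground (counit C)"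
      using lfun_linear_map[OF C ev[OF one]] counit
      by (auto simp: linear_map_def vs_add[OF C] vs_scale[OF C])
    fix c assume c: "c \<in> vcarrier C"
    show "tlift C C (\<lambda>x y. tens ?CC C (comul C x) y) (comul C c) =
        tlift C C (\<lambda>x y. tlift C C (\<lambda>y y'. tens ?CC C (tens C C x y) y') (comul C y)) (comul C c)"
      by (rule eqU[OF lhs(1)[OF c] rhs(1)[OF c]])
        (auto simp: lhs(2)[OF c] rhs(2)[OF c], auto simp: III_def comul_ev[OF c] mul assoc[OF c])
    have kl: "ev i (vscale C (counit C x) y) = 1 * (ev one x * ev i y)"
      if "i \<in> I" "x \<in> vcarrier C" "y \<in> vcarrier C" for i x y
      using that by (simp add: counit lfun_simps[OF C ev])
    note cl = tlift_eval[where e = ev and k = "\<lambda>_. 1" and p = "\<lambda>_. ev one" and q = ev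
        and \<beta> = "\<lambda>x y. vscale C (counit C x) y", OF C C C comul[OF c] lfun_linear_map[OF C ev] sep vs_scale[OF C] ev[OF one] ev kl]
    show "tlift C C (\<lambda>x y. vscale C (counit C x) y) (comul C c) = c"
      by (rule eqC[OF cl(1) c]) (simp_all add: cl(2) comul_ev c one mul_one)
    have kr: "ev i (vscale C (counit C y) x) = 1 * (ev i x * ev one y)"
      if "i \<in> I" "x \<in> vcarrier C" "y \<in> vcarrier C" for i x y
      using that by (simp add: counit lfun_simps[OF C ev] mult.commute)
    note cr = tlift_eval[where e = ev and k = "\<lambda>_. 1" and p = ev and q = "\<lambda>_. ev one"
        and \<beta> = "\<lambda>x y. vscale C (counit C y) x", OF C C C comul[OF c] lfun_linear_map[OF C ev] sep vs_scale[OF C] ev ev[OF one] kr]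
    show "tlift C C (\<lambda>x y. vscale C (counit C y) x) (comul C c) = c"
      by (rule eqC[OF cr(1) c]) (simp_all add: cr(2) comul_ev c one mul_one)
  qed
qed

subsection \<open>Tensor powers\<close>

lemma ltens_Nil: "ltens N [] fs = (if fs = [] then 1 else 0)"
  by (auto simp: ltens_def)

lemma ltens_Cons: "ltens N (x # xs) (f # fs) = (if lfun N f then f x else 0) * ltens N xs fs"
  by (auto simp: ltens_def)

lemma ltens_length: "length xs \<noteq> length fs \<Longrightarrow> ltens N xs fs = 0"
  by (auto simp: ltens_def)

lemma ltens_append:
  "length us = length fs \<Longrightarrow> ltens N (us @ vs) (fs @ gs) = ltens N us fs * ltens N vs gs"
proof (induction us arbitrary: fs)
  case Nil
  then show ?case by (simp add: ltens_Nil)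
next
  case (Cons u us)
  then obtain f fs' where "fs = f # fs'" by (cases fs) auto
  then show ?case using Cons by (simp add: ltens_Cons)
qed

lemma is_vspace_tensor_power [simp]: "is_vspace (tensor_power N n)"
  by (simp add: is_vspace_def tensor_power_def vector_space_fscale module.subspace_span[OF module_fscale])

lemma vscale_tensor_power [simp]: "vscale (tensor_power N n) = fscale"
  by (simp add: tensor_power_def)

lemma ltens_in: "length xs = n \<Longrightarrow> set xs \<subseteq> vcarrier N \<Longrightarrow> ltens N xs \<in> vcarrier (tensor_power N n)"
  unfolding tensor_power_def vspace.simps by (intro module.span_base[OF module_fscale]) auto

context
  fixes N :: "('k::field, 'n::ab_group_add, 'z) vspace_scheme"
  assumes N: "is_vspace N"
begin

lemma ltens_multilinear: "multilinear_map N n ground (\<lambda>xs. ltens N xs fs)"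
  unfolding multilinear_map_def
proof (intro allI impI)
  fix us vs assume "Suc (length us + length vs) = n \<and> set us \<subseteq> vcarrier N \<and> set vs \<subseteq> vcarrier N"
  show "linear_map N ground (\<lambda>x. ltens N (us @ x # vs) fs)"
  proof (cases "length fs = Suc (length us + length vs)")
    case True
    define f1 f f2 where "f1 = take (length us) fs" "f = fs ! length us" "f2 = drop (Suc (length us)) fs"
    have fs: "fs = f1 @ f # f2" "length us = length f1"
      using True by (auto simp: f1_f_f2_def id_take_nth_drop[symmetric])
    then show ?thesis
      by (auto simp: linear_map_def ltens_append ltens_Cons lfun_simps[OF N] algebra_simps)
  next
    case False
    then show ?thesis by (auto simp: linear_map_def ltens_length)
  qed
qed

lemma ltens_scale_hd: "ltens N (vscale N a x # xs) = fscale a (ltens N (x # xs))"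
proof
  fix fs show "ltens N (vscale N a x # xs) fs = fscale a (ltens N (x # xs)) fs"
    by (cases fs) (auto simp: ltens_Cons ltens_length fscale_def lfun_simps[OF N])
qed

lemma tensor_power_rep:
  assumes t: "t \<in> vcarrier (tensor_power N n)" and n: "n > 0"
  obtains xss where "\<forall>xs\<in>set xss. length xs = n \<and> set xs \<subseteq> vcarrier N" "t = (\<Sum>xs\<leftarrow>xss. ltens N xs)"
proof -
  interpret F: vector_space "fscale :: 'k \<Rightarrow> ('k, 'n) ltensor \<Rightarrow> _" by (rule vector_space_fscale)
  have "t \<in> F.span {ltens N xs |xs. length xs = n \<and> set xs \<subseteq> vcarrier N}"
    using t by (simp add: tensor_power_def)
  then have "\<exists>xss. (\<forall>xs\<in>set xss. length xs = n \<and> set xs \<subseteq> vcarrier N) \<and> t = (\<Sum>xs\<leftarrow>xss. ltens N xs)"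
  proof (induction rule: F.span_induct_alt)
    case base
    show ?case by (rule exI[of _ "[]"]) auto
  next
    case (step a b t)
    then obtain xs xss where *: "b = ltens N xs" "length xs = n" "set xs \<subseteq> vcarrier N"
      "\<forall>xs\<in>set xss. length xs = n \<and> set xs \<subseteq> vcarrier N" "t = (\<Sum>xs\<leftarrow>xss. ltens N xs)" by auto
    moreover obtain y ys where "xs = y # ys" using * n by (cases xs) auto
    ultimately show ?case
      by (intro exI[of _ "(vscale N a y # ys) # xss"]) (auto simp: ltens_scale_hd vs_scale[OF N])
  qed
  then show ?thesis using that by blast
qed

lemma tensor_power_length:
  assumes t: "t \<in> vcarrier (tensor_power N n)" and n: "n > 0" and "length fs \<noteq> n"
  shows "t fs = 0"
proof -
  obtain xss where "\<forall>xs\<in>set xss. length xs = n \<and> set xs \<subseteq> vcarrier N" "t = (\<Sum>xs\<leftarrow>xss. ltens N xs)"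
    by (rule tensor_power_rep[OF t n])
  then show ?thesis using assms(3)
    by (auto simp: sum_list_fun_apply ltens_def intro!: sum_list_0 cong: map_cong)
qed

lemma tensor_power_nonlinear:
  assumes t: "t \<in> vcarrier (tensor_power N n)" and n: "n > 0" and "\<not> (\<forall>f\<in>set fs. lfun N f)"
  shows "t fs = 0"
proof -
  obtain xss where "\<forall>xs\<in>set xss. length xs = n \<and> set xs \<subseteq> vcarrier N" "t = (\<Sum>xs\<leftarrow>xss. ltens N xs)"
    by (rule tensor_power_rep[OF t n])
  moreover have "ltens N xs fs = 0" for xs using assms(3) by (auto simp: ltens_def)
  ultimately show ?thesis by (simp add: sum_list_fun_apply)
qed

lemma tensor_power_slice:
  assumes t: "t \<in> vcarrier (tensor_power N (Suc (length us + length vs)))"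
  obtains z where "z \<in> vcarrier N" "\<And>f. lfun N f \<Longrightarrow> t (us @ f # vs) = f z"
proof -
  obtain xss where xss: "\<forall>xs\<in>set xss. length xs = Suc (length us + length vs) \<and> set xs \<subseteq> vcarrier N"
    "t = (\<Sum>xs\<leftarrow>xss. ltens N xs)" by (rule tensor_power_rep[OF t]) auto
  let ?i = "length us"
  define k where "k xs = ltens N (take ?i xs) us * ltens N (drop (Suc ?i) xs) vs" for xs
  define z where "z = (\<Sum>xs\<leftarrow>xss. vscale N (k xs) (xs ! ?i))"
  have "t (us @ f # vs) = f z" if f: "lfun N f" for f
  proof -
    have "ltens N xs (us @ f # vs) = k xs * f (xs ! ?i)" if "xs \<in> set xss" for xs
    proof -
      have i: "?i < length xs" using xss(1) that by auto
      have "ltens N (take ?i xs @ xs ! ?i # drop (Suc ?i) xs) (us @ f # vs) = k xs * f (xs ! ?i)"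
        unfolding k_def using i f by (subst ltens_append) (auto simp: ltens_Cons)
      then show ?thesis using id_take_nth_drop[OF i] by simp
    qed
    then show ?thesis
      by (simp add: xss(2) sum_list_fun_apply z_def lfun_sum_list[OF N f] lfun_simps[OF N f] cong: map_cong)
  qed
  moreover have "z \<in> vcarrier N"
    unfolding z_def
  proof (intro vs_sum_list[OF N] vs_scale[OF N])
    fix xs assume "xs \<in> set xss"
    then have "?i < length xs" "set xs \<subseteq> vcarrier N" using xss(1) by auto
    then show "xs ! ?i \<in> vcarrier N" using nth_mem by blast
  qed
  ultimately show ?thesis using that by blast
qed

text \<open>Arbitrary functionals are traded for members of the family one slot at a time:
  contracting all other slots leaves a vector of \<open>N\<close>, and the family separates such
  vectors.\<close>

lemma tensor_power_separated:
  assumes t: "t \<in> vcarrier (tensor_power N n)" and n: "n > 0"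
    and e: "\<And>i. i \<in> I \<Longrightarrow> lfun N (e i)"
    and sep: "\<And>x. x \<in> vcarrier N \<Longrightarrow> (\<And>i. i \<in> I \<Longrightarrow> e i x = 0) \<Longrightarrow> x = 0"
    and zero: "\<And>is. length is = n \<Longrightarrow> set is \<subseteq> I \<Longrightarrow> t (map e is) = 0"
  shows "t = 0"
proof -
  have *: "length fs + length is = n \<Longrightarrow> set is \<subseteq> I \<Longrightarrow> \<forall>f\<in>set fs. lfun N f \<Longrightarrow> t (fs @ map e is) = 0" for fs "is"
  proof (induction fs arbitrary: "is" rule: rev_induct)
    case Nil
    then show ?case using zero by simp
  next
    case (snoc f fs)
    have "n = Suc (length fs + length (map e is))" using snoc.prems by simp
    then obtain z where z: "z \<in> vcarrier N" "\<And>f. lfun N f \<Longrightarrow> t (fs @ f # map e is) = f z"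
      using tensor_power_slice t by blast
    have "z = 0"
    proof (rule sep[OF z(1)])
      fix i assume "i \<in> I"
      then show "e i z = 0" using snoc.IH[of "i # is"] snoc.prems z(2)[OF e] by simp
    qed
    then show ?case using z(2)[of f] snoc.prems by (simp add: lfun_simps[OF N])
  qed
  have "t fs = 0" for fs
    using *[of fs "[]"] tensor_power_length[OF t n] tensor_power_nonlinear[OF t n] by force
  then show ?thesis by auto
qed

text \<open>The counterpart of \<open>tlift_eval\<close> for tensor powers: the test functional
  \<open>e i\<close> of the target corresponds to the list \<open>F i\<close> of functionals on
  \<open>N\<close>, and multilinearity of \<open>\<beta>\<close> is inherited from
  \<open>ltens\<close>.\<close>

lemma llift_eval:
  fixes U :: "('k, 'u::ab_group_add, 'y) vspace_scheme"
  assumes U: "is_vspace U" and t: "t \<in> vcarrier (tensor_power N n)" and n: "n > 0"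
    and lin: "\<And>i. i \<in> I \<Longrightarrow> linear_map U ground (e i)"
    and sep: "\<And>x. x \<in> vcarrier U \<Longrightarrow> (\<And>i. i \<in> I \<Longrightarrow> e i x = 0) \<Longrightarrow> x = 0"
    and mem: "\<And>xs. length xs = n \<Longrightarrow> set xs \<subseteq> vcarrier N \<Longrightarrow> \<beta> xs \<in> vcarrier U"
    and e: "\<And>i xs. i \<in> I \<Longrightarrow> length xs = n \<Longrightarrow> set xs \<subseteq> vcarrier N \<Longrightarrow> e i (\<beta> xs) = ltens N xs (F i)"
  shows "llift N n \<beta> t \<in> vcarrier U" "\<And>i. i \<in> I \<Longrightarrow> e i (llift N n \<beta> t) = t (F i)"
proof -
  have eqI: "x = y" if "x \<in> vcarrier U" "y \<in> vcarrier U" "\<And>i. i \<in> I \<Longrightarrow> e i x = e i y" for x y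
  proof -
    have "e i (x - y) = 0" if i: "i \<in> I" for i
    proof -
      interpret U: vector_space "vscale U" using U by (simp add: is_vspace_def)
      have "e i (x + vscale U (- 1) y) = e i x + (- 1) * e i y"
        using lin[OF i] \<open>x \<in> _\<close> \<open>y \<in> _\<close> vs_scale[OF U, of y "-1"]
        unfolding linear_map_def by (metis ground_simps(2))
      then show ?thesis using \<open>\<And>i. i \<in> I \<Longrightarrow> e i x = e i y\<close>[OF i] by simp
    qed
    then have "x - y = 0" using that(1,2) by (intro sep vs_diff[OF U])
    then show ?thesis by simp
  qed
  have ml: "multilinear_map N n U \<beta>"
    unfolding multilinear_map_def
  proof (intro allI impI)
    fix us vs assume *: "Suc (length us + length vs) = n \<and> set us \<subseteq> vcarrier N \<and> set vs \<subseteq> vcarrier N"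
    have l: "linear_map N ground (\<lambda>x. ltens N (us @ x # vs) fs)" for fs
      using ltens_multilinear[of n fs] * unfolding multilinear_map_def by blast
    have m: "\<beta> (us @ x # vs) \<in> vcarrier U" if "x \<in> vcarrier N" for x using * that by (intro mem) auto
    have ev: "e i (\<beta> (us @ x # vs)) = ltens N (us @ x # vs) (F i)" if "x \<in> vcarrier N" "i \<in> I" for x i
      using * that by (intro e) auto
    show "linear_map N U (\<lambda>x. \<beta> (us @ x # vs))"
      unfolding linear_map_def
    proof (intro conjI ballI allI)
      fix x assume x: "x \<in> vcarrier N"
      show "\<beta> (us @ x # vs) \<in> vcarrier U" by (rule m[OF x])
      show "\<beta> (us @ (x + y) # vs) = \<beta> (us @ x # vs) + \<beta> (us @ y # vs)" if y: "y \<in> vcarrier N" for y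
      proof (rule eqI)
        fix i assume i: "i \<in> I"
        have "e i (\<beta> (us @ x # vs) + \<beta> (us @ y # vs)) = e i (\<beta> (us @ x # vs)) + e i (\<beta> (us @ y # vs))"
          using lin[OF i] m x y by (simp add: linear_map_def)
        then show "e i (\<beta> (us @ (x + y) # vs)) = e i (\<beta> (us @ x # vs) + \<beta> (us @ y # vs))"
          using l x y i by (simp add: ev vs_add[OF N] linear_map_def)
      qed (use m x y vs_add[OF N] vs_add[OF U] in auto)
      show "\<beta> (us @ (vscale N a x) # vs) = vscale U a (\<beta> (us @ x # vs))" for a
      proof (rule eqI)
        fix i assume i: "i \<in> I"
        have "e i (vscale U a (\<beta> (us @ x # vs))) = a * e i (\<beta> (us @ x # vs))"
          using lin[OF i] m x by (simp add: linear_map_def)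
        then show "e i (\<beta> (us @ (vscale N a x) # vs)) = e i (vscale U a (\<beta> (us @ x # vs)))"
          using l x i by (simp add: ev vs_scale[OF N] linear_map_def)
      qed (use m x vs_scale[OF N] vs_scale[OF U] in auto)
    qed
  qed
  obtain xss where xss: "\<forall>xs\<in>set xss. length xs = n \<and> set xs \<subseteq> vcarrier N" "t = (\<Sum>xs\<leftarrow>xss. ltens N xs)"
    by (rule tensor_power_rep[OF t n])
  have eq: "llift N n \<beta> t = (\<Sum>xs\<leftarrow>xss. \<beta> xs)"
    unfolding xss(2) using xss(1) by (intro llift_eq[OF N U ml n]) auto
  then show "llift N n \<beta> t \<in> vcarrier U" using xss(1) by (auto intro!: vs_sum_list[OF U] mem)
  fix i assume i: "i \<in> I"
  have "e i (llift N n \<beta> t) = (\<Sum>xs\<leftarrow>xss. e i (\<beta> xs))"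
    unfolding eq using xss(1) by (intro linear_map_sum_list[OF U is_vspace_ground lin[OF i]] mem) auto
  also have "\<dots> = (\<Sum>xs\<leftarrow>xss. ltens N xs (F i))"
    using xss(1) by (intro arg_cong[of _ _ sum_list] map_cong refl e i) auto
  finally show "e i (llift N n \<beta> t) = t (F i)" by (simp add: xss(2) sum_list_fun_apply)
qed

lemma tensor_power_cons:
  assumes t: "t \<in> vcarrier (tensor_power N n)" and n: "n > 0" and x: "x \<in> vcarrier N"
  obtains t' where "t' \<in> vcarrier (tensor_power N (Suc n))" "\<And>f fs. lfun N f \<Longrightarrow> t' (f # fs) = f x * t fs"
proof -
  obtain xss where xss: "\<forall>xs\<in>set xss. length xs = n \<and> set xs \<subseteq> vcarrier N" "t = (\<Sum>xs\<leftarrow>xss. ltens N xs)"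
    by (rule tensor_power_rep[OF t n])
  show ?thesis
  proof (rule that[of "\<Sum>xs\<leftarrow>xss. ltens N (x # xs)"])
    show "(\<Sum>xs\<leftarrow>xss. ltens N (x # xs)) \<in> vcarrier (tensor_power N (Suc n))"
      using xss(1) x by (intro vs_sum_list[OF is_vspace_tensor_power] ltens_in) auto
  qed (auto simp: xss(2) sum_list_fun_apply ltens_Cons sum_list_const_mult)
qed

end

subsection \<open>Finite dimension\<close>

text \<open>Phrased by vectors together with coordinate functionals, since transposes of bilinear
  maps are written as sums over such a pair.\<close>

definition fin_dim :: "('k::field, 'v::ab_group_add, 'z) vspace_scheme \<Rightarrow> bool" where
  "fin_dim V \<longleftrightarrow> (\<exists>B c. finite B \<and> B \<subseteq> vcarrier V \<and> (\<forall>b\<in>B. c b \<in> vcarrier (dual_space V)) \<and>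
     (\<forall>x\<in>vcarrier V. x = (\<Sum>b\<in>B. vscale V (c b x) b)))"

lemma fin_dimI:
  assumes V: "is_vspace V" and S: "finite S" "S \<subseteq> vcarrier V" "vcarrier V \<subseteq> module.span (vscale V) S"
  shows "fin_dim V"
proof -
  interpret V: vector_space "vscale V" using V by (simp add: is_vspace_def)
  obtain B c where B: "finite B" "B \<subseteq> S" "\<And>b. lfun V (c b)"
    "\<And>x. x \<in> S \<Longrightarrow> x = (\<Sum>b\<in>B. vscale V (c b x) b)"
    using coordinates_exist[OF V.vector_space_axioms S(1)] by blast
  have "x = (\<Sum>b\<in>B. vscale V (c b x) b)" if "x \<in> vcarrier V" for x
  proof -
    have "x \<in> V.span S" using that S by blast
    then show ?thesis
    proof (induction rule: V.span_induct_alt)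
      case base
      show ?case by (simp add: lfun_simps[OF V B(3)])
    next
      case (step a x y)
      have "(\<Sum>b\<in>B. vscale V (c b (vscale V a x + y)) b) =
          vscale V a (\<Sum>b\<in>B. vscale V (c b x) b) + (\<Sum>b\<in>B. vscale V (c b y) b)"
        by (simp add: lfun_simps(2,4)[OF V B(3)] V.scale_sum_right V.scale_left_distrib sum.distrib)
      then show ?case using B(4)[OF step(1)] step(2) by simp
    qed
  qed
  then have "\<forall>x\<in>vcarrier V. x = (\<Sum>b\<in>B. vscale V (if x \<in> vcarrier V then c b x else 0) b)"
    by simp
  then show ?thesis unfolding fin_dim_def
    using B S dual_space_restrict[OF V lfun_linear_map[OF V B(3)]]
    by (intro exI[of _ B] exI[of _ "\<lambda>b x. if x \<in> vcarrier V then c b x else 0"]) auto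
qed

lemma dual_space_simps [simp]: "vscale (dual_space V) = fscale"
  by (simp add: dual_space_def)

lemma dual_in_linear_map: "f \<in> vcarrier (dual_space V) \<Longrightarrow> linear_map V ground f"
  by (simp add: dual_space_def)

lemma dual_space_separated:
  assumes "f \<in> vcarrier (dual_space V)" "\<And>x. x \<in> vcarrier V \<Longrightarrow> f x = 0"
  shows "f = 0"
proof
  show "f x = 0 x" for x using assms by (cases "x \<in> vcarrier V") (auto simp: dual_space_def)
qed

text \<open>Uniqueness holds because evaluations at vectors separate tensors of functionals. For
  existence, coordinates \<open>c b\<close> on the finite-dimensional side give the sum over
  \<open>b\<close> of \<open>c b\<close> tensored with the functional that \<open>b\<close> induces
  on the other side. The disjunction serves left coactions, with \<open>D\<close> as first factor,
  as well as right ones.\<close>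

lemma transpose_map:
  assumes U: "is_vspace U" and V: "is_vspace V" and fd: "fin_dim U \<or> fin_dim V"
    and bil: "bilinear_map U V ground (\<lambda>u v. f (\<mu> u v))"
  shows "transpose_map U V \<mu> f \<in> vcarrier (tensor_space (dual_space U) (dual_space V))"
    and "\<And>u v. u \<in> vcarrier U \<Longrightarrow> v \<in> vcarrier V \<Longrightarrow>
      transpose_map U V \<mu> f (\<lambda>g. g u, \<lambda>h. h v) = f (\<mu> u v)"
proof -
  let ?T = "tensor_space (dual_space U) (dual_space V)"
  have dU: "is_vspace (dual_space U)" and dV: "is_vspace (dual_space V)"
    using U V by (simp_all add: is_vspace_dual)
  have eval: "tlift (dual_space U) (dual_space V) (\<lambda>g h. g u * h v) t = t (\<lambda>g. g u, \<lambda>h. h v)"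
    if "t \<in> vcarrier ?T" for t u v
    using tlift_eval(2)[OF dU dV is_vspace_ground that, where I = "{()}" and e = "\<lambda>_ x. x"
        and k = "\<lambda>_. 1" and p = "\<lambda>_ g. g u" and q = "\<lambda>_ h. h v" and \<beta> = "\<lambda>g h. g u * h v"]
    by (auto simp: lfun_eval linear_map_def)
  have uniq: "t = t'" if "t \<in> vcarrier ?T" "t' \<in> vcarrier ?T"
    "\<And>u v. u \<in> vcarrier U \<Longrightarrow> v \<in> vcarrier V \<Longrightarrow> t (\<lambda>g. g u, \<lambda>h. h v) = t' (\<lambda>g. g u, \<lambda>h. h v)" for t t'
    by (rule tensor_eqI[OF dU dV that(1,2), where I = "vcarrier U" and J = "vcarrier V"
          and e = "\<lambda>u g. g u" and f = "\<lambda>v h. h v"])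
      (auto simp: lfun_eval that(3) intro: dual_space_separated)
  have b: "linear_map V ground (\<lambda>v. f (\<mu> u v))" if "u \<in> vcarrier U" for u
    using bil that by (auto simp: bilinear_map_def)
  have b': "linear_map U ground (\<lambda>u. f (\<mu> u v))" if "v \<in> vcarrier V" for v
    using bil that by (auto simp: bilinear_map_def)
  have "\<exists>t\<in>vcarrier ?T. \<forall>u\<in>vcarrier U. \<forall>v\<in>vcarrier V. t (\<lambda>g. g u, \<lambda>h. h v) = f (\<mu> u v)"
    using fd
  proof
    assume "fin_dim U"
    then obtain B c where B: "finite B" "B \<subseteq> vcarrier U" "\<And>b. b \<in> B \<Longrightarrow> c b \<in> vcarrier (dual_space U)"
      "\<And>x. x \<in> vcarrier U \<Longrightarrow> x = (\<Sum>b\<in>B. vscale U (c b x) b)" unfolding fin_dim_def by blast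
    define h where "h b = (\<lambda>v. if v \<in> vcarrier V then f (\<mu> b v) else 0)" for b
    have h: "h b \<in> vcarrier (dual_space V)" if "b \<in> B" for b
      unfolding h_def using B that by (intro dual_space_restrict[OF V b]) auto
    show ?thesis
    proof (intro bexI ballI)
      show "(\<Sum>b\<in>B. tens (dual_space U) (dual_space V) (c b) (h b)) \<in> vcarrier ?T"
        using B h by (intro vs_sum[OF is_vspace_tensor] tens_in)
      fix u v assume u: "u \<in> vcarrier U" and v: "v \<in> vcarrier V"
      have "f (\<mu> u v) = f (\<mu> (\<Sum>b\<in>B. vscale U (c b u) b) v)" using B(4)[OF u] by simp
      also have "\<dots> = (\<Sum>b\<in>B. f (\<mu> (vscale U (c b u) b) v))"
        using B(2) by (intro linear_map_sum[OF U is_vspace_ground b'[OF v]] vs_scale[OF U]) auto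
      also have "\<dots> = (\<Sum>b\<in>B. c b u * f (\<mu> b v))"
        using b'[OF v] B(2) by (intro sum.cong refl) (auto simp: linear_map_def)
      finally show "(\<Sum>b\<in>B. tens (dual_space U) (dual_space V) (c b) (h b)) (\<lambda>g. g u, \<lambda>h. h v) = f (\<mu> u v)"
        using v by (simp add: fun_sum_apply tens_apply lfun_eval h_def)
    qed
  next
    assume "fin_dim V"
    then obtain B c where B: "finite B" "B \<subseteq> vcarrier V" "\<And>b. b \<in> B \<Longrightarrow> c b \<in> vcarrier (dual_space V)"
      "\<And>x. x \<in> vcarrier V \<Longrightarrow> x = (\<Sum>b\<in>B. vscale V (c b x) b)" unfolding fin_dim_def by blast
    define h where "h b = (\<lambda>u. if u \<in> vcarrier U then f (\<mu> u b) else 0)" for b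
    have h: "h b \<in> vcarrier (dual_space U)" if "b \<in> B" for b
      unfolding h_def using B that by (intro dual_space_restrict[OF U b']) auto
    show ?thesis
    proof (intro bexI ballI)
      show "(\<Sum>b\<in>B. tens (dual_space U) (dual_space V) (h b) (c b)) \<in> vcarrier ?T"
        using B h by (intro vs_sum[OF is_vspace_tensor] tens_in)
      fix u v assume u: "u \<in> vcarrier U" and v: "v \<in> vcarrier V"
      have "f (\<mu> u v) = f (\<mu> u (\<Sum>b\<in>B. vscale V (c b v) b))" using B(4)[OF v] by simp
      also have "\<dots> = (\<Sum>b\<in>B. f (\<mu> u (vscale V (c b v) b)))"
        using B(2) by (intro linear_map_sum[OF V is_vspace_ground b[OF u]] vs_scale[OF V]) auto
      also have "\<dots> = (\<Sum>b\<in>B. f (\<mu> u b) * c b v)"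
        using b[OF u] B(2) by (intro sum.cong refl) (auto simp: linear_map_def mult.commute)
      finally show "(\<Sum>b\<in>B. tens (dual_space U) (dual_space V) (h b) (c b)) (\<lambda>g. g u, \<lambda>h. h v) = f (\<mu> u v)"
        using u by (simp add: fun_sum_apply tens_apply lfun_eval h_def)
    qed
  qed
  then obtain t where t: "t \<in> vcarrier ?T"
    "\<And>u v. u \<in> vcarrier U \<Longrightarrow> v \<in> vcarrier V \<Longrightarrow> t (\<lambda>g. g u, \<lambda>h. h v) = f (\<mu> u v)" by blast
  have "transpose_map U V \<mu> f = t"
    unfolding transpose_map_def
  proof (rule the_equality)
    show "t \<in> vcarrier ?T \<and> (\<forall>u\<in>vcarrier U. \<forall>v\<in>vcarrier V.
        tlift (dual_space U) (dual_space V) (\<lambda>g h. g u * h v) t = f (\<mu> u v))"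
      using t eval by simp
    fix t' assume "t' \<in> vcarrier ?T \<and> (\<forall>u\<in>vcarrier U. \<forall>v\<in>vcarrier V.
        tlift (dual_space U) (dual_space V) (\<lambda>g h. g u * h v) t' = f (\<mu> u v))"
    then show "t' = t" using eval t by (intro uniq) auto
  qed
  then show "transpose_map U V \<mu> f \<in> vcarrier ?T"
    "\<And>u v. u \<in> vcarrier U \<Longrightarrow> v \<in> vcarrier V \<Longrightarrow> transpose_map U V \<mu> f (\<lambda>g. g u, \<lambda>h. h v) = f (\<mu> u v)"
    using t by auto
qed

subsection \<open>Finite-dimensional division algebras\<close>

context
  fixes s :: "'k::field \<Rightarrow> 'd::division_ring \<Rightarrow> 'd"
  assumes fd: "fd_division_algebra s"
begin

lemma fda_vector_space: "vector_space s"
  and fda_mult_left: "s a x * y = s a (x * y)"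
  and fda_mult_right: "x * s a y = s a (x * y)"
  using fd by (auto simp: fd_division_algebra_def)

interpretation s: vector_space s by (rule fda_vector_space)

lemma fda_basis: obtains B where "finite B" "s.span B = UNIV"
  using fd by (auto simp: fd_division_algebra_def)

lemma fda_is_vspace: "is_vspace (full_space s)"
  by (simp add: is_vspace_def full_space_def s.vector_space_axioms)

lemma fda_simps [simp]: "vcarrier (full_space s) = UNIV" "vscale (full_space s) = s"
  by (simp_all add: full_space_def)

lemma fda_fin_dim: "fin_dim (full_space s)"
proof -
  obtain B where "finite B" "s.span B = UNIV" by (rule fda_basis)
  then show ?thesis by (intro fin_dimI[OF fda_is_vspace, of B]) auto
qed

lemma fda_surj:
  assumes f: "Vector_Spaces.linear s s f" and "inj f"
  shows "surj f"
proof -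
  obtain A where A: "finite A" "s.span A = UNIV" by (rule fda_basis)
  obtain B where B: "B \<subseteq> A" "s.independent B" "A \<subseteq> s.span B"
    by (rule s.maximal_independent_subset)
  have "s.span B = UNIV" using s.span_mono[OF B(3)] A(2) unfolding s.span_span by auto
  then interpret finite_dimensional_vector_space s B
    using A(1) B(1,2) finite_subset by unfold_locales auto
  show ?thesis using linear_inj_imp_surj assms by blast
qed

lemma dual_coalgebra_simps [simp]:
  "vcarrier (dual_coalgebra s) = vcarrier (dual_space (full_space s))" "vscale (dual_coalgebra s) = fscale"
  "counit (dual_coalgebra s) = (\<lambda>f. f 1)"
  by (simp_all add: dual_coalgebra_def)

lemma fda_dual: "c \<in> vcarrier (dual_space (full_space s)) \<longleftrightarrow> linear_map (full_space s) ground c"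
  by (simp add: dual_space_def)

lemma is_vspace_dual_coalgebra: "is_vspace (dual_coalgebra s)"
  using is_vspace_dual[OF fda_is_vspace] by (simp add: is_vspace_def)

lemma fda_dual_simps:
  assumes "c \<in> vcarrier (dual_space (full_space s))"
  shows "c (x + y) = c x + c y" "c (s a x) = a * c x"
  using assms by (auto simp: fda_dual linear_map_def)

lemma fda_dual_translate:
  assumes "c \<in> vcarrier (dual_space (full_space s))"
  shows "bilinear_map (full_space s) (full_space s) ground (\<lambda>u v. c (u * v))"
  using fda_dual_simps[OF assms]
  by (simp add: bilinear_map_def linear_map_def distrib_left distrib_right fda_mult_left fda_mult_right)

lemma dual_comul:
  assumes "c \<in> vcarrier (dual_coalgebra s)"
  shows "comul (dual_coalgebra s) c \<in> vcarrier (tensor_space (dual_coalgebra s) (dual_coalgebra s))"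
    "comul (dual_coalgebra s) c (\<lambda>f. f x, \<lambda>f. f y) = c (x * y)"
proof -
  have b: "bilinear_map (full_space s) (full_space s) ground (\<lambda>u v. c (u * v))"
    using assms by (intro fda_dual_translate) simp
  note t = transpose_map[where f = c and \<mu> = "(*)", OF fda_is_vspace fda_is_vspace disjI1[OF fda_fin_dim] b]
  have "tensor_space (dual_coalgebra s) (dual_coalgebra s) =
      tensor_space (dual_space (full_space s)) (dual_space (full_space s))"
    by (simp add: tensor_space_def tens_def)
  then show "comul (dual_coalgebra s) c \<in> vcarrier (tensor_space (dual_coalgebra s) (dual_coalgebra s))"
    using t(1) by (simp add: dual_coalgebra_def)
  show "comul (dual_coalgebra s) c (\<lambda>f. f x, \<lambda>f. f y) = c (x * y)"
    using t(2) by (simp add: dual_coalgebra_def)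
qed

text \<open>The functionals \<open>\<lambda>a. c (a * d)\<close> have no common zero
  \<open>a \<noteq> 0\<close>, because \<open>a * d\<close> then runs through all of
  \<open>D\<close> and \<open>c\<close> would vanish. By the double annihilator argument they are
  all functionals.\<close>

lemma fda_dual_cyclic:
  assumes c: "c \<in> vcarrier (dual_space (full_space s))" "c \<noteq> 0"
    and f: "f \<in> vcarrier (dual_space (full_space s))"
  obtains d where "\<And>a. f a = c (a * d)"
proof -
  obtain B where B: "finite B" "s.span B = UNIV" by (rule fda_basis)
  show ?thesis
  proof (rule functional_in_family[OF fda_vector_space B fda_is_vspace, where f = f and \<Gamma> = "\<lambda>d a. c (a * d)"])
    show "linear_map (full_space s) ground (\<lambda>a. c (a * d))" for d
      using fda_dual_translate[OF c(1)] by (simp add: bilinear_map_def)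
    show "linear_map (full_space s) ground f" using f by (simp add: fda_dual)
    fix a assume a: "\<And>d. c (a * d) = 0"
    have "a = 0"
    proof (rule ccontr)
      assume "a \<noteq> 0"
      then have "c x = 0" for x using a[of "inverse a * x"] by (simp flip: mult.assoc)
      then show False using c(2) by auto
    qed
    then show "f a = 0" using fda_dual_simps(2)[OF f, of 0 0] by simp
  qed (use that in \<open>auto simp: fda_dual_simps[OF c(1)] distrib_left fda_mult_right\<close>)
qed

text \<open>Only the zero functional is annihilated by all evaluations at elements of
  \<open>D\<close>, so these evaluations exhaust the bidual.\<close>

lemma fda_bidual:
  assumes F: "linear_map (dual_space (full_space s)) ground F"
  obtains d where "\<And>c. c \<in> vcarrier (dual_space (full_space s)) \<Longrightarrow> F c = c d"
proof -
  obtain B where B: "finite B" "s.span B = UNIV" by (rule fda_basis)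
  have X: "is_vspace (dual_space (full_space s))" by (rule is_vspace_dual[OF fda_is_vspace])
  show ?thesis
  proof (rule functional_in_family[OF fda_vector_space B X, where f = F and \<Gamma> = "\<lambda>d c. c d"])
    show "linear_map (dual_space (full_space s)) ground (\<lambda>c. c d)" for d
      by (simp add: linear_map_def fscale_def)
    show "F c = 0" if "\<And>d. c d = 0" for c
    proof -
      have "c = 0" using that by auto
      then show ?thesis using linear_map_zero[OF X is_vspace_ground F] by simp
    qed
  qed (use that F in \<open>auto simp: fda_dual_simps\<close>)
qed

lemma fda_dual_separates:
  assumes "\<And>c. c \<in> vcarrier (dual_space (full_space s)) \<Longrightarrow> c x = c y"
  shows "x = y"
  by (rule lfun_eqI[OF fda_is_vspace])
    (use assms lfun_linear_map[OF fda_is_vspace] in \<open>auto simp: fda_dual\<close>)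

end

subsection \<open>The cotensor coalgebra of a one-dimensional bimodule\<close>

locale line_bimodule =
  fixes s :: "'k::field \<Rightarrow> 'd::division_ring \<Rightarrow> 'd" and M :: "('k, 'd, 'm::ab_group_add) bimod"
  assumes fd: "fd_division_algebra s" and bim: "bimodule s M" and iso: "vspace_iso M (full_space s)"
begin

abbreviation "Dc \<equiv> dual_coalgebra s"
abbreviation "N \<equiv> dual_bicomodule s M"
abbreviation "T \<equiv> cotensor_space Dc N"
abbreviation "E \<equiv> cotensor_coalgebra Dc N"
abbreviation "X \<equiv> vcarrier M"
abbreviation L where "L \<equiv> lact M"
abbreviation R where "R \<equiv> ract M"
text \<open>A word in \<open>M\<close>, read as a list of functionals on the dual of
  \<open>M\<close>.\<close>

abbreviation "evs \<equiv> map (\<lambda>(m::'m) (f::'m \<Rightarrow> 'k). f m)"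

lemma M_vspace: "is_vspace M" and LR_in: "m \<in> X \<Longrightarrow> L d m \<in> X" "m \<in> X \<Longrightarrow> R m d \<in> X"
  and LR_add: "m \<in> X \<Longrightarrow> m' \<in> X \<Longrightarrow> L d (m + m') = L d m + L d m'"
    "m \<in> X \<Longrightarrow> m' \<in> X \<Longrightarrow> R (m + m') d = R m d + R m' d"
    "m \<in> X \<Longrightarrow> L (d + e) m = L d m + L e m" "m \<in> X \<Longrightarrow> R m (d + e) = R m d + R m e"
  and LR_mult: "m \<in> X \<Longrightarrow> L (d * e) m = L d (L e m)" "m \<in> X \<Longrightarrow> R m (d * e) = R (R m d) e"
    "m \<in> X \<Longrightarrow> R (L d m) e = L d (R m e)"
  and LR_one: "m \<in> X \<Longrightarrow> L 1 m = m" "m \<in> X \<Longrightarrow> R m 1 = m"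
  and LR_scalar: "m \<in> X \<Longrightarrow> L (s a 1) m = vscale M a m" "m \<in> X \<Longrightarrow> R m (s a 1) = vscale M a m"
  using bim unfolding bimodule_def by auto

text \<open>Scalars act through the elements \<open>s a 1\<close>, which commute with everything in
  \<open>D\<close>.\<close>

lemma LR_scale:
  assumes m: "m \<in> X"
  shows "L (s a d) m = vscale M a (L d m)" "R m (s a d) = vscale M a (R m d)"
    "L d (vscale M a m) = vscale M a (L d m)" "R (vscale M a m) d = vscale M a (R m d)"
proof -
  have 1: "s a d = s a 1 * d" "s a d = d * s a 1"
    by (simp_all add: fda_mult_left[OF fd] fda_mult_right[OF fd])
  show "L (s a d) m = vscale M a (L d m)" "R m (s a d) = vscale M a (R m d)"
    by (subst 1(1), simp add: m LR_mult(1) LR_in LR_scalar) (subst 1(2), simp add: m LR_mult(2) LR_in LR_scalar)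
  have "L d (vscale M a m) = L (s a d) m" by (subst 1(2)) (simp add: m LR_mult(1) LR_scalar)
  also have "\<dots> = vscale M a (L d m)" by fact
  finally show "L d (vscale M a m) = vscale M a (L d m)" .
  have "R (vscale M a m) d = R m (s a d)" by (subst 1(1)) (simp add: m LR_mult(2) LR_scalar)
  also have "\<dots> = vscale M a (R m d)" by fact
  finally show "R (vscale M a m) d = vscale M a (R m d)" .
qed

lemma N_simps [simp]: "vcarrier N = vcarrier (dual_space M)" "vscale N = fscale"
  by (simp_all add: dual_bicomodule_def)

lemma N_vspace: "is_vspace N"
  using is_vspace_dual[OF M_vspace] by (simp add: is_vspace_def)

lemma Dc_vspace: "is_vspace Dc"
  by (rule is_vspace_dual_coalgebra[OF fd])

text \<open>The map \<open>\<lambda>d. R m0 d\<close> is injective since nonzero elements of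
  \<open>D\<close> are invertible. Transported by \<open>h\<close> it is an endomorphism of the
  finite-dimensional space \<open>D\<close>, hence onto. The generator is the preimage of 1 under
  \<open>h\<close>.\<close>

lemma M_line: obtains m0 where "m0 \<in> X" "m0 \<noteq> 0" "\<And>m. m \<in> X \<Longrightarrow> \<exists>d. m = R m0 d"
proof -
  obtain h where h: "linear_map M (full_space s) h" "bij_betw h X UNIV"
    using iso fd by (auto simp: vspace_iso_def fda_simps)
  have h0: "h 0 = 0" by (rule linear_map_zero[OF M_vspace fda_is_vspace[OF fd] h(1)])
  have hs: "h (x + y) = h x + h y" "h (vscale M a x) = s a (h x)" if "x \<in> X" "y \<in> X" for x y a
    using h(1) that by (auto simp: linear_map_def fda_simps[OF fd])
  obtain m0 where m0: "m0 \<in> X" "h m0 = 1" using h(2) unfolding bij_betw_def by (metis UNIV_I imageE)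
  have m00: "m0 \<noteq> 0" using m0 h0 by auto
  have inj0: "d = 0" if "R m0 d = 0" for d
  proof (rule ccontr)
    assume "d \<noteq> 0"
    have "R 0 (inverse d) = 0"
      using LR_add(2)[of 0 0 "inverse d"] vs_zero[OF M_vspace] by simp
    then have "R (R m0 d) (inverse d) = 0" using that by simp
    then show False using m0 m00 \<open>d \<noteq> 0\<close> by (simp flip: LR_mult(2) add: LR_one)
  qed
  have lin: "Vector_Spaces.linear s s (\<lambda>d. h (R m0 d))"
    using hs(1)[OF LR_in(2) LR_in(2)] hs(2)[OF LR_in(2) LR_in(2)] m0(1)
    by (simp add: Vector_Spaces.linear_iff fda_vector_space[OF fd] LR_add LR_scale)
  have "inj (\<lambda>d. h (R m0 d))"
  proof (rule injI)
    fix x y assume eq: "h (R m0 x) = h (R m0 y)"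
    then have "R m0 x = R m0 y" using h(2) m0 LR_in by (auto simp: bij_betw_def inj_on_def)
    moreover have "R m0 x = R m0 (x - y) + R m0 y" using LR_add(4)[OF m0(1), of "x - y" y] by simp
    ultimately show "x = y" using inj0[of "x - y"] by simp
  qed
  then have "surj (\<lambda>d. h (R m0 d))" by (rule fda_surj[OF fd lin])
  then have "\<exists>d. m = R m0 d" if "m \<in> X" for m
  proof -
    obtain d where "h m = h (R m0 d)" using \<open>surj _\<close> by (metis surjD)
    then have "m = R m0 d"
      using inj_onD[OF bij_betw_imp_inj_on[OF h(2)]] \<open>m \<in> X\<close> LR_in(2)[OF m0(1)] by blast
    then show ?thesis by blast
  qed
  then show ?thesis using that m0 m00 by blast
qed

lemma M_bilinear:
  assumes f: "f \<in> vcarrier (dual_space M)"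
  shows "bilinear_map (full_space s) M ground (\<lambda>d m. f (L d m))"
    "bilinear_map M (full_space s) ground (\<lambda>m d. f (R m d))"
proof -
  have "f (x + y) = f x + f y" "f (vscale M a x) = a * f x" if "x \<in> X" "y \<in> X" for x y a
    using dual_in_linear_map[OF f] that by (auto simp: linear_map_def)
  then show "bilinear_map (full_space s) M ground (\<lambda>d m. f (L d m))"
    "bilinear_map M (full_space s) ground (\<lambda>m d. f (R m d))"
    unfolding bilinear_map_def linear_map_def
    by (simp_all add: fda_simps[OF fd] LR_add LR_scale LR_in)
qed

lemma lcoact:
  assumes f: "f \<in> vcarrier N"
  shows "lcoact N f \<in> vcarrier (tensor_space Dc N)" "m \<in> X \<Longrightarrow> lcoact N f (\<lambda>c. c d, \<lambda>g. g m) = f (L d m)"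
proof -
  have f': "f \<in> vcarrier (dual_space M)" using f by simp
  note t = transpose_map[where f = f and \<mu> = L, OF fda_is_vspace[OF fd] M_vspace disjI1[OF fda_fin_dim[OF fd]] M_bilinear(1)[OF f']]
  have eq: "tensor_space Dc N = tensor_space (dual_space (full_space s)) (dual_space M)"
    by (simp add: tensor_space_def tens_def dual_coalgebra_simps[OF fd])
  show "lcoact N f \<in> vcarrier (tensor_space Dc N)"
    using t(1) unfolding eq by (simp add: dual_bicomodule_def)
  show "m \<in> X \<Longrightarrow> lcoact N f (\<lambda>c. c d, \<lambda>g. g m) = f (L d m)"
    using t(2) by (simp add: dual_bicomodule_def fda_simps[OF fd])
qed

lemma rcoact:
  assumes f: "f \<in> vcarrier N"
  shows "rcoact N f \<in> vcarrier (tensor_space N Dc)" "m \<in> X \<Longrightarrow> rcoact N f (\<lambda>g. g m, \<lambda>c. c d) = f (R m d)"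
proof -
  have f': "f \<in> vcarrier (dual_space M)" using f by simp
  note t = transpose_map[where f = f and \<mu> = R, OF M_vspace fda_is_vspace[OF fd] disjI2[OF fda_fin_dim[OF fd]] M_bilinear(2)[OF f']]
  have eq: "tensor_space N Dc = tensor_space (dual_space M) (dual_space (full_space s))"
    by (simp add: tensor_space_def tens_def dual_coalgebra_simps[OF fd])
  show "rcoact N f \<in> vcarrier (tensor_space N Dc)"
    using t(1) unfolding eq by (simp add: dual_bicomodule_def)
  show "m \<in> X \<Longrightarrow> rcoact N f (\<lambda>g. g m, \<lambda>c. c d) = f (R m d)"
    using t(2) by (simp add: dual_bicomodule_def fda_simps[OF fd])
qed

lemma lfun_evals: "lfun N (\<lambda>f. f m)" "lfun Dc (\<lambda>c. c d)" "lfun (tensor_power N n) (\<lambda>t. t fs)"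
  by (simp_all add: lfun_eval dual_coalgebra_simps[OF fd])

lemma N_separated: "f \<in> vcarrier N \<Longrightarrow> (\<And>m. m \<in> X \<Longrightarrow> f m = 0) \<Longrightarrow> f = 0"
  by (rule dual_space_separated) auto

lemma Dc_separated: "c \<in> vcarrier Dc \<Longrightarrow> (\<And>d. d \<in> UNIV \<Longrightarrow> c d = 0) \<Longrightarrow> c = 0"
  by auto

lemma power_separated:
  assumes "t \<in> vcarrier (tensor_power N n)" "n > 0"
    "\<And>w. length w = n \<Longrightarrow> set w \<subseteq> X \<Longrightarrow> t (evs w) = 0"
  shows "t = 0"
  by (rule tensor_power_separated[where e = "\<lambda>m f. f m" and I = X, OF N_vspace assms(1,2)])
    (use assms(3) lfun_evals N_separated in auto)

section \<open>The cotensor condition as balancedness over \<open>D\<close>\<close>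

definition balanced :: "('k, 'm \<Rightarrow> 'k) ltensor \<Rightarrow> nat \<Rightarrow> bool" where
  "balanced t n \<longleftrightarrow> (\<forall>us m d m' vs. length us + length vs + 2 = n \<longrightarrow> set us \<subseteq> X \<longrightarrow> m \<in> X \<longrightarrow> m' \<in> X \<longrightarrow>
     set vs \<subseteq> X \<longrightarrow> t (evs (us @ R m d # m' # vs)) = t (evs (us @ m # L d m' # vs)))"

text \<open>The two sides of the condition at position \<open>i\<close> are tensors with a factor
  from the dual of \<open>D\<close> inserted after \<open>i + 1\<close> letters. Evaluated at an
  element \<open>d\<close> in this slot, the right coaction turns the letter \<open>m\<close> before
  it into \<open>R m d\<close>, and the left coaction turns the letter \<open>m'\<close> after it
  into \<open>L d m'\<close>.\<close>

lemma cotensor_power_iff: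
  assumes n: "n > 0"
  shows "t \<in> cotensor_power Dc N n \<longleftrightarrow> t \<in> vcarrier (tensor_power N n) \<and> balanced t n"
proof -
  define P where "P i \<longleftrightarrow> (\<forall>us m d m' vs. length us = i \<longrightarrow> length us + length vs + 2 = n \<longrightarrow> set us \<subseteq> X \<longrightarrow>
     m \<in> X \<longrightarrow> m' \<in> X \<longrightarrow> set vs \<subseteq> X \<longrightarrow>
     t (evs (us @ R m d # m' # vs)) = t (evs (us @ m # L d m' # vs)))" for i
  have step: "(let A = tensor_power N (Suc i); B = tensor_power N (n - Suc i);
           word = (\<lambda>us c vs. tens (tensor_space A Dc) B (tens A Dc (ltens N us) c) (ltens N vs))
       in llift N n (\<lambda>xs. tlift N Dc (\<lambda>m c. word (take i xs @ [m]) c (drop (Suc i) xs))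
                      (rcoact N (xs ! i))) t =
          llift N n (\<lambda>xs. tlift Dc N (\<lambda>c m. word (take (Suc i) xs) c (m # drop (Suc (Suc i)) xs))
                      (lcoact N (xs ! Suc i))) t) \<longleftrightarrow>
     P i"
    if t: "t \<in> vcarrier (tensor_power N n)" and i: "Suc i < n" for i
  proof -
    define A where "A = tensor_power N (Suc i)"
    define B where "B = tensor_power N (n - Suc i)"
    define word where "word us c vs = tens (tensor_space A Dc) B (tens A Dc (ltens N us) c) (ltens N vs)" for us c vs
    define U where "U = tensor_space (tensor_space A Dc) B"
    \<comment> \<open>The test functionals: a word of length \<open>n\<close> cut after its letter
      \<open>m\<close>, with an element of \<open>D\<close> placed at the cut.\<close>
    define J where "J = {(us, m, d :: 'd, m', vs). length us = i \<and> length us + length vs + 2 = n \<and>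
      set us \<subseteq> X \<and> m \<in> X \<and> m' \<in> X \<and> set vs \<subseteq> X}"
    define e where "e = (\<lambda>(us, m, d, m', vs) (\<tau> :: ('k, ('k, ('k, 'm \<Rightarrow> 'k) ltensor, 'd \<Rightarrow> 'k) tensor, ('k, 'm \<Rightarrow> 'k) ltensor) tensor).
      \<tau> (\<lambda>q. q (\<lambda>t. t (evs (us @ [m])), \<lambda>c. c (d :: 'd)), \<lambda>t. t (evs (m' # vs))))"
    have AB: "is_vspace A" "is_vspace B" "is_vspace U" by (simp_all add: A_def B_def U_def)
    have lin: "linear_map U ground (e j)" for j
      unfolding e_def case_prod_unfold U_def by (rule lfun_linear_map[OF is_vspace_tensor lfun_tensor_eval])
    have sep: "x = 0" if x: "x \<in> vcarrier U" "\<And>j. j \<in> J \<Longrightarrow> e j x = 0" for x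
    proof (rule tensor_separated[OF is_vspace_tensor AB(2) x(1)[unfolded U_def],
          where I = "{w. length w = Suc i \<and> set w \<subseteq> X} \<times> UNIV" and J = "{w. length w = n - Suc i \<and> set w \<subseteq> X}"
            and e = "\<lambda>(w, d) q. q (\<lambda>t. t (evs w), \<lambda>c. c d)" and f = "\<lambda>w t. t (evs w)"])
      fix q assume q: "q \<in> vcarrier (tensor_space A Dc)"
        "\<And>r. r \<in> {w. length w = Suc i \<and> set w \<subseteq> X} \<times> UNIV \<Longrightarrow> (\<lambda>(w, d) q. q (\<lambda>t. t (evs w), \<lambda>c. c d)) r q = 0"
      show "q = 0"
      proof (rule tensor_separated[OF AB(1) Dc_vspace q(1), where I = "{w. length w = Suc i \<and> set w \<subseteq> X}"
          and J = UNIV and e = "\<lambda>w t. t (evs w)" and f = "\<lambda>d c. c d"])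
        show "x = 0" if "x \<in> vcarrier A" "\<And>w. w \<in> {w. length w = Suc i \<and> set w \<subseteq> X} \<Longrightarrow> x (evs w) = 0" for x
          using that unfolding A_def by (intro power_separated[of x "Suc i"]) auto
        show "q (\<lambda>t. t (evs w), \<lambda>c. c d) = 0" if "w \<in> {w. length w = Suc i \<and> set w \<subseteq> X}" for w d
          using q(2)[of "(w, d)"] that by simp
      qed (auto simp: A_def lfun_evals lfun_eval Dc_separated)
    next
      fix b assume "b \<in> vcarrier B" "\<And>w. w \<in> {w. length w = n - Suc i \<and> set w \<subseteq> X} \<Longrightarrow> b (evs w) = 0"
      then show "b = 0" unfolding B_def using i by (intro power_separated[of b "n - Suc i"]) auto
    next
      fix r w assume r: "r \<in> {w. length w = Suc i \<and> set w \<subseteq> X} \<times> (UNIV :: 'd set)" and w: "w \<in> {w. length w = n - Suc i \<and> set w \<subseteq> X}"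
      obtain v d where r': "r = (v, d)" "length v = Suc i" "set v \<subseteq> X" using r by auto
      obtain us m where v: "v = us @ [m]" using r' by (cases v rule: rev_cases) auto
      obtain m' vs where w': "w = m' # vs" using w i by (cases w) auto
      have "(us, m, d, m', vs) \<in> J" using r' v w w' i by (auto simp: J_def)
      then show "x ((\<lambda>(w, d) q. q (\<lambda>t. t (evs w), \<lambda>c. c d)) r, \<lambda>t. t (evs w)) = 0"
        using x(2) by (fastforce simp: r'(1) v w' e_def)
    qed (auto simp: B_def lfun_eval)
    have wordU: "word us c vs \<in> vcarrier U" if "length us = Suc i" "length vs = n - Suc i" "set us \<subseteq> vcarrier N"
      "set vs \<subseteq> vcarrier N" "c \<in> vcarrier Dc" for us c vs
      unfolding word_def U_def A_def B_def using that by (intro tens_in ltens_in) auto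
    have eword: "e (us, m, d, m', vs) (word xs c ys) = ltens N xs (evs (us @ [m])) * c d * ltens N ys (evs (m' # vs))"
      for us m d m' vs xs c ys
      by (simp add: e_def word_def tens_apply lfun_eval A_def B_def dual_coalgebra_simps[OF fd])
    \<comment> \<open>\<open>\<beta>\<close> and \<open>\<gamma>\<close> are the two sides of the
      cotensor condition at position \<open>i\<close>, on pure tensors.\<close>
    define \<beta> where "\<beta> xs = tlift N Dc (\<lambda>m c. word (take i xs @ [m]) c (drop (Suc i) xs)) (rcoact N (xs ! i))" for xs
    define \<gamma> where "\<gamma> xs = tlift Dc N (\<lambda>c m. word (take (Suc i) xs) c (m # drop (Suc (Suc i)) xs))
                      (lcoact N (xs ! Suc i))" for xs
    have \<beta>: "\<beta> xs \<in> vcarrier U"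
      "\<And>us m d m' vs. (us, m, d, m', vs) \<in> J \<Longrightarrow> e (us, m, d, m', vs) (\<beta> xs) = ltens N xs (evs (us @ R m d # m' # vs))"
      if xs: "length xs = n" "set xs \<subseteq> vcarrier N" for xs
    proof -
      define as a bs where "as = take i xs" "a = xs ! i" "bs = drop (Suc i) xs"
      have xs': "xs = as @ a # bs" "length as = i" "length bs = n - Suc i" "set as \<subseteq> vcarrier N" "a \<in> vcarrier N"
        "set bs \<subseteq> vcarrier N"
        using id_take_nth_drop[of i xs] xs i set_take_subset[of i xs] set_drop_subset[of "Suc i" xs]
        unfolding as_a_bs_def by auto
      have \<beta>': "\<beta> xs = tlift N Dc (\<lambda>m c. word (as @ [m]) c bs) (rcoact N a)"
        by (simp add: \<beta>_def as_a_bs_def)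
      define k where "k = (\<lambda>(us, m :: 'm, d :: 'd, m', vs). ltens N as (evs us) * ltens N bs (evs (m' # vs)))"
      define p where "p = (\<lambda>(us :: 'm list, m, d :: 'd, m' :: 'm, vs :: 'm list) (f :: 'm \<Rightarrow> 'k). f m)"
      define q where "q = (\<lambda>(us :: 'm list, m :: 'm, d, m' :: 'm, vs :: 'm list) (c :: 'd \<Rightarrow> 'k). c d)"
      have 1: "lfun N (p j)" "lfun Dc (q j)" for j
        by (simp_all add: p_def q_def case_prod_unfold lfun_evals del: N_simps)
      have 2: "word (as @ [m]) c bs \<in> vcarrier U" if "m \<in> vcarrier N" "c \<in> vcarrier Dc" for m c
        using that xs' by (intro wordU) auto
      have 3: "e j (word (as @ [m]) c bs) = k j * (p j m * q j c)" if "j \<in> J" for j m c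
        using that xs' by (auto simp: J_def eword k_def p_def q_def ltens_append ltens_Cons ltens_Nil lfun_eval
            map_append simp del: N_simps(1))
      note * = tlift_eval[where e = e and k = k and p = p and q = q and I = J, OF N_vspace Dc_vspace AB(3)
          rcoact(1)[OF xs'(5)] lin sep 2 1 3]
      show "\<beta> xs \<in> vcarrier U" unfolding \<beta>' by (rule *(1))
      have **: "\<And>j. j \<in> J \<Longrightarrow> e j (\<beta> xs) = k j * rcoact N a (p j, q j)" unfolding \<beta>' by (rule *(2))
      show "e (us, m, d, m', vs) (\<beta> xs) = ltens N xs (evs (us @ R m d # m' # vs))"
        if "(us, m, d, m', vs) \<in> J" for us m d m' vs
        using **[OF that] that xs'
        by (auto simp: k_def p_def q_def rcoact(2) J_def ltens_append ltens_Cons lfun_eval simp del: N_simps(1))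
    qed
    have \<gamma>: "\<gamma> xs \<in> vcarrier U"
      "\<And>us m d m' vs. (us, m, d, m', vs) \<in> J \<Longrightarrow> e (us, m, d, m', vs) (\<gamma> xs) = ltens N xs (evs (us @ m # L d m' # vs))"
      if xs: "length xs = n" "set xs \<subseteq> vcarrier N" for xs
    proof -
      define as a bs where "as = take (Suc i) xs" "a = xs ! Suc i" "bs = drop (Suc (Suc i)) xs"
      have xs': "xs = as @ a # bs" "length as = Suc i" "length bs = n - Suc (Suc i)" "set as \<subseteq> vcarrier N" "a \<in> vcarrier N"
        "set bs \<subseteq> vcarrier N"
        using id_take_nth_drop[of "Suc i" xs] xs i set_take_subset[of "Suc i" xs] set_drop_subset[of "Suc (Suc i)" xs]
        unfolding as_a_bs_def by auto
      have \<gamma>': "\<gamma> xs = tlift Dc N (\<lambda>c m. word as c (m # bs)) (lcoact N a)"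
        by (simp add: \<gamma>_def as_a_bs_def)
      define k where "k = (\<lambda>(us, m :: 'm, d :: 'd, m' :: 'm, vs). ltens N as (evs (us @ [m])) * ltens N bs (evs vs))"
      define q where "q = (\<lambda>(us :: 'm list, m :: 'm, d :: 'd, m' :: 'm, vs :: 'm list) (f :: 'm \<Rightarrow> 'k). f m')"
      define p where "p = (\<lambda>(us :: 'm list, m :: 'm, d, m' :: 'm, vs :: 'm list) (c :: 'd \<Rightarrow> 'k). c d)"
      have 1: "lfun Dc (p j)" "lfun N (q j)" for j
        by (simp_all add: p_def q_def case_prod_unfold lfun_evals del: N_simps)
      have 2: "word as c (m # bs) \<in> vcarrier U" if "c \<in> vcarrier Dc" "m \<in> vcarrier N" for m c
        using that xs' i by (intro wordU) auto
      have 3: "e j (word as c (m # bs)) = k j * (p j c * q j m)" if "j \<in> J" for j m c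
        using that xs' by (auto simp: J_def eword k_def p_def q_def ltens_Cons lfun_eval simp del: N_simps(1))
      note * = tlift_eval[where e = e and k = k and p = p and q = q and I = J, OF Dc_vspace N_vspace AB(3)
          lcoact(1)[OF xs'(5)] lin sep 2 1 3]
      show "\<gamma> xs \<in> vcarrier U" unfolding \<gamma>' by (rule *(1))
      have **: "\<And>j. j \<in> J \<Longrightarrow> e j (\<gamma> xs) = k j * lcoact N a (p j, q j)" unfolding \<gamma>' by (rule *(2))
      show "e (us, m, d, m', vs) (\<gamma> xs) = ltens N xs (evs (us @ m # L d m' # vs))"
        if "(us, m, d, m', vs) \<in> J" for us m d m' vs
      proof -
        have "ltens N xs (evs ((us @ [m]) @ L d m' # vs)) = ltens N as (evs (us @ [m])) * (a (L d m') * ltens N bs (evs vs))"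
          unfolding xs'(1) map_append list.map using that xs'(2)
          by (subst ltens_append) (auto simp: J_def ltens_Cons lfun_eval)
        then show ?thesis
          using **[OF that] that xs'(5)
          by (auto simp: k_def p_def q_def lcoact(2) J_def simp del: N_simps(1))
      qed
    qed
    define F where "F = (\<lambda>(us, m, d, m', vs). evs (us @ R m d # m' # vs))"
    define G where "G = (\<lambda>(us, m, d, m', vs). evs (us @ m # L d m' # vs))"
    have eF: "e j (\<beta> xs) = ltens N xs (F j)" "e j (\<gamma> xs) = ltens N xs (G j)"
      if "j \<in> J" "length xs = n" "set xs \<subseteq> vcarrier N" for j xs
      using that \<beta>(2)[OF that(2,3)] \<gamma>(2)[OF that(2,3)] by (cases j; auto simp: F_def G_def)+
    note lb' = llift_eval[where e = e and \<beta> = \<beta> and F = F and I = J, OF N_vspace AB(3) t n lin sep \<beta>(1) eF(1)]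
    note lc' = llift_eval[where e = e and \<beta> = \<gamma> and F = G and I = J, OF N_vspace AB(3) t n lin sep \<gamma>(1) eF(2)]
    have lb1: "llift N n \<beta> t \<in> vcarrier U" by (rule lb'(1))
    have lb2: "\<And>j. j \<in> J \<Longrightarrow> e j (llift N n \<beta> t) = t (F j)" by (rule lb'(2))
    have lc1: "llift N n \<gamma> t \<in> vcarrier U" by (rule lc'(1))
    have lc2: "\<And>j. j \<in> J \<Longrightarrow> e j (llift N n \<gamma> t) = t (G j)" by (rule lc'(2))
    have "llift N n \<beta> t = llift N n \<gamma> t \<longleftrightarrow> (\<forall>j\<in>J. t (F j) = t (G j))"
    proof
      assume "llift N n \<beta> t = llift N n \<gamma> t"
      then show "\<forall>j\<in>J. t (F j) = t (G j)" using lb2 lc2 by metis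
    next
      assume *: "\<forall>j\<in>J. t (F j) = t (G j)"
      have "llift N n \<beta> t - llift N n \<gamma> t = 0"
      proof (rule sep)
        show "llift N n \<beta> t - llift N n \<gamma> t \<in> vcarrier U" by (rule vs_diff[OF AB(3) lb1 lc1])
        fix j assume j: "j \<in> J"
        have "e j (llift N n \<beta> t - llift N n \<gamma> t) = e j (llift N n \<beta> t) - e j (llift N n \<gamma> t)"
          by (simp add: e_def case_prod_unfold)
        then show "e j (llift N n \<beta> t - llift N n \<gamma> t) = 0" using * lb2[OF j] lc2[OF j] j by simp
      qed
      then show "llift N n \<beta> t = llift N n \<gamma> t" by simp
    qed
    also have "\<dots> \<longleftrightarrow> P i"
      by (auto simp: P_def J_def F_def G_def)
    finally show ?thesis
      unfolding Let_def \<beta>_def[abs_def] \<gamma>_def[abs_def] word_def[abs_def] A_def B_def by simp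
  qed
  have "(\<forall>i. Suc i < n \<longrightarrow> P i) \<longleftrightarrow> balanced t n"
  proof
    assume *: "\<forall>i. Suc i < n \<longrightarrow> P i"
    show "balanced t n"
      unfolding balanced_def
    proof (intro allI impI)
      fix us m d m' vs
      assume a: "length us + length vs + 2 = n" "set us \<subseteq> X" "m \<in> X" "m' \<in> X" "set vs \<subseteq> X"
      then have "P (length us)" using * by simp
      then show "t (evs (us @ R m d # m' # vs)) = t (evs (us @ m # L d m' # vs))"
        unfolding P_def using a by blast
    qed
  qed (simp add: balanced_def P_def)
  then show ?thesis
    unfolding cotensor_power_def mem_Collect_eq using step by blast
qed


text \<open>
  An index is an element of \<open>D\<close> or a nonempty word in \<open>M\<close>, that is, a homogeneous pure element of
  the tensor algebra of \<open>M\<close> over \<open>D\<close>; \<open>ev\<close> evaluates elements of the cotensor coalgebra on it.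
\<close>

definition idx :: "('d + 'm list) set" where
  "idx = range Inl \<union> Inr ` {w. w \<noteq> [] \<and> set w \<subseteq> X}"

text \<open>The product of the tensor algebra on representatives: a scalar is absorbed by the
  adjacent letter. A pure element has many representing words, so associativity holds only after
  evaluation at balanced elements (\<open>ev_imul_assoc\<close>).\<close>

fun imul :: "'d + 'm list \<Rightarrow> 'd + 'm list \<Rightarrow> 'd + 'm list" where
  "imul (Inl d) (Inl e) = Inl (d * e)"
| "imul (Inl d) (Inr w) = Inr (L d (hd w) # tl w)"
| "imul (Inr w) (Inl d) = Inr (butlast w @ [R (last w) d])"
| "imul (Inr v) (Inr w) = Inr (v @ w)"

fun ev :: "'d + 'm list \<Rightarrow> ('k, 'd \<Rightarrow> 'k, 'm \<Rightarrow> 'k) cotensor \<Rightarrow> 'k" where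
  "ev (Inl d) z = fst z d"
| "ev (Inr w) z = snd z (length w) (evs w)"

fun deg :: "'d + 'm list \<Rightarrow> nat" where
  "deg (Inl d) = 0"
| "deg (Inr w) = length w"

lemma idx_simps [simp]: "Inl d \<in> idx" "Inr w \<in> idx \<longleftrightarrow> w \<noteq> [] \<and> set w \<subseteq> X"
  by (auto simp: idx_def)

lemma imul_idx:
  assumes "i \<in> idx" "j \<in> idx" shows "imul i j \<in> idx"
proof (cases i; cases j)
  fix d w assume *: "i = Inl d" "j = Inr w"
  then obtain m w' where "w = m # w'" using assms by (cases w) auto
  then show ?thesis using * assms LR_in by auto
next
  fix d w assume *: "i = Inr w" "j = Inl d"
  then obtain m w' where "w = w' @ [m]" using assms by (cases w rule: rev_cases) auto
  then show ?thesis using * assms LR_in by auto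
qed (use assms in auto)

lemma deg_imul: "i \<in> idx \<Longrightarrow> j \<in> idx \<Longrightarrow> deg (imul i j) = deg i + deg j"
  by (cases i; cases j) (auto simp: Suc_diff_1)

text \<open>The direct sum with full tensor powers in place of cotensor powers. The individual terms
  of the comultiplication are controlled only in the tensor square of this space. It has the same
  ambient type and scalars as \<open>T\<close>, so that \<open>tens T T\<close> and
  \<open>tens W W\<close> coincide.\<close>

definition W :: "('k, ('k, 'd \<Rightarrow> 'k, 'm \<Rightarrow> 'k) cotensor) vspace" where
  "W = \<lparr>vcarrier = {(c, t). c \<in> vcarrier Dc \<and> t 0 = 0 \<and> (\<forall>n\<ge>1. t n \<in> vcarrier (tensor_power N n)) \<and>
      finite {n. t n \<noteq> 0}}, vscale = vscale T\<rparr>"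

lemma W_scale [simp]: "vscale W = vscale T"
  by (simp add: W_def)

lemma W_iff: "z \<in> vcarrier W \<longleftrightarrow> fst z \<in> vcarrier Dc \<and> snd z 0 = 0 \<and>
    (\<forall>n\<ge>1. snd z n \<in> vcarrier (tensor_power N n)) \<and> finite {n. snd z n \<noteq> 0}"
  by (cases z) (simp add: W_def)

lemma T_scale: "vscale T a z = (fscale a (fst z), \<lambda>n. fscale a (snd z n))"
  by (simp add: cotensor_space_def dual_coalgebra_simps[OF fd] case_prod_unfold)

lemma T_vector_space: "vector_space (vscale T)"
  by unfold_locales (auto simp: T_scale fscale_def fun_eq_iff algebra_simps prod_eq_iff)

lemma E_simps [simp]: "vcarrier E = vcarrier T" "vscale E = vscale T"
  by (simp_all add: cotensor_coalgebra_def Let_def)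

lemma ev_lfun: "Vector_Spaces.linear (vscale T) (*) (ev i)"
  by (cases i)
    (simp_all add: Vector_Spaces.linear_iff T_vector_space vector_space_ground, simp_all add: T_scale fscale_def)

lemma W_vspace: "is_vspace W"
proof -
  interpret T: vector_space "vscale T" by (rule T_vector_space)
  have "T.subspace (vcarrier W)"
    unfolding T.subspace_def
  proof (intro conjI ballI allI)
    show "0 \<in> vcarrier W" by (simp add: W_iff vs_zero[OF Dc_vspace] vs_zero[OF is_vspace_tensor_power])
    fix x y assume x: "x \<in> vcarrier W" and y: "y \<in> vcarrier W"
    have "finite ({n. snd x n \<noteq> 0} \<union> {n. snd y n \<noteq> 0})" using x y by (auto simp: W_iff)
    then have "finite {n. snd x n + snd y n \<noteq> 0}" by (rule rev_finite_subset) auto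
    moreover have "fst x + fst y \<in> vcarrier Dc" using x y by (intro vs_add[OF Dc_vspace]) (auto simp only: W_iff)
    ultimately show "x + y \<in> vcarrier W" using x y
      by (auto simp: W_iff intro!: vs_add[OF is_vspace_tensor_power])
    fix a
    have "finite {n. fscale a (snd x n) \<noteq> 0}"
      by (rule finite_subset[of _ "{n. snd x n \<noteq> 0}"]) (use x in \<open>auto simp: W_iff fscale_def\<close>)
    moreover have "fscale a (fst x) \<in> vcarrier Dc"
      using vs_scale[OF Dc_vspace, of "fst x" a] x by (simp add: W_iff dual_coalgebra_simps[OF fd])
    moreover have "fscale a (snd x n) \<in> vcarrier (tensor_power N n)" if "n \<ge> 1" for n
      using vs_scale[OF is_vspace_tensor_power, of "snd x n" N n a] x that by (simp add: W_iff)
    ultimately show "vscale T a x \<in> vcarrier W" using x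
      by (auto simp: W_iff T_scale fscale_def zero_fun_def)
  qed
  then show ?thesis by (simp add: is_vspace_def T_vector_space)
qed

lemma W_ev_lfun: "lfun W (ev i)"
  using ev_lfun by simp

lemma ev_zero_component:
  assumes z: "z \<in> vcarrier W" and "\<And>i. i \<in> idx \<Longrightarrow> deg i = n \<Longrightarrow> ev i z = 0"
  shows "if n = 0 then fst z = 0 else snd z n = 0"
proof (cases "n = 0")
  case True
  then show ?thesis using assms(2)[of "Inl _"] by auto
next
  case False
  then have "snd z n \<in> vcarrier (tensor_power N n)" using z by (auto simp: W_iff)
  then have "snd z n = 0"
    by (rule power_separated) (use assms(2)[of "Inr _"] False in auto)
  then show ?thesis using False by simp
qed

lemma ev_separated:
  assumes z: "z \<in> vcarrier W" and "\<And>i. i \<in> idx \<Longrightarrow> ev i z = 0"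
  shows "z = 0"
proof -
  have "snd z n = 0" for n
    using ev_zero_component[OF z, of n] assms z by (cases "n = 0") (auto simp: W_iff)
  moreover have "fst z = 0" using ev_zero_component[OF z, of 0] assms by auto
  ultimately show ?thesis by (auto simp: prod_eq_iff)
qed

lemma T_iff: "z \<in> vcarrier T \<longleftrightarrow> z \<in> vcarrier W \<and> (\<forall>n>0. balanced (snd z n) n)"
proof -
  have "(\<forall>n\<ge>1. t n \<in> cotensor_power Dc N n) \<longleftrightarrow>
      (\<forall>n\<ge>1. t n \<in> vcarrier (tensor_power N n)) \<and> (\<forall>n>0. balanced (t n) n)" for t
    using cotensor_power_iff by (metis Suc_leI One_nat_def less_eq_Suc_le)
  then show ?thesis by (cases z) (auto simp: cotensor_space_def W_iff)
qed

lemma T_balanced: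
  "z \<in> vcarrier T \<longleftrightarrow> z \<in> vcarrier W \<and> (\<forall>us m d m' vs. set us \<subseteq> X \<longrightarrow> m \<in> X \<longrightarrow> m' \<in> X \<longrightarrow> set vs \<subseteq> X \<longrightarrow>
     ev (Inr (us @ R m d # m' # vs)) z = ev (Inr (us @ m # L d m' # vs)) z)"
  unfolding T_iff balanced_def by auto

lemma T_W: "z \<in> vcarrier T \<Longrightarrow> z \<in> vcarrier W"
  by (simp add: T_balanced)

lemma T_subspace: "module.subspace (vscale W) (vcarrier T)"
proof -
  interpret T: vector_space "vscale T" by (rule T_vector_space)
  interpret e: Vector_Spaces.linear "vscale T" "(*)" "ev i" for i by (rule ev_lfun)
  show ?thesis
    unfolding W_scale T.subspace_def
  proof (intro conjI ballI allI)
    show "0 \<in> vcarrier T" by (simp add: T_balanced vs_zero[OF W_vspace] e.zero del: ev.simps)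
    fix x y a assume x: "x \<in> vcarrier T" and y: "y \<in> vcarrier T"
    show "x + y \<in> vcarrier T"
      using x y vs_add[OF W_vspace, of x y] by (simp add: T_balanced e.add del: ev.simps)
    show "vscale T a x \<in> vcarrier T"
      using x vs_scale[OF W_vspace, of x a] by (simp add: T_balanced e.scale del: ev.simps)
  qed
qed

lemma T_vspace: "is_vspace T"
  using T_subspace T_vector_space by (simp add: is_vspace_def)

lemma W_restrict: "W\<lparr>vcarrier := vcarrier T\<rparr> = T"
  by (simp add: W_def)

lemma inj_base_W: "c \<in> vcarrier Dc \<Longrightarrow> inj_base c \<in> vcarrier W"
  by (simp add: inj_base_def W_iff vs_zero[OF is_vspace_tensor_power])

lemma inj_power_W: "t \<in> vcarrier (tensor_power N n) \<Longrightarrow> n > 0 \<Longrightarrow> inj_power n t \<in> vcarrier W"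
  by (auto simp: inj_power_def W_iff vs_zero[OF is_vspace_tensor_power] vs_zero[OF Dc_vspace]
      intro: finite_subset[of _ "{n}"])

lemma ev_inj_base: "ev (Inl d) (inj_base c) = c d" "ev (Inr w) (inj_base c) = 0"
  by (simp_all add: inj_base_def)

lemma ev_inj_word: "ev (Inl d) (inj_power n t) = 0"
  "length ys = n \<Longrightarrow> ev (Inr w) (inj_power n (ltens N ys)) = ltens N ys (evs w)"
  by (auto simp: inj_power_def ltens_length)

lemma tens_T: "tens T T = tens W W"
  by (intro ext) (simp add: tens_def)

lemma tens_W_ev: "tens W W x y (ev i, ev j) = ev i x * ev j y"
  by (rule tens_apply[OF W_ev_lfun W_ev_lfun])

lemma WW_separated:
  assumes "t \<in> vcarrier (tensor_space W W)" "\<And>r. r \<in> idx \<times> idx \<Longrightarrow> t (ev (fst r), ev (snd r)) = 0"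
  shows "t = 0"
  by (rule tensor_separated[OF W_vspace W_vspace assms(1), where e = ev and f = ev and I = idx and J = idx])
    (use assms(2) ev_separated W_ev_lfun in auto)

lemma WW_lin: "linear_map (tensor_space W W) ground (\<lambda>t. t x)"
  by (rule lfun_linear_map[OF is_vspace_tensor lfun_tensor_eval])

section \<open>The comultiplication as the dual of the multiplication of words\<close>

definition iword :: "'d + 'm list \<Rightarrow> (('m \<Rightarrow> 'k) \<Rightarrow> 'k) list" where
  "iword i = (case i of Inl d \<Rightarrow> [] | Inr w \<Rightarrow> evs w)"

lemma word_comul_first:
  assumes "length xs > 0" "set xs \<subseteq> vcarrier N"
  shows "tlift Dc N (\<lambda>c m. tens T T (inj_base c) (inj_power (length (m # tl xs)) (ltens N (m # tl xs)))) (lcoact N (hd xs))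
      \<in> vcarrier (tensor_space W W)" (is "?t \<in> _")
    "\<And>i j. i \<in> idx \<Longrightarrow> j \<in> idx \<Longrightarrow> tlift Dc N (\<lambda>c m. tens T T (inj_base c) (inj_power (length (m # tl xs)) (ltens N (m # tl xs))))
        (lcoact N (hd xs)) (ev i, ev j) =
      (case (i, j) of (Inl d, Inr w) \<Rightarrow> ltens N xs (iword (imul i j)) | _ \<Rightarrow> 0)"
proof -
  obtain x xs' where xs: "xs = x # xs'" "x \<in> vcarrier N" "set xs' \<subseteq> vcarrier N" using assms by (cases xs) auto
  define e where "e r t = t (ev (fst r), ev (snd r))" for r and t :: "('k, ('k, 'd \<Rightarrow> 'k, 'm \<Rightarrow> 'k) cotensor, _) tensor"
  define \<beta> where "\<beta> c m = tens W W (inj_base c) (inj_power (length (m # xs')) (ltens N (m # xs')))" for c m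
  define k where "k = (\<lambda>r :: ('d + 'm list) \<times> ('d + 'm list).
    case r of (Inl d, Inr w) \<Rightarrow> ltens N xs' (evs (tl w)) | _ \<Rightarrow> 0)"
  \<comment> \<open>For the other kinds of index pairs the factor \<open>k\<close> is 0; evaluation
    at 0 is then merely some linear functional.\<close>
  define p where "p = (\<lambda>(r :: ('d + 'm list) \<times> ('d + 'm list)) (c :: 'd \<Rightarrow> 'k). case r of (Inl d, Inr w) \<Rightarrow> c d | _ \<Rightarrow> c 0)"
  define q where "q = (\<lambda>(r :: ('d + 'm list) \<times> ('d + 'm list)) (f :: 'm \<Rightarrow> 'k). case r of (Inl d, Inr w) \<Rightarrow> f (hd w) | _ \<Rightarrow> f 0)"
  have lin: "linear_map (tensor_space W W) ground (e r)" for r unfolding e_def by (rule WW_lin)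
  have sep: "t = 0" if "t \<in> vcarrier (tensor_space W W)" "\<And>r. r \<in> idx \<times> idx \<Longrightarrow> e r t = 0" for t
    using that unfolding e_def by (intro WW_separated)
  have mem: "\<beta> c m \<in> vcarrier (tensor_space W W)" if "c \<in> vcarrier Dc" "m \<in> vcarrier N" for c m
    unfolding \<beta>_def using that xs by (intro tens_in inj_base_W inj_power_W ltens_in) auto
  have p: "lfun Dc (p r)" for r
    unfolding p_def by (cases r rule: prod.exhaust; cases "fst r"; cases "snd r") (simp_all add: lfun_evals)
  have q: "lfun N (q r)" for r
    unfolding q_def by (cases r rule: prod.exhaust; cases "fst r"; cases "snd r") (simp_all add: lfun_eval)
  have ke: "e r (\<beta> c m) = k r * (p r c * q r m)" if "r \<in> idx \<times> idx" for r c m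
  proof -
    obtain i j where r: "r = (i, j)" "i \<in> idx" "j \<in> idx" using \<open>r \<in> _\<close> by auto
    show ?thesis
    proof (cases i; cases j)
      fix d w assume ij: "i = Inl d" "j = Inr w"
      then obtain m' w' where "w = m' # w'" using r by (cases w) auto
      then show ?thesis using r ij
        by (simp add: e_def \<beta>_def tens_W_ev ev_inj_base ev_inj_word k_def p_def q_def ltens_Cons lfun_eval del: ev.simps)
    qed (use r in \<open>simp_all add: e_def \<beta>_def tens_W_ev ev_inj_base ev_inj_word k_def del: ev.simps\<close>)
  qed
  note * = tlift_eval[where e = e and k = k and p = p and q = q and I = "idx \<times> idx" and \<beta> = \<beta>,
      OF Dc_vspace N_vspace is_vspace_tensor lcoact(1)[OF xs(2)] lin sep mem p q ke]
  have eq: "?t = tlift Dc N \<beta> (lcoact N x)"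
    by (simp add: tens_T xs(1) \<beta>_def[abs_def])
  show "?t \<in> vcarrier (tensor_space W W)" unfolding eq by (rule *(1))
  have **: "\<And>r. r \<in> idx \<times> idx \<Longrightarrow> e r ?t = k r * lcoact N x (p r, q r)" unfolding eq by (rule *(2))
  fix i j assume ij: "i \<in> idx" "j \<in> idx"
  show "?t (ev i, ev j) = (case (i, j) of (Inl d, Inr w) \<Rightarrow> ltens N xs (iword (imul i j)) | _ \<Rightarrow> 0)"
  proof (cases i; cases j)
    fix d w assume ij': "i = Inl d" "j = Inr w"
    then obtain m' w' where "w = m' # w'" "m' \<in> X" using ij by (cases w) auto
    then show ?thesis using ij' ij **[of "(i, j)"] lcoact(2)[OF xs(2)]
      by (simp add: e_def k_def p_def q_def iword_def xs(1) ltens_Cons lfun_eval mult.commute)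
  qed (use ij **[of "(i, j)"] in \<open>simp_all add: e_def k_def\<close>)
qed

lemma word_comul_last:
  assumes "length xs > 0" "set xs \<subseteq> vcarrier N"
  shows "tlift N Dc (\<lambda>m c. tens T T (inj_power (length (butlast xs @ [m])) (ltens N (butlast xs @ [m]))) (inj_base c))
      (rcoact N (last xs)) \<in> vcarrier (tensor_space W W)" (is "?t \<in> _")
    "\<And>i j. i \<in> idx \<Longrightarrow> j \<in> idx \<Longrightarrow> tlift N Dc (\<lambda>m c. tens T T (inj_power (length (butlast xs @ [m])) (ltens N (butlast xs @ [m]))) (inj_base c))
      (rcoact N (last xs)) (ev i, ev j) =
      (case (i, j) of (Inr w, Inl d) \<Rightarrow> ltens N xs (iword (imul i j)) | _ \<Rightarrow> 0)"
proof -
  obtain x xs' where xs: "xs = xs' @ [x]" "x \<in> vcarrier N" "set xs' \<subseteq> vcarrier N"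
    using assms by (cases xs rule: rev_cases) auto
  define e where "e r t = t (ev (fst r), ev (snd r))" for r and t :: "('k, ('k, 'd \<Rightarrow> 'k, 'm \<Rightarrow> 'k) cotensor, _) tensor"
  define \<beta> where "\<beta> m c = tens W W (inj_power (length (xs' @ [m])) (ltens N (xs' @ [m]))) (inj_base c)" for c m
  define k where "k = (\<lambda>r :: ('d + 'm list) \<times> ('d + 'm list).
    case r of (Inr w, Inl d) \<Rightarrow> ltens N xs' (evs (butlast w)) | _ \<Rightarrow> 0)"
  define q where "q = (\<lambda>(r :: ('d + 'm list) \<times> ('d + 'm list)) (c :: 'd \<Rightarrow> 'k). case r of (Inr w, Inl d) \<Rightarrow> c d | _ \<Rightarrow> c 0)"
  define p where "p = (\<lambda>(r :: ('d + 'm list) \<times> ('d + 'm list)) (f :: 'm \<Rightarrow> 'k). case r of (Inr w, Inl d) \<Rightarrow> f (last w) | _ \<Rightarrow> f 0)"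
  have lin: "linear_map (tensor_space W W) ground (e r)" for r unfolding e_def by (rule WW_lin)
  have sep: "t = 0" if "t \<in> vcarrier (tensor_space W W)" "\<And>r. r \<in> idx \<times> idx \<Longrightarrow> e r t = 0" for t
    using that unfolding e_def by (intro WW_separated)
  have mem: "\<beta> m c \<in> vcarrier (tensor_space W W)" if "m \<in> vcarrier N" "c \<in> vcarrier Dc" for c m
    unfolding \<beta>_def using that xs by (intro tens_in inj_base_W inj_power_W ltens_in) auto
  have p: "lfun N (p r)" for r
    unfolding p_def by (cases r rule: prod.exhaust; cases "fst r"; cases "snd r") (simp_all add: lfun_eval)
  have q: "lfun Dc (q r)" for r
    unfolding q_def by (cases r rule: prod.exhaust; cases "fst r"; cases "snd r") (simp_all add: lfun_evals)
  have snocl: "ltens N (xs' @ [m]) (evs (w' @ [m'])) = ltens N xs' (evs w') * m m'" for m w' m'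
  proof (cases "length xs' = length w'")
    case True
    then show ?thesis by (simp add: ltens_append ltens_Cons ltens_Nil lfun_eval)
  qed (simp add: ltens_length)
  have ke: "e r (\<beta> m c) = k r * (p r m * q r c)" if "r \<in> idx \<times> idx" for r c m
  proof -
    obtain i j where r: "r = (i, j)" "i \<in> idx" "j \<in> idx" using \<open>r \<in> _\<close> by auto
    show ?thesis
    proof (cases i; cases j)
      fix d w assume ij: "i = Inr w" "j = Inl d"
      then obtain m' w' where "w = w' @ [m']" using r by (cases w rule: rev_cases) auto
      then show ?thesis using r ij
        by (simp add: e_def \<beta>_def tens_W_ev ev_inj_base ev_inj_word k_def p_def q_def snocl[simplified] del: ev.simps)
    qed (use r in \<open>simp_all add: e_def \<beta>_def tens_W_ev ev_inj_base ev_inj_word k_def del: ev.simps\<close>)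
  qed
  note * = tlift_eval[where e = e and k = k and p = p and q = q and I = "idx \<times> idx" and \<beta> = \<beta>,
      OF N_vspace Dc_vspace is_vspace_tensor rcoact(1)[OF xs(2)] lin sep mem p q ke]
  have eq: "?t = tlift N Dc \<beta> (rcoact N x)"
    by (simp add: tens_T xs(1) \<beta>_def[abs_def])
  show "?t \<in> vcarrier (tensor_space W W)" unfolding eq by (rule *(1))
  have **: "\<And>r. r \<in> idx \<times> idx \<Longrightarrow> e r ?t = k r * rcoact N x (p r, q r)" unfolding eq by (rule *(2))
  fix i j assume ij: "i \<in> idx" "j \<in> idx"
  show "?t (ev i, ev j) = (case (i, j) of (Inr w, Inl d) \<Rightarrow> ltens N xs (iword (imul i j)) | _ \<Rightarrow> 0)"
  proof (cases i; cases j)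
    fix d w assume ij': "i = Inr w" "j = Inl d"
    then obtain m' w' where "w = w' @ [m']" "m' \<in> X" using ij by (cases w rule: rev_cases) auto
    then show ?thesis using ij' ij **[of "(i, j)"] rcoact(2)[OF xs(2)]
      by (simp add: e_def k_def p_def q_def iword_def xs(1) snocl[simplified])
  qed (use ij **[of "(i, j)"] in \<open>simp_all add: e_def k_def\<close>)
qed

text \<open>The three parts of the formula are seen by different kinds of index pairs: the left
  coaction by an element of \<open>D\<close> and a word, the middle sum by two words, the right
  coaction by a word and an element of \<open>D\<close>. Two elements of \<open>D\<close> see
  nothing, which agrees with \<open>iword\<close> being empty there.\<close>

lemma word_comul_ev:
  assumes xs: "length xs > 0" "set xs \<subseteq> vcarrier N"
  shows "word_comul Dc N xs \<in> vcarrier (tensor_space W W)"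
    "\<And>i j. i \<in> idx \<Longrightarrow> j \<in> idx \<Longrightarrow> word_comul Dc N xs (ev i, ev j) = ltens N xs (iword (imul i j))"
proof -
  let ?mid = "\<Sum>i = 1..<length xs. tens T T (inj_power (length (take i xs)) (ltens N (take i xs)))
    (inj_power (length (drop i xs)) (ltens N (drop i xs)))"
  have wc: "word_comul Dc N xs = tlift Dc N (\<lambda>c m. tens T T (inj_base c) (inj_power (length (m # tl xs)) (ltens N (m # tl xs)))) (lcoact N (hd xs))
      + ?mid + tlift N Dc (\<lambda>m c. tens T T (inj_power (length (butlast xs @ [m])) (ltens N (butlast xs @ [m]))) (inj_base c))
      (rcoact N (last xs))"
    by (simp only: word_comul_def Let_def)
  have mid: "?mid \<in> vcarrier (tensor_space W W)"
    unfolding tens_T using xs 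
    by (intro vs_sum[OF is_vspace_tensor] tens_in inj_power_W ltens_in) (auto dest: in_set_takeD in_set_dropD)
  show "word_comul Dc N xs \<in> vcarrier (tensor_space W W)"
    unfolding wc by (intro vs_add[OF is_vspace_tensor] word_comul_first word_comul_last mid xs)
  fix i j assume ij: "i \<in> idx" "j \<in> idx"
  have mid_ev: "?mid (ev i, ev j) = (case (i, j) of (Inr v, Inr w) \<Rightarrow> ltens N xs (iword (imul i j)) | _ \<Rightarrow> 0)"
  proof (cases i; cases j)
    fix v w assume ij': "i = Inr v" "j = Inr w"
    have "?mid (ev i, ev j) = (\<Sum>l = 1..<length xs. ltens N (take l xs) (evs v) * ltens N (drop l xs) (evs w))"
      unfolding tens_T fun_sum_apply tens_W_ev ij' ev_inj_word(2)[OF refl] ..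
    \<comment> \<open>A pure tensor vanishes on a list of the wrong length, so only the cut after
      \<open>length v\<close> letters contributes.\<close>
    also have "\<dots> = (\<Sum>l = 1..<length xs. if l = length v then ltens N xs (evs v @ evs w) else 0)"
    proof (rule sum.cong[OF refl])
      fix l assume l: "l \<in> {1..<length xs}"
      show "ltens N (take l xs) (evs v) * ltens N (drop l xs) (evs w) = (if l = length v then ltens N xs (evs v @ evs w) else 0)"
      proof (cases "l = length v")
        case True
        then have "ltens N (take l xs @ drop l xs) (evs v @ evs w) = ltens N (take l xs) (evs v) * ltens N (drop l xs) (evs w)"
          using l by (intro ltens_append) simp
        then show ?thesis using True by simp
      qed (use l in \<open>simp add: ltens_length\<close>)
    qed
    also have "\<dots> = ltens N xs (evs v @ evs w)"
    proof (cases "length v \<in> {1..<length xs}")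
      case False
      \<comment> \<open>\<open>v\<close> and \<open>w\<close> are nonempty, so
        \<open>length v\<close> fails to be an inner cut of \<open>xs\<close> only if the lengths do
        not add up.\<close>
      then have "length xs \<noteq> length (evs v @ evs w)" using ij ij' by (auto simp: Suc_le_eq)
      then have "ltens N xs (evs v @ evs w) = 0" by (rule ltens_length)
      then show ?thesis using False by (simp only: sum.delta finite_atLeastLessThan if_False)
    qed (simp only: sum.delta finite_atLeastLessThan if_True)
    finally show ?thesis using ij' by (simp add: iword_def)
  qed (simp_all add: tens_T fun_sum_apply tens_W_ev ev_inj_word del: ev.simps)
  show "word_comul Dc N xs (ev i, ev j) = ltens N xs (iword (imul i j))"
    unfolding wc plus_fun_apply mid_ev word_comul_first(2)[OF xs ij] word_comul_last(2)[OF xs ij]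
    using xs by (cases i; cases j) (auto simp: iword_def ltens_length)
qed

text \<open>The coalgebra part accounts for two elements of \<open>D\<close>, by duality with their
  product; the homogeneous components account for the remaining pairs, by
  \<open>word_comul_ev\<close>. A component vanishes on lists of another length, so in the sum over
  degrees only the degree of \<open>imul i j\<close> is left.\<close>

lemma comul_ev:
  assumes z: "z \<in> vcarrier W"
  shows "comul E z \<in> vcarrier (tensor_space W W)"
    "\<And>i j. i \<in> idx \<Longrightarrow> j \<in> idx \<Longrightarrow> comul E z (ev i, ev j) = ev (imul i j) z"
proof -
  define c t where "c = fst z" "t = snd z"
  have c: "c \<in> vcarrier Dc" and t: "t 0 = 0" "\<And>n. n \<ge> 1 \<Longrightarrow> t n \<in> vcarrier (tensor_power N n)" "finite {n. t n \<noteq> 0}"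
    using z by (auto simp: W_iff c_t_def)
  have E: "comul E z = tlift Dc Dc (\<lambda>x y. tens T T (inj_base x) (inj_base y)) (comul Dc c) +
      (\<Sum>n | t n \<noteq> 0. llift N n (word_comul Dc N) (t n))"
    by (simp add: cotensor_coalgebra_def Let_def case_prod_unfold c_t_def)
  define e where "e r t = t (ev (fst r), ev (snd r))" for r and t :: "('k, ('k, 'd \<Rightarrow> 'k, 'm \<Rightarrow> 'k) cotensor, _) tensor"
  have lin: "linear_map (tensor_space W W) ground (e r)" for r unfolding e_def by (rule WW_lin)
  have sep: "t = 0" if "t \<in> vcarrier (tensor_space W W)" "\<And>r. r \<in> idx \<times> idx \<Longrightarrow> e r t = 0" for t
    using that unfolding e_def by (intro WW_separated)
  define k where "k = (\<lambda>r :: ('d + 'm list) \<times> ('d + 'm list). case r of (Inl d, Inl d') \<Rightarrow> 1 :: 'k | _ \<Rightarrow> 0)"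
  define p where "p = (\<lambda>(r :: ('d + 'm list) \<times> ('d + 'm list)) (c :: 'd \<Rightarrow> 'k). case fst r of Inl d \<Rightarrow> c d | _ \<Rightarrow> c 0)"
  define q where "q = (\<lambda>(r :: ('d + 'm list) \<times> ('d + 'm list)) (c :: 'd \<Rightarrow> 'k). case snd r of Inl d \<Rightarrow> c d | _ \<Rightarrow> c 0)"
  define \<beta> where "\<beta> x y = tens W W (inj_base x) (inj_base y)" for x y :: "'d \<Rightarrow> 'k"
  have mem: "\<beta> x y \<in> vcarrier (tensor_space W W)" if "x \<in> vcarrier Dc" "y \<in> vcarrier Dc" for x y
    unfolding \<beta>_def using that by (intro tens_in inj_base_W)
  have pq: "lfun Dc (p r) \<and> lfun Dc (q r)" for r
    unfolding p_def q_def by (cases "fst r"; cases "snd r") (simp_all add: lfun_evals)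
  have ke: "e r (\<beta> x y) = k r * (p r x * q r y)" for r x y
    by (cases "fst r"; cases "snd r")
      (simp_all add: e_def \<beta>_def tens_W_ev ev_inj_base k_def p_def q_def case_prod_unfold del: ev.simps)
  note tl0 = tlift_eval[where e = e and k = k and p = p and q = q and I = "idx \<times> idx" and \<beta> = \<beta>,
      OF Dc_vspace Dc_vspace is_vspace_tensor dual_comul(1)[OF fd c] lin sep mem pq[THEN conjunct1] pq[THEN conjunct2] ke]
  have *: "tlift Dc Dc \<beta> (comul Dc c) \<in> vcarrier (tensor_space W W)" by (rule tl0(1))
  have **: "\<And>r. r \<in> idx \<times> idx \<Longrightarrow> e r (tlift Dc Dc \<beta> (comul Dc c)) = k r * comul Dc c (p r, q r)" by (rule tl0(2))
  have l1: "llift N n (word_comul Dc N) (t n) \<in> vcarrier (tensor_space W W)"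
    and l2: "\<And>r. r \<in> idx \<times> idx \<Longrightarrow> e r (llift N n (word_comul Dc N) (t n)) = t n (iword (imul (fst r) (snd r)))"
    if n: "n > 0" for n
  proof -
    have m: "word_comul Dc N xs \<in> vcarrier (tensor_space W W)" if "length xs = n" "set xs \<subseteq> vcarrier N" for xs
      using that n by (intro word_comul_ev) auto
    have ew: "e r (word_comul Dc N xs) = ltens N xs (iword (imul (fst r) (snd r)))"
      if "r \<in> idx \<times> idx" "length xs = n" "set xs \<subseteq> vcarrier N" for r xs
      unfolding e_def using that n by (intro word_comul_ev) auto
    have tn: "t n \<in> vcarrier (tensor_power N n)" using t(2) n by simp
    note l = llift_eval[where e = e and I = "idx \<times> idx" and \<beta> = "word_comul Dc N"
        and F = "\<lambda>r. iword (imul (fst r) (snd r))", OF N_vspace is_vspace_tensor tn n lin sep m ew]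
    show "llift N n (word_comul Dc N) (t n) \<in> vcarrier (tensor_space W W)" by (rule l(1))
    show "\<And>r. r \<in> idx \<times> idx \<Longrightarrow> e r (llift N n (word_comul Dc N) (t n)) = t n (iword (imul (fst r) (snd r)))"
      by (rule l(2))
  qed
  have pos: "n > 0" if "t n \<noteq> 0" for n using that t(1) by (cases n) auto
  show "comul E z \<in> vcarrier (tensor_space W W)"
    unfolding E tens_T using * l1 pos unfolding \<beta>_def[abs_def]
    by (intro vs_add[OF is_vspace_tensor] vs_sum[OF is_vspace_tensor]) auto
  fix i j assume ij: "i \<in> idx" "j \<in> idx"
  have "comul E z (ev i, ev j) = k (i, j) * comul Dc c (p (i, j), q (i, j)) + (\<Sum>n | t n \<noteq> 0. t n (iword (imul i j)))"
  proof -
    have "(\<Sum>n | t n \<noteq> 0. llift N n (word_comul Dc N) (t n) (ev i, ev j)) = (\<Sum>n | t n \<noteq> 0. t n (iword (imul i j)))"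
      using l2[OF pos, of _ "(i, j)"] ij by (intro sum.cong refl) (auto simp: e_def)
    moreover have "tlift Dc Dc \<beta> (comul Dc c) (ev i, ev j) = k (i, j) * comul Dc c (p (i, j), q (i, j))"
      using **[of "(i, j)"] ij by (simp add: e_def)
    ultimately show ?thesis
      unfolding E tens_T plus_fun_apply fun_sum_apply \<beta>_def[abs_def] by simp
  qed
  moreover have "(\<Sum>n | t n \<noteq> 0. t n (iword (imul i j))) = t (length (iword (imul i j))) (iword (imul i j))"
  proof -
    have "t n fs = 0" if "n \<noteq> length fs" for n fs
    proof (cases "n = 0")
      case False
      then show ?thesis using tensor_power_length[OF N_vspace t(2)] that by auto
    qed (simp add: t(1))
    then have "(\<Sum>n | t n \<noteq> 0. t n fs) = (\<Sum>n | t n \<noteq> 0. if n = length fs then t n fs else 0)" for fs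
      by (intro sum.cong refl) auto
    then show ?thesis using t(3) by (simp add: sum.delta')
  qed
  ultimately show "comul E z (ev i, ev j) = ev (imul i j) z"
    using dual_comul(2)[OF fd c] t(1)
    by (cases i; cases j) (auto simp: k_def p_def q_def iword_def c_t_def)
qed


section \<open>From full tensor powers to cotensor powers\<close>

lemma ev_imul_balanced:
  assumes z: "z \<in> vcarrier T" and "set us \<subseteq> X" "m \<in> X" "m' \<in> X" "set vs \<subseteq> X" and j: "j \<in> idx"
  shows "ev (imul (Inr (us @ R m d # m' # vs)) j) z = ev (imul (Inr (us @ m # L d m' # vs)) j) z"
    "ev (imul j (Inr (us @ R m d # m' # vs))) z = ev (imul j (Inr (us @ m # L d m' # vs))) z"
proof -
  have bal: "ev (Inr (us @ R m d # m' # vs)) z = ev (Inr (us @ m # L d m' # vs)) z"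
    if "set us \<subseteq> X" "m \<in> X" "m' \<in> X" "set vs \<subseteq> X" for us m m' vs d
    using z that unfolding T_balanced by blast
  show "ev (imul (Inr (us @ R m d # m' # vs)) j) z = ev (imul (Inr (us @ m # L d m' # vs)) j) z"
  proof (cases j)
    case (Inl e)
    \<comment> \<open>The scalar \<open>e\<close> acts on the last letter. If that is
      \<open>m'\<close>, on which \<open>d\<close> acts as well, the relation survives because the
      left and right actions on \<open>M\<close> commute.\<close>
    show ?thesis
    proof (cases vs rule: rev_cases)
      case Nil
      then show ?thesis
        using Inl bal[of us m "R m' e" "[]" d] assms LR_in by (simp add: LR_mult(3) butlast_append del: ev.simps)
    next
      case (snoc vs' m'')
      then show ?thesis
        using Inl bal[of us m m' "vs' @ [R m'' e]" d] assms LR_in by (simp add: butlast_append del: ev.simps)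
    qed
  next
    case (Inr w)
    then show ?thesis using bal[of us m m' "vs @ w" d] assms by (simp del: ev.simps)
  qed
  show "ev (imul j (Inr (us @ R m d # m' # vs))) z = ev (imul j (Inr (us @ m # L d m' # vs))) z"
  proof (cases j)
    case (Inl e)
    show ?thesis
    proof (cases us)
      case Nil
      then show ?thesis
        using Inl bal[of "[]" "L e m" m' vs d] assms LR_in by (simp add: LR_mult(3) del: ev.simps)
    next
      case (Cons u us')
      then show ?thesis
        using Inl bal[of "L e u # us'" m m' vs d] assms LR_in by (simp del: ev.simps)
    qed
  next
    case (Inr w)
    then show ?thesis using bal[of "w @ us" m m' vs d] assms by (simp del: ev.simps)
  qed
qed

text \<open>Balancedness of \<open>z\<close> is needed only for a scalar between two words, where
  the two bracketings attach it to different letters. A single letter between two scalars needs the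
  commuting actions, and the other cases are identities of indices.\<close>

lemma ev_imul_assoc:
  assumes z: "z \<in> vcarrier T" and ijk: "i \<in> idx" "j \<in> idx" "k \<in> idx"
  shows "ev (imul (imul i j) k) z = ev (imul i (imul j k)) z"
proof (cases j)
  case (Inl d)
  then show ?thesis
  proof (cases i; cases k)
    fix v w assume ik: "i = Inr v" "k = Inr w"
    obtain v' m where v: "v = v' @ [m]" using ik ijk by (cases v rule: rev_cases) auto
    obtain m' w' where w: "w = m' # w'" using ik ijk by (cases w) auto
    show ?thesis
      using z[unfolded T_balanced] ijk Inl by (simp add: ik v w del: ev.simps)
  next
    fix e w assume ik: "i = Inl e" "k = Inr w"
    obtain m' w' where w: "w = m' # w'" using ik ijk by (cases w) auto
    show ?thesis using ijk Inl ik w by (simp add: LR_mult del: ev.simps)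
  next
    fix e v assume ik: "i = Inr v" "k = Inl e"
    obtain v' m where v: "v = v' @ [m]" using ik ijk by (cases v rule: rev_cases) auto
    show ?thesis using ijk Inl ik v by (simp add: LR_mult del: ev.simps)
  qed (use Inl in \<open>simp add: mult.assoc\<close>)
next
  case (Inr u)
  show ?thesis
  proof (cases i; cases k)
    fix d e assume ik: "i = Inl d" "k = Inl e"
    show ?thesis
    proof (cases "tl u")
      case Nil
      then obtain m where "u = [m]" "m \<in> X" using Inr ijk by (cases u) auto
      then show ?thesis using Inr ik by (simp add: LR_mult del: ev.simps)
    next
      case (Cons m w)
      then obtain m' where u: "u = m' # m # w" by (cases u) auto
      show ?thesis using Inr ik unfolding u by (simp del: ev.simps)
    qed
  qed (use Inr ijk in \<open>auto simp: butlast_append hd_append simp del: ev.simps\<close>)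
qed

lemma imul_one:
  assumes i: "i \<in> idx" shows "imul i (Inl 1) = i" "imul (Inl 1) i = i"
proof -
  show "imul i (Inl 1) = i"
  proof (cases i)
    case (Inr w)
    then obtain v m where "w = v @ [m]" using i by (cases w rule: rev_cases) auto
    then show ?thesis using i Inr by (simp add: LR_one)
  qed auto
  show "imul (Inl 1) i = i"
  proof (cases i)
    case (Inr w)
    then obtain v m where "w = m # v" using i by (cases w) auto
    then show ?thesis using i Inr by (simp add: LR_one)
  qed auto
qed

lemma tensor_E: "tensor_space E E = tensor_space T T" "tens E E = tens T T"
  by (simp_all add: tensor_space_def tens_def fun_eq_iff)

lemma T_separated: "z \<in> vcarrier T \<Longrightarrow> (\<And>i. i \<in> idx \<Longrightarrow> ev i z = 0) \<Longrightarrow> z = 0"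
  by (rule ev_separated[OF T_W])

lemma T_eqI: "z \<in> vcarrier T \<Longrightarrow> z' \<in> vcarrier T \<Longrightarrow> (\<And>i. i \<in> idx \<Longrightarrow> ev i z = ev i z') \<Longrightarrow> z = z'"
  using T_separated[of "z - z'"] vs_diff[OF T_vspace, of z z'] lfun_simps(3)[OF W_vspace W_ev_lfun]
  by (simp del: ev.simps)

text \<open>The slice by \<open>ev j\<close> takes the value \<open>ev (imul i j) z\<close> at
  \<open>ev i\<close>, and balance relations survive multiplication by \<open>j\<close>, so the
  slice is balanced. Membership of all slices puts the tensor into the smaller space, first in the
  left and then in the right factor.\<close>

lemma comul_T:
  assumes z: "z \<in> vcarrier T"
  shows "comul E z \<in> vcarrier (tensor_space T T)"
proof -
  note c = comul_ev[OF T_W[OF z]]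
  have 1: "comul E z \<in> vcarrier (tensor_space (W\<lparr>vcarrier := vcarrier T\<rparr>) W)"
  proof (rule tensor_in_left[OF W_vspace W_vspace c(1) T_subspace, where E = "ev ` idx"])
    show "\<exists>x\<in>vcarrier T. \<forall>f. lfun W f \<longrightarrow> comul E z (f, g) = f x" if g: "g \<in> ev ` idx" for g
    proof -
      obtain j where j: "j \<in> idx" "g = ev j" using g by auto
      obtain x where x: "x \<in> vcarrier W" "\<And>f. lfun W f \<Longrightarrow> comul E z (f, ev j) = f x"
        using tensor_slice_right[OF W_vspace W_vspace c(1) W_ev_lfun] by metis
      have ex: "ev i x = ev (imul i j) z" if "i \<in> idx" for i
        using x(2)[OF W_ev_lfun, of i] c(2)[OF that j(1)] by simp
      have "x \<in> vcarrier T"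
        unfolding T_balanced
      proof (intro conjI allI impI)
        fix us m d m' vs assume *: "set us \<subseteq> X" "m \<in> X" "m' \<in> X" "set vs \<subseteq> X"
        show "ev (Inr (us @ R m d # m' # vs)) x = ev (Inr (us @ m # L d m' # vs)) x"
          using ev_imul_balanced(1)[OF z * j(1)] * LR_in by (subst (1 2) ex) auto
      qed (rule x(1))
      then show ?thesis using x j by auto
    qed
  qed (use ev_separated W_ev_lfun in auto)
  have "comul E z \<in> vcarrier (tensor_space T (W\<lparr>vcarrier := vcarrier T\<rparr>))"
  proof (rule tensor_in_right[OF T_vspace W_vspace 1[unfolded W_restrict] T_subspace, where E = "ev ` idx"])
    show "\<exists>x\<in>vcarrier T. \<forall>g. lfun W g \<longrightarrow> comul E z (f, g) = g x" if f: "f \<in> ev ` idx" for f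
    proof -
      obtain j where j: "j \<in> idx" "f = ev j" using f by auto
      obtain x where x: "x \<in> vcarrier W" "\<And>f. lfun W f \<Longrightarrow> comul E z (ev j, f) = f x"
        using tensor_slice_left[OF W_vspace W_vspace c(1) W_ev_lfun] by metis
      have ex: "ev i x = ev (imul j i) z" if "i \<in> idx" for i
        using x(2)[OF W_ev_lfun, of i] c(2)[OF j(1) that] by simp
      have "x \<in> vcarrier T"
        unfolding T_balanced
      proof (intro conjI allI impI)
        fix us m d m' vs assume *: "set us \<subseteq> X" "m \<in> X" "m' \<in> X" "set vs \<subseteq> X"
        show "ev (Inr (us @ R m d # m' # vs)) x = ev (Inr (us @ m # L d m' # vs)) x"
          using ev_imul_balanced(2)[OF z * j(1)] * LR_in by (subst (1 2) ex) auto
      qed (rule x(1))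
      then show ?thesis using x j by auto
    qed
  qed (use T_separated ev_lfun in auto)
  then show ?thesis by (simp add: W_restrict)
qed

lemma coalgebra_E: "coalgebra E"
proof (rule coalgebraI_eval[where I = idx and ev = ev and mul = imul and one = "Inl 1"])
  show "is_vspace E" using T_vspace by (simp add: is_vspace_def)
  show "lfun E (ev i)" for i by (simp add: ev_lfun)
  show "counit E c = ev (Inl 1) c" for c
    by (simp add: cotensor_coalgebra_def Let_def case_prod_unfold dual_coalgebra_simps[OF fd])
qed (simp_all add: T_separated imul_idx comul_T comul_ev T_W tensor_E imul_one ev_imul_assoc del: ev.simps)

text \<open>Right coideals and \<open>C\<^sup>*\<close>-submodules are both closed under the slices \<open>z \<mapsto> \<Sum> ev j (z\<^sub>2) z\<^sub>1\<close>.\<close>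

definition invariant :: "('k, 'd \<Rightarrow> 'k, 'm \<Rightarrow> 'k) cotensor set \<Rightarrow> bool" where
  "invariant S \<longleftrightarrow> S \<subseteq> vcarrier T \<and> module.subspace (vscale T) S \<and>
     (\<forall>z\<in>S. \<forall>j\<in>idx. \<exists>z'\<in>S. \<forall>i\<in>idx. ev i z' = ev (imul i j) z)"

lemma right_coideal_invariant:
  assumes "right_coideal E S" shows "invariant S"
  unfolding invariant_def
proof (intro conjI ballI)
  show S: "S \<subseteq> vcarrier T" "module.subspace (vscale T) S" using assms by (auto simp: right_coideal_def)
  fix z j assume z: "z \<in> S" and j: "j \<in> idx"
  have V: "is_vspace (E\<lparr>vcarrier := S\<rparr>)" "is_vspace E" using S(2) T_vector_space T_vspace by (auto simp: is_vspace_def)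
  have "comul E z \<in> vcarrier (tensor_space (E\<lparr>vcarrier := S\<rparr>) E)"
    using assms z by (simp add: right_coideal_def)
  moreover have "lfun E (ev j)" by (simp add: ev_lfun)
  ultimately obtain x where x: "x \<in> vcarrier (E\<lparr>vcarrier := S\<rparr>)"
    "\<And>f. lfun (E\<lparr>vcarrier := S\<rparr>) f \<Longrightarrow> comul E z (f, ev j) = f x"
    using tensor_slice_right[OF V] by metis
  have "ev i x = ev (imul i j) z" if "i \<in> idx" for i
    using x(2)[of "ev i"] comul_ev(2)[OF T_W that j, of z] z S(1) by (auto simp: ev_lfun simp del: ev.simps)
  then show "\<exists>z'\<in>S. \<forall>i\<in>idx. ev i z' = ev (imul i j) z" using x(1) by auto
qed

text \<open>\<open>f\<close> is given on \<open>T\<close> only, whereas tensors are evaluated at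
  functionals on the ambient type; \<open>g\<close> stands for any extension of
  \<open>f\<close>.\<close>

lemma dual_action_ev:
  assumes z: "z \<in> vcarrier T" and f: "linear_map T ground f"
  shows "dual_action E f z \<in> vcarrier T"
    "\<And>g. lfun T g \<Longrightarrow> (\<And>x. x \<in> vcarrier T \<Longrightarrow> f x = g x) \<Longrightarrow> i \<in> idx \<Longrightarrow> ev i (dual_action E f z) = comul E z (ev i, g)"
proof -
  have V: "is_vspace E" using T_vspace by (simp add: is_vspace_def)
  obtain g' where g': "lfun T g'" "\<And>x. x \<in> vcarrier T \<Longrightarrow> g' x = f x"
    using functional_extension[OF T_vspace f] by blast
  have *: "dual_action E f z \<in> vcarrier E \<and> (\<forall>i\<in>idx. ev i (dual_action E f z) = 1 * comul E z (ev i, g))"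
    if g: "lfun T g" "\<And>x. x \<in> vcarrier T \<Longrightarrow> f x = g x" for g
  proof -
    have c: "comul E z \<in> vcarrier (tensor_space E E)" using comul_T[OF z] by (simp add: tensor_E)
    have lin: "linear_map E ground (ev i)" for i by (rule lfun_linear_map[OF V]) (simp add: ev_lfun)
    have sep: "x = 0" if "x \<in> vcarrier E" "\<And>i. i \<in> idx \<Longrightarrow> ev i x = 0" for x
      using that by (intro T_separated) auto
    have mem: "vscale E (f y) x \<in> vcarrier E" if "x \<in> vcarrier E" "y \<in> vcarrier E" for x y
      using vs_scale[OF V that(1)] .
    have p: "lfun E (ev i)" "lfun E g" for i using g by (simp_all add: ev_lfun)
    have k: "ev i (vscale E (f y) x) = 1 * (ev i x * g y)" if "x \<in> vcarrier E" "y \<in> vcarrier E" for i x y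
      using lfun_simps(4)[OF V p(1)] g(2)[of y] that by (simp del: ev.simps)
    note t = tlift_eval[where e = ev and k = "\<lambda>_. 1" and p = ev and q = "\<lambda>_. g" and I = idx and \<beta> = "\<lambda>x y. vscale E (f y) x",
        OF V V V c lin sep mem p k]
    have 1: "tlift E E (\<lambda>x y. vscale E (f y) x) (comul E z) \<in> vcarrier E" by (rule t(1))
    have 2: "\<And>i. i \<in> idx \<Longrightarrow> ev i (tlift E E (\<lambda>x y. vscale E (f y) x) (comul E z)) = 1 * comul E z (ev i, g)" by (rule t(2))
    show ?thesis unfolding dual_action_def using 1 2 by blast
  qed
  show "dual_action E f z \<in> vcarrier T" using *[of g'] g' by simp
  show "\<And>g. lfun T g \<Longrightarrow> (\<And>x. x \<in> vcarrier T \<Longrightarrow> f x = g x) \<Longrightarrow> i \<in> idx \<Longrightarrow> ev i (dual_action E f z) = comul E z (ev i, g)"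
    using * by simp
qed

lemma dual_submodule_invariant:
  assumes "dual_submodule E S" shows "invariant S"
  unfolding invariant_def
proof (intro conjI ballI)
  show S: "S \<subseteq> vcarrier T" "module.subspace (vscale T) S" using assms by (auto simp: dual_submodule_def)
  fix z j assume z: "z \<in> S" and j: "j \<in> idx"
  define f where "f = (\<lambda>x. if x \<in> vcarrier T then ev j x else 0)"
  have lf: "linear_map T ground (ev j)" by (rule lfun_linear_map[OF T_vspace]) (simp add: ev_lfun)
  have f: "f \<in> vcarrier (dual_space T)" unfolding f_def by (rule dual_space_restrict[OF T_vspace lf])
  have "dual_space T = dual_space E" by (simp add: dual_space_def linear_map_def)
  then have "dual_action E f z \<in> S" using assms f z by (simp add: dual_submodule_def)
  moreover have "ev i (dual_action E f z) = ev (imul i j) z" if "i \<in> idx" for i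
  proof -
    have "ev i (dual_action E f z) = comul E z (ev i, ev j)"
      using z S(1) dual_in_linear_map[OF f] that
      by (intro dual_action_ev(2)) (auto simp: ev_lfun f_def simp del: ev.simps)
    then show ?thesis using comul_ev(2)[OF T_W that j, of z] z S(1) by auto
  qed
  ultimately show "\<exists>z'\<in>S. \<forall>i\<in>idx. ev i z' = ev (imul i j) z" by blast
qed

section \<open>The degree filtration and the chain condition\<close>

definition filt :: "nat \<Rightarrow> ('k, 'd \<Rightarrow> 'k, 'm \<Rightarrow> 'k) cotensor set" where
  "filt n = {z \<in> vcarrier T. \<forall>m>n. snd z m = 0}"

lemma filtI:
  assumes z: "z \<in> vcarrier T" and "\<And>i. i \<in> idx \<Longrightarrow> deg i > n \<Longrightarrow> ev i z = 0"
  shows "z \<in> filt n"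
proof -
  have "snd z m = 0" if "m > n" for m
    using ev_zero_component[OF T_W[OF z], of m] assms(2) that by (auto split: if_splits)
  then show ?thesis using z by (simp add: filt_def)
qed

lemma filtD: "z \<in> filt n \<Longrightarrow> deg i > n \<Longrightarrow> ev i z = 0"
  by (cases i) (auto simp: filt_def)

lemma filt_mono: "m \<le> n \<Longrightarrow> filt m \<subseteq> filt n"
  by (auto simp: filt_def)

lemma filt_exhaustive: "z \<in> vcarrier T \<Longrightarrow> \<exists>n. z \<in> filt n"
proof -
  assume z: "z \<in> vcarrier T"
  then have "finite {n. snd z n \<noteq> 0}" using T_W by (auto simp: W_iff)
  then obtain n where "\<forall>m\<in>{n. snd z n \<noteq> 0}. m \<le> n" using finite_nat_set_iff_bounded_le by blast
  then show ?thesis using z by (auto simp: filt_def not_le[symmetric])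
qed

text \<open>
  A fixed generator \<open>m0\<close> of \<open>M\<close> as a right \<open>D\<close>-space makes the degree \<open>n\<close> part isomorphic to \<open>D\<^sup>*\<close>
  via \<open>\<psi> n\<close>, and the action of \<open>D\<close> by slices becomes the translation action on \<open>D\<^sup>*\<close>.
\<close>

definition m0 :: 'm where "m0 = (SOME m. m \<in> X \<and> (\<forall>x\<in>X. \<exists>d. x = R m d))"

lemma m0: "m0 \<in> X" "m \<in> X \<Longrightarrow> \<exists>d. m = R m0 d"
proof -
  obtain m1 where "m1 \<in> X \<and> (\<forall>x\<in>X. \<exists>d. x = R m1 d)" using M_line by metis
  from someI[where P = "\<lambda>m. m \<in> X \<and> (\<forall>x\<in>X. \<exists>d. x = R m d)", OF this]
  show "m0 \<in> X" "m \<in> X \<Longrightarrow> \<exists>d. m = R m0 d" unfolding m0_def by blast+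
qed

text \<open>The power of \<open>m0\<close> in the tensor algebra; words are nonempty, so the empty
  power is the unit of \<open>D\<close>.\<close>

definition top_word :: "nat \<Rightarrow> 'd + 'm list" where
  "top_word n = (if n = 0 then Inl 1 else Inr (replicate n m0))"

definition \<psi> :: "nat \<Rightarrow> ('k, 'd \<Rightarrow> 'k, 'm \<Rightarrow> 'k) cotensor \<Rightarrow> 'd \<Rightarrow> 'k" where
  "\<psi> n z d = ev (imul (top_word n) (Inl d)) z"

lemma top_word_idx: "top_word n \<in> idx" and deg_top_word: "deg (top_word n) = n"
  by (auto simp: top_word_def m0(1))

lemma top_word_Suc: "imul (top_word (Suc n)) (Inl d) = imul (top_word n) (Inr [R m0 d])"
  by (cases n) (auto simp: top_word_def LR_one LR_in m0(1) replicate_append_same[symmetric] butlast_append)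

lemma top_word_snoc: "m \<in> X \<Longrightarrow> imul (top_word n) (Inr [m]) = Inr (replicate n m0 @ [m])"
  by (auto simp: top_word_def LR_one)

text \<open>Over \<open>D\<close> every word equals one of the form \<open>m0 \<dots> m0 m\<close>:
  its first letter other than the initial copies of \<open>m0\<close> is \<open>R m0 d\<close>, and
  balancedness moves \<open>d\<close> into the next letter. The last letter, again of the form
  \<open>R m0 d\<close>, is what \<open>\<psi>\<close> reads.\<close>

lemma \<psi>_separates:
  assumes z: "z \<in> vcarrier T" and \<psi>: "\<And>d. \<psi> n z d = 0" and i: "i \<in> idx" "deg i = n"
  shows "ev i z = 0"
proof (cases i)
  case (Inl d)
  then show ?thesis using \<psi>[of d] i(2) by (auto simp: \<psi>_def top_word_def)
next
  case (Inr w)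
  have "k < n \<Longrightarrow> length ws = n - k \<Longrightarrow> set ws \<subseteq> X \<Longrightarrow> ev (Inr (replicate k m0 @ ws)) z = 0" for k ws
  proof (induction "n - 1 - k" arbitrary: k ws)
    case 0
    then have k: "n = Suc k" by simp
    then obtain m where ws: "ws = [m]" "m \<in> X" using 0 by (cases ws) auto
    then obtain d where "m = R m0 d" using m0(2) by blast
    then show ?case
      using \<psi>[of d] ws LR_in m0(1) unfolding \<psi>_def k by (simp add: top_word_Suc top_word_snoc del: ev.simps)
  next
    case (Suc l)
    then obtain m m' ws' where ws: "ws = m # m' # ws'" by (cases ws; cases "tl ws") auto
    obtain d where d: "m = R m0 d" using m0(2) Suc.prems ws by auto
    have "ev (Inr (replicate (Suc k) m0 @ (L d m' # ws'))) z = 0"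
      using Suc.prems Suc.hyps(2) ws LR_in by (intro Suc.hyps(1)) auto
    moreover have "ev (Inr (replicate k m0 @ R m0 d # m' # ws')) z = ev (Inr (replicate k m0 @ m0 # L d m' # ws')) z"
      using z[unfolded T_balanced] Suc.prems ws m0(1) by (auto simp del: ev.simps simp: set_replicate_conv_if)
    ultimately show ?case
      by (simp add: ws d replicate_app_Cons_same del: ev.simps)
  qed
  from this[of 0 w] show ?thesis using i Inr by auto
qed

lemma \<psi>_dual: assumes "z \<in> vcarrier T" shows "\<psi> n z \<in> vcarrier (dual_space (full_space s))"
proof (cases "n = 0")
  case True
  then have "\<psi> n z = fst z" by (auto simp: \<psi>_def top_word_def)
  then show ?thesis using T_W[OF assms] by (simp add: W_iff dual_coalgebra_simps[OF fd])
next
  case False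
  then obtain l where n: "n = Suc l" by (cases n) auto
  have t: "snd z n \<in> vcarrier (tensor_power N (Suc (length (evs (replicate l m0)) + length ([] :: (('m \<Rightarrow> 'k) \<Rightarrow> 'k) list))))"
    using T_W[OF assms] n by (simp add: W_iff)
  obtain f where f: "f \<in> vcarrier N" "\<And>g. lfun N g \<Longrightarrow> snd z n (evs (replicate l m0) @ g # []) = g f"
    using tensor_power_slice[OF N_vspace t] by metis
  have "\<psi> n z d = f (R m0 d)" for d
    using f(2)[of "\<lambda>f. f (R m0 d)"] n
    by (simp add: \<psi>_def top_word_def lfun_eval butlast_conv_take min_def del: replicate.simps)
  moreover have "linear_map (full_space s) ground (\<lambda>d. f (R m0 d))"
    using M_bilinear(2)[of f] f(1) m0(1) by (simp add: bilinear_map_def)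
  ultimately show ?thesis by (simp add: fda_dual[OF fd] linear_map_def)
qed



lemma T_ev_diff: "ev i (x - y) = ev i x - ev i y"
  by (rule lfun_simps(3)[OF W_vspace W_ev_lfun])

text \<open>Slices by scalars let \<open>z\<close> imitate the top degree of any element of
  \<open>filt n\<close>, which leaves a difference of lower degree. A slice by one letter lowers the
  degree of \<open>z\<close> by exactly one, so the lower part of the filtration lies in
  \<open>S\<close> by induction.\<close>

lemma invariant_filt:
  assumes S: "invariant S"
  shows "z \<in> S \<Longrightarrow> z \<in> filt n \<Longrightarrow> \<psi> n z \<noteq> 0 \<Longrightarrow> filt n \<subseteq> S"
proof -
  have ST: "S \<subseteq> vcarrier T" and sub: "module.subspace (vscale T) S"
    and slice: "\<And>z j. z \<in> S \<Longrightarrow> j \<in> idx \<Longrightarrow> \<exists>z'\<in>S. \<forall>i\<in>idx. ev i z' = ev (imul i j) z"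
    using S by (auto simp: invariant_def simp del: ev.simps)
  interpret T: vector_space "vscale T" by (rule T_vector_space)
  have top: "\<exists>z'\<in>S. y - z' \<in> filt n \<and> (\<forall>i\<in>idx. deg i = n \<longrightarrow> ev i (y - z') = 0)"
    if z: "z \<in> S" "z \<in> filt n" "\<psi> n z \<noteq> 0" and y: "y \<in> filt n" for n y z
  proof -
    have zT: "z \<in> vcarrier T" and yT: "y \<in> vcarrier T" using z y by (auto simp: filt_def)
    \<comment> \<open>Transitivity on the nonzero functionals of \<open>D\<close>: the slice of
      \<open>z\<close> by \<open>d\<close> has the same part of degree \<open>n\<close> as
      \<open>y\<close>.\<close>
    obtain d where d: "\<And>a. \<psi> n y a = \<psi> n z (a * d)"
      using fda_dual_cyclic[OF fd \<psi>_dual[OF zT] z(3) \<psi>_dual[OF yT]] by metis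
    obtain z' where z': "z' \<in> S" "\<And>i. i \<in> idx \<Longrightarrow> ev i z' = ev (imul i (Inl d)) z"
      using slice[OF z(1), of "Inl d"] by auto
    have yz: "y - z' \<in> vcarrier T" using z'(1) ST yT by (intro vs_diff[OF T_vspace]) auto
    have "\<psi> n (y - z') a = 0" for a
    proof -
      have "ev (imul (imul (top_word n) (Inl a)) (Inl d)) z = \<psi> n z (a * d)"
        using ev_imul_assoc[OF zT top_word_idx, of "Inl a" "Inl d" n] by (simp add: \<psi>_def del: ev.simps)
      then show ?thesis
        using d[of a] z'(2)[OF imul_idx[OF top_word_idx], of "Inl a" n] by (simp add: \<psi>_def T_ev_diff del: ev.simps)
    qed
    then have "ev i (y - z') = 0" if "i \<in> idx" "deg i = n" for i
      using \<psi>_separates[OF yz] that by metis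
    moreover have "y - z' \<in> filt n"
      by (rule filtI[OF yz])
        (simp add: T_ev_diff z' filtD[OF y] filtD[OF z(2)] deg_imul del: ev.simps)
    ultimately show ?thesis using z'(1) by blast
  qed
  show "z \<in> S \<Longrightarrow> z \<in> filt n \<Longrightarrow> \<psi> n z \<noteq> 0 \<Longrightarrow> filt n \<subseteq> S"
  proof (induction n arbitrary: z)
    case (0 z)
    show ?case
    proof
      fix y assume y: "y \<in> filt 0"
      then obtain z' where z': "z' \<in> S" "y - z' \<in> filt 0" "\<forall>i\<in>idx. deg i = 0 \<longrightarrow> ev i (y - z') = 0"
        using top[OF 0 y] by blast
      have "y - z' = 0"
      proof (rule T_separated)
        show "y - z' \<in> vcarrier T" using z'(2) by (simp add: filt_def)
        show "ev i (y - z') = 0" if "i \<in> idx" for i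
          using z'(3) that filtD[OF z'(2), of i] by (cases "deg i = 0") auto
      qed
      then show "y \<in> S" using z'(1) by simp
    qed
  next
    case (Suc n z)
    have zT: "z \<in> vcarrier T" using Suc.prems(2) by (simp add: filt_def)
    obtain d where d: "\<psi> (Suc n) z d \<noteq> 0" using Suc.prems(3) by auto
    \<comment> \<open>Splitting off the letter at which \<open>\<psi> (Suc n) z\<close> is nonzero
      leaves an element whose \<open>\<psi> n\<close> is nonzero at 1.\<close>
    have j: "Inr [R m0 d] \<in> idx" using m0(1) LR_in by simp
    obtain z1 where z1: "z1 \<in> S" "\<And>i. i \<in> idx \<Longrightarrow> ev i z1 = ev (imul i (Inr [R m0 d])) z"
      using slice[OF Suc.prems(1) j] by auto
    have "z1 \<in> filt n"
      by (rule filtI) (use z1 ST j in \<open>auto simp: filtD[OF Suc.prems(2)] deg_imul simp del: ev.simps\<close>)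
    moreover have "\<psi> n z1 1 = \<psi> (Suc n) z d"
      using z1(2)[OF imul_idx[OF top_word_idx], of "Inl 1" n]
      by (simp add: \<psi>_def top_word_Suc imul_one[OF top_word_idx] del: ev.simps)
    then have "\<psi> n z1 \<noteq> 0" using d by auto
    ultimately have sub_n: "filt n \<subseteq> S" using Suc.IH z1(1) by blast
    show ?case
    proof
      fix y assume y: "y \<in> filt (Suc n)"
      then obtain z' where z': "z' \<in> S" "y - z' \<in> filt (Suc n)" "\<forall>i\<in>idx. deg i = Suc n \<longrightarrow> ev i (y - z') = 0"
        using top[OF Suc.prems y] by blast
      have "y - z' \<in> filt n"
      proof (rule filtI)
        show "y - z' \<in> vcarrier T" using z'(2) by (simp add: filt_def)
        show "ev i (y - z') = 0" if "i \<in> idx" "n < deg i" for i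
          using z'(3) that filtD[OF z'(2), of i] by (cases "deg i = Suc n") auto
      qed
      then have "(y - z') + z' \<in> S" using sub_n z'(1) T.subspace_add[OF sub] by blast
      then show "y \<in> S" by simp
    qed
  qed
qed

lemma exact_degree:
  assumes z: "z \<in> vcarrier T" "z \<noteq> 0"
  obtains n where "z \<in> filt n" "\<psi> n z \<noteq> 0"
proof -
  define n where "n = (LEAST n. z \<in> filt n)"
  have n: "z \<in> filt n" unfolding n_def using filt_exhaustive[OF z(1)] by (rule LeastI_ex)
  have "\<psi> n z \<noteq> 0"
  proof
    assume "\<psi> n z = 0"
    then have *: "ev i z = 0" if "i \<in> idx" "deg i = n" for i
      using \<psi>_separates[OF z(1) _ that] by simp
    show False
    proof (cases n)
      case 0
      then have "ev i z = 0" if "i \<in> idx" for i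
        using * filtD[OF n, of i] that by (cases "deg i = 0") auto
      then show False using T_separated z by blast
    next
      case (Suc k)
      have "z \<in> filt k"
      proof (rule filtI[OF z(1)])
        show "ev i z = 0" if "i \<in> idx" "k < deg i" for i
          using * filtD[OF n, of i] that Suc by (cases "deg i = n") auto
      qed
      then have "n \<le> k" unfolding n_def by (rule Least_le)
      then show False using Suc by simp
    qed
  qed
  then show ?thesis using that n by blast
qed

lemma invariant_chain:
  assumes S: "invariant S" "invariant S'" shows "S \<subseteq> S' \<or> S' \<subseteq> S"
proof (rule ccontr)
  interpret T: vector_space "vscale T" by (rule T_vector_space)
  assume "\<not> ?thesis"
  then obtain z z' where z: "z \<in> S" "z \<notin> S'" "z' \<in> S'" "z' \<notin> S" by blast
  have "0 \<in> S" "0 \<in> S'" using S by (auto simp: invariant_def T.subspace_0)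
  then have "z \<noteq> 0" "z' \<noteq> 0" using z by auto
  moreover have "z \<in> vcarrier T" "z' \<in> vcarrier T" using z S by (auto simp: invariant_def)
  ultimately obtain n n' where n: "z \<in> filt n" "\<psi> n z \<noteq> 0" "z' \<in> filt n'" "\<psi> n' z' \<noteq> 0"
    using exact_degree by metis
  have "filt n \<subseteq> S" "filt n' \<subseteq> S'" using invariant_filt S z n by blast+
  then show False using filt_mono[of n n'] filt_mono[of n' n] n z by (cases "n \<le> n'") auto
qed

lemma chain_coalgebra_E: "chain_coalgebra E"
  using coalgebra_E invariant_chain right_coideal_invariant by (auto simp: chain_coalgebra_def)

section \<open>The coradical of the cotensor coalgebra and its type\<close>

lemma filt_subspace: "module.subspace (vscale T) (filt n)"
proof -
  interpret T: vector_space "vscale T" by (rule T_vector_space)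
  have "T.subspace (vcarrier T)" using T_subspace by simp
  then show ?thesis
    unfolding T.subspace_def filt_def by (auto simp: T_scale fscale_def zero_fun_def)
qed

text \<open>Degrees add under \<open>imul\<close>, so every slice of an element of degree 0 has
  degree 0 on either side.\<close>

lemma comul_filt_0:
  assumes z: "z \<in> filt 0"
  shows "comul E z \<in> vcarrier (tensor_space (T\<lparr>vcarrier := filt 0\<rparr>) (T\<lparr>vcarrier := filt 0\<rparr>))"
proof -
  have zT: "z \<in> vcarrier T" using z by (simp add: filt_def)
  note c = comul_T[OF zT] and ce = comul_ev(2)[OF T_W[OF zT]]
  have lf: "lfun T (ev i)" for i by (rule ev_lfun)
  have 1: "comul E z \<in> vcarrier (tensor_space (T\<lparr>vcarrier := filt 0\<rparr>) T)"
  proof (rule tensor_in_left[OF T_vspace T_vspace c filt_subspace, where E = "ev ` idx"])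
    show "\<exists>x\<in>filt 0. \<forall>f. lfun T f \<longrightarrow> comul E z (f, g) = f x" if g: "g \<in> ev ` idx" for g
    proof -
      obtain j where j: "j \<in> idx" "g = ev j" using g by auto
      obtain x where x: "x \<in> vcarrier T" "\<And>f. lfun T f \<Longrightarrow> comul E z (f, ev j) = f x"
        using tensor_slice_right[OF T_vspace T_vspace c lf] by metis
      have "x \<in> filt 0"
        using x(2)[OF lf] ce[OF _ j(1)] filtD[OF z] j(1)
        by (intro filtI[OF x(1)]) (auto simp: deg_imul simp del: ev.simps)
      then show ?thesis using x j by auto
    qed
  qed (use T_separated lf in auto)
  show ?thesis
  proof (rule tensor_in_right[OF is_vspace_restrict[OF T_vspace filt_subspace] T_vspace 1 filt_subspace, where E = "ev ` idx"])
    show "\<exists>x\<in>filt 0. \<forall>g. lfun T g \<longrightarrow> comul E z (f, g) = g x" if f: "f \<in> ev ` idx" for f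
    proof -
      obtain j where j: "j \<in> idx" "f = ev j" using f by auto
      obtain x where x: "x \<in> vcarrier T" "\<And>f. lfun T f \<Longrightarrow> comul E z (ev j, f) = f x"
        using tensor_slice_left[OF T_vspace T_vspace c lf] by metis
      have "x \<in> filt 0"
        using x(2)[OF lf] ce[OF j(1)] filtD[OF z] j(1)
        by (intro filtI[OF x(1)]) (auto simp: deg_imul simp del: ev.simps)
      then show ?thesis using x j by auto
    qed
    show "x = 0" if "x \<in> vcarrier (T\<lparr>vcarrier := filt 0\<rparr>)" "\<And>f. f \<in> ev ` idx \<Longrightarrow> f x = 0" for x
      using that by (intro T_separated) (auto simp: filt_def)
  qed (use lf in auto)
qed

lemma filt_0_submodule: "dual_submodule E (filt 0)"
  unfolding dual_submodule_def
proof (intro conjI ballI)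
  show "filt 0 \<subseteq> vcarrier E" "module.subspace (vscale E) (filt 0)"
    using filt_subspace by (auto simp: filt_def)
  fix f z assume f: "f \<in> vcarrier (dual_space E)" and z: "z \<in> filt 0"
  have zT: "z \<in> vcarrier T" using z by (simp add: filt_def)
  have "dual_space E = dual_space T" by (simp add: dual_space_def linear_map_def)
  then have lf: "linear_map T ground f" using dual_in_linear_map f by metis
  obtain g where g: "lfun T g" "\<And>x. x \<in> vcarrier T \<Longrightarrow> g x = f x"
    using functional_extension[OF T_vspace lf] by blast
  show "dual_action E f z \<in> filt 0"
  proof (rule filtI[OF dual_action_ev(1)[OF zT lf]])
    fix i assume i: "i \<in> idx" "0 < deg i"
    obtain x where x: "x \<in> vcarrier T" "\<And>g. lfun T g \<Longrightarrow> comul E z (ev i, g) = g x"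
      using tensor_slice_left[OF T_vspace T_vspace comul_T[OF zT] ev_lfun] by metis
    have "x = 0"
      using x(2)[OF ev_lfun] comul_ev(2)[OF T_W[OF zT] i(1)] filtD[OF z] i
      by (intro T_separated[OF x(1)]) (auto simp: deg_imul simp del: ev.simps)
    then have "comul E z (ev i, g) = 0" using x(2)[OF g(1)] lfun_simps(1)[OF T_vspace g(1)] by simp
    then show "ev i (dual_action E f z) = 0"
      using dual_action_ev(2)[OF zT lf g(1) _ i(1)] g(2) by simp
  qed
qed

lemma invariant_contains_filt_0:
  assumes "invariant S" "S \<noteq> {0}" shows "filt 0 \<subseteq> S"
proof -
  interpret T: vector_space "vscale T" by (rule T_vector_space)
  have "0 \<in> S" using assms by (auto simp: invariant_def T.subspace_0)
  then obtain z where z: "z \<in> S" "z \<noteq> 0" using assms(2) by blast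
  moreover from z have "z \<in> vcarrier T" using assms(1) by (auto simp: invariant_def)
  ultimately obtain n where "z \<in> filt n" "\<psi> n z \<noteq> 0" using exact_degree by blast
  then have "filt n \<subseteq> S" using invariant_filt assms(1) z by blast
  then show ?thesis using filt_mono[of 0 n] by auto
qed

lemma filt_0_iff: "z \<in> filt 0 \<longleftrightarrow> (\<exists>c\<in>vcarrier Dc. z = (c, 0))"
proof
  assume z: "z \<in> filt 0"
  then have "z \<in> vcarrier W" by (simp add: filt_def T_W)
  moreover have "snd z n = 0" for n using z \<open>z \<in> vcarrier W\<close> by (cases n) (auto simp: filt_def W_iff)
  ultimately show "\<exists>c\<in>vcarrier Dc. z = (c, 0)"
    by (intro bexI[of _ "fst z"]) (auto simp: W_iff prod_eq_iff)
next
  assume "\<exists>c\<in>vcarrier Dc. z = (c, 0)"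
  then show "z \<in> filt 0"
    using inj_base_W by (auto simp: filt_def T_balanced inj_base_def)
qed

text \<open>Every nonzero invariant subspace contains \<open>filt 0\<close>, since it contains a
  whole step of the filtration; so \<open>filt 0\<close> is the only simple submodule.\<close>

lemma coradical_E: "coradical E = filt 0"
proof -
  interpret T: vector_space "vscale T" by (rule T_vector_space)
  have ne: "filt 0 \<noteq> {0}"
  proof -
    obtain c where c: "lfun (full_space s) c" "c 1 \<noteq> 0"
      using functionals_separate[OF fda_vector_space[OF fd], of 1] by (auto simp: fda_simps[OF fd])
    then have "(c, 0) \<in> filt 0" unfolding filt_0_iff
      using lfun_linear_map[OF fda_is_vspace[OF fd] c(1)] by (auto simp: dual_coalgebra_simps[OF fd] fda_dual[OF fd])
    moreover have "(c, 0) \<noteq> 0" using c(2) by (auto simp: zero_prod_def)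
    ultimately show ?thesis by blast
  qed
  have "simple_dual_submodule E S \<longleftrightarrow> S = filt 0" for S
  proof
    assume S: "simple_dual_submodule E S"
    then have "filt 0 \<subseteq> S"
      by (intro invariant_contains_filt_0) (auto simp: simple_dual_submodule_def dual_submodule_invariant)
    then show "S = filt 0" using S filt_0_submodule ne by (auto simp: simple_dual_submodule_def)
  next
    assume "S = filt 0"
    then show "simple_dual_submodule E S"
      using filt_0_submodule ne invariant_contains_filt_0 dual_submodule_invariant
      by (auto simp: simple_dual_submodule_def)
  qed
  then have "coradical E = T.span (\<Union>{filt 0})" by (simp add: coradical_def)
  then show ?thesis using filt_subspace by (simp add: T.span_eq_iff)
qed

text \<open>\<open>filt 0\<close> is a copy of the dual coalgebra of \<open>D\<close>, so its dual
  is the bidual of \<open>D\<close>: \<open>\<delta> d\<close> is evaluation at \<open>d\<close>,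
  onto by reflexivity and multiplicative by \<open>comul_ev\<close>. The required isomorphism is the
  inverse of \<open>\<delta>\<close>.\<close>

lemma of_type_E: "of_type E s"
proof -
  define C0 where "C0 = E\<lparr>vcarrier := filt 0\<rparr>"
  have C0: "is_vspace C0" using filt_subspace T_vector_space by (simp add: C0_def is_vspace_def)
  define \<delta> where "\<delta> d z = (if z \<in> filt 0 then fst z d else 0)" for d and z :: "('k, 'd \<Rightarrow> 'k, 'm \<Rightarrow> 'k) cotensor"
  have dual: "dual_space C0 = dual_space (T\<lparr>vcarrier := filt 0\<rparr>)"
    by (simp add: C0_def dual_space_def linear_map_def)
  have \<delta>_dual: "\<delta> d \<in> vcarrier (dual_space C0)" for d
  proof -
    have "linear_map (T\<lparr>vcarrier := filt 0\<rparr>) ground (ev (Inl d))"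
      by (rule lfun_linear_map[OF is_vspace_restrict[OF T_vspace filt_subspace]]) (simp add: ev_lfun del: ev.simps)
    from dual_space_restrict[OF is_vspace_restrict[OF T_vspace filt_subspace] this]
    show ?thesis by (simp add: dual \<delta>_def[abs_def] cong: if_cong)
  qed
  have \<delta>_add: "\<delta> (d + e) = \<delta> d + \<delta> e" and \<delta>_scale: "\<delta> (s a d) = fscale a (\<delta> d)" for d e a
    by (auto simp: fun_eq_iff \<delta>_def filt_0_iff dual_coalgebra_simps[OF fd] fda_dual_simps[OF fd] fscale_def)
  have \<delta>_inj: "inj \<delta>"
  proof (rule injI)
    fix x y assume eq: "\<delta> x = \<delta> y"
    show "x = y"
    proof (rule fda_dual_separates[OF fd])
      fix c assume "c \<in> vcarrier (dual_space (full_space s))"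
      then have "(c, 0) \<in> filt 0" by (simp add: filt_0_iff dual_coalgebra_simps[OF fd])
      then show "c x = c y" using fun_cong[OF eq, of "(c, 0)"] by (simp add: \<delta>_def)
    qed
  qed
  have \<delta>_surj: "\<exists>d. f = \<delta> d" if f: "f \<in> vcarrier (dual_space C0)" for f
  proof -
    have mem: "(c, 0) \<in> vcarrier C0" if "c \<in> vcarrier (dual_space (full_space s))" for c
      using that by (simp add: C0_def filt_0_iff dual_coalgebra_simps[OF fd])
    have "linear_map (dual_space (full_space s)) ground (\<lambda>c. f (c, 0))"
      unfolding linear_map_def
    proof (intro conjI ballI allI)
      fix x y a assume x: "x \<in> vcarrier (dual_space (full_space s))" and y: "y \<in> vcarrier (dual_space (full_space s))"
      have l: "f (u + v) = f u + f v" "f (vscale C0 a u) = a * f u" if "u \<in> vcarrier C0" "v \<in> vcarrier C0" for u v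
        using dual_in_linear_map[OF f] that by (auto simp: linear_map_def)
      show "f (x + y, 0) = f (x, 0) + f (y, 0)" using l(1)[OF mem[OF x] mem[OF y]] by simp
      show "f (vscale (dual_space (full_space s)) a x, 0) = vscale ground a (f (x, 0))"
        using l(2)[OF mem[OF x] mem[OF x]] by (simp add: C0_def T_scale fscale_def zero_fun_def)
    qed simp
    then obtain d where d: "\<And>c. c \<in> vcarrier (dual_space (full_space s)) \<Longrightarrow> f (c, 0) = c d"
      using fda_bidual[OF fd] by blast
    have "f z = \<delta> d z" for z
    proof (cases "z \<in> filt 0")
      case True
      then show ?thesis using d by (auto simp: \<delta>_def filt_0_iff dual_coalgebra_simps[OF fd])
    next
      case False
      then show ?thesis using f by (cases z) (simp add: \<delta>_def dual_space_def C0_def)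
    qed
    then show ?thesis by blast
  qed
  have conv: "convolution C0 (\<delta> d) (\<delta> e) = \<delta> (d * e)" for d e
  proof
    fix z show "convolution C0 (\<delta> d) (\<delta> e) z = \<delta> (d * e) z"
    proof (cases "z \<in> filt 0")
      case True
      have "tensor_space C0 C0 = tensor_space (T\<lparr>vcarrier := filt 0\<rparr>) (T\<lparr>vcarrier := filt 0\<rparr>)"
        by (simp add: C0_def tensor_space_def tens_def fun_eq_iff)
      then have c: "comul E z \<in> vcarrier (tensor_space C0 C0)" using comul_filt_0[OF True] by simp
      have lf: "lfun C0 (ev i)" for i by (simp add: C0_def ev_lfun)
      have k: "\<delta> d x * \<delta> e y = 1 * (ev (Inl d) x * ev (Inl e) y)" if "x \<in> vcarrier C0" "y \<in> vcarrier C0" for x y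
        using that by (simp add: C0_def \<delta>_def)
      have "id (tlift C0 C0 (\<lambda>x y. \<delta> d x * \<delta> e y) (comul E z)) = 1 * comul E z (ev (Inl d), ev (Inl e))"
        by (rule tlift_eval(2)[where I = "{()}" and e = "\<lambda>_. id" and i = "()", OF C0 C0 is_vspace_ground c])
          (simp_all add: lf k linear_map_def del: ev.simps)
      then show ?thesis
        using True comul_ev(2)[OF T_W, of z "Inl d" "Inl e"] by (simp add: convolution_def C0_def \<delta>_def filt_def)
    qed (simp add: convolution_def C0_def \<delta>_def)
  qed
  have one: "convolution_one C0 = \<delta> 1"
    by (auto simp: fun_eq_iff convolution_one_def C0_def \<delta>_def cotensor_coalgebra_def Let_def case_prod_unfold
        dual_coalgebra_simps[OF fd])
  define \<phi> where "\<phi> = inv \<delta>"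
  have \<phi>: "\<phi> (\<delta> d) = d" for d unfolding \<phi>_def by (rule inv_f_f[OF \<delta>_inj])
  have lin: "linear_map (dual_space C0) (full_space s) \<phi>"
    unfolding linear_map_def
  proof (intro conjI ballI allI)
    fix f g a assume "f \<in> vcarrier (dual_space C0)" "g \<in> vcarrier (dual_space C0)"
    then obtain d e where de: "f = \<delta> d" "g = \<delta> e" using \<delta>_surj by metis
    show "\<phi> (f + g) = \<phi> f + \<phi> g" unfolding de \<delta>_add[symmetric] \<phi> ..
    show "\<phi> (vscale (dual_space C0) a f) = vscale (full_space s) a (\<phi> f)"
      unfolding de dual_space_simps \<delta>_scale[symmetric] \<phi> fda_simps[OF fd] ..
  qed (simp add: fda_simps[OF fd])
  have bij: "bij_betw \<phi> (vcarrier (dual_space C0)) UNIV"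
    by (rule bij_betw_byWitness[where f' = \<delta>]) (use \<phi> \<delta>_dual in \<open>auto dest!: \<delta>_surj\<close>)
  have "\<forall>f\<in>vcarrier (dual_space C0). \<forall>g\<in>vcarrier (dual_space C0). \<phi> (convolution C0 f g) = \<phi> f * \<phi> g"
    using \<delta>_surj conv \<phi> by metis
  then show ?thesis
    unfolding of_type_def Let_def coradical_E C0_def[symmetric] using lin bij one \<phi> by auto
qed

end

subsection \<open>The dual algebra of a coalgebra\<close>

lemma subspace_functional:
  assumes V: "is_vspace V" and S: "module.subspace (vscale V) S" "c \<notin> S"
  obtains f where "lfun V f" "\<forall>x\<in>S. f x = 0" "f c \<noteq> 0"
proof -
  interpret V: vector_space "vscale V" using V by (simp add: is_vspace_def)
  obtain p where p: "Vector_Spaces.linear (vscale V) (vscale V) p" "\<And>x. p x \<in> S" "\<And>x. x \<in> S \<Longrightarrow> p x = x"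
    using subspace_projection[OF V S(1)] by blast
  interpret p: Vector_Spaces.linear "vscale V" "vscale V" p by fact
  have "c - p c \<noteq> 0" using p(2)[of c] S(2) by auto
  then obtain g where g: "lfun V g" "g (c - p c) \<noteq> 0"
    using functionals_separate[OF V.vector_space_axioms] by blast
  have "lfun V (\<lambda>x. g (x - p x))"
    unfolding Vector_Spaces.linear_iff
    by (simp add: V.vector_space_axioms vector_space_ground lfun_simps[OF V g(1)] p.add p.scale algebra_simps)
  then show ?thesis using g p(3) lfun_simps(1)[OF V g(1)] by (intro that[of "\<lambda>x. g (x - p x)"]) auto
qed

lemma subspace_dim_less:
  assumes V: "vector_space s" and sub: "module.subspace s S" "module.subspace s S'" and less: "S \<subset> S'"
    and F: "finite F" "S' \<subseteq> module.span s F"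
  shows "vector_space.dim s S < vector_space.dim s S'"
proof -
  interpret vector_space s by fact
  obtain B where B: "B \<subseteq> S" "independent B" "S \<subseteq> span B" using maximal_independent_subset by blast
  obtain B' where B': "B \<subseteq> B'" "B' \<subseteq> S'" "independent B'" "S' \<subseteq> span B'"
    using maximal_independent_subset_extend[of B S'] B less by blast
  have "finite B'" using independent_span_bound[OF F(1) B'(3)] B'(2) F(2) by blast
  moreover have "B \<noteq> B'"
  proof
    assume "B = B'"
    then have "S' \<subseteq> S" using B'(4) span_minimal[OF B(1) sub(1)] by auto
    then show False using less by auto
  qed
  ultimately have "card B < card B'" using B'(1) by (auto intro: psubset_card_mono)
  then show ?thesis using dim_unique[OF B(1,3,2)] dim_unique[OF B'(2,4,3)] by auto
qed

lemma tlift_linear: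
  assumes "is_vspace V" "is_vspace W" "is_vspace U" "bilinear_map V W U \<beta>"
  shows "linear_map (tensor_space V W) U (tlift V W \<beta>)"
  by (rule tensor_universal(2)[OF assms])

locale coalg_dual =
  fixes C :: "('k::field, 'c::ab_group_add) coalg"
  assumes coalg: "coalgebra C"
begin

abbreviation "K \<equiv> vcarrier C"
abbreviation "A \<equiv> vcarrier (dual_space C)"

lemma C_vspace: "is_vspace C"
  using coalg by (simp add: coalgebra_def)

lemma A_vspace: "is_vspace (dual_space C)"
  by (rule is_vspace_dual[OF C_vspace])

lemma comul_in: "c \<in> K \<Longrightarrow> comul C c \<in> vcarrier (tensor_space C C)"
  and comul_add: "c \<in> K \<Longrightarrow> c' \<in> K \<Longrightarrow> comul C (c + c') = comul C c + comul C c'"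
  and comul_scale: "c \<in> K \<Longrightarrow> comul C (vscale C a c) = fscale a (comul C c)"
proof -
  have "linear_map C (tensor_space C C) (comul C)" using coalg by (simp add: coalgebra_def)
  then show "c \<in> K \<Longrightarrow> comul C c \<in> vcarrier (tensor_space C C)"
    "c \<in> K \<Longrightarrow> c' \<in> K \<Longrightarrow> comul C (c + c') = comul C c + comul C c'"
    "c \<in> K \<Longrightarrow> comul C (vscale C a c) = fscale a (comul C c)"
    by (simp_all add: linear_map_def)
qed

text \<open>
  A fixed expression \<open>\<Sum> c\<^sub>1 \<otimes> c\<^sub>2\<close> of the comultiplication makes the convolution product bilinear on
  all functions, not only on linear ones.
\<close>

definition rep :: "'c \<Rightarrow> ('c \<times> 'c) list" where
  "rep c = (SOME ps. (\<forall>p\<in>set ps. fst p \<in> K \<and> snd p \<in> K) \<and> comul C c = (\<Sum>p\<leftarrow>ps. tens C C (fst p) (snd p)))"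

lemma rep:
  assumes "c \<in> K"
  shows "\<forall>p\<in>set (rep c). fst p \<in> K \<and> snd p \<in> K" "comul C c = (\<Sum>p\<leftarrow>rep c. tens C C (fst p) (snd p))"
proof -
  obtain ps where "\<forall>p\<in>set ps. fst p \<in> K \<and> snd p \<in> K" "comul C c = (\<Sum>p\<leftarrow>ps. tens C C (fst p) (snd p))"
    by (rule tensor_rep[OF C_vspace C_vspace comul_in[OF assms]])
  then have "(\<forall>p\<in>set ps. fst p \<in> K \<and> snd p \<in> K) \<and> comul C c = (\<Sum>p\<leftarrow>ps. tens C C (fst p) (snd p))" by simp
  from someI[where P = "\<lambda>ps. (\<forall>p\<in>set ps. fst p \<in> K \<and> snd p \<in> K) \<and> comul C c = (\<Sum>p\<leftarrow>ps. tens C C (fst p) (snd p))", OF this]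
  show "\<forall>p\<in>set (rep c). fst p \<in> K \<and> snd p \<in> K" "comul C c = (\<Sum>p\<leftarrow>rep c. tens C C (fst p) (snd p))"
    unfolding rep_def by blast+
qed

definition conv :: "('c \<Rightarrow> 'k) \<Rightarrow> ('c \<Rightarrow> 'k) \<Rightarrow> 'c \<Rightarrow> 'k" (infixl "\<star>" 70) where
  "f \<star> g = (\<lambda>c. if c \<in> K then \<Sum>p\<leftarrow>rep c. f (fst p) * g (snd p) else 0)"

text \<open>\<open>la\<close> is the left action of the dual algebra and \<open>ra\<close> the right
  one. They are adjoint to multiplication by \<open>f\<close> from the right and from the left
  (\<open>conv_la\<close>, \<open>conv_ra\<close>), which is how identities in the algebra and in
  \<open>C\<close> are exchanged.\<close>

definition la :: "('c \<Rightarrow> 'k) \<Rightarrow> 'c \<Rightarrow> 'c" where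
  "la f c = (\<Sum>p\<leftarrow>rep c. vscale C (f (snd p)) (fst p))"

definition ra :: "'c \<Rightarrow> ('c \<Rightarrow> 'k) \<Rightarrow> 'c" where
  "ra c f = (\<Sum>p\<leftarrow>rep c. vscale C (f (fst p)) (snd p))"

definition eps :: "'c \<Rightarrow> 'k" where
  "eps = (\<lambda>c. if c \<in> K then counit C c else 0)"

lemma A_simps:
  assumes "f \<in> A" "x \<in> K"
  shows "y \<in> K \<Longrightarrow> f (x + y) = f x + f y" "y \<in> K \<Longrightarrow> f (x - y) = f x - f y" "f (vscale C a x) = a * f x"
proof -
  obtain g where g: "lfun C g" "\<And>x. x \<in> K \<Longrightarrow> g x = f x"
    using functional_extension[OF C_vspace dual_in_linear_map[OF assms(1)]] by blast
  show "y \<in> K \<Longrightarrow> f (x + y) = f x + f y" "y \<in> K \<Longrightarrow> f (x - y) = f x - f y" "f (vscale C a x) = a * f x"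
    using lfun_simps[OF C_vspace g(1)] g(2) assms(2) vs_add[OF C_vspace] vs_diff[OF C_vspace] vs_scale[OF C_vspace]
    by metis+
qed

lemma scale_zero: "vscale C 0 c = 0" "vscale C a 0 = 0"
proof -
  interpret V: vector_space "vscale C" by (rule is_vspace_vector_space[OF C_vspace])
  show "vscale C 0 c = 0" "vscale C a 0 = 0" by simp_all
qed

lemma A_zero: "f \<in> A \<Longrightarrow> f 0 = 0"
  using A_simps(3)[of f 0 0] vs_zero[OF C_vspace] by (simp add: scale_zero)

lemma A_outside: "f \<in> A \<Longrightarrow> x \<notin> K \<Longrightarrow> f x = 0"
  by (simp add: dual_space_def)

lemma A_eqI: "f \<in> A \<Longrightarrow> g \<in> A \<Longrightarrow> (\<And>x. x \<in> K \<Longrightarrow> f x = g x) \<Longrightarrow> f = g"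
  by (metis A_outside ext)

lemma A_sum_list:
  assumes "f \<in> A" "\<And>p. p \<in> set ps \<Longrightarrow> g p \<in> K"
  shows "f (\<Sum>p\<leftarrow>ps. g p) = (\<Sum>p\<leftarrow>ps. f (g p))"
  by (rule linear_map_sum_list[OF C_vspace is_vspace_ground dual_in_linear_map]) (use assms in auto)

lemma A_ambient: "lfun C f \<Longrightarrow> (\<lambda>x. if x \<in> K then f x else 0) \<in> A"
  by (rule dual_space_restrict[OF C_vspace lfun_linear_map[OF C_vspace]])

lemma A_separates:
  assumes "x \<in> K" "y \<in> K" "\<And>f. f \<in> A \<Longrightarrow> f x = f y" shows "x = y"
proof (rule lfun_eqI[OF C_vspace])
  fix f assume "lfun C f"
  from assms(3)[OF A_ambient[OF this]] show "f x = f y" using assms(1,2) by simp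
qed

lemma A_closed:
  "0 \<in> A" "f \<in> A \<Longrightarrow> g \<in> A \<Longrightarrow> f + g \<in> A" "f \<in> A \<Longrightarrow> g \<in> A \<Longrightarrow> f - g \<in> A" "f \<in> A \<Longrightarrow> fscale a f \<in> A"
  using vs_zero[OF A_vspace] vs_add[OF A_vspace] vs_diff[OF A_vspace] vs_scale[OF A_vspace] by auto

lemma la_in: "c \<in> K \<Longrightarrow> la f c \<in> K" and ra_in: "c \<in> K \<Longrightarrow> ra c f \<in> K"
  unfolding la_def ra_def using rep(1) by (auto intro!: vs_sum_list[OF C_vspace] vs_scale[OF C_vspace])

lemma conv_la: "c \<in> K \<Longrightarrow> h \<in> A \<Longrightarrow> (h \<star> f) c = h (la f c)"
  unfolding la_def conv_def using rep(1)
  by (subst A_sum_list) (auto intro!: vs_scale[OF C_vspace] arg_cong[of _ _ sum_list] simp: A_simps mult.commute)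

lemma conv_ra: "c \<in> K \<Longrightarrow> h \<in> A \<Longrightarrow> (f \<star> h) c = h (ra c f)"
  unfolding ra_def conv_def using rep(1)
  by (subst A_sum_list) (auto intro!: vs_scale[OF C_vspace] arg_cong[of _ _ sum_list] simp: A_simps mult.commute)

lemma conv_eval:
  assumes "c \<in> K" "lfun C f'" "lfun C g'" "\<And>x. x \<in> K \<Longrightarrow> f x = f' x" "\<And>x. x \<in> K \<Longrightarrow> g x = g' x"
  shows "(f \<star> g) c = comul C c (f', g')"
  unfolding rep(2)[OF assms(1)] tensor_rep_apply[OF assms(2,3)]
  using rep(1)[OF assms(1)] assms by (auto simp: conv_def intro!: arg_cong[of _ _ sum_list])

text \<open>The chosen expression \<open>rep c\<close> need not depend linearly on \<open>c\<close>.
  Linearity comes from the other description of the value, as \<open>comul C c\<close> evaluated at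
  ambient extensions of the two functionals.\<close>

lemma conv_closed:
  assumes "f \<in> A" "g \<in> A" shows "f \<star> g \<in> A"
proof -
  obtain f' where f': "lfun C f'" "\<And>x. x \<in> K \<Longrightarrow> f' x = f x"
    using functional_extension[OF C_vspace dual_in_linear_map[OF assms(1)]] by blast
  obtain g' where g': "lfun C g'" "\<And>x. x \<in> K \<Longrightarrow> g' x = g x"
    using functional_extension[OF C_vspace dual_in_linear_map[OF assms(2)]] by blast
  have eq: "(f \<star> g) c = comul C c (f', g')" if "c \<in> K" for c
    using that f' g' by (intro conv_eval) auto
  have "linear_map C ground (f \<star> g)"
    by (simp add: linear_map_def eq vs_add[OF C_vspace] vs_scale[OF C_vspace] comul_add comul_scale)
      (simp add: fscale_def)
  then show ?thesis by (simp add: dual_space_def conv_def)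
qed

lemma conv_add_left: "(f + g) \<star> h = f \<star> h + g \<star> h"
  and conv_add_right: "h \<star> (f + g) = h \<star> f + h \<star> g"
  and conv_diff_left: "(f - g) \<star> h = f \<star> h - g \<star> h"
  and conv_diff_right: "h \<star> (f - g) = h \<star> f - h \<star> g"
  and conv_scale_left: "fscale a f \<star> h = fscale a (f \<star> h)"
  and conv_scale_right: "h \<star> fscale a f = fscale a (h \<star> f)"
  and conv_zero_left: "0 \<star> h = 0"
  and conv_zero_right: "h \<star> 0 = 0"
  by (auto simp: conv_def fun_eq_iff sum_list_addf sum_list_subtractf fscale_def algebra_simps
      sum_list_const_mult)

lemma conv_sum_left: "(\<Sum>p\<leftarrow>ps. F p) \<star> h = (\<Sum>p\<leftarrow>ps. F p \<star> h)"
  by (induction ps) (simp_all add: conv_zero_left conv_add_left del: plus_fun_apply zero_fun_apply)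

lemma conv_sum_right: "h \<star> (\<Sum>p\<leftarrow>ps. F p) = (\<Sum>p\<leftarrow>ps. h \<star> F p)"
  by (induction ps) (simp_all add: conv_zero_right conv_add_right del: plus_fun_apply zero_fun_apply)

text \<open>Coassociativity, tested by the product \<open>e\<close> of three ambient extensions
  \<open>f'\<close>, \<open>g'\<close>, \<open>h'\<close>. The two iterated comultiplications are
  first expanded by \<open>rep\<close>, and \<open>e\<close> of each expansion is one of the two
  bracketings.\<close>

lemma conv_assoc:
  assumes f: "f \<in> A" and g: "g \<in> A" and h: "h \<in> A"
  shows "(f \<star> g) \<star> h = f \<star> (g \<star> h)"
proof (rule A_eqI)
  show "(f \<star> g) \<star> h \<in> A" "f \<star> (g \<star> h) \<in> A" using f g h by (simp_all add: conv_closed)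
  fix c assume c: "c \<in> K"
  obtain f' where f': "lfun C f'" "\<And>x. x \<in> K \<Longrightarrow> f' x = f x"
    using functional_extension[OF C_vspace dual_in_linear_map[OF f]] by blast
  obtain g' where g': "lfun C g'" "\<And>x. x \<in> K \<Longrightarrow> g' x = g x"
    using functional_extension[OF C_vspace dual_in_linear_map[OF g]] by blast
  obtain h' where h': "lfun C h'" "\<And>x. x \<in> K \<Longrightarrow> h' x = h x"
    using functional_extension[OF C_vspace dual_in_linear_map[OF h]] by blast
  let ?CC = "tensor_space C C" and ?U = "tensor_space (tensor_space C C) C"
  have CC: "is_vspace ?CC" "is_vspace ?U" by simp_all
  define e where "e t = t (\<lambda>q :: ('k, 'c, 'c) tensor. q (f', g'), h')" for t :: "('k, ('k, 'c, 'c) tensor, 'c) tensor"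
  have e_sum: "e (\<Sum>p\<leftarrow>ps. F p) = (\<Sum>p\<leftarrow>ps. e (F p))" for F :: "'i \<Rightarrow> _" and ps
    by (simp add: e_def sum_list_fun_apply)
  have e_tens: "e (tens ?CC C t z) = t (f', g') * h' z" for t z
    by (simp add: e_def tens_apply lfun_eval h')
  note tl = tens_linear[OF CC(1) C_vspace] and tl' = tens_linear[OF C_vspace C_vspace]
  define \<beta> where "\<beta> x y = tens ?CC C (comul C x) y" for x y
  have "bilinear_map C C ?U \<beta>"
    unfolding bilinear_map_def linear_map_def \<beta>_def
    using comul_in comul_add comul_scale tl tens_in[of _ ?CC _ C] by (simp del: plus_fun_apply)
  then have lhs: "tlift C C \<beta> (comul C c) = (\<Sum>p\<leftarrow>rep c. \<beta> (fst p) (snd p))"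
    by (rule tlift_rep[OF C_vspace C_vspace CC(2) _ rep[OF c]])
  define \<gamma>' where "\<gamma>' x y z = tens ?CC C (tens C C x y) z" for x y z
  define \<gamma> where "\<gamma> x y = tlift C C (\<gamma>' x) (comul C y)" for x y
  have b': "bilinear_map C C ?U (\<gamma>' x)" if "x \<in> K" for x
    unfolding bilinear_map_def linear_map_def \<gamma>'_def
    using that tl tl' tens_in[of _ ?CC _ C] tens_in[of _ C _ C] by (simp del: plus_fun_apply)
  have \<gamma>: "\<gamma> x y = (\<Sum>p\<leftarrow>rep y. \<gamma>' x (fst p) (snd p))" if "x \<in> K" "y \<in> K" for x y
    unfolding \<gamma>_def by (rule tlift_rep[OF C_vspace C_vspace CC(2) b'[OF that(1)] rep[OF that(2)]])
  have "bilinear_map C C ?U \<gamma>"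
    unfolding bilinear_map_def
  proof (intro conjI ballI)
    fix x assume x: "x \<in> K"
    from tlift_linear[OF C_vspace C_vspace CC(2) b'[OF x]]
    show "linear_map C ?U (\<gamma> x)"
      unfolding linear_map_def \<gamma>_def by (simp add: comul_in comul_add comul_scale del: plus_fun_apply)
  next
    fix y assume y: "y \<in> K"
    show "linear_map C ?U (\<lambda>x. \<gamma> x y)"
      unfolding linear_map_def
    proof (intro conjI ballI allI)
      fix x x' a assume x: "x \<in> K" and x': "x' \<in> K"
      show "\<gamma> x y \<in> vcarrier ?U" unfolding \<gamma>[OF x y] \<gamma>'_def
        using rep(1)[OF y] x by (intro vs_sum_list[OF CC(2)] tens_in) auto
      show "\<gamma> (x + x') y = \<gamma> x y + \<gamma> x' y"
        unfolding \<gamma>[OF x y] \<gamma>[OF x' y] \<gamma>[OF vs_add[OF C_vspace x x'] y] \<gamma>'_def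
        by (simp add: tl tl' sum_list_addf del: plus_fun_apply)
      have "\<gamma>' (vscale C a x) z w = fscale a (\<gamma>' x z w)" for z w
        unfolding \<gamma>'_def tl'(3) using tl(3)[of a "tens C C x z" w] by simp
      moreover have "(\<Sum>p\<leftarrow>ps. fscale a (F p)) = fscale a (\<Sum>p\<leftarrow>ps. F p)" for F :: "'c \<times> 'c \<Rightarrow> ('k, ('k, 'c, 'c) tensor, 'c) tensor" and ps
        by (induction ps) (auto simp: fscale_def fun_eq_iff algebra_simps)
      ultimately show "\<gamma> (vscale C a x) y = vscale ?U a (\<gamma> x y)"
        unfolding \<gamma>[OF x y] \<gamma>[OF vs_scale[OF C_vspace x] y] by simp
    qed
  qed
  then have rhs: "tlift C C \<gamma> (comul C c) = (\<Sum>p\<leftarrow>rep c. \<gamma> (fst p) (snd p))"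
    by (rule tlift_rep[OF C_vspace C_vspace CC(2) _ rep[OF c]])
  have "tlift C C \<beta> (comul C c) = tlift C C \<gamma> (comul C c)"
    using coalg c unfolding coalgebra_def \<beta>_def[abs_def] \<gamma>_def[abs_def] \<gamma>'_def[abs_def] by blast
  then have e1: "(\<Sum>p\<leftarrow>rep c. e (\<beta> (fst p) (snd p))) = (\<Sum>p\<leftarrow>rep c. e (\<gamma> (fst p) (snd p)))"
    unfolding lhs rhs e_sum[symmetric] by (rule arg_cong)
  have e2: "e (\<beta> x y) = (f \<star> g) x * h y" if "x \<in> K" "y \<in> K" for x y
    using that(2) h'(2) conv_eval[OF that(1) f'(1) g'(1), of f g] f'(2) g'(2) by (simp add: \<beta>_def e_tens)
  have e3: "e (\<gamma> x y) = f x * (g \<star> h) y" if xy: "x \<in> K" "y \<in> K" for x y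
  proof -
    have "e (\<gamma> x y) = (\<Sum>p\<leftarrow>rep y. f x * (g (fst p) * h (snd p)))"
      unfolding \<gamma>[OF xy] e_sum \<gamma>'_def e_tens tens_apply[OF f'(1) g'(1)]
      using rep(1)[OF xy(2)] f'(2) g'(2) h'(2) xy(1) by (intro arg_cong[of _ _ sum_list] map_cong refl) auto
    then show ?thesis using xy by (simp add: conv_def sum_list_const_mult)
  qed
  have "((f \<star> g) \<star> h) c = (\<Sum>p\<leftarrow>rep c. e (\<beta> (fst p) (snd p)))"
    unfolding conv_def[of "f \<star> g" h] using c rep(1)[OF c] e2
    by (auto intro!: arg_cong[of _ _ sum_list])
  also have "\<dots> = (f \<star> (g \<star> h)) c"
    unfolding e1 conv_def[of f "g \<star> h"] using c rep(1)[OF c] e3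
    by (auto intro!: arg_cong[of _ _ sum_list])
  finally show "((f \<star> g) \<star> h) c = (f \<star> (g \<star> h)) c" .
qed

lemma eps_in: "eps \<in> A"
  unfolding eps_def using coalg by (intro dual_space_restrict[OF C_vspace]) (simp add: coalgebra_def)

lemma conv_eps: "f \<in> A \<Longrightarrow> eps \<star> f = f" "f \<in> A \<Longrightarrow> f \<star> eps = f"
proof -
  have lin: "linear_map C ground (counit C)" using coalg by (simp add: coalgebra_def)
  have b: "bilinear_map C C C (\<lambda>x y. vscale C (counit C x) y)" "bilinear_map C C C (\<lambda>x y. vscale C (counit C y) x)"
  proof -
    interpret V: vector_space "vscale C" by (rule is_vspace_vector_space[OF C_vspace])
    show "bilinear_map C C C (\<lambda>x y. vscale C (counit C x) y)" "bilinear_map C C C (\<lambda>x y. vscale C (counit C y) x)"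
      using lin by (auto simp: bilinear_map_def linear_map_def vs_scale[OF C_vspace] V.scale_right_distrib
          V.scale_left_distrib mult.commute)
  qed
  have l: "ra c eps = c" "la eps c = c" if c: "c \<in> K" for c
  proof -
    have "tlift C C (\<lambda>x y. vscale C (counit C x) y) (comul C c) = c"
      "tlift C C (\<lambda>x y. vscale C (counit C y) x) (comul C c) = c"
      using coalg c by (auto simp: coalgebra_def)
    then show "ra c eps = c" "la eps c = c"
      using tlift_rep[OF C_vspace C_vspace C_vspace b(1) rep[OF c]] tlift_rep[OF C_vspace C_vspace C_vspace b(2) rep[OF c]]
        rep(1)[OF c] by (auto simp: ra_def la_def eps_def cong: map_cong)
  qed
  show "eps \<star> f = f" if "f \<in> A"
    by (rule A_eqI) (use that l in \<open>auto simp: conv_closed eps_in conv_ra\<close>)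
  show "f \<star> eps = f" if "f \<in> A"
    by (rule A_eqI) (use that l in \<open>auto simp: conv_closed eps_in conv_la\<close>)
qed

lemma la_conv: "c \<in> K \<Longrightarrow> f \<in> A \<Longrightarrow> g \<in> A \<Longrightarrow> la (f \<star> g) c = la f (la g c)"
  by (rule A_separates) (simp_all add: la_in flip: conv_la, simp add: conv_la[symmetric] la_in conv_closed conv_assoc)

text \<open>The two actions commute because both sides paired with \<open>h\<close> are products of
  \<open>g\<close>, \<open>h\<close>, \<open>f\<close> in this order, bracketed differently.\<close>

lemma la_ra: "c \<in> K \<Longrightarrow> f \<in> A \<Longrightarrow> g \<in> A \<Longrightarrow> la f (ra c g) = ra (la f c) g"
proof (rule A_separates)
  fix h assume *: "c \<in> K" "f \<in> A" "g \<in> A" "h \<in> A"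
  have "h (la f (ra c g)) = (g \<star> (h \<star> f)) c"
    using conv_la[OF ra_in[OF *(1)] *(4)] conv_ra[OF *(1) conv_closed[OF *(4,2)]] by simp
  also have "\<dots> = ((g \<star> h) \<star> f) c" using * by (simp add: conv_assoc)
  also have "\<dots> = h (ra (la f c) g)"
    using conv_la[OF *(1) conv_closed[OF *(3,4)]] conv_ra[OF la_in[OF *(1)] *(4)] by simp
  finally show "h (la f (ra c g)) = h (ra (la f c) g)" .
qed (simp_all add: la_in ra_in)

lemma la_linear:
  assumes c: "c \<in> K" and f: "f \<in> A"
  shows "c' \<in> K \<Longrightarrow> la f (c + c') = la f c + la f c'" "la f (vscale C a c) = vscale C a (la f c)"
    "g \<in> A \<Longrightarrow> la (f + g) c = la f c + la g c" "la (fscale a f) c = vscale C a (la f c)"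
proof -
  have cv: "(h \<star> f) (x + y) = (h \<star> f) x + (h \<star> f) y" "(h \<star> f) (vscale C a x) = a * (h \<star> f) x"
    if "h \<in> A" "x \<in> K" "y \<in> K" for h x y a
    using conv_closed[OF that(1) f] that by (simp_all add: A_simps)
  show "la f (c + c') = la f c + la f c'" if "c' \<in> K"
    using c f that cv
    by (intro A_separates) (simp_all add: la_in vs_add[OF C_vspace] A_simps(1) conv_la[symmetric] conv_closed)
  show "la f (vscale C a c) = vscale C a (la f c)"
    using c f cv(2)[OF _ c c]
    by (intro A_separates) (simp_all add: la_in vs_scale[OF C_vspace] A_simps(3) conv_la[symmetric] conv_closed)
  show "la (f + g) c = la f c + la g c" if "g \<in> A"
    using c f that
    by (intro A_separates) (simp_all add: la_in vs_add[OF C_vspace] A_simps(1) conv_la[symmetric] conv_add_right)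
  show "la (fscale a f) c = vscale C a (la f c)"
    using c f
    by (intro A_separates)
      (simp_all add: la_in vs_scale[OF C_vspace] A_simps(3) conv_la[symmetric] conv_scale_right, simp add: fscale_def)
qed

lemma ra_linear:
  assumes c: "c \<in> K" and f: "f \<in> A"
  shows "c' \<in> K \<Longrightarrow> ra (c + c') f = ra c f + ra c' f" "ra (vscale C a c) f = vscale C a (ra c f)"
proof -
  have cv: "(f \<star> h) (x + y) = (f \<star> h) x + (f \<star> h) y" "(f \<star> h) (vscale C a x) = a * (f \<star> h) x"
    if "h \<in> A" "x \<in> K" "y \<in> K" for h x y a
    using conv_closed[OF f that(1)] that by (simp_all add: A_simps)
  show "ra (c + c') f = ra c f + ra c' f" if "c' \<in> K"
    using c f that cv
    by (intro A_separates) (simp_all add: ra_in vs_add[OF C_vspace] A_simps(1) conv_ra[symmetric] conv_closed)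
  show "ra (vscale C a c) f = vscale C a (ra c f)"
    using c f cv(2)[OF _ c c]
    by (intro A_separates) (simp_all add: ra_in vs_scale[OF C_vspace] A_simps(3) conv_ra[symmetric] conv_closed)
qed

lemma la_zero: "f \<in> A \<Longrightarrow> la f 0 = 0"
  using la_linear(2)[of 0 f 0] vs_zero[OF C_vspace] by (simp add: scale_zero)

lemma la_eps: "c \<in> K \<Longrightarrow> la eps c = c"
  by (rule A_separates) (simp_all add: la_in conv_la[symmetric] conv_eps)

definition stable :: "'c set \<Rightarrow> bool" where
  "stable S \<longleftrightarrow> S \<subseteq> K \<and> module.subspace (vscale C) S \<and> (\<forall>f\<in>A. \<forall>c\<in>S. la f c \<in> S)"

text \<open>The slices of \<open>comul C c\<close> in the right factor are the elements
  \<open>la h c\<close>. This carries the chain condition, assumed for right coideals, over to the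
  submodules that define the coradical.\<close>

lemma stable_right_coideal:
  assumes S: "stable S" shows "right_coideal C S"
  unfolding right_coideal_def
proof (intro conjI ballI)
  show sub: "S \<subseteq> K" "module.subspace (vscale C) S" using S by (auto simp: stable_def)
  fix c assume c: "c \<in> S"
  show "comul C c \<in> vcarrier (tensor_space (C\<lparr>vcarrier := S\<rparr>) C)"
  proof (rule tensor_in_left[OF C_vspace C_vspace comul_in sub(2), where E = "Collect (lfun C)"])
    show "c \<in> K" using c sub by auto
    show "x = 0" if "\<And>g. g \<in> Collect (lfun C) \<Longrightarrow> g x = 0" for x
      using that functionals_separate[OF is_vspace_vector_space[OF C_vspace]] by blast
    fix g assume "g \<in> Collect (lfun C)"
    then have g: "lfun C g" by simp
    define h where "h = (\<lambda>x. if x \<in> K then g x else 0)"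
    have h: "h \<in> A" unfolding h_def by (rule A_ambient[OF g])
    have "comul C c (f, g) = f (la h c)" if f: "lfun C f" for f
    proof -
      define f' where "f' = (\<lambda>x. if x \<in> K then f x else 0)"
      have f': "f' \<in> A" unfolding f'_def by (rule A_ambient[OF f])
      have "(f' \<star> h) c = comul C c (f, g)"
        using c sub by (intro conv_eval f g) (auto simp: f'_def h_def)
      then show ?thesis using conv_la[OF \<open>c \<in> K\<close> f', of h] la_in[OF \<open>c \<in> K\<close>, of h] by (simp add: f'_def)
    qed
    moreover have "la h c \<in> S" using S h c by (auto simp: stable_def)
    ultimately show "\<exists>x\<in>S. \<forall>f. lfun C f \<longrightarrow> comul C c (f, g) = f x" by blast
  qed simp
qed

lemma dual_action_la:
  assumes "f \<in> A" "c \<in> K" shows "dual_action C f c = la f c"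
proof -
  interpret V: vector_space "vscale C" by (rule is_vspace_vector_space[OF C_vspace])
  have "bilinear_map C C C (\<lambda>x y. vscale C (f y) x)"
    using assms(1) by (auto simp: bilinear_map_def linear_map_def vs_scale[OF C_vspace] V.scale_right_distrib
        V.scale_left_distrib mult.commute A_simps)
  from tlift_rep[OF C_vspace C_vspace C_vspace this rep[OF assms(2)]]
  show ?thesis by (simp add: dual_action_def la_def)
qed

lemma dual_submodule_iff: "dual_submodule C S \<longleftrightarrow> stable S"
  unfolding dual_submodule_def stable_def using dual_action_la by (metis subsetD)

end

subsection \<open>Chain coalgebras of type \<open>D\<close>\<close>

context coalg_dual
begin

lemma stableD: "stable S \<Longrightarrow> S \<subseteq> K" "stable S \<Longrightarrow> module.subspace (vscale C) S"
  "stable S \<Longrightarrow> f \<in> A \<Longrightarrow> c \<in> S \<Longrightarrow> la f c \<in> S"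
  by (auto simp: stable_def)

lemma stable_closed:
  assumes "stable S"
  shows "0 \<in> S" "x \<in> S \<Longrightarrow> y \<in> S \<Longrightarrow> x + y \<in> S" "x \<in> S \<Longrightarrow> y \<in> S \<Longrightarrow> x - y \<in> S" "x \<in> S \<Longrightarrow> vscale C a x \<in> S"
proof -
  interpret V: vector_space "vscale C" by (rule is_vspace_vector_space[OF C_vspace])
  note S = stableD(2)[OF assms]
  show "0 \<in> S" "x \<in> S \<Longrightarrow> y \<in> S \<Longrightarrow> x + y \<in> S" "x \<in> S \<Longrightarrow> y \<in> S \<Longrightarrow> x - y \<in> S" "x \<in> S \<Longrightarrow> vscale C a x \<in> S"
    using V.subspace_0[OF S] V.subspace_add[OF S] V.subspace_diff[OF S] V.subspace_scale[OF S] by blast+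
qed

lemma stableI:
  assumes "S \<subseteq> K" "0 \<in> S" "\<And>x y. x \<in> S \<Longrightarrow> y \<in> S \<Longrightarrow> x + y \<in> S" "\<And>a x. x \<in> S \<Longrightarrow> vscale C a x \<in> S"
    "\<And>f x. f \<in> A \<Longrightarrow> x \<in> S \<Longrightarrow> la f x \<in> S"
  shows "stable S"
proof -
  interpret V: vector_space "vscale C" by (rule is_vspace_vector_space[OF C_vspace])
  show ?thesis using assms by (auto simp: stable_def V.subspace_def)
qed

lemma stable_zero: "stable {0}"
  by (rule stableI) (auto simp: scale_zero la_zero vs_zero[OF C_vspace])

definition simple :: "'c set \<Rightarrow> bool" where
  "simple S \<longleftrightarrow> stable S \<and> S \<noteq> {0} \<and> (\<forall>S'. stable S' \<and> S' \<subseteq> S \<longrightarrow> S' = {0} \<or> S' = S)"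

lemma simple_iff: "simple_dual_submodule C S \<longleftrightarrow> simple S"
  by (simp add: simple_dual_submodule_def simple_def dual_submodule_iff)

text \<open>The cyclic submodule of \<open>c\<close>. It is finite-dimensional, being spanned by the
  left factors of \<open>rep c\<close> (\<open>orb_finite\<close>).\<close>

definition orb :: "'c \<Rightarrow> 'c set" where
  "orb c = (\<lambda>f. la f c) ` A"

lemma orb_self: "c \<in> K \<Longrightarrow> c \<in> orb c"
  unfolding orb_def using la_eps eps_in by (metis imageI)

lemma orb_stable: assumes c: "c \<in> K" shows "stable (orb c)"
proof (rule stableI)
  show "orb c \<subseteq> K" using la_in[OF c] by (auto simp: orb_def)
  have "la 0 c = 0" using la_linear(4)[OF c A_closed(1), of 0] by (simp add: scale_zero fscale_def zero_fun_def)
  then show "0 \<in> orb c" using A_closed(1) by (auto simp: orb_def intro: rev_image_eqI)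
  show "x + y \<in> orb c" if "x \<in> orb c" "y \<in> orb c" for x y
    using that la_linear(3)[OF c] A_closed(2) by (auto simp: orb_def image_iff) metis
  show "vscale C a x \<in> orb c" if "x \<in> orb c" for x a
    using that la_linear(4)[OF c] A_closed(4) by (auto simp: orb_def image_iff) metis
  show "la f x \<in> orb c" if "f \<in> A" "x \<in> orb c" for f x
    using that la_conv[OF c] conv_closed by (auto simp: orb_def image_iff) metis
qed

lemma orb_subset: "stable S \<Longrightarrow> c \<in> S \<Longrightarrow> orb c \<subseteq> S"
  by (auto simp: orb_def stableD)

lemma orb_finite: "c \<in> K \<Longrightarrow> orb c \<subseteq> module.span (vscale C) (fst ` set (rep c))"
proof -
  interpret V: vector_space "vscale C" by (rule is_vspace_vector_space[OF C_vspace])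
  have "(\<Sum>p\<leftarrow>ps. vscale C (f (snd p)) (fst p)) \<in> V.span (fst ` set ps)" for f :: "'c \<Rightarrow> 'k" and ps
  proof (induction ps)
    case (Cons p ps)
    have "V.span (fst ` set ps) \<subseteq> V.span (fst ` set (p # ps))" by (rule V.span_mono) auto
    then show ?case using Cons by (auto intro!: V.span_add V.span_scale intro: V.span_base)
  qed (simp add: V.span_zero)
  then show ?thesis by (auto simp: orb_def la_def)
qed

text \<open>Right translation by \<open>f\<close> commutes with \<open>la\<close>, so it is a
  homomorphism of left modules; images and preimages of submodules are submodules.\<close>

lemma ra_image_stable:
  assumes S: "stable S" and f: "f \<in> A" shows "stable ((\<lambda>c. ra c f) ` S)"
proof (rule stableI)
  have SK: "S \<subseteq> K" by (rule stableD[OF S])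
  then show "(\<lambda>c. ra c f) ` S \<subseteq> K" using ra_in by auto
  have "ra 0 f = 0" using ra_linear(2)[of 0 f 0] vs_zero[OF C_vspace] f by (simp add: scale_zero)
  then show "0 \<in> (\<lambda>c. ra c f) ` S" using stable_closed(1)[OF S] by (metis imageI)
  show "x + y \<in> (\<lambda>c. ra c f) ` S" if xy: "x \<in> (\<lambda>c. ra c f) ` S" "y \<in> (\<lambda>c. ra c f) ` S" for x y
  proof -
    obtain u v where "u \<in> S" "v \<in> S" "x = ra u f" "y = ra v f" using xy by auto
    moreover from this have "ra (u + v) f = x + y" using ra_linear(1)[of u f v] SK f by (metis subsetD)
    ultimately show ?thesis using stable_closed(2)[OF S] by (metis imageI)
  qed
  show "vscale C a x \<in> (\<lambda>c. ra c f) ` S" if x: "x \<in> (\<lambda>c. ra c f) ` S" for x a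
  proof -
    obtain u where "u \<in> S" "x = ra u f" using x by auto
    moreover from this have "ra (vscale C a u) f = vscale C a x" using ra_linear(2)[of u f a] SK f by (metis subsetD)
    ultimately show ?thesis using stable_closed(4)[OF S] by (metis imageI)
  qed
  show "la g x \<in> (\<lambda>c. ra c f) ` S" if g: "g \<in> A" and x: "x \<in> (\<lambda>c. ra c f) ` S" for g x
  proof -
    obtain u where "u \<in> S" "x = ra u f" using x by auto
    moreover from this have "ra (la g u) f = la g x" using la_ra[of u g f] SK f g by (metis subsetD)
    ultimately show ?thesis using stableD(3)[OF S g] by (metis imageI)
  qed
qed

lemma ra_preimage_stable:
  assumes S: "stable S" and S': "stable S'" and f: "f \<in> A" shows "stable {c \<in> S. ra c f \<in> S'}"
proof (rule stableI)
  have SK: "S \<subseteq> K" by (rule stableD[OF S])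
  have "ra 0 f = 0" using ra_linear(2)[of 0 f 0] vs_zero[OF C_vspace] f by (simp add: scale_zero)
  then show "0 \<in> {c \<in> S. ra c f \<in> S'}" using stable_closed(1) S S' by simp
  fix x assume "x \<in> {c \<in> S. ra c f \<in> S'}"
  then have x: "x \<in> S" "ra x f \<in> S'" "x \<in> K" using SK by auto
  show "x + y \<in> {c \<in> S. ra c f \<in> S'}" if "y \<in> {c \<in> S. ra c f \<in> S'}" for y
  proof -
    have y: "y \<in> S" "ra y f \<in> S'" "y \<in> K" using that SK by auto
    then show ?thesis using x ra_linear(1)[OF x(3) f y(3)] stable_closed(2)[OF S] stable_closed(2)[OF S'] by simp
  qed
  show "vscale C a x \<in> {c \<in> S. ra c f \<in> S'}" for a
    using x ra_linear(2)[OF x(3) f] stable_closed(4)[OF S] stable_closed(4)[OF S'] by simp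
  show "la g x \<in> {c \<in> S. ra c f \<in> S'}" if "g \<in> A" for g
    using x la_ra[OF x(3) that f, symmetric] stableD(3)[OF S that] stableD(3)[OF S' that] by simp
qed (use stableD[OF S] in auto)

end

section \<open>The coradical as the unique simple right coideal\<close>

locale chain_of_type = coalg_dual C for C :: "('k::field, 'c::ab_group_add) coalg" +
  fixes s :: "'k \<Rightarrow> 'd::division_ring \<Rightarrow> 'd"
  assumes fd: "fd_division_algebra s" and chain: "chain_coalgebra C" and type_D: "of_type C s"
begin

abbreviation "C0 \<equiv> coradical C"
abbreviation "C0r \<equiv> C\<lparr>vcarrier := C0\<rparr>"

lemma stable_chain: "stable S \<Longrightarrow> stable S' \<Longrightarrow> S \<subseteq> S' \<or> S' \<subseteq> S"
  using chain stable_right_coideal by (auto simp: chain_coalgebra_def)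

lemma simple_unique: "simple S \<Longrightarrow> simple S' \<Longrightarrow> S = S'"
  unfolding simple_def using stable_chain by metis

text \<open>Two simple submodules are comparable, hence equal. If there were none, the coradical
  would be 0 and so would be its dual, which is in bijection with \<open>D\<close>, where 0 and 1
  differ.\<close>

lemma simple_C0: "simple C0" and C0_unique: "simple S \<Longrightarrow> S = C0"
proof -
  interpret V: vector_space "vscale C" by (rule is_vspace_vector_space[OF C_vspace])
  have "\<exists>S. simple S"
  proof (rule ccontr)
    assume "\<not> ?thesis"
    then have "C0 = V.span {}" unfolding coradical_def simple_iff by simp
    then have C0: "C0 = {0}" by simp
    obtain \<phi> where \<phi>: "bij_betw \<phi> (vcarrier (dual_space C0r)) (UNIV :: 'd set)"
      using type_D unfolding of_type_def Let_def by blast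
    have "f = 0" if "f \<in> vcarrier (dual_space C0r)" for f
    proof (rule dual_space_separated[OF that])
      have "is_vspace C0r" unfolding C0 by (rule is_vspace_restrict[OF C_vspace]) (rule stableD(2)[OF stable_zero])
      then have "f 0 = 0" using linear_map_zero[OF _ is_vspace_ground dual_in_linear_map[OF that]] by blast
      then show "f x = 0" if "x \<in> vcarrier C0r" for x using that C0 by simp
    qed
    then have "UNIV = {\<phi> 0} \<or> UNIV = ({} :: 'd set)" using \<phi> unfolding bij_betw_def by auto
    then have "(0 :: 'd) = 1" by (metis UNIV_I emptyE singletonD)
    then show False by simp
  qed
  then obtain S where S: "simple S" by blast
  then have "{S'. simple S'} = {S}" using simple_unique by blast
  then have "C0 = V.span (\<Union>{S})" by (simp add: coradical_def simple_iff)
  then have "C0 = S" using S by (simp add: simple_def stable_def V.span_eq_iff)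
  then show "simple C0" using S by simp
  show "simple S \<Longrightarrow> S = C0" for S using \<open>simple C0\<close> simple_unique by blast
qed

lemma C0_stable: "stable C0"
  using simple_C0 by (simp add: simple_def)

lemma C0_K: "c \<in> C0 \<Longrightarrow> c \<in> K"
  using stableD(1)[OF C0_stable] by auto

text \<open>The right translate of the unique simple right coideal is zero or simple.\<close>

lemma C0_ra: assumes c: "c \<in> C0" and f: "f \<in> A" shows "ra c f \<in> C0"
proof (cases "(\<lambda>c. ra c f) ` C0 = {0}")
  case True
  then have "ra c f = 0" using c by blast
  then show ?thesis using stable_closed(1)[OF C0_stable] by simp
next
  case False
  let ?S = "(\<lambda>c. ra c f) ` C0"
  have "simple ?S"
    unfolding simple_def
  proof (intro conjI allI impI False ra_image_stable[OF C0_stable f])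
    fix S' assume S': "stable S' \<and> S' \<subseteq> ?S"
    have "stable {c \<in> C0. ra c f \<in> S'}" using S' by (intro ra_preimage_stable C0_stable f) auto
    then have "{c \<in> C0. ra c f \<in> S'} = {0} \<or> {c \<in> C0. ra c f \<in> S'} = C0"
      using simple_C0 unfolding simple_def by blast
    then show "S' = {0} \<or> S' = ?S"
    proof
      assume *: "{c \<in> C0. ra c f \<in> S'} = {0}"
      have "ra 0 f = 0" using ra_linear(2)[of 0 f 0] vs_zero[OF C_vspace] f by (simp add: scale_zero)
      have "x = 0" if x: "x \<in> S'" for x
      proof -
        obtain u where u: "u \<in> C0" "x = ra u f" using x S' by auto
        then have "u \<in> {c \<in> C0. ra c f \<in> S'}" using x by simp
        then show ?thesis using u(2) * \<open>ra 0 f = 0\<close> by simp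
      qed
      then show ?thesis using S' stable_closed(1)[of S'] by auto
    next
      assume "{c \<in> C0. ra c f \<in> S'} = C0"
      then have "?S \<subseteq> S'" by auto
      then show ?thesis using S' by simp
    qed
  qed
  then have "?S = C0" by (rule C0_unique)
  then show ?thesis using c by blast
qed

lemma C0r_vspace: "is_vspace C0r"
  by (rule is_vspace_restrict[OF C_vspace stableD(2)[OF C0_stable]])

text \<open>Stability under \<open>la\<close> places the left factor in the coradical, stability
  under \<open>ra\<close> the right factor.\<close>

lemma comul_C0:
  assumes c: "c \<in> C0" shows "comul C c \<in> vcarrier (tensor_space C0r C0r)"
proof -
  have cK: "c \<in> K" by (rule C0_K[OF c])
  have 1: "comul C c \<in> vcarrier (tensor_space C0r C)"
    using stable_right_coideal[OF C0_stable] c by (simp add: right_coideal_def)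
  show ?thesis
  proof (rule tensor_in_right[OF C0r_vspace C_vspace 1 stableD(2)[OF C0_stable], where E = "Collect (lfun C)"])
    show "lfun C0r g" if "g \<in> Collect (lfun C)" for g using that by simp
    show "x = 0" if "\<And>g. g \<in> Collect (lfun C) \<Longrightarrow> g x = 0" for x
      using that functionals_separate[OF is_vspace_vector_space[OF C_vspace]] by blast
    fix f assume "f \<in> Collect (lfun C)"
    then have f: "lfun C f" by simp
    define h where "h = (\<lambda>x. if x \<in> K then f x else 0)"
    have h: "h \<in> A" unfolding h_def by (rule A_ambient[OF f])
    have "comul C c (f, g) = g (ra c h)" if g: "lfun C g" for g
    proof -
      define g' where "g' = (\<lambda>x. if x \<in> K then g x else 0)"
      have g': "g' \<in> A" unfolding g'_def by (rule A_ambient[OF g])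
      have "(h \<star> g') c = comul C c (f, g)"
        using cK by (intro conv_eval f g) (auto simp: g'_def h_def)
      then show ?thesis using conv_ra[OF cK g', of h] ra_in[OF cK, of h] by (simp add: g'_def)
    qed
    then show "\<exists>x\<in>C0. \<forall>g. lfun C g \<longrightarrow> comul C c (f, g) = g x" using C0_ra[OF c h] by blast
  qed
qed

definition res :: "('c \<Rightarrow> 'k) \<Rightarrow> 'c \<Rightarrow> 'k" where
  "res f = (\<lambda>c. if c \<in> C0 then f c else 0)"

lemma res_dual: "f \<in> A \<Longrightarrow> res f \<in> vcarrier (dual_space C0r)"
proof -
  assume "f \<in> A"
  then have "linear_map C0r ground f" using C0_K by (simp add: linear_map_def A_simps)
  from dual_space_restrict[OF C0r_vspace this] show ?thesis by (simp add: res_def cong: if_cong)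
qed

lemma res_conv:
  assumes f: "f \<in> A" and g: "g \<in> A"
  shows "convolution C0r (res f) (res g) = res (f \<star> g)"
proof
  fix c show "convolution C0r (res f) (res g) c = res (f \<star> g) c"
  proof (cases "c \<in> C0")
    case True
    obtain ps where ps: "\<forall>p\<in>set ps. fst p \<in> vcarrier C0r \<and> snd p \<in> vcarrier C0r"
      "comul C c = (\<Sum>p\<leftarrow>ps. tens C0r C0r (fst p) (snd p))"
      by (rule tensor_rep[OF C0r_vspace C0r_vspace comul_C0[OF True]])
    have b: "bilinear_map C0r C0r ground (\<lambda>x y. res f x * res g y)"
      using dual_in_linear_map[OF res_dual[OF f]] dual_in_linear_map[OF res_dual[OF g]]
      by (simp add: bilinear_map_def linear_map_def algebra_simps)
    obtain f' where f': "lfun C f'" "\<And>x. x \<in> K \<Longrightarrow> f' x = f x"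
      using functional_extension[OF C_vspace dual_in_linear_map[OF f]] by blast
    obtain g' where g': "lfun C g'" "\<And>x. x \<in> K \<Longrightarrow> g' x = g x"
      using functional_extension[OF C_vspace dual_in_linear_map[OF g]] by blast
    have "convolution C0r (res f) (res g) c = (\<Sum>p\<leftarrow>ps. res f (fst p) * res g (snd p))"
      unfolding convolution_def using True tlift_rep[OF C0r_vspace C0r_vspace is_vspace_ground b ps] by simp
    also have "\<dots> = (\<Sum>p\<leftarrow>ps. f' (fst p) * g' (snd p))"
      using ps(1) f'(2) g'(2) C0_K by (intro arg_cong[of _ _ sum_list] map_cong refl) (auto simp: res_def)
    also have "\<dots> = comul C c (f', g')"
      unfolding ps(2) tens_update by (rule tensor_rep_apply[symmetric, OF f'(1) g'(1)])
    also have "\<dots> = (f \<star> g) c"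
      using C0_K[OF True] f' g' by (intro conv_eval[symmetric]) auto
    finally show ?thesis using True by (simp add: res_def)
  qed (simp add: convolution_def res_def)
qed

text \<open>The inverse of the isomorphism in the definition of type, which is the direction needed
  for lifting elements of \<open>D\<close> to functionals on \<open>C\<close>.\<close>

lemma type_iso:
  obtains \<psi> :: "'d \<Rightarrow> 'c \<Rightarrow> 'k" where "\<And>d. \<psi> d \<in> vcarrier (dual_space C0r)"
    "\<And>d e. \<psi> (d + e) = \<psi> d + \<psi> e" "\<And>a d. \<psi> (s a d) = fscale a (\<psi> d)"
    "\<And>d e. \<psi> (d * e) = convolution C0r (\<psi> d) (\<psi> e)" "\<psi> 1 = res eps"
    "\<And>f. f \<in> vcarrier (dual_space C0r) \<Longrightarrow> \<exists>d. f = \<psi> d" "inj \<psi>"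
proof -
  obtain \<phi> where \<phi>: "linear_map (dual_space C0r) (full_space s) \<phi>" "bij_betw \<phi> (vcarrier (dual_space C0r)) UNIV"
    "\<And>f g. f \<in> vcarrier (dual_space C0r) \<Longrightarrow> g \<in> vcarrier (dual_space C0r) \<Longrightarrow> \<phi> (convolution C0r f g) = \<phi> f * \<phi> g"
    "\<phi> (convolution_one C0r) = 1"
    using type_D unfolding of_type_def Let_def by blast
  let ?DC = "vcarrier (dual_space C0r)"
  define \<psi> where "\<psi> = inv_into ?DC \<phi>"
  have \<psi>: "\<psi> d \<in> ?DC" "\<phi> (\<psi> d) = d" for d
    using \<phi>(2) inv_into_into[of d \<phi> ?DC] f_inv_into_f[of d \<phi> ?DC] unfolding \<psi>_def bij_betw_def by auto
  have \<psi>\<phi>: "f = \<psi> d" if "f \<in> ?DC" "\<phi> f = d" for f d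
    using that \<phi>(2) unfolding \<psi>_def bij_betw_def by auto
  have DV: "is_vspace (dual_space C0r)" by (rule is_vspace_dual[OF C0r_vspace])
  \<comment> \<open>That a product of functionals on the coradical is again linear is known through
    extensions to \<open>C\<close>, by \<open>res_conv\<close>.\<close>
  have res_surj: "\<exists>g\<in>A. f = res g" if f: "f \<in> ?DC" for f
  proof -
    obtain g where g: "lfun C0r g" "\<And>x. x \<in> vcarrier C0r \<Longrightarrow> g x = f x"
      using functional_extension[OF C0r_vspace dual_in_linear_map[OF f]] by blast
    have "(\<lambda>x. if x \<in> K then g x else 0) \<in> A" using g(1) by (intro A_ambient) simp
    moreover have "f = res (\<lambda>x. if x \<in> K then g x else 0)"
      using g(2) C0_K f by (auto simp: fun_eq_iff res_def dual_space_def)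
    ultimately show ?thesis by blast
  qed
  show ?thesis
  proof (rule that[of \<psi>])
    show "\<psi> d \<in> ?DC" for d by (rule \<psi>)
    show "\<psi> (d + e) = \<psi> d + \<psi> e" for d e
      using \<phi>(1) \<psi> vs_add[OF DV] by (intro \<psi>\<phi>[symmetric]) (auto simp: linear_map_def)
    show "\<psi> (s a d) = fscale a (\<psi> d)" for a d
      using \<phi>(1) \<psi> vs_scale[OF DV] by (intro \<psi>\<phi>[symmetric]) (auto simp: linear_map_def fda_simps[OF fd])
    show "\<psi> (d * e) = convolution C0r (\<psi> d) (\<psi> e)" for d e
    proof -
      obtain f g where fg: "f \<in> A" "\<psi> d = res f" "g \<in> A" "\<psi> e = res g" using res_surj[OF \<psi>(1)] by metis
      have "convolution C0r (\<psi> d) (\<psi> e) \<in> ?DC"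
        using fg by (simp add: res_conv res_dual conv_closed)
      then show ?thesis using \<phi>(3)[OF \<psi>(1) \<psi>(1)] \<psi>(2) by (intro \<psi>\<phi>[symmetric]) auto
    qed
    have "convolution_one C0r = res eps"
      using C0_K by (auto simp: convolution_one_def res_def eps_def fun_eq_iff)
    then show "\<psi> 1 = res eps" using \<phi>(4) res_dual[OF eps_in] by (intro \<psi>\<phi>[symmetric]) auto
    show "\<exists>d. f = \<psi> d" if "f \<in> ?DC" for f using \<psi>\<phi>[OF that refl] by blast
    show "inj \<psi>" by (metis \<psi>(2) injI)
  qed
qed

section \<open>The ideal \<open>J\<close> and the coradical filtration\<close>

definition J :: "('c \<Rightarrow> 'k) set" where
  "J = {f \<in> A. \<forall>c\<in>C0. f c = 0}"

lemma J_A: "f \<in> J \<Longrightarrow> f \<in> A"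
  by (simp add: J_def)

lemma J_ideal: "f \<in> J \<Longrightarrow> a \<in> A \<Longrightarrow> f \<star> a \<in> J" "f \<in> J \<Longrightarrow> a \<in> A \<Longrightarrow> a \<star> f \<in> J"
proof -
  assume f: "f \<in> J" and a: "a \<in> A"
  have "(f \<star> a) c = 0" "(a \<star> f) c = 0" if "c \<in> C0" for c
    using f conv_la[OF C0_K[OF that], of f a] conv_ra[OF C0_K[OF that], of f a]
      stableD(3)[OF C0_stable a that] C0_ra[OF that a] by (simp_all add: J_def)
  then show "f \<star> a \<in> J" "a \<star> f \<in> J" using f a by (simp_all add: J_def conv_closed)
qed

lemma J_closed: "f \<in> J \<Longrightarrow> g \<in> J \<Longrightarrow> f + g \<in> J" "f \<in> J \<Longrightarrow> g \<in> J \<Longrightarrow> f - g \<in> J" "0 \<in> J"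
  using A_closed by (auto simp: J_def)

lemma J_C0: "c \<in> K \<Longrightarrow> (\<And>j. j \<in> J \<Longrightarrow> j c = 0) \<Longrightarrow> c \<in> C0"
proof (rule ccontr)
  assume c: "c \<in> K" "\<And>j. j \<in> J \<Longrightarrow> j c = 0" "c \<notin> C0"
  obtain f where f: "lfun C f" "\<forall>x\<in>C0. f x = 0" "f c \<noteq> 0"
    by (rule subspace_functional[OF C_vspace stableD(2)[OF C0_stable] c(3)])
  have "(\<lambda>x. if x \<in> K then f x else 0) \<in> J"
    using A_ambient[OF f(1)] f(2) by (simp add: J_def)
  from c(2)[OF this] show False using f(3) c(1) by simp
qed

lemma la_J_C0: "j \<in> J \<Longrightarrow> c \<in> C0 \<Longrightarrow> la j c = 0"
  by (rule A_separates)
    (use J_ideal(2) C0_K in \<open>auto simp: la_in vs_zero[OF C_vspace] A_zero conv_la[symmetric] J_def\<close>)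

text \<open>Products of \<open>n\<close> elements of \<open>J\<close>, starting from an arbitrary
  factor. Only their annihilators matter, so no spans are taken; this makes every member an explicit
  product in inductions.\<close>

fun P :: "nat \<Rightarrow> ('c \<Rightarrow> 'k) set" where
  "P 0 = A"
| "P (Suc n) = {q \<star> j |q j. q \<in> P n \<and> j \<in> J}"

lemma P_A: "p \<in> P n \<Longrightarrow> p \<in> A"
  by (induction n arbitrary: p) (auto intro: conv_closed J_A)

lemma P_right: "p \<in> P n \<Longrightarrow> a \<in> A \<Longrightarrow> p \<star> a \<in> P n"
proof (induction n arbitrary: p a)
  case (Suc n)
  then obtain q j where qj: "p = q \<star> j" "q \<in> P n" "j \<in> J" by auto
  then have "p \<star> a = q \<star> (j \<star> a)" using Suc.prems by (simp add: conv_assoc P_A J_A)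
  then show ?case using qj Suc.prems J_ideal by auto
qed (simp add: conv_closed)

lemma P_mult: "p \<in> P m \<Longrightarrow> q \<in> P n \<Longrightarrow> p \<star> q \<in> P (m + n)"
proof (induction n arbitrary: q)
  case 0
  then show ?case by (simp add: P_right)
next
  case (Suc n)
  then obtain r j where rj: "q = r \<star> j" "r \<in> P n" "j \<in> J" by auto
  then have "p \<star> q = (p \<star> r) \<star> j" using Suc.prems(1) by (simp add: conv_assoc P_A J_A)
  then show ?case using rj Suc.IH[OF Suc.prems(1) rj(2)] by auto
qed

lemma J_P: "j \<in> J \<Longrightarrow> j \<in> P (Suc 0)"
  using eps_in conv_eps(1)[OF J_A] by force

lemma P_J: "p \<in> P (Suc n) \<Longrightarrow> p \<in> J"
  by (auto intro: J_ideal P_A)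

lemma P_mono: "p \<in> P (Suc n) \<Longrightarrow> p \<in> P n"
  using P_right J_A by auto

text \<open>The annihilator of the \<open>n\<close>-th power of \<open>J\<close>: the coradical
  filtration with its index shifted by one, so that \<open>W 0\<close> is zero and
  \<open>W (Suc 0)\<close> is the coradical.\<close>

definition W :: "nat \<Rightarrow> 'c set" where
  "W n = {c \<in> K. \<forall>p\<in>P n. p c = 0}"

lemma W_K: "c \<in> W n \<Longrightarrow> c \<in> K"
  by (simp add: W_def)

lemma W_mono: "m \<le> n \<Longrightarrow> W m \<subseteq> W n"
proof (induction rule: dec_induct)
  case (step n)
  have "W n \<subseteq> W (Suc n)" unfolding W_def using P_mono by blast
  then show ?case using step.IH by blast
qed simp

lemma W_1: "W (Suc 0) = C0"
proof
  show "W (Suc 0) \<subseteq> C0" unfolding W_def using J_P J_C0 by blast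
  show "C0 \<subseteq> W (Suc 0)" unfolding W_def using P_J C0_K by (auto simp: J_def simp del: P.simps)
qed

lemma W_stable: "stable (W n)"
proof (rule stableI)
  show "la f x \<in> W n" if "f \<in> A" "x \<in> W n" for f x
    using that P_right[of _ n f] by (auto simp: W_def la_in conv_la[symmetric] P_A)
qed (auto simp: W_def A_simps[OF P_A] A_zero[OF P_A] vs_zero[OF C_vspace] vs_add[OF C_vspace] vs_scale[OF C_vspace])

lemma P_left: "p \<in> P n \<Longrightarrow> a \<in> A \<Longrightarrow> a \<star> p \<in> P n"
  using P_mult[of a 0 p n] by simp

lemma W_ra: "c \<in> W n \<Longrightarrow> a \<in> A \<Longrightarrow> ra c a \<in> W n"
  using P_left[of _ n a] by (auto simp: W_def ra_in conv_ra[symmetric] P_A)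

text \<open>
  Nakayama's lemma: \<open>J\<close> moves every \<open>c \<noteq> 0\<close> into a proper subcoideal of the finite-dimensional
  coideal \<open>orb c\<close>. A relation \<open>j \<cdot> c = c\<close> would survive in the simple quotient of \<open>orb c\<close>, which a
  functional \<open>\<lambda>\<close> embeds into \<open>C\<close>, hence as \<open>C0\<close>, where \<open>J\<close> acts as zero.
\<close>

lemma J_decreases:
  assumes c: "c \<in> K" "c \<noteq> 0" and j: "j \<in> J" and jc: "la j c = c"
  shows False
proof -
  \<comment> \<open>The elements of \<open>orb c\<close> that do not generate it. They are closed
    under addition because \<open>orb x\<close> and \<open>orb y\<close> are comparable, so
    \<open>I\<close> is the largest proper submodule of \<open>orb c\<close>.\<close>
  define I where "I = {x \<in> orb c. c \<notin> orb x}"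
  have oK: "x \<in> K" if "x \<in> orb c" for x using that stableD(1)[OF orb_stable[OF c(1)]] by auto
  have I: "stable I"
  proof (rule stableI)
    show "I \<subseteq> K" using oK by (auto simp: I_def)
    have "orb 0 \<subseteq> {0}" using orb_subset[OF stable_zero] by simp
    then show "0 \<in> I" using c(2) stable_closed(1)[OF orb_stable[OF c(1)]] by (auto simp: I_def)
    fix x assume x: "x \<in> I"
    then have xK: "x \<in> K" and xo: "x \<in> orb c" using oK by (auto simp: I_def)
    show "x + y \<in> I" if y: "y \<in> I" for y
    proof -
      have yK: "y \<in> K" and yo: "y \<in> orb c" using y oK by (auto simp: I_def)
      have "orb (x + y) \<subseteq> orb x \<or> orb (x + y) \<subseteq> orb y"
        using stable_chain[OF orb_stable[OF xK] orb_stable[OF yK]] orb_self[OF xK] orb_self[OF yK]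
          stable_closed(2)[OF orb_stable[OF xK], of x y] stable_closed(2)[OF orb_stable[OF yK], of x y]
          orb_subset[OF orb_stable[OF xK], of "x + y"] orb_subset[OF orb_stable[OF yK], of "x + y"] by blast
      then show ?thesis using x y stable_closed(2)[OF orb_stable[OF c(1)] xo yo] by (auto simp: I_def)
    qed
    show "vscale C a x \<in> I" for a
      using orb_subset[OF orb_stable[OF xK], of "vscale C a x"] x stable_closed(4)[OF orb_stable[OF xK] orb_self[OF xK]]
        stable_closed(4)[OF orb_stable[OF c(1)] xo] by (auto simp: I_def)
    show "la f x \<in> I" if f: "f \<in> A" for f
      using orb_subset[OF orb_stable[OF xK], of "la f x"] x stableD(3)[OF orb_stable[OF xK] f orb_self[OF xK]]
        stableD(3)[OF orb_stable[OF c(1)] f xo] by (auto simp: I_def)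
  qed
  have "c \<notin> I" using orb_self[OF c(1)] by (simp add: I_def)
  then obtain f where f: "lfun C f" "\<forall>x\<in>I. f x = 0" "f c \<noteq> 0"
    using subspace_functional[OF C_vspace stableD(2)[OF I]] by blast
  define l where "l = (\<lambda>x. if x \<in> K then f x else 0)"
  have l: "l \<in> A" "\<And>x. x \<in> I \<Longrightarrow> l x = 0" "l c \<noteq> 0"
    using A_ambient[OF f(1)] f c(1) by (auto simp: l_def)
  have nz: "ra c l \<noteq> 0"
    using conv_ra[OF c(1) eps_in, of l] conv_eps(2)[OF l(1)] l(3) A_zero[OF eps_in] by auto
  \<comment> \<open>Right translation by \<open>l\<close> kills \<open>I\<close>, since
    \<open>l\<close> vanishes on this submodule, but not \<open>c\<close>; its image is therefore a
    copy of the simple quotient.\<close>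
  let ?S = "(\<lambda>x. ra x l) ` orb c"
  have "simple ?S"
    unfolding simple_def
  proof (intro conjI allI impI ra_image_stable[OF orb_stable[OF c(1)] l(1)])
    show "?S \<noteq> {0}" using nz orb_self[OF c(1)] by blast
    fix S' assume S': "stable S' \<and> S' \<subseteq> ?S"
    let ?T = "{x \<in> orb c. ra x l \<in> S'}"
    have T: "stable ?T" using S' by (intro ra_preimage_stable orb_stable c l) auto
    show "S' = {0} \<or> S' = ?S"
    proof (cases "c \<in> ?T")
      case True
      then have "orb c \<subseteq> ?T" by (rule orb_subset[OF T])
      then have "?S \<subseteq> S'" by auto
      then show ?thesis using S' by simp
    next
      case False
      have "ra x l = 0" if x: "x \<in> ?T" for x
      proof (rule A_separates)
        have "x \<in> I" using x False orb_subset[OF T x] by (auto simp: I_def)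
        then show "h (ra x l) = h 0" if "h \<in> A" for h
          using that l stableD(3)[OF I that] oK x by (simp add: conv_ra[symmetric] conv_la A_zero)
      qed (use x oK in \<open>auto simp: ra_in vs_zero[OF C_vspace]\<close>)
      then have "x = 0" if "x \<in> S'" for x using that S' by auto
      then show ?thesis using S' stable_closed(1)[of S'] by auto
    qed
  qed
  then have "ra c l \<in> C0" using C0_unique orb_self[OF c(1)] by blast
  then have "la j (ra c l) = 0" by (rule la_J_C0[OF j])
  moreover have "la j (ra c l) = ra c l" using la_ra[OF c(1) J_A[OF j] l(1)] jc by simp
  ultimately show False using nz by simp
qed

text \<open>Each factor from \<open>J\<close> shrinks the cyclic submodule:
  \<open>c = la a (la j c)\<close> would make \<open>c\<close> a fixed vector of an element of
  \<open>J\<close>, which \<open>J_decreases\<close> excludes. After as many factors as the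
  dimension of \<open>orb c\<close> nothing is left.\<close>

lemma P_kills:
  "c \<in> K \<Longrightarrow> vector_space.dim (vscale C) (orb c) \<le> n \<Longrightarrow> p \<in> P n \<Longrightarrow> la p c = 0"
proof (induction n arbitrary: c p)
  interpret V: vector_space "vscale C" by (rule is_vspace_vector_space[OF C_vspace])
  have less: "V.dim S < V.dim (orb c)" if "stable S" "S \<subseteq> orb c" "c \<notin> S" "c \<in> K" for S c
    by (rule subspace_dim_less[OF V.vector_space_axioms stableD(2)[OF that(1)] stableD(2)[OF orb_stable[OF that(4)]]
          _ _ orb_finite[OF that(4)]]) (use that orb_self in auto)
  {
    case 0
    have "c = 0"
    proof (rule ccontr)
      assume "c \<noteq> 0"
      then have "V.dim {0} < V.dim (orb c)"
        using 0 stable_closed(1)[OF orb_stable[OF 0(1)]] by (intro less stable_zero) auto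
      then show False using 0(2) by simp
    qed
    then show ?case using 0 la_zero by simp
  next
    case (Suc n)
    obtain q j where qj: "p = q \<star> j" "q \<in> P n" "j \<in> J" using Suc.prems by auto
    have eq: "la p c = la q (la j c)" using qj Suc.prems by (simp add: la_conv P_A J_A)
    show ?case
    proof (cases "c = 0")
      case True
      then show ?thesis using P_A[OF Suc.prems(3)] la_zero by simp
    next
      case False
      have jc: "la j c \<in> K" using Suc.prems la_in by simp
      have "c \<notin> orb (la j c)"
      proof
        assume "c \<in> orb (la j c)"
        then obtain a where a: "a \<in> A" "c = la a (la j c)" by (auto simp: orb_def)
        then have "la (a \<star> j) c = c" using Suc.prems qj by (simp add: la_conv J_A)
        then show False using J_decreases[OF Suc.prems(1) False] J_ideal(2)[OF qj(3) a(1)] by blast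
      qed
      moreover have "orb (la j c) \<subseteq> orb c"
        using orb_subset[OF orb_stable[OF Suc.prems(1)]] J_A[OF qj(3)] by (auto simp: orb_def)
      ultimately have "V.dim (orb (la j c)) < V.dim (orb c)"
        using Suc.prems by (intro less orb_stable jc) auto
      then show ?thesis unfolding eq using Suc jc qj(2) by (intro Suc.IH) auto
    qed
  }
qed

lemma exhaustive: "c \<in> K \<Longrightarrow> \<exists>n. c \<in> W n"
proof -
  assume c: "c \<in> K"
  let ?n = "vector_space.dim (vscale C) (orb c)"
  \<comment> \<open>The value \<open>p c\<close> is recovered from the action as
    \<open>eps (la p c)\<close>.\<close>
  have "p c = 0" if p: "p \<in> P ?n" for p
    using conv_la[OF c eps_in, of p] conv_eps(1)[OF P_A[OF p]] P_kills[OF c order_refl p] A_zero[OF eps_in] by simp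
  then show ?thesis using c by (auto simp: W_def)
qed

end

subsection \<open>Splitting off the coradical in the separable case\<close>

text \<open>\<open>es\<close> is an expression of the separability element
  \<open>\<sigma> 1\<close>. Its balancing property says that left and right multiplication by
  \<open>a\<close> agree on it, both giving \<open>\<sigma> a\<close>; it is stated for values of
  bilinear maps, which is the form used in the corrections below.\<close>

lemma separable_element:
  fixes s :: "'k::field \<Rightarrow> 'd::division_ring \<Rightarrow> 'd"
  assumes fd: "fd_division_algebra s" and sep: "separable s"
  obtains es :: "('d \<times> 'd) list" where "(\<Sum>p\<leftarrow>es. fst p * snd p) = 1"
    "\<forall>\<beta> a. bilinear_map (full_space s) (full_space s) (full_space (fscale :: 'k \<Rightarrow> ('u \<Rightarrow> 'k) \<Rightarrow> _)) \<beta> \<longrightarrow>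
      (\<Sum>p\<leftarrow>es. \<beta> (a * fst p) (snd p)) = (\<Sum>p\<leftarrow>es. \<beta> (fst p) (snd p * a))"
proof -
  let ?D = "full_space s"
  let ?T = "tensor_space ?D ?D"
  have D: "is_vspace ?D" by (rule fda_is_vspace[OF fd])
  have Dc: "vcarrier ?D = UNIV" by (simp add: full_space_def)
  note ml = fda_mult_left[OF fd] and mr = fda_mult_right[OF fd] and Ds = fda_simps(2)[OF fd]
  obtain \<sigma> where \<sigma>: "linear_map ?D ?T \<sigma>"
    "\<And>a x b. \<sigma> (a * x * b) = tlift ?D ?D (\<lambda>y z. tens ?D ?D (a * y) (z * b)) (\<sigma> x)"
    "\<And>x. tlift ?D ?D (*) (\<sigma> x) = x"
    using sep unfolding separable_def Let_def by blast
  have "\<sigma> 1 \<in> vcarrier ?T" using \<sigma>(1) by (simp add: linear_map_def Dc)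
  then obtain es where es: "\<forall>p\<in>set es. fst p \<in> vcarrier ?D \<and> snd p \<in> vcarrier ?D"
    "\<sigma> 1 = (\<Sum>p\<leftarrow>es. tens ?D ?D (fst p) (snd p))" by (rule tensor_rep[OF D D])
  have b1: "bilinear_map ?D ?D ?D (*)"
    unfolding bilinear_map_def linear_map_def Dc Ds by (simp add: ml mr distrib_left distrib_right)
  have one: "(\<Sum>p\<leftarrow>es. fst p * snd p) = 1"
    using tlift_rep[OF D D D b1 es] \<sigma>(3)[of 1] by simp
  have b2: "bilinear_map ?D ?D ?T (\<lambda>y z. tens ?D ?D (a * y) (z * b))" for a b
    unfolding bilinear_map_def linear_map_def vscale_tensor using tens_linear[OF D D, unfolded Ds]
    by (simp add: Ds Dc tens_in ml mr distrib_left distrib_right del: plus_fun_apply)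
  have e: "\<sigma> (a * 1 * b) = (\<Sum>p\<leftarrow>es. tens ?D ?D (a * fst p) (snd p * b))" for a b
    unfolding \<sigma>(2) by (rule tlift_rep[OF D D is_vspace_tensor b2 es])
  have bal: "(\<Sum>p\<leftarrow>es. \<beta> (a * fst p) (snd p)) = (\<Sum>p\<leftarrow>es. \<beta> (fst p) (snd p * a))"
    if \<beta>: "bilinear_map ?D ?D (full_space (fscale :: 'k \<Rightarrow> ('u \<Rightarrow> 'k) \<Rightarrow> _)) \<beta>" for \<beta> a
  proof -
    let ?U = "full_space (fscale :: 'k \<Rightarrow> ('u \<Rightarrow> 'k) \<Rightarrow> _)"
    have U: "is_vspace ?U" using module.subspace_UNIV[OF module_fscale]
      by (simp add: is_vspace_def full_space_def vector_space_fscale)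
    have 1: "tlift ?D ?D \<beta> (\<Sum>p\<leftarrow>map (\<lambda>p. (a * fst p, snd p * b)) es. tens ?D ?D (fst p) (snd p)) =
        (\<Sum>p\<leftarrow>map (\<lambda>p. (a * fst p, snd p * b)) es. \<beta> (fst p) (snd p))" for a b
      by (rule tlift_rep[OF D D U \<beta> _ refl]) (simp add: Dc)
    \<comment> \<open>Both sides are \<open>\<sigma> a\<close>, written once as
      \<open>\<sigma> (a * 1 * 1)\<close> and once as \<open>\<sigma> (1 * 1 * a)\<close>.\<close>
    have "(\<Sum>p\<leftarrow>es. tens ?D ?D (a * fst p) (snd p * 1)) = (\<Sum>p\<leftarrow>es. tens ?D ?D (1 * fst p) (snd p * a))"
      using e[of a 1] e[of 1 a] by simp
    then show ?thesis using 1[of a 1] 1[of 1 a] by (simp add: o_def)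
  qed
  show ?thesis by (rule that[of es]) (use one bal in auto)
qed

text \<open>The bookkeeping for a corrected lift: \<open>x\<close> is
  \<open>\<rho> a \<star> \<rho> b\<close>, \<open>y\<close> is \<open>\<rho> (a * b)\<close>,
  \<open>h\<close> is the correction at \<open>a * b\<close>, and \<open>gg\<close> is the product
  of the two corrections. The first-order terms \<open>d\<close>, \<open>Z\<close> and
  \<open>h\<close> cancel.\<close>

lemma lift_defect_identity:
  fixes x y :: "'g::ab_group_add"
  assumes "d = x - y"
  shows "x - (q + d - Z + h) - (S + Z - gg) - (y - h) = gg - S - q"
  using assms by (simp add: algebra_simps)

section \<open>Closed powers of \<open>J\<close> and the lifting of \<open>D\<close> to the dual
  algebra\<close>

locale separable_chain = chain_of_type C s
  for C :: "('k::field, 'c::ab_group_add) coalg" and s :: "'k \<Rightarrow> 'd::division_ring \<Rightarrow> 'd" +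
  fixes es :: "('d \<times> 'd) list"
  assumes es_one: "(\<Sum>p\<leftarrow>es. fst p * snd p) = 1"
    and es_balanced: "\<And>(\<beta> :: 'd \<Rightarrow> 'd \<Rightarrow> 'c \<Rightarrow> 'k) a.
      (\<And>x x' y. \<beta> (x + x') y = \<beta> x y + \<beta> x' y) \<Longrightarrow> (\<And>x y y'. \<beta> x (y + y') = \<beta> x y + \<beta> x y') \<Longrightarrow>
      (\<And>b x y. \<beta> (s b x) y = fscale b (\<beta> x y)) \<Longrightarrow> (\<And>b x y. \<beta> x (s b y) = fscale b (\<beta> x y)) \<Longrightarrow>
      (\<Sum>p\<leftarrow>es. \<beta> (a * fst p) (snd p)) = (\<Sum>p\<leftarrow>es. \<beta> (fst p) (snd p * a))"
begin

text \<open>The double annihilator of the \<open>n\<close>-th power of \<open>J\<close>: two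
  functionals agree modulo it exactly when they agree on \<open>W n\<close>.\<close>

definition Jn :: "nat \<Rightarrow> ('c \<Rightarrow> 'k) set" where
  "Jn n = {f \<in> A. \<forall>c\<in>W n. f c = 0}"

lemma Jn_A: "f \<in> Jn n \<Longrightarrow> f \<in> A"
  by (simp add: Jn_def)

lemma Jn_closed: "0 \<in> Jn n" "f \<in> Jn n \<Longrightarrow> g \<in> Jn n \<Longrightarrow> f + g \<in> Jn n" "f \<in> Jn n \<Longrightarrow> g \<in> Jn n \<Longrightarrow> f - g \<in> Jn n"
  using A_closed by (auto simp: Jn_def)

lemma Jn_sum: "(\<And>p. p \<in> set ps \<Longrightarrow> F p \<in> Jn n) \<Longrightarrow> (\<Sum>p\<leftarrow>ps. F p) \<in> Jn n"
  by (induction ps) (simp_all add: Jn_closed del: plus_fun_apply zero_fun_apply)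

lemma Jn_1: "Jn (Suc 0) = J"
  by (simp add: Jn_def J_def W_1)

lemma Jn_mono: "m \<le> n \<Longrightarrow> Jn n \<subseteq> Jn m"
  using W_mono by (fastforce simp: Jn_def)

lemma Jn_J: "f \<in> Jn (Suc n) \<Longrightarrow> f \<in> J"
  using Jn_mono[of "Suc 0" "Suc n"] Jn_1 by auto

lemma Jn_ideal:
  assumes "f \<in> Jn n" "a \<in> A" shows "f \<star> a \<in> Jn n" "a \<star> f \<in> Jn n"
proof -
  have "(f \<star> a) c = 0" "(a \<star> f) c = 0" if "c \<in> W n" for c
    using assms conv_la[OF W_K[OF that], of f a] conv_ra[OF W_K[OF that], of f a]
      stableD(3)[OF W_stable assms(2) that] W_ra[OF that assms(2)] by (simp_all add: Jn_def)
  then show "f \<star> a \<in> Jn n" "a \<star> f \<in> Jn n" using assms by (simp_all add: Jn_def conv_closed)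
qed

text \<open>Right multiplication by \<open>g\<close> is adjoint to \<open>la g\<close>, which maps
  \<open>W (Suc n)\<close> into \<open>W n\<close>.\<close>

lemma Jn_mult:
  assumes f: "f \<in> Jn n" and g: "g \<in> J" shows "f \<star> g \<in> Jn (Suc n)"
proof -
  have "(f \<star> g) c = 0" if c: "c \<in> W (Suc n)" for c
  proof -
    have "la g c \<in> W n"
      unfolding W_def
    proof (intro CollectI conjI ballI la_in W_K[OF c])
      fix p assume p: "p \<in> P n"
      then have "p \<star> g \<in> P (Suc n)" using g by auto
      then show "p (la g c) = 0" using c conv_la[OF W_K[OF c] P_A[OF p], of g] by (auto simp: W_def simp del: P.simps)
    qed
    then show ?thesis using f conv_la[OF W_K[OF c], of f g] by (auto simp: Jn_def)
  qed
  then show ?thesis using f g by (simp add: Jn_def conv_closed J_A)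
qed

text \<open>Left multiplication by \<open>f\<close> is adjoint to right translation by
  \<open>f\<close>, and a product of \<open>n\<close> elements of \<open>J\<close> lowers the
  filtration by \<open>n\<close>.\<close>

lemma P_Jn:
  assumes f: "f \<in> P n" and g: "g \<in> Jn m" shows "f \<star> g \<in> Jn (n + m)"
proof -
  have "(f \<star> g) c = 0" if c: "c \<in> W (n + m)" for c
  proof -
    have "ra c f \<in> W m"
      unfolding W_def
    proof (intro CollectI conjI ballI ra_in W_K[OF c])
      fix p assume p: "p \<in> P m"
      have "(f \<star> p) c = 0" using c P_mult[OF f p] by (simp add: W_def)
      then show "p (ra c f) = 0" using conv_ra[OF W_K[OF c] P_A[OF p], of f] by simp
    qed
    then show ?thesis using g conv_ra[OF W_K[OF c] Jn_A[OF g], of f] by (auto simp: Jn_def)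
  qed
  then show ?thesis using f g by (simp add: Jn_def conv_closed P_A)
qed

text \<open>A unital linear map into the dual algebra; the last clause says that it is onto modulo
  \<open>J\<close>. Multiplicativity modulo \<open>J\<close> is kept apart, as the bound on
  \<open>defect\<close>.\<close>

definition linlift :: "('d \<Rightarrow> 'c \<Rightarrow> 'k) \<Rightarrow> bool" where
  "linlift \<rho> \<longleftrightarrow> (\<forall>d. \<rho> d \<in> A) \<and> (\<forall>d e. \<rho> (d + e) = \<rho> d + \<rho> e) \<and> (\<forall>a d. \<rho> (s a d) = fscale a (\<rho> d)) \<and>
     \<rho> 1 = eps \<and> (\<forall>f\<in>A. \<exists>d. f - \<rho> d \<in> J)"

lemma linliftD:
  assumes "linlift \<rho>"
  shows "\<rho> d \<in> A" "\<rho> (d + e) = \<rho> d + \<rho> e" "\<rho> (s a d) = fscale a (\<rho> d)" "\<rho> 1 = eps" "f \<in> A \<Longrightarrow> \<exists>d. f - \<rho> d \<in> J"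
    "\<rho> 0 = 0"
proof -
  show *: "\<rho> d \<in> A" "\<rho> (d + e) = \<rho> d + \<rho> e" "\<rho> (s a d) = fscale a (\<rho> d)" "\<rho> 1 = eps" "f \<in> A \<Longrightarrow> \<exists>d. f - \<rho> d \<in> J" for d e a f
    using assms unfolding linlift_def by blast+
  show "\<rho> 0 = 0" using *(2)[of 0 0] by simp
qed

definition defect :: "('d \<Rightarrow> 'c \<Rightarrow> 'k) \<Rightarrow> 'd \<Rightarrow> 'd \<Rightarrow> 'c \<Rightarrow> 'k" where
  "defect \<rho> a b = \<rho> a \<star> \<rho> b - \<rho> (a * b)"

text \<open>
  The defect is a Hochschild 2-cocycle; it is the coboundary of \<open>corr \<rho>\<close> up to products of two
  defects, by the standard contraction that the separability element provides.
\<close>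

definition corr :: "('d \<Rightarrow> 'c \<Rightarrow> 'k) \<Rightarrow> 'd \<Rightarrow> 'c \<Rightarrow> 'k" where
  "corr \<rho> a = (\<Sum>p\<leftarrow>es. \<rho> (fst p) \<star> defect \<rho> (snd p) a)"

lemma defect_linear:
  assumes "linlift \<rho>"
  shows "defect \<rho> a b \<in> A" "defect \<rho> (a + a') b = defect \<rho> a b + defect \<rho> a' b"
    "defect \<rho> a (b + b') = defect \<rho> a b + defect \<rho> a b'"
    "defect \<rho> (s r a) b = fscale r (defect \<rho> a b)" "defect \<rho> a (s r b) = fscale r (defect \<rho> a b)"
    "defect \<rho> a 1 = 0"
proof -
  note \<rho> = linliftD[OF assms]
  have fds: "fscale r (f - g) = fscale r f - fscale r g" for r and f g :: "'c \<Rightarrow> 'k"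
    by (auto simp: fscale_def algebra_simps)
  show "defect \<rho> a b \<in> A" by (simp add: defect_def A_closed conv_closed \<rho>)
  show "defect \<rho> (a + a') b = defect \<rho> a b + defect \<rho> a' b" "defect \<rho> a (b + b') = defect \<rho> a b + defect \<rho> a b'"
    unfolding defect_def distrib_left distrib_right \<rho>(2) conv_add_left conv_add_right by (simp_all add: algebra_simps)
  show "defect \<rho> (s r a) b = fscale r (defect \<rho> a b)" "defect \<rho> a (s r b) = fscale r (defect \<rho> a b)"
    unfolding defect_def fda_mult_left[OF fd] fda_mult_right[OF fd] \<rho>(3) conv_scale_left conv_scale_right fds
    by (rule refl)+
  show "defect \<rho> a 1 = 0" by (simp add: defect_def \<rho> conv_eps)
qed

text \<open>After the correction the defect consists of products of two terms, each a sum of defects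
  or a correction. One factor lies in \<open>Jn (Suc n)\<close> and the other in \<open>J\<close>,
  so every product lies one level deeper.\<close>

lemma linlift_correct:
  assumes \<rho>: "linlift \<rho>" and n: "\<And>a b. defect \<rho> a b \<in> Jn (Suc n)"
  shows "linlift (\<lambda>a. \<rho> a - corr \<rho> a)" "corr \<rho> a \<in> Jn (Suc n)"
    "defect (\<lambda>a. \<rho> a - corr \<rho> a) a b \<in> Jn (Suc (Suc n))"
proof -
  note r = linliftD[OF \<rho>] and d = defect_linear[OF \<rho>]
  have fdist: "fscale r (f - g) = fscale r f - fscale r g" "fscale r (f + g) = fscale r f + fscale r g"
    "fscale r 0 = 0" for r and f g :: "'c \<Rightarrow> 'k"
    by (auto simp: fscale_def algebra_simps)
  have corr_J: "corr \<rho> a \<in> Jn (Suc n)" for a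
    unfolding corr_def by (intro Jn_sum Jn_ideal n r)
  then show "corr \<rho> a \<in> Jn (Suc n)" .
  have corr_A: "corr \<rho> a \<in> A" for a using corr_J Jn_A by blast
  have corr_add: "corr \<rho> (a + b) = corr \<rho> a + corr \<rho> b" for a b
    unfolding corr_def d(3) conv_add_right by (rule sum_list_addf)
  have corr_scale: "corr \<rho> (s t a) = fscale t (corr \<rho> a)" for t a
  proof -
    have "(\<Sum>p\<leftarrow>ps. fscale t (F p)) = fscale t (\<Sum>p\<leftarrow>ps. F p)" for F :: "'d \<times> 'd \<Rightarrow> 'c \<Rightarrow> 'k" and ps
      by (induction ps) (simp_all add: fdist del: plus_fun_apply zero_fun_apply)
    then show ?thesis unfolding corr_def d(5) conv_scale_right by simp
  qed
  have corr_one: "corr \<rho> 1 = 0"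
    unfolding corr_def d(6) conv_zero_right by (induction es) simp_all
  show "linlift (\<lambda>a. \<rho> a - corr \<rho> a)"
    unfolding linlift_def
  proof (intro conjI allI ballI)
    show "\<exists>e. f - (\<rho> e - corr \<rho> e) \<in> J" if f: "f \<in> A" for f
    proof -
      obtain e where "f - \<rho> e \<in> J" using r(5)[OF f] by blast
      then have "(f - \<rho> e) + corr \<rho> e \<in> J" by (intro J_closed(1) Jn_J[OF corr_J])
      then show ?thesis by (intro exI[of _ e]) (simp add: algebra_simps)
    qed
  qed (simp_all add: A_closed r corr_A corr_add corr_scale corr_one fdist)
  show "defect (\<lambda>a. \<rho> a - corr \<rho> a) a b \<in> Jn (Suc (Suc n))"
  proof -
    define S where "S = (\<Sum>p\<leftarrow>es. defect \<rho> a (fst p) \<star> defect \<rho> (snd p) b)"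
    define Z where "Z = (\<Sum>p\<leftarrow>es. \<rho> (fst p) \<star> defect \<rho> (snd p * a) b)"
    define Q where "Q = (\<Sum>p\<leftarrow>es. defect \<rho> (fst p) (snd p))"
    have rr: "\<rho> x \<star> \<rho> y = defect \<rho> x y + \<rho> (x * y)" for x y by (simp add: defect_def)
    have E1: "\<rho> a \<star> corr \<rho> b = S + Z"
    proof -
      have "\<rho> a \<star> corr \<rho> b = (\<Sum>p\<leftarrow>es. (\<rho> a \<star> \<rho> (fst p)) \<star> defect \<rho> (snd p) b)"
        unfolding corr_def conv_sum_right by (simp add: conv_assoc r(1) d(1))
      also have "\<dots> = S + (\<Sum>p\<leftarrow>es. \<rho> (a * fst p) \<star> defect \<rho> (snd p) b)"
        unfolding rr conv_add_left S_def by (rule sum_list_addf)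
      \<comment> \<open>The balancing of the separability element moves \<open>a\<close> to the
        second factor, where the sum becomes a term that also occurs in
        \<open>corr \<rho> a \<star> \<rho> b\<close>, with the opposite sign.\<close>
      also have "(\<Sum>p\<leftarrow>es. \<rho> (a * fst p) \<star> defect \<rho> (snd p) b) = Z"
        unfolding Z_def
        by (rule es_balanced[where \<beta> = "\<lambda>x y. \<rho> x \<star> defect \<rho> y b"])
          (simp_all only: r(2,3) d(2,4) conv_add_left conv_add_right conv_scale_left conv_scale_right)
      finally show ?thesis .
    qed
    \<comment> \<open>The Hochschild cocycle identity, which is associativity of
      \<open>\<rho> x \<star> \<rho> a \<star> \<rho> b\<close> expressed by defects.\<close>
    have cocycle: "defect \<rho> x a \<star> \<rho> b = \<rho> x \<star> defect \<rho> a b - defect \<rho> (x * a) b + defect \<rho> x (a * b)" for x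
    proof -
      have "\<rho> x \<star> (\<rho> a \<star> \<rho> b) = (\<rho> x \<star> \<rho> a) \<star> \<rho> b" by (simp add: conv_assoc r(1))
      then show ?thesis
        unfolding defect_def conv_diff_left conv_diff_right by (simp add: mult.assoc)
    qed
    have E2: "corr \<rho> a \<star> \<rho> b = Q \<star> defect \<rho> a b + defect \<rho> a b - Z + corr \<rho> (a * b)"
    proof -
      have "corr \<rho> a \<star> \<rho> b = (\<Sum>p\<leftarrow>es. \<rho> (fst p) \<star> (defect \<rho> (snd p) a \<star> \<rho> b))"
        unfolding corr_def conv_sum_left by (simp add: conv_assoc r(1) d(1))
      also have "\<dots> = (\<Sum>p\<leftarrow>es. (\<rho> (fst p) \<star> \<rho> (snd p)) \<star> defect \<rho> a b) - Z + corr \<rho> (a * b)"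
        unfolding cocycle conv_add_right conv_diff_right sum_list_addf sum_list_subtractf Z_def corr_def
        by (simp add: conv_assoc r(1) d(1))
      also have "(\<Sum>p\<leftarrow>es. (\<rho> (fst p) \<star> \<rho> (snd p)) \<star> defect \<rho> a b) = (\<Sum>p\<leftarrow>es. \<rho> (fst p) \<star> \<rho> (snd p)) \<star> defect \<rho> a b"
        by (rule conv_sum_left[symmetric])
      \<comment> \<open>The separability element multiplies to 1, so this sum is the unit up to a
        sum of defects.\<close>
      also have "(\<Sum>p\<leftarrow>es. \<rho> (fst p) \<star> \<rho> (snd p)) = Q + eps"
      proof -
        have "(\<Sum>p\<leftarrow>ps. \<rho> (fst p * snd p)) = \<rho> (\<Sum>p\<leftarrow>ps. fst p * snd p)" for ps
          by (induction ps) (simp_all add: r(2,6) del: plus_fun_apply zero_fun_apply)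
        then show ?thesis unfolding rr sum_list_addf Q_def by (simp add: es_one r(4))
      qed
      also have "(Q + eps) \<star> defect \<rho> a b = Q \<star> defect \<rho> a b + defect \<rho> a b"
        unfolding conv_add_left by (simp add: conv_eps d(1))
      finally show ?thesis .
    qed
    have "defect (\<lambda>a. \<rho> a - corr \<rho> a) a b = corr \<rho> a \<star> corr \<rho> b - S - Q \<star> defect \<rho> a b"
      unfolding defect_def[of "\<lambda>a. \<rho> a - corr \<rho> a"] conv_diff_left conv_diff_right E1 E2
      by (rule lift_defect_identity) (rule defect_def)
    moreover have "S \<in> Jn (Suc (Suc n))" unfolding S_def by (intro Jn_sum Jn_mult n Jn_J[OF n])
    moreover have "Q \<star> defect \<rho> a b \<in> Jn (Suc (Suc n))" unfolding Q_def by (intro Jn_mult Jn_sum n Jn_J[OF n])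
    moreover have "corr \<rho> a \<star> corr \<rho> b \<in> Jn (Suc (Suc n))" by (intro Jn_mult corr_J Jn_J[OF corr_J])
    ultimately show ?thesis by (simp add: Jn_closed)
  qed
qed

text \<open>Functionals on the coradical are extended to \<open>C\<close> by a linear projection.
  Any such extension is multiplicative on the coradical, hence modulo \<open>J\<close>; only the
  unit has to be adjusted.\<close>

lemma initial_lift:
  obtains \<rho> where "linlift \<rho>" "\<forall>a b. defect \<rho> a b \<in> Jn (Suc 0)"
proof -
  obtain \<psi> :: "'d \<Rightarrow> 'c \<Rightarrow> 'k" where \<psi>: "\<And>d. \<psi> d \<in> vcarrier (dual_space C0r)"
    "\<And>d e. \<psi> (d + e) = \<psi> d + \<psi> e" "\<And>a d. \<psi> (s a d) = fscale a (\<psi> d)"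
    "\<And>d e. \<psi> (d * e) = convolution C0r (\<psi> d) (\<psi> e)" "\<psi> 1 = res eps"
    "\<And>f. f \<in> vcarrier (dual_space C0r) \<Longrightarrow> \<exists>d. f = \<psi> d" "inj \<psi>"
    using type_iso by blast
  obtain p where p: "Vector_Spaces.linear (vscale C) (vscale C) p" "\<And>x. p x \<in> C0" "\<And>x. x \<in> C0 \<Longrightarrow> p x = x"
    using subspace_projection[OF C_vspace stableD(2)[OF C0_stable]] by blast
  interpret p: Vector_Spaces.linear "vscale C" "vscale C" p by fact
  obtain g where g: "lfun (full_space s) g" "g 1 \<noteq> 0"
    using functionals_separate[OF fda_vector_space[OF fd], of 1] by (auto simp: fda_simps[OF fd])
  have gl: "g (x + y) = g x + g y" "g (s a x) = a * g x" for x y a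
    using lfun_simps[OF fda_is_vspace[OF fd] g(1)] by (simp_all add: fda_simps[OF fd])
  define \<rho>1 where "\<rho>1 d = (\<lambda>x. if x \<in> K then \<psi> d (p x) else 0)" for d
  have \<rho>1_A: "\<rho>1 d \<in> A" for d
    unfolding \<rho>1_def
  proof (rule dual_space_restrict[OF C_vspace])
    show "linear_map C ground (\<lambda>x. \<psi> d (p x))"
      using dual_in_linear_map[OF \<psi>(1)[of d]] p(2) by (simp add: linear_map_def p.add p.scale)
  qed
  \<comment> \<open>The added term forces 1 to go to \<open>eps\<close>. It vanishes on the
    coradical, where \<open>\<rho>1 1\<close> and \<open>eps\<close> agree; dividing by
    \<open>g 1 \<noteq> 0\<close> keeps it linear in \<open>d\<close>.\<close>
  define \<rho> where "\<rho> d = \<rho>1 d + fscale (g d / g 1) (eps - \<rho>1 1)" for d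
  have \<rho>_A: "\<rho> d \<in> A" for d by (simp add: \<rho>_def A_closed \<rho>1_A eps_in)
  have \<rho>_res: "res (\<rho> d) = \<psi> d" for d
  proof
    fix c show "res (\<rho> d) c = \<psi> d c"
    proof (cases "c \<in> C0")
      case True
      then have "\<rho>1 e c = \<psi> e c" for e using p(3) C0_K by (simp add: \<rho>1_def)
      then show ?thesis using True fun_cong[OF \<psi>(5), of c] by (simp add: \<rho>_def res_def fscale_def)
    next
      case False
      then show ?thesis using \<psi>(1)[of d] by (simp add: res_def dual_space_def)
    qed
  qed
  have res_J: "f - f' \<in> J" if "f \<in> A" "f' \<in> A" "res f = res f'" for f f'
  proof -
    have "f c = f' c" if "c \<in> C0" for c using fun_cong[OF \<open>res f = res f'\<close>, of c] that by (simp add: res_def)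
    then show ?thesis using that A_closed(3) by (simp add: J_def)
  qed
  have "linlift \<rho>"
    unfolding linlift_def
  proof (intro conjI allI ballI \<rho>_A)
    show "\<rho> (d + e) = \<rho> d + \<rho> e" for d e
      by (auto simp: fun_eq_iff \<rho>_def \<rho>1_def \<psi>(2) gl fscale_def add_divide_distrib algebra_simps)
    show "\<rho> (s a d) = fscale a (\<rho> d)" for a d
      by (auto simp: fun_eq_iff \<rho>_def \<rho>1_def \<psi>(3) gl fscale_def algebra_simps)
    show "\<rho> 1 = eps" using g(2) by (auto simp: fun_eq_iff \<rho>_def fscale_def)
    show "\<exists>d. f - \<rho> d \<in> J" if "f \<in> A" for f
      using \<psi>(6)[OF res_dual[OF that]] res_J[OF that \<rho>_A] \<rho>_res by metis
  qed
  moreover have "defect \<rho> a b \<in> Jn (Suc 0)" for a b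
  proof -
    have "res (\<rho> a \<star> \<rho> b) = res (\<rho> (a * b))"
      unfolding res_conv[OF \<rho>_A \<rho>_A, symmetric] \<rho>_res \<psi>(4) ..
    then show ?thesis unfolding defect_def Jn_1 by (intro res_J conv_closed \<rho>_A)
  qed
  ultimately show ?thesis using that by blast
qed

text \<open>The \<open>n\<close>-th correction vanishes on \<open>W (Suc n)\<close>, so the values
  at a given element of \<open>C\<close> become stationary and the lifts converge pointwise. Each
  property of the limit involves finitely many elements of \<open>C\<close> at a time and is read
  off at one sufficiently late stage.\<close>

theorem splitting:
  obtains \<alpha> where "linlift \<alpha>" "\<forall>a b. \<alpha> a \<star> \<alpha> b = \<alpha> (a * b)"
proof -
  obtain \<rho>0 where \<rho>0: "linlift \<rho>0" "\<forall>a b. defect \<rho>0 a b \<in> Jn (Suc 0)" by (rule initial_lift)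
  define r where "r n = ((\<lambda>\<rho> a. \<rho> a - corr \<rho> a) ^^ n) \<rho>0" for n
  have r: "linlift (r n) \<and> (\<forall>a b. defect (r n) a b \<in> Jn (Suc n))" for n
  proof (induction n)
    case (Suc n)
    have eq: "r (Suc n) = (\<lambda>a. r n a - corr (r n) a)" by (simp add: r_def)
    have "linlift (r n)" "\<And>a b. defect (r n) a b \<in> Jn (Suc n)" using Suc by auto
    from linlift_correct(1,3)[OF this] show ?case unfolding eq by blast
  qed (simp add: r_def \<rho>0)
  have step: "r (Suc n) d c = r n d c" if "c \<in> W (Suc n)" for n d c
  proof -
    have "r (Suc n) d = r n d - corr (r n) d" by (simp add: r_def)
    then show ?thesis using linlift_correct(2)[of "r n" n d] r[of n] that by (auto simp: Jn_def)
  qed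
  have stab: "m \<ge> n \<Longrightarrow> c \<in> W (Suc n) \<Longrightarrow> r m d c = r n d c" for m n d c
  proof (induction m rule: dec_induct)
    case (step m)
    then have "c \<in> W (Suc m)" using W_mono[of "Suc n" "Suc m"] by auto
    then show ?case using step \<open>\<And>n d c. c \<in> W (Suc n) \<Longrightarrow> r (Suc n) d c = r n d c\<close> by simp
  qed simp
  have ex: "\<exists>n. c \<in> W (Suc n)" if "c \<in> K" for c
  proof -
    from exhaustive[OF that] obtain n where "c \<in> W n" by blast
    then show ?thesis using W_mono[of n "Suc n"] by auto
  qed
  \<comment> \<open>The value at the first stage that is final for \<open>c\<close>; by
    \<open>stab\<close> every later stage gives the same.\<close>
  define \<alpha> where "\<alpha> d = (\<lambda>c. if c \<in> K then r (LEAST n. c \<in> W (Suc n)) d c else 0)" for d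
  have \<alpha>: "\<alpha> d c = r n d c" if c: "c \<in> W (Suc n)" for d c n
  proof -
    have "c \<in> W (Suc (LEAST n. c \<in> W (Suc n)))" using c by (rule LeastI)
    moreover have "(LEAST n. c \<in> W (Suc n)) \<le> n" using c by (rule Least_le)
    ultimately show ?thesis using stab[of "LEAST n. c \<in> W (Suc n)" n c d] W_K[OF c] by (simp add: \<alpha>_def)
  qed
  have common: "\<exists>n. \<forall>c\<in>F. c \<in> W (Suc n)" if "finite F" "F \<subseteq> K" for F
    using that
  proof (induction F)
    case (insert c F)
    from insert obtain n where n: "\<forall>c\<in>F. c \<in> W (Suc n)" by auto
    from insert ex[of c] obtain m where m: "c \<in> W (Suc m)" by auto
    have "W (Suc n) \<subseteq> W (Suc (max n m))" "W (Suc m) \<subseteq> W (Suc (max n m))" by (simp_all add: W_mono)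
    then have "\<forall>c\<in>insert c F. c \<in> W (Suc (max n m))" using n m by blast
    then show ?case by blast
  qed simp
  have \<alpha>_A: "\<alpha> d \<in> A" for d
  proof -
    have "linear_map C ground (\<alpha> d)"
      unfolding linear_map_def
    proof (intro conjI ballI allI)
      fix x y a assume x: "x \<in> K" and y: "y \<in> K"
      obtain n where n: "\<forall>c\<in>{x, y}. c \<in> W (Suc n)" using common[of "{x, y}"] x y by auto
      have rA: "r n d \<in> A" using r linliftD(1) by blast
      show "\<alpha> d (x + y) = \<alpha> d x + \<alpha> d y"
        using n stable_closed(2)[OF W_stable, of x "Suc n" y] A_simps(1)[OF rA x y] by (simp add: \<alpha>[of _ n])
      show "\<alpha> d (vscale C a x) = vscale ground a (\<alpha> d x)"
        using n stable_closed(4)[OF W_stable, of x "Suc n" a] A_simps(3)[OF rA x] by (simp add: \<alpha>[of _ n])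
    qed simp
    then show ?thesis by (simp add: dual_space_def \<alpha>_def)
  qed
  have K_eqI: "f = f'" if "f \<in> A" "f' \<in> A" "\<And>c n. c \<in> W (Suc n) \<Longrightarrow> f c = f' c" for f f'
  proof (rule A_eqI[OF that(1,2)])
    fix c assume "c \<in> K"
    from ex[OF this] obtain n where "c \<in> W (Suc n)" by blast
    then show "f c = f' c" by (rule that(3))
  qed
  have lin: "linlift \<alpha>"
    unfolding linlift_def
  proof (intro conjI allI ballI \<alpha>_A)
    show "\<alpha> (d + e) = \<alpha> d + \<alpha> e" for d e
      using r linliftD(2) by (intro K_eqI A_closed \<alpha>_A) (simp add: \<alpha>)
    show "\<alpha> (s a d) = fscale a (\<alpha> d)" for a d
      using r linliftD(3) by (intro K_eqI A_closed \<alpha>_A) (simp add: \<alpha> fscale_def)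
    show "\<alpha> 1 = eps" using r linliftD(4) by (intro K_eqI \<alpha>_A eps_in) (simp add: \<alpha>)
    show "\<exists>d. f - \<alpha> d \<in> J" if f: "f \<in> A" for f
    proof -
      obtain d where "f - r 0 d \<in> J" using linliftD(5)[OF _ f, of "r 0"] r by blast
      then have "f - \<alpha> d \<in> J" using \<alpha>[of _ 0 d] f \<alpha>_A A_closed by (auto simp: J_def W_1)
      then show ?thesis by blast
    qed
  qed
  have "\<alpha> a \<star> \<alpha> b = \<alpha> (a * b)" for a b
  proof (rule A_eqI)
    fix c assume c: "c \<in> K"
    \<comment> \<open>One stage has to serve \<open>c\<close> together with all factors that occur
      in its comultiplication.\<close>
    define F where "F = insert c (fst ` set (rep c) \<union> snd ` set (rep c))"
    have "finite F" "F \<subseteq> K" using rep(1)[OF c] c by (auto simp: F_def)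
    from common[OF this] obtain n where "\<forall>x\<in>F. x \<in> W (Suc n)" by blast
    then have n: "c \<in> W (Suc n)" "\<And>p. p \<in> set (rep c) \<Longrightarrow> fst p \<in> W (Suc n) \<and> snd p \<in> W (Suc n)"
      by (auto simp: F_def)
    have "(\<Sum>p\<leftarrow>rep c. \<alpha> a (fst p) * \<alpha> b (snd p)) = (\<Sum>p\<leftarrow>rep c. r n a (fst p) * r n b (snd p))"
      using n(2) by (intro arg_cong[of _ _ sum_list] map_cong refl) (simp add: \<alpha>[of _ n])
    then have "(\<alpha> a \<star> \<alpha> b) c = (r n a \<star> r n b) c" using c by (simp add: conv_def)
    also have "\<dots> = r n (a * b) c"
    proof -
      have "defect (r n) a b c = 0" using r[of n] n(1) by (simp add: Jn_def)
      then show ?thesis by (simp add: defect_def)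
    qed
    also have "\<dots> = \<alpha> (a * b) c" using n by (simp add: \<alpha>[of _ n])
    finally show "(\<alpha> a \<star> \<alpha> b) c = \<alpha> (a * b) c" .
  qed (simp_all add: \<alpha>_A conv_closed)
  then show ?thesis using that lin by blast
qed


section \<open>A generator of \<open>J\<close> normalized by \<open>D\<close>\<close>

lemma Jn_scale: "f \<in> Jn n \<Longrightarrow> fscale r f \<in> Jn n"
  using A_closed(4)[of f r] by (simp add: Jn_def) (simp add: fscale_def)

text \<open>
  A generator \<open>y\<close> of \<open>J\<close> modulo \<open>(J\<^sup>2)\<^sup>\<bottom>\<^sup>\<bottom>\<close> as a right \<open>D\<close>-space that is normalized by \<open>D\<close>; the
  automorphism \<open>\<sigma>\<close> describes the left action.
\<close>

theorem twisted_generator: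
  assumes \<alpha>: "linlift \<alpha>" and mult: "\<forall>a b. \<alpha> a \<star> \<alpha> b = \<alpha> (a * b)"
  obtains y \<sigma> where "y \<in> J" "\<forall>f\<in>J. \<exists>d. f - y \<star> \<alpha> d \<in> Jn 2" "\<forall>d. \<alpha> d \<star> y = y \<star> \<alpha> (\<sigma> d)"
    "\<forall>d e. \<sigma> (d + e) = \<sigma> d + \<sigma> e" "\<forall>d e. \<sigma> (d * e) = \<sigma> d * \<sigma> e" "\<sigma> 1 = 1" "\<forall>a d. \<sigma> (s a d) = s a (\<sigma> d)"
proof (cases "\<forall>f\<in>J. f \<in> Jn 2")
  case True
  have "0 \<star> f = (0 :: 'c \<Rightarrow> 'k)" "f \<star> 0 = (0 :: 'c \<Rightarrow> 'k)" for f by (rule conv_zero_left, rule conv_zero_right)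
  \<comment> \<open>Here \<open>W 2\<close> is already the coradical, so 0 generates and the
    identity can serve as automorphism.\<close>
  then show ?thesis using True J_closed(3)
    by (intro that[of 0 "\<lambda>d. d"]) (simp_all del: zero_fun_apply)
next
  case False
  note a = linliftD[OF \<alpha>]
  obtain x where x: "x \<in> J" "x \<notin> Jn 2" using False by blast
  then have xA: "x \<in> A" by (simp add: J_A)
  obtain c1 where c1: "c1 \<in> W 2" "x c1 \<noteq> 0" using x xA by (auto simp: Jn_def)
  have c1K: "c1 \<in> K" by (rule W_K[OF c1(1)])
  have sup: "\<exists>d j. f = \<alpha> d + j \<and> j \<in> J" if "f \<in> A" for f
  proof -
    obtain d where "f - \<alpha> d \<in> J" using a(5)[OF \<open>f \<in> A\<close>] by blast
    then show ?thesis by (intro exI[of _ d] exI[of _ "f - \<alpha> d"]) simp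
  qed
  have laJ: "la j c \<in> C0" if "j \<in> J" "c \<in> W 2" for j c
  proof -
    have "p (la j c) = 0" if p: "p \<in> P 1" for p
    proof -
      have "p \<star> j \<in> P 2" using p \<open>j \<in> J\<close> by (auto simp: numeral_2_eq_2 simp del: P.simps(1))
      then have "(p \<star> j) c = 0" using \<open>c \<in> W 2\<close> by (simp add: W_def)
      then show ?thesis using conv_la[OF W_K[OF \<open>c \<in> W 2\<close>] P_A[OF p], of j] by simp
    qed
    then have "la j c \<in> W (Suc 0)" using la_in[OF W_K[OF that(2)]] by (simp add: W_def)
    then show ?thesis using W_1 by simp
  qed
  have C0W2: "C0 \<subseteq> W 2" using W_mono[of "Suc 0" 2] W_1 by simp
  have xJ2: "x \<star> j \<in> Jn 2" if "j \<in> J" for j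
    using Jn_mult[of x "Suc 0" j] x(1) that Jn_1 by (simp add: numeral_2_eq_2)
  \<comment> \<open>The annihilator in \<open>W 2\<close> of the right ideal of \<open>x\<close>. It
    turns out to be the coradical, which is what makes \<open>x\<close> a generator of
    \<open>J\<close> modulo \<open>Jn 2\<close>.\<close>
  define I where "I = {c \<in> W 2. \<forall>f\<in>A. (x \<star> f) c = 0}"
  have I_stable: "stable I"
  proof (rule stableI)
    show "I \<subseteq> K" using W_K by (auto simp: I_def)
    show "0 \<in> I" using A_zero[OF conv_closed[OF xA]] stable_closed(1)[OF W_stable] by (simp add: I_def)
    show "u + v \<in> I" if "u \<in> I" "v \<in> I" for u v
      using that A_simps(1)[OF conv_closed[OF xA]] W_K[of _ 2] stable_closed(2)[OF W_stable] by (simp add: I_def)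
    show "vscale C r u \<in> I" if "u \<in> I" for r u
      using that A_simps(3)[OF conv_closed[OF xA]] W_K[of _ 2] stable_closed(4)[OF W_stable] by (simp add: I_def)
    show "la f u \<in> I" if f: "f \<in> A" and u: "u \<in> I" for f u
    proof -
      have uW: "u \<in> W 2" and uK: "u \<in> K" using u W_K by (auto simp: I_def)
      have "(x \<star> g) (la f u) = 0" if g: "g \<in> A" for g
        using u conv_la[OF uK conv_closed[OF xA g], of f] conv_assoc[OF xA g f] conv_closed[OF g f] by (simp add: I_def)
      then show ?thesis using stableD(3)[OF W_stable f uW] by (simp add: I_def)
    qed
  qed
  have c1I: "c1 \<notin> I" using c1(2) conv_eps(2)[OF xA] eps_in by (auto simp: I_def intro!: bexI[of _ eps])
  have C0I: "C0 \<subseteq> I" using C0W2 J_ideal(1)[OF x(1)] by (auto simp: I_def J_def)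
  \<comment> \<open>By the chain condition \<open>c\<close> lies in the cyclic submodule of
    \<open>c1\<close>, so \<open>c = la (\<alpha> d) c1\<close> up to the coradical. If
    \<open>c\<close> is outside the coradical, then \<open>d \<noteq> 0\<close>, and applying
    \<open>\<alpha> (inverse d)\<close> would put \<open>c1\<close> into \<open>I\<close>.\<close>
  have I_C0: "c \<in> C0" if c: "c \<in> I" for c
  proof (rule ccontr)
    assume n: "c \<notin> C0"
    have "\<not> orb c1 \<subseteq> I" using orb_self[OF c1K] c1I by auto
    then have "c \<in> orb c1" using stable_chain[OF I_stable orb_stable[OF c1K]] c by auto
    then obtain f where f: "f \<in> A" "c = la f c1" by (auto simp: orb_def)
    then obtain d j where dj: "f = \<alpha> d + j" "j \<in> J" using sup by blast
    have cd: "c = la (\<alpha> d) c1 + la j c1" unfolding f(2) dj(1) using la_linear(3)[OF c1K a(1) J_A[OF dj(2)]] .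
    have j0: "la j c1 \<in> C0" by (rule laJ[OF dj(2) c1(1)])
    have "d \<noteq> 0"
    proof
      assume "d = 0"
      then have "la (\<alpha> d) c1 = 0"
        using a(6) la_linear(4)[OF c1K A_closed(1), of 0] by (simp add: scale_zero fscale_def zero_fun_def)
      then show False using cd j0 n by simp
    qed
    have "la (\<alpha> d) c1 \<in> I" using stable_closed(3)[OF I_stable c, of "la j c1"] j0 C0I cd by auto
    then have "la (\<alpha> (inverse d)) (la (\<alpha> d) c1) \<in> I" by (rule stableD(3)[OF I_stable a(1)])
    moreover have "la (\<alpha> (inverse d)) (la (\<alpha> d) c1) = c1"
      using la_conv[OF c1K a(1) a(1), of "inverse d" d] mult \<open>d \<noteq> 0\<close> a(4) la_eps[OF c1K] by simp
    ultimately show False using c1I by simp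
  qed
  have x_gen: "\<exists>d. f - x \<star> \<alpha> d \<in> Jn 2" if f: "f \<in> J" for f
  proof -
    obtain B where B: "finite B" "module.span s B = UNIV" by (rule fda_basis[OF fd])
    let ?X = "C\<lparr>vcarrier := W 2\<rparr>"
    have X: "is_vspace ?X" by (rule is_vspace_restrict[OF C_vspace stableD(2)[OF W_stable]])
    have lin: "linear_map ?X ground g" if "g \<in> A" for g
      using A_simps[OF that] W_K[of _ 2] by (simp add: linear_map_def)
    \<comment> \<open>On \<open>W 2\<close> the functionals \<open>x \<star> \<alpha> d\<close> form
      a finite-dimensional family, as \<open>D\<close> is finite-dimensional. Their common kernel
      lies in the coradical, where \<open>f\<close> vanishes, so \<open>f\<close> belongs to the
      family.\<close>
    have "\<exists>d. \<forall>c\<in>W 2. f c = (x \<star> \<alpha> d) c"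
    proof (rule functional_in_family[OF fda_vector_space[OF fd] B X, where f = f and \<Gamma> = "\<lambda>d. x \<star> \<alpha> d"])
      show "f c = 0" if "c \<in> vcarrier ?X" "\<And>d. (x \<star> \<alpha> d) c = 0" for c
      proof -
        have c: "c \<in> W 2" using that by simp
        have "(x \<star> g) c = 0" if g: "g \<in> A" for g
        proof -
          obtain d j where dj: "g = \<alpha> d + j" "j \<in> J" using sup[OF g] by blast
          then have "(x \<star> g) c = (x \<star> \<alpha> d) c + (x \<star> j) c" by (simp add: conv_add_right)
          then show ?thesis using \<open>\<And>d. (x \<star> \<alpha> d) c = 0\<close> xJ2[OF dj(2)] c by (simp add: Jn_def)
        qed
        then have "c \<in> C0" using c by (intro I_C0) (simp add: I_def)
        then show ?thesis using f by (simp add: J_def)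
      qed
      show "(x \<star> \<alpha> (d + e)) c = (x \<star> \<alpha> d) c + (x \<star> \<alpha> e) c" for d e c
        by (simp add: a(2) conv_add_right)
      show "(x \<star> \<alpha> (s r d)) c = r * (x \<star> \<alpha> d) c" for r d c
        unfolding a(3) conv_scale_right by (simp add: fscale_def)
      show "linear_map ?X ground (x \<star> \<alpha> d)" for d by (intro lin conv_closed xA a)
      show "linear_map ?X ground f" by (intro lin J_A f)
    qed auto
    then obtain d where "\<And>c. c \<in> W 2 \<Longrightarrow> f c = (x \<star> \<alpha> d) c" by blast
    then have "f - x \<star> \<alpha> d \<in> Jn 2" using f by (simp add: Jn_def A_closed J_A conv_closed xA a)
    then show ?thesis by blast
  qed
  \<comment> \<open>A nonzero difference would be invertible in \<open>D\<close> and bring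
    \<open>x\<close> itself into \<open>Jn 2\<close>. Uniqueness makes \<open>\<sigma>\<close>
    additive, multiplicative, unital and linear over the scalars.\<close>
  have uniq: "d = e" if "x \<star> \<alpha> d - x \<star> \<alpha> e \<in> Jn 2" for d e
  proof (rule ccontr)
    assume "d \<noteq> e"
    then have ne: "d - e \<noteq> 0" by simp
    have "\<alpha> d = \<alpha> (d - e) + \<alpha> e" using a(2)[of "d - e" e] by simp
    then have "x \<star> \<alpha> (d - e) \<in> Jn 2" using that by (simp add: conv_add_right)
    then have "(x \<star> \<alpha> (d - e)) \<star> \<alpha> (inverse (d - e)) \<in> Jn 2" by (rule Jn_ideal(1)[OF _ a(1)])
    moreover have "(x \<star> \<alpha> (d - e)) \<star> \<alpha> (inverse (d - e)) = x"
      using mult ne by (simp add: conv_assoc xA a conv_eps)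
    ultimately show False using x(2) by simp
  qed
  define \<sigma> where "\<sigma> d = (SOME e. \<alpha> d \<star> x - x \<star> \<alpha> e \<in> Jn 2)" for d
  have \<sigma>: "\<alpha> d \<star> x - x \<star> \<alpha> (\<sigma> d) \<in> Jn 2" for d
    unfolding \<sigma>_def by (rule someI_ex, rule x_gen, rule J_ideal(2)[OF x(1) a(1)])
  have \<sigma>_eqI: "\<sigma> d = e" if "\<alpha> d \<star> x - x \<star> \<alpha> e \<in> Jn 2" for d e
  proof (rule uniq)
    have "(\<alpha> d \<star> x - x \<star> \<alpha> e) - (\<alpha> d \<star> x - x \<star> \<alpha> (\<sigma> d)) \<in> Jn 2" by (rule Jn_closed(3)[OF that \<sigma>])
    then show "x \<star> \<alpha> (\<sigma> d) - x \<star> \<alpha> e \<in> Jn 2" by simp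
  qed
  have \<sigma>_add: "\<sigma> (d + e) = \<sigma> d + \<sigma> e" for d e
  proof (rule \<sigma>_eqI)
    have "\<alpha> (d + e) \<star> x - x \<star> \<alpha> (\<sigma> d + \<sigma> e) = (\<alpha> d \<star> x - x \<star> \<alpha> (\<sigma> d)) + (\<alpha> e \<star> x - x \<star> \<alpha> (\<sigma> e))"
      unfolding a(2) conv_add_left conv_add_right by simp
    then show "\<alpha> (d + e) \<star> x - x \<star> \<alpha> (\<sigma> d + \<sigma> e) \<in> Jn 2" using Jn_closed(2)[OF \<sigma> \<sigma>] by simp
  qed
  have \<sigma>_mult: "\<sigma> (d * e) = \<sigma> d * \<sigma> e" for d e
  proof (rule \<sigma>_eqI)
    have "\<alpha> d \<star> (\<alpha> e \<star> x - x \<star> \<alpha> (\<sigma> e)) + (\<alpha> d \<star> x - x \<star> \<alpha> (\<sigma> d)) \<star> \<alpha> (\<sigma> e) \<in> Jn 2"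
      by (intro Jn_closed Jn_ideal \<sigma> a)
    moreover have "\<alpha> d \<star> (\<alpha> e \<star> x - x \<star> \<alpha> (\<sigma> e)) + (\<alpha> d \<star> x - x \<star> \<alpha> (\<sigma> d)) \<star> \<alpha> (\<sigma> e) =
        (\<alpha> d \<star> \<alpha> e) \<star> x - x \<star> (\<alpha> (\<sigma> d) \<star> \<alpha> (\<sigma> e))"
      unfolding conv_diff_left conv_diff_right by (simp add: conv_assoc a(1) xA)
    ultimately show "\<alpha> (d * e) \<star> x - x \<star> \<alpha> (\<sigma> d * \<sigma> e) \<in> Jn 2" using mult by simp
  qed
  have \<sigma>_one: "\<sigma> 1 = 1"
    by (rule \<sigma>_eqI) (simp add: a conv_eps xA Jn_closed(1)[unfolded zero_fun_def] Jn_closed(1))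
  have \<sigma>_scale: "\<sigma> (s r d) = s r (\<sigma> d)" for r d
  proof (rule \<sigma>_eqI)
    have "\<alpha> (s r d) \<star> x - x \<star> \<alpha> (s r (\<sigma> d)) = fscale r (\<alpha> d \<star> x - x \<star> \<alpha> (\<sigma> d))"
      unfolding a(3) conv_scale_left conv_scale_right by (auto simp: fscale_def algebra_simps)
    then show "\<alpha> (s r d) \<star> x - x \<star> \<alpha> (s r (\<sigma> d)) \<in> Jn 2" using Jn_scale[OF \<sigma>] by metis
  qed
  \<comment> \<open>\<open>x\<close> is normalized by \<open>D\<close> only modulo
    \<open>Jn 2\<close>. Averaging over the separability element, with its second factor twisted by
    \<open>\<sigma>\<close>, makes the relation exact.\<close>
  define y where "y = (\<Sum>p\<leftarrow>es. \<alpha> (fst p) \<star> x \<star> \<alpha> (\<sigma> (snd p)))"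
  have yJ: "y \<in> J" unfolding y_def Jn_1[symmetric]
    by (intro Jn_sum Jn_ideal a) (use x(1) Jn_1 in simp)
  have yA: "y \<in> A" by (rule J_A[OF yJ])
  have y_norm: "\<alpha> d \<star> y = y \<star> \<alpha> (\<sigma> d)" for d
  proof -
    have "\<alpha> d \<star> y = (\<Sum>p\<leftarrow>es. \<alpha> (d * fst p) \<star> x \<star> \<alpha> (\<sigma> (snd p)))"
      unfolding y_def conv_sum_right using mult by (simp add: conv_assoc[symmetric] a xA conv_closed)
    also have "\<dots> = (\<Sum>p\<leftarrow>es. \<alpha> (fst p) \<star> x \<star> \<alpha> (\<sigma> (snd p * d)))"
      by (rule es_balanced[where \<beta> = "\<lambda>u v. \<alpha> u \<star> x \<star> \<alpha> (\<sigma> v)"])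
        (simp_all only: a(2,3) \<sigma>_add \<sigma>_scale conv_add_left conv_add_right conv_scale_left conv_scale_right)
    also have "\<dots> = y \<star> \<alpha> (\<sigma> d)"
      unfolding y_def conv_sum_left \<sigma>_mult using mult by (simp add: conv_assoc a xA conv_closed)
    finally show ?thesis .
  qed
  \<comment> \<open>Averaging changes nothing modulo \<open>Jn 2\<close>: there
    \<open>\<alpha> (fst p)\<close> may be moved past \<open>x\<close> as
    \<open>\<sigma> (fst p)\<close>, and the separability element multiplies to 1.\<close>
  have yx: "y - x \<in> Jn 2"
  proof -
    have \<sigma>_sum: "\<sigma> (\<Sum>p\<leftarrow>ps. fst p * snd p) = (\<Sum>p\<leftarrow>ps. \<sigma> (fst p * snd p))" for ps
    proof (induction ps)
      case Nil
      show ?case using \<sigma>_add[of 0 0] by simp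
    qed (simp add: \<sigma>_add)
    have \<alpha>_sum: "\<alpha> (\<Sum>p\<leftarrow>ps. g p) = (\<Sum>p\<leftarrow>ps. \<alpha> (g p))" for g :: "'d \<times> 'd \<Rightarrow> 'd" and ps
      by (induction ps) (simp_all add: a(2,6) del: plus_fun_apply zero_fun_apply)
    have "(\<Sum>p\<leftarrow>es. x \<star> \<alpha> (\<sigma> (fst p)) \<star> \<alpha> (\<sigma> (snd p))) = (\<Sum>p\<leftarrow>es. x \<star> \<alpha> (\<sigma> (fst p * snd p)))"
      using mult by (simp add: conv_assoc a xA \<sigma>_mult)
    also have "\<dots> = x \<star> \<alpha> (\<sigma> (\<Sum>p\<leftarrow>es. fst p * snd p))"
      unfolding \<sigma>_sum \<alpha>_sum conv_sum_right ..
    also have "\<dots> = x" by (simp add: es_one \<sigma>_one a(4) conv_eps xA)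
    finally have "y - x = (\<Sum>p\<leftarrow>es. (\<alpha> (fst p) \<star> x - x \<star> \<alpha> (\<sigma> (fst p))) \<star> \<alpha> (\<sigma> (snd p)))"
      unfolding y_def conv_diff_left sum_list_subtractf by simp
    then show ?thesis using \<sigma> by (simp add: Jn_sum Jn_ideal a)
  qed
  have "\<exists>d. f - y \<star> \<alpha> d \<in> Jn 2" if f: "f \<in> J" for f
  proof -
    obtain d where d: "f - x \<star> \<alpha> d \<in> Jn 2" using x_gen[OF f] by blast
    have "(f - x \<star> \<alpha> d) - (y - x) \<star> \<alpha> d \<in> Jn 2" by (intro Jn_closed(3) d Jn_ideal yx a)
    then show ?thesis unfolding conv_diff_left by (intro exI[of _ d]) simp
  qed
  then show ?thesis using that yJ y_norm \<sigma>_add \<sigma>_mult \<sigma>_one \<sigma>_scale by blast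
qed

end

section \<open>The embedding into the cotensor coalgebra\<close>

locale split_chain = separable_chain C s es
  for C :: "('k::field, 'c::ab_group_add) coalg" and s :: "'k \<Rightarrow> 'd::division_ring \<Rightarrow> 'd" and es +
  fixes \<alpha> :: "'d \<Rightarrow> 'c \<Rightarrow> 'k" and y :: "'c \<Rightarrow> 'k" and \<sigma> :: "'d \<Rightarrow> 'd"
  assumes \<alpha>: "linlift \<alpha>" and \<alpha>_mult: "\<alpha> d \<star> \<alpha> e = \<alpha> (d * e)"
    and y: "y \<in> J" and y_gen: "f \<in> J \<Longrightarrow> \<exists>d. f - y \<star> \<alpha> d \<in> Jn 2"
    and y_norm: "\<alpha> d \<star> y = y \<star> \<alpha> (\<sigma> d)"
    and \<sigma>_add: "\<sigma> (d + e) = \<sigma> d + \<sigma> e" and \<sigma>_mult: "\<sigma> (d * e) = \<sigma> d * \<sigma> e" and \<sigma>_one: "\<sigma> 1 = 1"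
    and \<sigma>_scale: "\<sigma> (s r d) = s r (\<sigma> d)"
begin

text \<open>An element \<open>m\<close> stands for \<open>y \<star> \<alpha> m\<close>; moving
  \<open>\<alpha> d\<close> past \<open>y\<close> produces the twist by \<open>\<sigma>\<close> in
  the left action. The carrier is \<open>D\<close> itself, so the bimodule has the right dimension
  even if \<open>y\<close> is 0.\<close>

definition M :: "('k, 'd, 'd) bimod" where
  "M = \<lparr>vcarrier = UNIV, vscale = s, lact = \<lambda>d m. \<sigma> d * m, ract = (*)\<rparr>"

lemma M_simps [simp]: "vcarrier M = UNIV" "vscale M = s" "lact M d m = \<sigma> d * m" "ract M m d = m * d"
  by (simp_all add: M_def)

lemma M_bimodule: "bimodule s M"
proof -
  interpret s: vector_space s by (rule fda_vector_space[OF fd])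
  show ?thesis
    unfolding bimodule_def is_vspace_def
    by (simp add: s.vector_space_axioms distrib_left distrib_right \<sigma>_add \<sigma>_mult \<sigma>_one \<sigma>_scale mult.assoc
        fda_mult_left[OF fd] fda_mult_right[OF fd])
qed

lemma M_iso: "vspace_iso M (full_space s)"
  unfolding vspace_iso_def
  by (rule exI[of _ id]) (simp add: linear_map_def full_space_def)

interpretation B: line_bimodule s M
  by unfold_locales (simp_all add: fd M_bimodule M_iso)

lemmas a = linliftD[OF \<alpha>]

lemma y_A: "y \<in> A"
  by (rule J_A[OF y])

definition \<mu> :: "'d \<Rightarrow> 'c \<Rightarrow> 'k" where
  "\<mu> m = y \<star> \<alpha> m"

lemma \<mu>_J: "\<mu> m \<in> J" and \<mu>_A: "\<mu> m \<in> A"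
  by (simp_all add: \<mu>_def J_ideal y a conv_closed y_A)

lemma \<mu>_right: "\<mu> m \<star> \<alpha> d = \<mu> (m * d)"
  by (simp add: \<mu>_def conv_assoc y_A a \<alpha>_mult)

lemma \<mu>_left: "\<alpha> d \<star> \<mu> m = \<mu> (\<sigma> d * m)"
  by (simp add: \<mu>_def conv_assoc[symmetric] y_A a y_norm) (simp add: conv_assoc y_A a \<alpha>_mult)

fun eta :: "'d list \<Rightarrow> 'c \<Rightarrow> 'k" where
  "eta [] = eps"
| "eta (m # w) = \<mu> m \<star> eta w"

lemma eta_A: "eta w \<in> A"
  by (induction w) (simp_all add: eps_in conv_closed \<mu>_A)

lemma eta_append: "eta (v @ w) = eta v \<star> eta w"
  by (induction v) (simp_all add: conv_eps eta_A conv_assoc \<mu>_A)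

lemma eta_single: "eta [m] = \<mu> m"
  by (simp add: conv_eps \<mu>_A)

lemma eta_P: "eta w \<in> P (length w)"
proof (induction w rule: rev_induct)
  case (snoc m w)
  then show ?case using \<mu>_J by (auto simp: eta_append conv_eps \<mu>_A)
qed (simp add: eps_in)

lemma eta_balanced: "eta (us @ m * d # m' # vs) = eta (us @ m # \<sigma> d * m' # vs)"
proof -
  have "\<mu> (m * d) \<star> (\<mu> m' \<star> eta vs) = \<mu> m \<star> (\<mu> (\<sigma> d * m') \<star> eta vs)"
    unfolding \<mu>_left[of d m', symmetric] using \<mu>_right[of m d, symmetric]
    by (simp add: conv_assoc \<mu>_A a eta_A conv_closed)
  then show ?thesis by (simp add: eta_append)
qed

text \<open>The algebra homomorphism from the tensor algebra of \<open>M\<close> to the dual algebra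
  of \<open>C\<close> that is \<open>\<alpha>\<close> on \<open>D\<close> and \<open>\<mu>\<close>
  on \<open>M\<close>; the embedding is its transpose.\<close>

fun hom :: "'d + 'd list \<Rightarrow> 'c \<Rightarrow> 'k" where
  "hom (Inl d) = \<alpha> d"
| "hom (Inr w) = eta w"

lemma hom_A: "hom i \<in> A"
  by (cases i) (simp_all add: a eta_A)

lemma hom_mult: "i \<in> B.idx \<Longrightarrow> j \<in> B.idx \<Longrightarrow> hom (B.imul i j) = hom i \<star> hom j"
proof (cases i; cases j)
  fix d w assume ij: "j \<in> B.idx" "i = Inl d" "j = Inr w"
  then obtain m w' where "w = m # w'" by (cases w) auto
  then show ?thesis using ij by (simp add: \<mu>_left[symmetric] conv_assoc a \<mu>_A eta_A)
next
  fix d w assume ij: "i \<in> B.idx" "i = Inr w" "j = Inl d"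
  then obtain m w' where "w = w' @ [m]" by (cases w rule: rev_cases) auto
  then show ?thesis using ij by (simp add: eta_append conv_eps \<mu>_A \<mu>_right[symmetric] conv_assoc a eta_A conv_closed)
qed (simp_all add: \<alpha>_mult eta_append)

lemma \<mu>_dual: "(\<lambda>m. \<mu> m c) \<in> vcarrier B.N"
  by (simp add: dual_space_def linear_map_def \<mu>_def a conv_add_right conv_scale_right) (simp add: fscale_def)

text \<open>The form \<open>\<lambda>w. eta w c\<close> has to be exhibited as an element of the
  tensor power. The comultiplication of \<open>c\<close> splits off the first letter:
  \<open>eta (m # w) c\<close> is the sum of \<open>\<mu> m u * eta w v\<close> over the pairs
  \<open>(u, v)\<close> in \<open>rep c\<close>.\<close>

lemma tensor_exists:
  "c \<in> K \<Longrightarrow> \<exists>t\<in>vcarrier (tensor_power B.N (Suc n)). \<forall>w. length w = Suc n \<longrightarrow> t (B.evs w) = eta w c"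
proof (induction n arbitrary: c)
  case 0
  show ?case
  proof (intro bexI allI impI)
    show "ltens B.N [\<lambda>m. \<mu> m c] \<in> vcarrier (tensor_power B.N (Suc 0))"
      using \<mu>_dual by (intro ltens_in) auto
    fix w :: "'d list" assume "length w = Suc 0"
    then obtain m where "w = [m]" by (cases w) auto
    then show "ltens B.N [\<lambda>m. \<mu> m c] (B.evs w) = eta w c"
      by (simp add: ltens_Cons ltens_Nil lfun_eval conv_eps \<mu>_A)
  qed
next
  case (Suc n)
  let ?TP = "tensor_power B.N (Suc (Suc n))"
  have "\<exists>t\<in>vcarrier ?TP. \<forall>m w. length w = Suc n \<longrightarrow> t (B.evs (m # w)) = \<mu> m u * eta w v"
    if "v \<in> K" for u v
  proof -
    obtain t where t: "t \<in> vcarrier (tensor_power B.N (Suc n))" "\<forall>w. length w = Suc n \<longrightarrow> t (B.evs w) = eta w v"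
      using Suc.IH[OF \<open>v \<in> K\<close>] by blast
    obtain t' where t': "t' \<in> vcarrier ?TP" "\<And>f fs. lfun B.N f \<Longrightarrow> t' (f # fs) = f (\<lambda>m. \<mu> m u) * t fs"
      using tensor_power_cons[OF B.N_vspace t(1) _ \<mu>_dual] by (metis zero_less_Suc)
    show ?thesis using t' t(2) by (intro bexI[of _ t']) (simp_all add: lfun_eval)
  qed
  then obtain F where F: "\<And>u v. v \<in> K \<Longrightarrow> F u v \<in> vcarrier ?TP"
    "\<And>u v m w. v \<in> K \<Longrightarrow> length w = Suc n \<Longrightarrow> F u v (B.evs (m # w)) = \<mu> m u * eta w v"
    by metis
  show ?case
  proof (intro bexI allI impI)
    show "(\<Sum>p\<leftarrow>rep c. F (fst p) (snd p)) \<in> vcarrier ?TP"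
      using rep(1)[OF Suc.prems] by (intro vs_sum_list[OF is_vspace_tensor_power] F) auto
    fix w :: "'d list" assume "length w = Suc (Suc n)"
    then obtain m w' where w: "w = m # w'" "length w' = Suc n" by (cases w) auto
    have "(\<Sum>p\<leftarrow>rep c. F (fst p) (snd p)) (B.evs w) = (\<Sum>p\<leftarrow>rep c. \<mu> m (fst p) * eta w' (snd p))"
      unfolding sum_list_fun_apply w(1) using rep(1)[OF Suc.prems] F(2)[OF _ w(2)]
      by (intro arg_cong[of _ _ sum_list] map_cong refl) auto
    then show "(\<Sum>p\<leftarrow>rep c. F (fst p) (snd p)) (B.evs w) = eta w c"
      using Suc.prems by (simp add: w(1) conv_def)
  qed
qed

text \<open>Degree 0 is stored in the first component of the direct sum, whence the value 0 there.
  The chosen tensor is determined by its values on words (\<open>B.power_separated\<close>).\<close>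

definition comp :: "'c \<Rightarrow> nat \<Rightarrow> ('k, 'd \<Rightarrow> 'k) ltensor" where
  "comp c n = (if n = 0 then 0 else
     (SOME t. t \<in> vcarrier (tensor_power B.N n) \<and> (\<forall>w. length w = n \<longrightarrow> t (B.evs w) = eta w c)))"

lemma comp:
  assumes "c \<in> K" "n > 0"
  shows "comp c n \<in> vcarrier (tensor_power B.N n)" "length w = n \<Longrightarrow> comp c n (B.evs w) = eta w c"
proof -
  obtain k where n: "n = Suc k" using assms(2) by (cases n) auto
  have "\<exists>t. t \<in> vcarrier (tensor_power B.N n) \<and> (\<forall>w. length w = n \<longrightarrow> t (B.evs w) = eta w c)"
    using tensor_exists[OF assms(1), of k] unfolding n by blast
  from someI_ex[OF this] show "comp c n \<in> vcarrier (tensor_power B.N n)" "length w = n \<Longrightarrow> comp c n (B.evs w) = eta w c"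
    unfolding comp_def using assms(2) by auto
qed

definition emb :: "'c \<Rightarrow> ('k, 'd \<Rightarrow> 'k, 'd \<Rightarrow> 'k) cotensor" where
  "emb c = (\<lambda>d. \<alpha> d c, comp c)"

lemma emb_ev: "c \<in> K \<Longrightarrow> i \<in> B.idx \<Longrightarrow> B.ev i (emb c) = hom i c"
  by (cases i) (auto simp: emb_def comp)

text \<open>The support is finite because \<open>c\<close> is killed by some power of
  \<open>J\<close> and \<open>eta w\<close> is a product of \<open>length w\<close> elements of
  \<open>J\<close>. Balancedness is \<open>eta_balanced\<close>.\<close>

lemma emb_T: assumes c: "c \<in> K" shows "emb c \<in> vcarrier B.T"
proof -
  obtain n where n: "c \<in> W n" using exhaustive[OF c] by blast
  have "comp c m = 0" if m: "m > n" for m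
  proof (rule B.power_separated)
    show "comp c m \<in> vcarrier (tensor_power B.N m)" "m > 0" using comp(1)[OF c] m by auto
    fix w :: "'d list" assume w: "length w = m"
    have "eta w \<in> P m" using eta_P[of w] w by simp
    moreover have "c \<in> W m" using n W_mono[of n m] m by auto
    ultimately have "eta w c = 0" by (simp add: W_def)
    then show "comp c m (B.evs w) = 0" using comp(2)[OF c _ w] m by simp
  qed
  then have "m \<le> n" if "comp c m \<noteq> 0" for m using that not_le by blast
  then have "{m. comp c m \<noteq> 0} \<subseteq> {..n}" by blast
  then have "finite {m. comp c m \<noteq> 0}" by (rule finite_subset) simp
  moreover have "(\<lambda>d. \<alpha> d c) \<in> vcarrier B.Dc"
    by (simp add: dual_coalgebra_simps[OF fd] fda_dual[OF fd] linear_map_def fda_simps[OF fd] a fscale_def)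
  ultimately have "emb c \<in> vcarrier B.W" using comp(1)[OF c]
    by (simp add: B.W_iff emb_def) (simp add: comp_def)
  then show ?thesis
    unfolding B.T_balanced using emb_ev[OF c, of "Inr _"] by (simp add: eta_balanced del: B.ev.simps)
qed

text \<open>The factors of a product are replaced one after the other by values of
  \<open>\<mu>\<close>, each replacement costing an error one level deeper. One word suffices,
  without sums, because every element of \<open>J\<close> is congruent modulo \<open>Jn 2\<close> to
  a single \<open>\<mu> d\<close>.\<close>

lemma eta_generates: "p \<in> P (Suc n) \<Longrightarrow> \<exists>w. length w = Suc n \<and> p - eta w \<in> Jn (Suc (Suc n))"
proof (induction n arbitrary: p)
  case 0
  then have "p \<in> J" by (rule P_J)
  then obtain d where "p - \<mu> d \<in> Jn 2" using y_gen by (auto simp: \<mu>_def)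
  then have "p - eta [d] \<in> Jn (Suc (Suc 0))" unfolding eta_single numeral_2_eq_2 .
  moreover have "length [d] = Suc 0" by simp
  ultimately show ?case by blast
next
  case (Suc n)
  obtain q j where qj: "p = q \<star> j" "q \<in> P (Suc n)" "j \<in> J" using Suc.prems by auto
  obtain w where w: "length w = Suc n" "q - eta w \<in> Jn (Suc (Suc n))" using Suc.IH[OF qj(2)] by blast
  obtain d where d: "j - \<mu> d \<in> Jn 2" using y_gen[OF qj(3)] by (auto simp: \<mu>_def)
  have "(q - eta w) \<star> j \<in> Jn (Suc (Suc (Suc n)))" by (rule Jn_mult[OF w(2) qj(3)])
  moreover have "eta w \<star> (j - \<mu> d) \<in> Jn (Suc (Suc (Suc n)))"
    using P_Jn[OF eta_P d, of w] w(1) by (simp add: numeral_2_eq_2)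
  moreover have "p - eta (w @ [d]) = (q - eta w) \<star> j + eta w \<star> (j - \<mu> d)"
    unfolding eta_append eta_single qj(1) conv_diff_left conv_diff_right by simp
  ultimately have "p - eta (w @ [d]) \<in> Jn (Suc (Suc (Suc n)))" by (metis Jn_closed(2))
  moreover have "length (w @ [d]) = Suc (Suc n)" using w(1) by simp
  ultimately show ?case by blast
qed

text \<open>Descent along the filtration: on \<open>W (Suc (Suc n))\<close> every element of
  \<open>P (Suc n)\<close> coincides with some \<open>eta w\<close>, which vanishes at
  \<open>c\<close>, so \<open>c\<close> lies in \<open>W (Suc n)\<close>. This ends in the
  coradical, where every functional coincides with some \<open>\<alpha> d\<close>.\<close>

lemma hom_separates:
  assumes c: "c \<in> K" and zero: "\<And>i. i \<in> B.idx \<Longrightarrow> hom i c = 0"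
  shows "c = 0"
proof -
  have "c \<in> W (Suc n) \<Longrightarrow> c \<in> W (Suc 0)" for n
  proof (induction n)
    case (Suc n)
    have "p c = 0" if p: "p \<in> P (Suc n)" for p
    proof -
      obtain w where w: "length w = Suc n" "p - eta w \<in> Jn (Suc (Suc n))" using eta_generates[OF p] by blast
      have "w \<noteq> []" using w(1) by auto
      then have "eta w c = 0" using zero[of "Inr w"] by simp
      then show ?thesis using w(2) Suc.prems by (simp add: Jn_def)
    qed
    then have "c \<in> W (Suc n)" using c by (simp add: W_def)
    then show ?case by (rule Suc.IH)
  qed
  moreover obtain n where "c \<in> W n" using exhaustive[OF c] by blast
  then have "c \<in> W (Suc n)" using W_mono[of n "Suc n"] by auto
  ultimately have c0: "c \<in> C0" using W_1 by auto
  show ?thesis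
  proof (rule A_separates[OF c vs_zero[OF C_vspace]])
    fix f assume f: "f \<in> A"
    obtain d where d: "f - \<alpha> d \<in> J" using a(5)[OF f] by blast
    have "\<alpha> d c = 0" using zero[of "Inl d"] by simp
    then have "f c = 0" using d c0 by (simp add: J_def)
    then show "f c = f 0" using A_zero[OF f] by simp
  qed
qed

lemma emb_linear: "linear_map C B.T emb"
  unfolding linear_map_def
proof (intro conjI ballI allI)
  fix x y r assume x: "x \<in> K" and y: "y \<in> K"
  show "emb x \<in> vcarrier B.T" by (rule emb_T[OF x])
  show "emb (x + y) = emb x + emb y"
    using x y vs_add[OF C_vspace x y]
    by (intro B.T_eqI emb_T vs_add[OF B.T_vspace])
      (simp_all add: lfun_simps(2)[OF B.W_vspace B.W_ev_lfun] emb_ev A_simps(1)[OF hom_A] del: B.ev.simps)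
  show "emb (vscale C r x) = vscale B.T r (emb x)"
    using x vs_scale[OF C_vspace x] lfun_simps(4)[OF B.T_vspace B.ev_lfun]
    by (intro B.T_eqI emb_T vs_scale[OF B.T_vspace])
      (simp_all add: emb_ev A_simps(3)[OF hom_A] del: B.ev.simps)
qed

theorem emb_embedding: "coalgebra_embedding C B.E emb"
  unfolding coalgebra_embedding_def
proof (intro conjI ballI)
  show "linear_map C B.E emb" using emb_linear by (simp add: linear_map_def)
  show "inj_on emb K"
  proof (rule inj_onI)
    fix x x' assume x: "x \<in> K" and x': "x' \<in> K" and eq: "emb x = emb x'"
    have "hom i (x - x') = 0" if "i \<in> B.idx" for i
      using emb_ev[OF x that] emb_ev[OF x' that] eq A_simps(2)[OF hom_A x x'] by simp
    then have "x - x' = 0" by (intro hom_separates vs_diff[OF C_vspace x x'])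
    then show "x = x'" by simp
  qed
  fix c assume c: "c \<in> K"
  show "counit B.E (emb c) = counit C c"
    using c by (simp add: cotensor_coalgebra_def Let_def emb_def dual_coalgebra_simps[OF fd] a eps_def)
  have TT: "is_vspace (tensor_space B.T B.T)" by simp
  have b: "bilinear_map C C (tensor_space B.T B.T) (\<lambda>x y. tens B.T B.T (emb x) (emb y))"
    using emb_linear unfolding bilinear_map_def linear_map_def
    by (simp add: tens_in tens_linear[OF B.T_vspace B.T_vspace] del: plus_fun_apply)
  have eq: "tlift C C (\<lambda>x y. tens B.T B.T (emb x) (emb y)) (comul C c) =
      (\<Sum>p\<leftarrow>rep c. tens B.T B.T (emb (fst p)) (emb (snd p)))"
    by (rule tlift_rep[OF C_vspace C_vspace TT b rep[OF c]])
  have "comul B.E (emb c) = (\<Sum>p\<leftarrow>rep c. tens B.T B.T (emb (fst p)) (emb (snd p)))"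
  proof (rule tensor_eqI[OF B.T_vspace B.T_vspace, where e = B.ev and f = B.ev and I = B.idx and J = B.idx])
    show "comul B.E (emb c) \<in> vcarrier (tensor_space B.T B.T)" by (rule B.comul_T[OF emb_T[OF c]])
    show "(\<Sum>p\<leftarrow>rep c. tens B.T B.T (emb (fst p)) (emb (snd p))) \<in> vcarrier (tensor_space B.T B.T)"
      using rep(1)[OF c] by (intro vs_sum_list[OF TT] tens_in emb_T) auto
    \<comment> \<open>At a pair of evaluations, compatibility with the comultiplications is the
      multiplicativity of \<open>hom\<close>.\<close>
    fix i j assume ij: "i \<in> B.idx" "j \<in> B.idx"
    have "comul B.E (emb c) (B.ev i, B.ev j) = (hom i \<star> hom j) c"
      using B.comul_ev(2)[OF B.T_W[OF emb_T[OF c]] ij] emb_ev[OF c B.imul_idx[OF ij]] hom_mult[OF ij] by simp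
    also have "\<dots> = (\<Sum>p\<leftarrow>rep c. B.ev i (emb (fst p)) * B.ev j (emb (snd p)))"
      using c rep(1)[OF c] ij by (auto simp: conv_def emb_ev simp del: B.ev.simps intro!: arg_cong[of _ _ sum_list])
    also have "\<dots> = (\<Sum>p\<leftarrow>rep c. tens B.T B.T (emb (fst p)) (emb (snd p))) (B.ev i, B.ev j)"
      by (simp add: sum_list_fun_apply tens_apply[OF B.ev_lfun B.ev_lfun])
    finally show "comul B.E (emb c) (B.ev i, B.ev j) =
        (\<Sum>p\<leftarrow>rep c. tens B.T B.T (emb (fst p)) (emb (snd p))) (B.ev i, B.ev j)" .
  qed (use B.T_separated B.ev_lfun in auto)
  then show "comul B.E (emb c) = tlift C C (\<lambda>x y. tens B.E B.E (emb x) (emb y)) (comul C c)"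
    by (simp add: eq B.tensor_E(2))
qed

theorem embedding_exists:
  "\<exists>(M :: ('k, 'd, 'd) bimod) f. bimodule s M \<and> vspace_iso M (full_space s) \<and>
     coalgebra_embedding C (cotensor_coalgebra (dual_coalgebra s) (dual_bicomodule s M)) f"
  using M_bimodule M_iso emb_embedding by blast

end

theorem theorem5p6:
  fixes s :: "'k::field \<Rightarrow> 'd::division_ring \<Rightarrow> 'd"
  assumes "fd_division_algebra s"
  shows "(\<forall>M :: ('k, 'd, 'm::ab_group_add) bimod.
            bimodule s M \<and> vspace_iso M (full_space s) \<longrightarrow>
              chain_coalgebra (cotensor_coalgebra (dual_coalgebra s) (dual_bicomodule s M)) \<and>
              of_type (cotensor_coalgebra (dual_coalgebra s) (dual_bicomodule s M)) s) \<and>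
         (separable s \<longrightarrow>
            (\<forall>C :: ('k, 'c::ab_group_add) coalg.
               chain_coalgebra C \<and> of_type C s \<longrightarrow>
                 (\<exists>(M :: ('k, 'd, 'd) bimod) f.
                    bimodule s M \<and> vspace_iso M (full_space s) \<and>
                    coalgebra_embedding C
                      (cotensor_coalgebra (dual_coalgebra s) (dual_bicomodule s M)) f)))"
proof (intro conjI allI impI)
  fix M :: "('k, 'd, 'm) bimod" assume M: "bimodule s M \<and> vspace_iso M (full_space s)"
  then interpret line_bimodule s M using assms by unfold_locales auto
  show "chain_coalgebra (cotensor_coalgebra (dual_coalgebra s) (dual_bicomodule s M))" by (rule chain_coalgebra_E)
  show "of_type (cotensor_coalgebra (dual_coalgebra s) (dual_bicomodule s M)) s" by (rule of_type_E)
next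
  fix C :: "('k, 'c) coalg" assume sep: "separable s" and C: "chain_coalgebra C \<and> of_type C s"
  obtain es :: "('d \<times> 'd) list" where es: "(\<Sum>p\<leftarrow>es. fst p * snd p) = 1"
    "\<forall>\<beta> a. bilinear_map (full_space s) (full_space s) (full_space (fscale :: 'k \<Rightarrow> ('c \<Rightarrow> 'k) \<Rightarrow> _)) \<beta> \<longrightarrow>
      (\<Sum>p\<leftarrow>es. \<beta> (a * fst p) (snd p)) = (\<Sum>p\<leftarrow>es. \<beta> (fst p) (snd p * a))"
    by (rule separable_element[OF assms sep])
  interpret separable_chain C s es
  proof unfold_locales
    show "coalgebra C" "chain_coalgebra C" "of_type C s" using C by (auto simp: chain_coalgebra_def)
    fix \<beta> :: "'d \<Rightarrow> 'd \<Rightarrow> 'c \<Rightarrow> 'k" and a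
    assume "\<And>x x' y. \<beta> (x + x') y = \<beta> x y + \<beta> x' y" "\<And>x y y'. \<beta> x (y + y') = \<beta> x y + \<beta> x y'"
      "\<And>b x y. \<beta> (s b x) y = fscale b (\<beta> x y)" "\<And>b x y. \<beta> x (s b y) = fscale b (\<beta> x y)"
    then have "bilinear_map (full_space s) (full_space s) (full_space fscale) \<beta>"
      by (simp add: bilinear_map_def linear_map_def full_space_def del: plus_fun_apply)
    then show "(\<Sum>p\<leftarrow>es. \<beta> (a * fst p) (snd p)) = (\<Sum>p\<leftarrow>es. \<beta> (fst p) (snd p * a))" using es(2) by blast
  qed (use assms es(1) in auto)
  obtain \<alpha> where \<alpha>: "linlift \<alpha>" "\<forall>a b. conv (\<alpha> a) (\<alpha> b) = \<alpha> (a * b)" by (rule splitting)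
  obtain y \<sigma> where y: "y \<in> J" "\<forall>f\<in>J. \<exists>d. f - conv y (\<alpha> d) \<in> Jn 2" "\<forall>d. conv (\<alpha> d) y = conv y (\<alpha> (\<sigma> d))"
    "\<forall>d e. \<sigma> (d + e) = \<sigma> d + \<sigma> e" "\<forall>d e. \<sigma> (d * e) = \<sigma> d * \<sigma> e" "\<sigma> 1 = 1" "\<forall>a d. \<sigma> (s a d) = s a (\<sigma> d)"
    by (rule twisted_generator[OF \<alpha>])
  interpret split_chain C s es \<alpha> y \<sigma>
    by unfold_locales (use \<alpha> y in auto)
  show "\<exists>(M :: ('k, 'd, 'd) bimod) f. bimodule s M \<and> vspace_iso M (full_space s) \<and>
      coalgebra_embedding C (cotensor_coalgebra (dual_coalgebra s) (dual_bicomodule s M)) f"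
    by (rule embedding_exists)
qed

end
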